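(* Let $B=B_q(\mathfrak g)$ be the Kashiwara algebra over $R=\mathbb Q[[\hbar]]$ of a symmetrizable Kac-Moody algebra $\mathfrak g$, and let $U'=U'_q(\mathfrak g)$ and $\hat U=\hat U_q(\mathfrak g)$. The following assignments on generators ($i\in I$, $h\in P$; products inside tensor factors $B^{\mathrm{op}}$ are written as products in $B$) give well-defined algebra morphisms: $$\alpha_B:B\to U'\otimes B:\quad e'_i\mapsto1\otimes e'_i+\mathbf t_i^{-1}\mathbf e'_i\otimes t_i^{-1},\quad f_i\mapsto1\otimes f_i+\mathbf t_i^{-1}\mathbf f'_i\otimes t_i^{-1},\quad q^h\mapsto\mathbf q^h\otimes q^h;$$ $$\beta_B:B\to B\otimes\hat U:\quad e'_i\mapsto1\otimes\mathbf t_i^{-1}\hat{\mathbf e}_i+e'_i\otimes\mathbf t_i^{-1},\quad f_i\mapsto f_i\otimes\mathbf t_i^{-1}+1\otimes\mathbf f_i,\quad q^h\mapsto q^h\otimes\mathbf q^h;$$ $$\alpha_{B^{\mathrm{op}}}:B^{\mathrm{op}}\to\hat U\otimes B^{\mathrm{op}}:\quad e'_i\mapsto\mathbf t_i\otimes e'_i-\hat{\mathbf e}_i\otimes1,\quad f_i\mapsto-\mathbf t_i\mathbf f_i\otimes1+\mathbf t_i\otimes f_i,\quad q^h\mapsto\mathbf q^{-h}\otimes q^h;$$ $$\beta_{B^{\mathrm{op}}}:B^{\mathrm{op}}\to B^{\mathrm{op}}\otimes U':\quad e'_i\mapsto-t_i^{-1}\otimes\mathbf e'_i+e'_i\otimes1,\quad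 f_i\mapsto-t_i^{-1}\otimes\mathbf f'_i+f_i\otimes1,\quad q^h\mapsto q^h\otimes\mathbf q^{-h};$$ $$\gamma:U'\to B\otimes B^{\mathrm{op}}:\quad\mathbf e'_i\mapsto t_ie'_i\otimes1-t_i\otimes e'_i,\quad\mathbf f'_i\mapsto t_if_i\otimes1-t_i\otimes f_i,\quad\mathbf q^h\mapsto q^h\otimes q^{-h};$$ $$\delta:\hat U\to B^{\mathrm{op}}\otimes B:\quad\hat{\mathbf e}_i\mapsto t_i^{-1}\otimes t_ie'_i-e'_i\otimes1,\quad\mathbf f_i\mapsto1\otimes f_i-f_it_i\otimes t_i^{-1},\quad\mathbf q^h\mapsto q^{-h}\otimes q^h;$$ $$S_{B^{\mathrm{op}}}:=\mathrm{Id}_B:B^{\mathrm{op}}\to B^{\mathrm{op}};\qquad S_B:=\theta_B:B\to(B^{\mathrm{op}})^{\mathrm{op}}=B,\quad e'_i\mapsto t_i^{-1}e'_it_i,\ f_i\mapsto t_i^{-1}f_it_i,\ q^h\mapsto q^h.$$ With these maps, $(U',\hat U,B,B^{\mathrm{op}})$ is a complete autonomous Hopf-Galois system over $R$ (with $T=B$, $Z=B^{\mathrm{op}}$, $\alpha_T=\alpha_B$, $\beta_T=\beta_B$, $\lambda_Z=\alpha_{B^{\mathrm{op}}}$, $\rho_Z=\beta_{B^{\mathrm{op}}}$, $S_T=S_B$, $S_Z=S_{B^{\mathrm{op}}}$ in the notation of the definition of a complete Hopf-Galois system).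
   Context: Notation. $\mathfrak g$ is a symmetrizable Kac-Moody algebra over $\mathbb Q$ with Cartan subalgebra $\mathfrak t$, simple roots $\alpha_i\in\mathfrak t^*$ and coroots $h_i\in\mathfrak t$ ($i\in I$, $I$ finite). Fix an inner product on $\mathfrak t^*$ with $(\alpha_i,\alpha_i)$ a positive even integer and $\langle h_i,\lambda\rangle=2(\alpha_i,\lambda)/(\alpha_i,\alpha_i)$ for $\lambda\in\mathfrak t^*$. Put $P=\bigoplus_i\mathbb Zh_i$, $R=\mathbb Q[[\hbar]]$, $q=\exp(\hbar)$, $q_i=q^{(\alpha_i,\alpha_i)/2}$, $t_i=q^{(\alpha_i,\alpha_i)h_i/2}$ and $\mathbf t_i=\mathbf q^{(\alpha_i,\alpha_i)h_i/2}$, $[n]_i=(q_i^n-q_i^{-n})/(q_i-q_i^{-1})$, $[n]_i!=\prod_{k=1}^n[k]_i$. The Serre relations for a family $X=(X_i)_{i\in I}$ are, for all $i\ne j$, $\sum_{k=0}^{1-\langle h_i,\alpha_j\rangle}(-1)^kX_i^{(k)}X_jX_i^{(1-\langle h_i,\alpha_j\rangle-k)}=0$, with $X_i^{(n)}=X_i^n/[n]_i!$. In all algebras below the symbols $q^h$ (resp. $\mathbf q^h$), $h\in P$, satisfy $q^0=1$, $q^hq^{h'}=q^{h+h'}$ (resp. the same for $\mathbf q^h$). $B=B_q(\mathfrak g)$: the associative unital $R$-algebra generated by $e'_i,f_i$ ($i\in I$), $q^h$ ($h\in P$) with $q^he'_iq^{-h}=q^{\langle h,\alpha_i\rangle}e'_i$,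 $q^hf_iq^{-h}=q^{-\langle h,\alpha_i\rangle}f_i$, $e'_if_j=q_i^{\langle h_i,\alpha_j\rangle}f_je'_i+\delta_{i,j}$ and the Serre relations for $e'$ and for $f$. $\hat U=\hat U_q(\mathfrak g)$: the $R$-algebra generated by $\hat{\mathbf e}_i,\mathbf f_i$, $\mathbf q^h$ with $\mathbf q^h\hat{\mathbf e}_i\mathbf q^{-h}=q^{\langle h,\alpha_i\rangle}\hat{\mathbf e}_i$, $\mathbf q^h\mathbf f_i\mathbf q^{-h}=q^{-\langle h,\alpha_i\rangle}\mathbf f_i$, $[\hat{\mathbf e}_i,\mathbf f_j]=\delta_{i,j}(\mathbf t_i-\mathbf t_i^{-1})$ and the Serre relations for $\hat{\mathbf e}$ and for $\mathbf f$. It is a Hopf algebra with $\hat\Delta(\mathbf q^h)=\mathbf q^h\otimes\mathbf q^h$, $\hat\Delta(\hat{\mathbf e}_i)=\hat{\mathbf e}_i\otimes1+\mathbf t_i\otimes\hat{\mathbf e}_i$, $\hat\Delta(\mathbf f_i)=\mathbf f_i\otimes\mathbf t_i^{-1}+1\otimes\mathbf f_i$; counit $\hat{\mathbf e}_i,\mathbf f_i\mapsto0$, $\mathbf q^h\mapsto1$; antipode $\hat{\mathbf e}_i\mapsto-\mathbf t_i^{-1}\hat{\mathbf e}_i$, $\mathbf f_i\mapsto-\mathbf f_i\mathbf t_i$, $\mathbf q^h\mapsto\mathbf q^{-h}$. $U'=U'_q(\mathfrak g)$: the $R$-algebra generated by $\mathbf e'_i,\mathbf f'_i$, $\mathbf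 q^h$ with $\mathbf q^h\mathbf e'_i\mathbf q^{-h}=q^{\langle h,\alpha_i\rangle}\mathbf e'_i$, $\mathbf q^h\mathbf f'_i\mathbf q^{-h}=q^{-\langle h,\alpha_i\rangle}\mathbf f'_i$, $\mathbf e'_i\mathbf f'_j=q_i^{-\langle h_i,\alpha_j\rangle}\mathbf f'_j\mathbf e'_i$ and the Serre relations for $\mathbf e'$ and for $\mathbf f'$. It is a Hopf algebra with $\Delta'(\mathbf q^h)=\mathbf q^h\otimes\mathbf q^h$, $\Delta'(\mathbf e'_i)=\mathbf e'_i\otimes1+\mathbf t_i\otimes\mathbf e'_i$, $\Delta'(\mathbf f'_i)=\mathbf f'_i\otimes1+\mathbf t_i\otimes\mathbf f'_i$; counit $\mathbf e'_i,\mathbf f'_i\mapsto0$, $\mathbf q^h\mapsto1$; antipode $\mathbf e'_i\mapsto-\mathbf t_i^{-1}\mathbf e'_i$, $\mathbf f'_i\mapsto-\mathbf t_i^{-1}\mathbf f'_i$, $\mathbf q^h\mapsto\mathbf q^{-h}$. Hopf-Galois system (over a commutative ring $k$; $\otimes=\otimes_k$, a module also denotes its identity map, $m$ multiplication, $u$ unit, $\tau_{(X,Y)}$ the flip $X\otimes Y\to Y\otimes X$). Four non-zero $k$-algebras $(A,B,T,Z)$ such that: (i) $A,B$ are bialgebras; (ii) $T$ is an $(A,B)$-bicomodule algebra with coactions $\alpha_T:T\to A\otimes T$, $\beta_T:T\to T\otimes B$; (iii) there are algebra morphisms $\gamma:A\to T\otimes Z$, $\delta:B\to Z\otimes T$ with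 $(\gamma\otimes T)\alpha_T=(T\otimes\delta)\beta_T$, $(A\otimes\gamma)\Delta_A=(\alpha_T\otimes Z)\gamma$, $(\delta\otimes B)\Delta_B=(Z\otimes\beta_T)\delta$; (iv) there is a linear map $S_Z:Z\to T$ with $m_T(T\otimes S_Z)\gamma=u_T\varepsilon_A$, $m_T(S_Z\otimes T)\delta=u_T\varepsilon_B$. Then $A,B$ are automatically Hopf algebras, with antipodes $S_A,S_B$. Complete Hopf-Galois system. $(A,B,T,Z)$ with $\alpha_T,\beta_T$, $\lambda_Z:Z\to B\otimes Z$, $\rho_Z:Z\to Z\otimes A$, $\gamma,\delta$, $S_T:T\to Z$, $S_Z:Z\to T$ such that: $(A,B,T,Z)$ with $(\alpha_T,\beta_T,\gamma,\delta,S_Z)$ is a Hopf-Galois system; $(B,A,Z,T)$ with $(\lambda_Z,\rho_Z,\delta,\gamma,S_T)$ is a Hopf-Galois system ($\delta$ playing the role of "$\gamma$" and $\gamma$ that of "$\delta$"); and $(\beta_T\otimes Z)\gamma=(T\otimes\lambda_Z)\gamma$, $(\rho_Z\otimes T)\delta=(Z\otimes\alpha_T)\delta$, $\tau_{(Z,T)}(S_T\otimes S_Z)\gamma=\gamma S_A$, $\tau_{(T,Z)}(S_Z\otimes S_T)\delta=\delta S_B$, $\tau_{(A,Z)}(S_A\otimes S_T)\alpha_T=\rho_ZS_T$, $\tau_{(Z,B)}(S_T\otimes S_B)\beta_T=\lambda_ZS_T$, $\tau_{(B,T)}(S_B\otimes S_Z)\lambda_Z=\beta_TS_Z$, $\tau_{(T,A)}(S_Z\otimes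 S_A)\rho_Z=\alpha_TS_Z$. (In these general definitions $S_B$ is the antipode of the Hopf algebra $B$, not the map $S_B=\theta_B$ of the claim.) It is autonomous if the associated torsor map $\theta=S_Z\circ S_T:T\to T$ is bijective. *)

theory Defs
  imports
    "HOL-Algebra.QuotRing"
    "HOL-Algebra.Module"
    "HOL-Algebra.Algebraic_Closure_Type"
    "HOL-Library.Poly_Mapping"
    "HOL-Computational_Algebra.Formal_Power_Series"
begin

section \<open>Associative algebras over a commutative ring\<close>

text \<open>The ground ring is a type \<open>'k\<close> of class \<open>comm_ring_1\<close>, seen as a carrier-based ring through
  \<^const>\<open>ring_of_type_algebra\<close>.  Algebras are records of type \<^type>\<open>module\<close>; the library locale
  \<^locale>\<open>algebra\<close> is not used because it demands commutativity.\<close>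

definition assoc_algebra :: "('k::comm_ring_1, 'a, 'm) module_scheme \<Rightarrow> bool" where
  "assoc_algebra A \<longleftrightarrow>
     module ring_of_type_algebra A \<and> ring A \<and>
     (\<forall>r. \<forall>x\<in>carrier A. \<forall>y\<in>carrier A.
        (r \<odot>\<^bsub>A\<^esub> x) \<otimes>\<^bsub>A\<^esub> y = r \<odot>\<^bsub>A\<^esub> (x \<otimes>\<^bsub>A\<^esub> y) \<and> x \<otimes>\<^bsub>A\<^esub> (r \<odot>\<^bsub>A\<^esub> y) = r \<odot>\<^bsub>A\<^esub> (x \<otimes>\<^bsub>A\<^esub> y))"

definition nonzero_algebra :: "('k::comm_ring_1, 'a, 'm) module_scheme \<Rightarrow> bool" where
  "nonzero_algebra A \<longleftrightarrow> assoc_algebra A \<and> \<one>\<^bsub>A\<^esub> \<noteq> \<zero>\<^bsub>A\<^esub>"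

definition linear_map ::
    "('k::comm_ring_1, 'a, 'm) module_scheme \<Rightarrow> ('k, 'b, 'n) module_scheme \<Rightarrow> ('a \<Rightarrow> 'b) \<Rightarrow> bool" where
  "linear_map A C f \<longleftrightarrow>
     f \<in> carrier A \<rightarrow> carrier C \<and>
     (\<forall>x\<in>carrier A. \<forall>y\<in>carrier A. f (x \<oplus>\<^bsub>A\<^esub> y) = f x \<oplus>\<^bsub>C\<^esub> f y) \<and>
     (\<forall>r. \<forall>x\<in>carrier A. f (r \<odot>\<^bsub>A\<^esub> x) = r \<odot>\<^bsub>C\<^esub> f x)"

definition alg_hom ::
    "('k::comm_ring_1, 'a, 'm) module_scheme \<Rightarrow> ('k, 'b, 'n) module_scheme \<Rightarrow> ('a \<Rightarrow> 'b) \<Rightarrow> bool" where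
  "alg_hom A C f \<longleftrightarrow> f \<in> ring_hom A C \<and> (\<forall>r. \<forall>x\<in>carrier A. f (r \<odot>\<^bsub>A\<^esub> x) = r \<odot>\<^bsub>C\<^esub> f x)"

definition ground_algebra :: "('k::comm_ring_1, 'k) module" where
  "ground_algebra = ring.extend ring_of_type_algebra (module.fields (*))"

definition op_algebra :: "('k, 'a, 'm) module_scheme \<Rightarrow> ('k, 'a, 'm) module_scheme" where
  "op_algebra A = A\<lparr>monoid.mult := \<lambda>x y. y \<otimes>\<^bsub>A\<^esub> x\<rparr>"

definition quotient_algebra :: "('k::comm_ring_1, 'a, 'm) module_scheme \<Rightarrow> 'a set \<Rightarrow> ('k, 'a set) module" where
  "quotient_algebra A J =
     ring.extend (A Quot J) (module.fields (\<lambda>r Y. \<Union>x\<in>Y. J +>\<^bsub>A\<^esub> (r \<odot>\<^bsub>A\<^esub> x)))"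


subsection \<open>Algebras given by generators and relations\<close>

text \<open>Words form a monoid under concatenation, so that \<^typ>\<open>'g list \<Rightarrow>\<^sub>0 'k\<close>, with the convolution
  product of the library, is the free associative algebra on \<open>'g\<close>.\<close>

instantiation list :: (type) monoid_add
begin

definition zero_list :: "'a list" where "0 = []"
definition plus_list :: "'a list \<Rightarrow> 'a list \<Rightarrow> 'a list" where "xs + ys = xs @ ys"

instance by standard (simp_all add: zero_list_def plus_list_def)

end

definition scalar :: "'k \<Rightarrow> ('g list \<Rightarrow>\<^sub>0 'k::comm_ring_1)" where
  "scalar r = Poly_Mapping.single [] r"

definition letter :: "'g \<Rightarrow> ('g list \<Rightarrow>\<^sub>0 'k::comm_ring_1)" where
  "letter g = Poly_Mapping.single [g] 1"

definition free_algebra :: "'g set \<Rightarrow> ('k::comm_ring_1, 'g list \<Rightarrow>\<^sub>0 'k) module" where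
  "free_algebra G =
     \<lparr>carrier = {p. \<forall>w\<in>Poly_Mapping.keys p. set w \<subseteq> G}, monoid.mult = (*), one = 1, ring.zero = 0, add = (+),
      module.smult = (\<lambda>r p. scalar r * p)\<rparr>"

text \<open>A relation \<open>x = y\<close> is represented by the element \<open>x - y\<close>.\<close>

definition presented_algebra ::
    "'g set \<Rightarrow> ('g list \<Rightarrow>\<^sub>0 'k::comm_ring_1) set \<Rightarrow> ('k, ('g list \<Rightarrow>\<^sub>0 'k) set) module" where
  "presented_algebra G Rels = quotient_algebra (free_algebra G) (Idl\<^bsub>free_algebra G\<^esub> Rels)"

definition generator ::
    "'g set \<Rightarrow> ('g list \<Rightarrow>\<^sub>0 'k::comm_ring_1) set \<Rightarrow> 'g \<Rightarrow> ('g list \<Rightarrow>\<^sub>0 'k) set" where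
  "generator G Rels g = (Idl\<^bsub>free_algebra G\<^esub> Rels) +>\<^bsub>free_algebra G\<^esub> letter g"

text \<open>An assignment \<open>\<phi>\<close> on the generators \<open>\<iota> g\<close> (\<open>g \<in> G\<close>) of \<open>A\<close> gives a well-defined algebra morphism
  to \<open>C\<close> if there is exactly one morphism with these values; \<open>induced_hom\<close> is that morphism.
  Extensionality only fixes the irrelevant values outside the carrier.\<close>

definition is_extension ::
    "('k::comm_ring_1, 'a, 'm) module_scheme \<Rightarrow> 'g set \<Rightarrow> ('g \<Rightarrow> 'a) \<Rightarrow> ('k, 'b, 'n) module_scheme \<Rightarrow>
     ('g \<Rightarrow> 'b) \<Rightarrow> ('a \<Rightarrow> 'b) \<Rightarrow> bool" where
  "is_extension A G \<iota> C \<phi> f \<longleftrightarrow>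
     f \<in> extensional (carrier A) \<and> alg_hom A C f \<and> (\<forall>g\<in>G. f (\<iota> g) = \<phi> g)"

definition well_defined_hom ::
    "('k::comm_ring_1, 'a, 'm) module_scheme \<Rightarrow> 'g set \<Rightarrow> ('g \<Rightarrow> 'a) \<Rightarrow> ('k, 'b, 'n) module_scheme \<Rightarrow>
     ('g \<Rightarrow> 'b) \<Rightarrow> bool" where
  "well_defined_hom A G \<iota> C \<phi> \<longleftrightarrow> (\<exists>!f. is_extension A G \<iota> C \<phi> f)"

definition induced_hom ::
    "('k::comm_ring_1, 'a, 'm) module_scheme \<Rightarrow> 'g set \<Rightarrow> ('g \<Rightarrow> 'a) \<Rightarrow> ('k, 'b, 'n) module_scheme \<Rightarrow>
     ('g \<Rightarrow> 'b) \<Rightarrow> 'a \<Rightarrow> 'b" where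
  "induced_hom A G \<iota> C \<phi> = (THE f. is_extension A G \<iota> C \<phi> f)"


subsection \<open>Tensor products\<close>

text \<open>\<open>A \<boxtimes> B\<close> is the free module on \<open>A \<times> B\<close> modulo the submodule spanned by the bilinearity
  relators, with the product induced by \<open>(a, b) (a', b') = (a a', b b')\<close>.\<close>

definition free_on_pairs ::
    "('k::comm_ring_1, 'a, 'm) module_scheme \<Rightarrow> ('k, 'b, 'n) module_scheme \<Rightarrow> ('k, ('a \<times> 'b) \<Rightarrow>\<^sub>0 'k) module" where
  "free_on_pairs A B =
     \<lparr>carrier = {p. Poly_Mapping.keys p \<subseteq> carrier A \<times> carrier B},
      monoid.mult = (\<lambda>p q. \<Sum>(a, b)\<in>Poly_Mapping.keys p. \<Sum>(a', b')\<in>Poly_Mapping.keys q.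
                Poly_Mapping.single (a \<otimes>\<^bsub>A\<^esub> a', b \<otimes>\<^bsub>B\<^esub> b')
                  (Poly_Mapping.lookup p (a, b) * Poly_Mapping.lookup q (a', b'))),
      one = Poly_Mapping.single (\<one>\<^bsub>A\<^esub>, \<one>\<^bsub>B\<^esub>) 1, ring.zero = 0, add = (+),
      module.smult = (\<lambda>r. Poly_Mapping.map ((*) r))\<rparr>"

definition bilinear_relators ::
    "('k::comm_ring_1, 'a, 'm) module_scheme \<Rightarrow> ('k, 'b, 'n) module_scheme \<Rightarrow> (('a \<times> 'b) \<Rightarrow>\<^sub>0 'k) set" where
  "bilinear_relators A B =
     {Poly_Mapping.single (a \<oplus>\<^bsub>A\<^esub> a', b) 1 - Poly_Mapping.single (a, b) 1 - Poly_Mapping.single (a', b) 1 |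
        a a' b. a \<in> carrier A \<and> a' \<in> carrier A \<and> b \<in> carrier B} \<union>
     {Poly_Mapping.single (a, b \<oplus>\<^bsub>B\<^esub> b') 1 - Poly_Mapping.single (a, b) 1 - Poly_Mapping.single (a, b') 1 |
        a b b'. a \<in> carrier A \<and> b \<in> carrier B \<and> b' \<in> carrier B} \<union>
     {Poly_Mapping.single (r \<odot>\<^bsub>A\<^esub> a, b) 1 - Poly_Mapping.single (a, b) r |
        r a b. a \<in> carrier A \<and> b \<in> carrier B} \<union>
     {Poly_Mapping.single (a, r \<odot>\<^bsub>B\<^esub> b) 1 - Poly_Mapping.single (a, b) r |
        r a b. a \<in> carrier A \<and> b \<in> carrier B}"

definition tensor_ker ::
    "('k::comm_ring_1, 'a, 'm) module_scheme \<Rightarrow> ('k, 'b, 'n) module_scheme \<Rightarrow> (('a \<times> 'b) \<Rightarrow>\<^sub>0 'k) set" where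
  "tensor_ker A B =
     (\<lambda>H. submodule H ring_of_type_algebra (free_on_pairs A B)) hull bilinear_relators A B"

definition tensor ::
    "('k::comm_ring_1, 'a, 'm) module_scheme \<Rightarrow> ('k, 'b, 'n) module_scheme \<Rightarrow>
     ('k, (('a \<times> 'b) \<Rightarrow>\<^sub>0 'k) set) module"  (infixr \<open>\<boxtimes>\<close> 72) where
  "A \<boxtimes> B = quotient_algebra (free_on_pairs A B) (tensor_ker A B)"

definition pure_tensor ::
    "'a \<Rightarrow> ('k::comm_ring_1, 'a, 'm) module_scheme \<Rightarrow> ('k, 'b, 'n) module_scheme \<Rightarrow> 'b \<Rightarrow>
     (('a \<times> 'b) \<Rightarrow>\<^sub>0 'k) set"  (\<open>(_ \<boxtimes>\<^bsub>_,_\<^esub> _)\<close> [72, 0, 0, 73] 72) where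
  "a \<boxtimes>\<^bsub>A,B\<^esub> b = tensor_ker A B +>\<^bsub>free_on_pairs A B\<^esub> Poly_Mapping.single (a, b) 1"

text \<open>The linear map \<open>A \<boxtimes> B \<rightarrow> C\<close> induced by a bilinear map \<open>\<phi>\<close>: evaluate \<open>\<phi>\<close> on any representative.\<close>

definition tensor_lift ::
    "('k::comm_ring_1, 'c, 'n) module_scheme \<Rightarrow> ('a \<Rightarrow> 'b \<Rightarrow> 'c) \<Rightarrow> (('a \<times> 'b) \<Rightarrow>\<^sub>0 'k) set \<Rightarrow> 'c" where
  "tensor_lift C \<phi> Y =
     (let p = (SOME p. p \<in> Y) in
      \<Oplus>\<^bsub>C\<^esub>x\<in>Poly_Mapping.keys p. Poly_Mapping.lookup p x \<odot>\<^bsub>C\<^esub> \<phi> (fst x) (snd x))"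

text \<open>\<open>tensor_map C D f g\<close> is \<open>f \<otimes> g\<close> with values in \<open>C \<boxtimes> D\<close>.\<close>

definition tensor_map ::
    "('k::comm_ring_1, 'c, 'm) module_scheme \<Rightarrow> ('k, 'd, 'n) module_scheme \<Rightarrow> ('a \<Rightarrow> 'c) \<Rightarrow> ('b \<Rightarrow> 'd) \<Rightarrow>
     (('a \<times> 'b) \<Rightarrow>\<^sub>0 'k) set \<Rightarrow> (('c \<times> 'd) \<Rightarrow>\<^sub>0 'k) set" where
  "tensor_map C D f g = tensor_lift (C \<boxtimes> D) (\<lambda>a b. f a \<boxtimes>\<^bsub>C,D\<^esub> g b)"

definition assoc_map ::
    "('k::comm_ring_1, 'a, 'l) module_scheme \<Rightarrow> ('k, 'b, 'm) module_scheme \<Rightarrow> ('k, 'c, 'n) module_scheme \<Rightarrow>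
     (((('a \<times> 'b) \<Rightarrow>\<^sub>0 'k) set \<times> 'c) \<Rightarrow>\<^sub>0 'k) set \<Rightarrow> (('a \<times> (('b \<times> 'c) \<Rightarrow>\<^sub>0 'k) set) \<Rightarrow>\<^sub>0 'k) set" where
  "assoc_map A B C =
     tensor_lift (A \<boxtimes> (B \<boxtimes> C)) (\<lambda>x c. tensor_lift (A \<boxtimes> (B \<boxtimes> C)) (\<lambda>a b. a \<boxtimes>\<^bsub>A,B \<boxtimes> C\<^esub> (b \<boxtimes>\<^bsub>B,C\<^esub> c)) x)"

definition flip_map ::
    "('k::comm_ring_1, 'a, 'm) module_scheme \<Rightarrow> ('k, 'b, 'n) module_scheme \<Rightarrow>
     (('a \<times> 'b) \<Rightarrow>\<^sub>0 'k) set \<Rightarrow> (('b \<times> 'a) \<Rightarrow>\<^sub>0 'k) set" where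
  "flip_map A B = tensor_lift (B \<boxtimes> A) (\<lambda>a b. b \<boxtimes>\<^bsub>B,A\<^esub> a)"

definition mult_map :: "('k::comm_ring_1, 'a, 'm) module_scheme \<Rightarrow> (('a \<times> 'a) \<Rightarrow>\<^sub>0 'k) set \<Rightarrow> 'a" where
  "mult_map A = tensor_lift A (\<lambda>x y. x \<otimes>\<^bsub>A\<^esub> y)"


section \<open>Hopf-Galois systems\<close>

record (overloaded) ('k::zero, 'a) bialgebra = "('k, 'a) module" +
  comult :: "'a \<Rightarrow> (('a \<times> 'a) \<Rightarrow>\<^sub>0 'k) set"
  counit :: "'a \<Rightarrow> 'k"

text \<open>The identifications \<open>k \<otimes> M = M = M \<otimes> k\<close> are written out as lifts of the scalar multiplication.\<close>

definition left_comodule_algebra ::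
    "('k::comm_ring_1, 'a) bialgebra \<Rightarrow> ('k, 't, 'n) module_scheme \<Rightarrow>
     ('t \<Rightarrow> (('a \<times> 't) \<Rightarrow>\<^sub>0 'k) set) \<Rightarrow> bool" where
  "left_comodule_algebra A T \<alpha> \<longleftrightarrow>
     assoc_algebra T \<and> alg_hom T (A \<boxtimes> T) \<alpha> \<and>
     (\<forall>x\<in>carrier T. assoc_map A A T (tensor_map (A \<boxtimes> A) T (comult A) (\<lambda>y. y) (\<alpha> x)) =
        tensor_map A (A \<boxtimes> T) (\<lambda>y. y) \<alpha> (\<alpha> x)) \<and>
     (\<forall>x\<in>carrier T. tensor_lift T (\<lambda>a y. counit A a \<odot>\<^bsub>T\<^esub> y) (\<alpha> x) = x)"

definition right_comodule_algebra ::
    "('k::comm_ring_1, 'b) bialgebra \<Rightarrow> ('k, 't, 'n) module_scheme \<Rightarrow>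
     ('t \<Rightarrow> (('t \<times> 'b) \<Rightarrow>\<^sub>0 'k) set) \<Rightarrow> bool" where
  "right_comodule_algebra B T \<beta> \<longleftrightarrow>
     assoc_algebra T \<and> alg_hom T (T \<boxtimes> B) \<beta> \<and>
     (\<forall>x\<in>carrier T. assoc_map T B B (tensor_map (T \<boxtimes> B) B \<beta> (\<lambda>y. y) (\<beta> x)) =
        tensor_map T (B \<boxtimes> B) (\<lambda>y. y) (comult B) (\<beta> x)) \<and>
     (\<forall>x\<in>carrier T. tensor_lift T (\<lambda>y b. counit B b \<odot>\<^bsub>T\<^esub> y) (\<beta> x) = x)"

definition bialgebra :: "('k::comm_ring_1, 'a) bialgebra \<Rightarrow> bool" where
  "bialgebra A \<longleftrightarrow>
     left_comodule_algebra A A (comult A) \<and> right_comodule_algebra A A (comult A) \<and>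
     alg_hom A ground_algebra (counit A)"

definition antipode :: "('k::comm_ring_1, 'a) bialgebra \<Rightarrow> ('a \<Rightarrow> 'a) \<Rightarrow> bool" where
  "antipode A S \<longleftrightarrow>
     linear_map A A S \<and>
     (\<forall>x\<in>carrier A.
        mult_map A (tensor_map A A S (\<lambda>y. y) (comult A x)) = counit A x \<odot>\<^bsub>A\<^esub> \<one>\<^bsub>A\<^esub> \<and>
        mult_map A (tensor_map A A (\<lambda>y. y) S (comult A x)) = counit A x \<odot>\<^bsub>A\<^esub> \<one>\<^bsub>A\<^esub>)"

definition bicomodule_algebra ::
    "('k::comm_ring_1, 'a) bialgebra \<Rightarrow> ('k, 'b) bialgebra \<Rightarrow> ('k, 't) module \<Rightarrow>
     ('t \<Rightarrow> (('a \<times> 't) \<Rightarrow>\<^sub>0 'k) set) \<Rightarrow> ('t \<Rightarrow> (('t \<times> 'b) \<Rightarrow>\<^sub>0 'k) set) \<Rightarrow> bool" where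
  "bicomodule_algebra A B T \<alpha> \<beta> \<longleftrightarrow>
     left_comodule_algebra A T \<alpha> \<and> right_comodule_algebra B T \<beta> \<and>
     (\<forall>x\<in>carrier T. assoc_map A T B (tensor_map (A \<boxtimes> T) B \<alpha> (\<lambda>y. y) (\<beta> x)) =
        tensor_map A (T \<boxtimes> B) (\<lambda>y. y) \<beta> (\<alpha> x))"

definition hopf_galois_system ::
    "('k::comm_ring_1, 'a) bialgebra \<Rightarrow> ('k, 'b) bialgebra \<Rightarrow> ('k, 't) module \<Rightarrow> ('k, 'z) module \<Rightarrow>
     ('t \<Rightarrow> (('a \<times> 't) \<Rightarrow>\<^sub>0 'k) set) \<Rightarrow> ('t \<Rightarrow> (('t \<times> 'b) \<Rightarrow>\<^sub>0 'k) set) \<Rightarrow>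
     ('a \<Rightarrow> (('t \<times> 'z) \<Rightarrow>\<^sub>0 'k) set) \<Rightarrow> ('b \<Rightarrow> (('z \<times> 't) \<Rightarrow>\<^sub>0 'k) set) \<Rightarrow> ('z \<Rightarrow> 't) \<Rightarrow> bool" where
  "hopf_galois_system A B T Z \<alpha>\<^sub>T \<beta>\<^sub>T \<gamma> \<delta> S\<^sub>Z \<longleftrightarrow>
     nonzero_algebra A \<and> nonzero_algebra B \<and> nonzero_algebra T \<and> nonzero_algebra Z \<and>
     bialgebra A \<and> bialgebra B \<and>
     bicomodule_algebra A B T \<alpha>\<^sub>T \<beta>\<^sub>T \<and>
     alg_hom A (T \<boxtimes> Z) \<gamma> \<and> alg_hom B (Z \<boxtimes> T) \<delta> \<and>
     (\<forall>x\<in>carrier T. assoc_map T Z T (tensor_map (T \<boxtimes> Z) T \<gamma> (\<lambda>y. y) (\<alpha>\<^sub>T x)) =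
        tensor_map T (Z \<boxtimes> T) (\<lambda>y. y) \<delta> (\<beta>\<^sub>T x)) \<and>
     (\<forall>a\<in>carrier A. tensor_map A (T \<boxtimes> Z) (\<lambda>y. y) \<gamma> (comult A a) =
        assoc_map A T Z (tensor_map (A \<boxtimes> T) Z \<alpha>\<^sub>T (\<lambda>y. y) (\<gamma> a))) \<and>
     (\<forall>b\<in>carrier B. assoc_map Z T B (tensor_map (Z \<boxtimes> T) B \<delta> (\<lambda>y. y) (comult B b)) =
        tensor_map Z (T \<boxtimes> B) (\<lambda>y. y) \<beta>\<^sub>T (\<delta> b)) \<and>
     linear_map Z T S\<^sub>Z \<and>
     (\<forall>a\<in>carrier A. mult_map T (tensor_map T T (\<lambda>y. y) S\<^sub>Z (\<gamma> a)) = counit A a \<odot>\<^bsub>T\<^esub> \<one>\<^bsub>T\<^esub>) \<and>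
     (\<forall>b\<in>carrier B. mult_map T (tensor_map T T S\<^sub>Z (\<lambda>y. y) (\<delta> b)) = counit B b \<odot>\<^bsub>T\<^esub> \<one>\<^bsub>T\<^esub>)"

text \<open>\<open>S\<^sub>A\<close> and \<open>S\<^sub>B\<close> are the (unique) antipodes of \<open>A\<close> and \<open>B\<close>.\<close>

definition complete_hopf_galois_system ::
    "('k::comm_ring_1, 'a) bialgebra \<Rightarrow> ('k, 'b) bialgebra \<Rightarrow> ('k, 't) module \<Rightarrow> ('k, 'z) module \<Rightarrow>
     ('a \<Rightarrow> 'a) \<Rightarrow> ('b \<Rightarrow> 'b) \<Rightarrow>
     ('t \<Rightarrow> (('a \<times> 't) \<Rightarrow>\<^sub>0 'k) set) \<Rightarrow> ('t \<Rightarrow> (('t \<times> 'b) \<Rightarrow>\<^sub>0 'k) set) \<Rightarrow>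
     ('z \<Rightarrow> (('b \<times> 'z) \<Rightarrow>\<^sub>0 'k) set) \<Rightarrow> ('z \<Rightarrow> (('z \<times> 'a) \<Rightarrow>\<^sub>0 'k) set) \<Rightarrow>
     ('a \<Rightarrow> (('t \<times> 'z) \<Rightarrow>\<^sub>0 'k) set) \<Rightarrow> ('b \<Rightarrow> (('z \<times> 't) \<Rightarrow>\<^sub>0 'k) set) \<Rightarrow>
     ('t \<Rightarrow> 'z) \<Rightarrow> ('z \<Rightarrow> 't) \<Rightarrow> bool" where
  "complete_hopf_galois_system A B T Z S\<^sub>A S\<^sub>B \<alpha>\<^sub>T \<beta>\<^sub>T lam\<^sub>Z \<rho>\<^sub>Z \<gamma> \<delta> S\<^sub>T S\<^sub>Z \<longleftrightarrow>
     hopf_galois_system A B T Z \<alpha>\<^sub>T \<beta>\<^sub>T \<gamma> \<delta> S\<^sub>Z \<and>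
     hopf_galois_system B A Z T lam\<^sub>Z \<rho>\<^sub>Z \<delta> \<gamma> S\<^sub>T \<and>
     antipode A S\<^sub>A \<and> antipode B S\<^sub>B \<and>
     (\<forall>a\<in>carrier A. assoc_map T B Z (tensor_map (T \<boxtimes> B) Z \<beta>\<^sub>T (\<lambda>y. y) (\<gamma> a)) =
        tensor_map T (B \<boxtimes> Z) (\<lambda>y. y) lam\<^sub>Z (\<gamma> a)) \<and>
     (\<forall>b\<in>carrier B. assoc_map Z A T (tensor_map (Z \<boxtimes> A) T \<rho>\<^sub>Z (\<lambda>y. y) (\<delta> b)) =
        tensor_map Z (A \<boxtimes> T) (\<lambda>y. y) \<alpha>\<^sub>T (\<delta> b)) \<and>
     (\<forall>a\<in>carrier A. flip_map Z T (tensor_map Z T S\<^sub>T S\<^sub>Z (\<gamma> a)) = \<gamma> (S\<^sub>A a)) \<and>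
     (\<forall>b\<in>carrier B. flip_map T Z (tensor_map T Z S\<^sub>Z S\<^sub>T (\<delta> b)) = \<delta> (S\<^sub>B b)) \<and>
     (\<forall>x\<in>carrier T. flip_map A Z (tensor_map A Z S\<^sub>A S\<^sub>T (\<alpha>\<^sub>T x)) = \<rho>\<^sub>Z (S\<^sub>T x)) \<and>
     (\<forall>x\<in>carrier T. flip_map Z B (tensor_map Z B S\<^sub>T S\<^sub>B (\<beta>\<^sub>T x)) = lam\<^sub>Z (S\<^sub>T x)) \<and>
     (\<forall>z\<in>carrier Z. flip_map B T (tensor_map B T S\<^sub>B S\<^sub>Z (lam\<^sub>Z z)) = \<beta>\<^sub>T (S\<^sub>Z z)) \<and>
     (\<forall>z\<in>carrier Z. flip_map T A (tensor_map T A S\<^sub>Z S\<^sub>A (\<rho>\<^sub>Z z)) = \<alpha>\<^sub>T (S\<^sub>Z z))"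

definition autonomous :: "('k, 't) module \<Rightarrow> ('t \<Rightarrow> 'z) \<Rightarrow> ('z \<Rightarrow> 't) \<Rightarrow> bool" where
  "autonomous T S\<^sub>T S\<^sub>Z \<longleftrightarrow> bij_betw (S\<^sub>Z \<circ> S\<^sub>T) (carrier T) (carrier T)"


section \<open>Symmetrizable Kac-Moody algebras over the rationals\<close>

text \<open>The Cartan subalgebra is a type \<open>'t\<close>; elements of its dual are functions \<open>'t \<Rightarrow> rat\<close>.\<close>

record ('i, 't) root_datum =
  index :: "'i set"
  t_scale :: "rat \<Rightarrow> 't \<Rightarrow> 't"
  coroot :: "'i \<Rightarrow> 't"
  root :: "'i \<Rightarrow> 't \<Rightarrow> rat"
  form :: "('t \<Rightarrow> rat) \<Rightarrow> ('t \<Rightarrow> rat) \<Rightarrow> rat"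

definition t_dual :: "('i, 't::ab_group_add) root_datum \<Rightarrow> ('t \<Rightarrow> rat) set" where
  "t_dual D = {\<mu>. Vector_Spaces.linear (t_scale D) (*) \<mu>}"

definition column_rank :: "'i set \<Rightarrow> ('i \<Rightarrow> 'i \<Rightarrow> rat) \<Rightarrow> nat" where
  "column_rank I a =
     Max {card J |J. J \<subseteq> I \<and> (\<forall>c. (\<forall>i\<in>I. (\<Sum>j\<in>J. c j * a i j) = 0) \<longrightarrow> (\<forall>j\<in>J. c j = 0))}"

locale kac_moody_algebra =
  t: vector_space "t_scale D" + g: vector_space g_scale
  for D :: "('i, 't::ab_group_add) root_datum" and g_scale :: "rat \<Rightarrow> 'g::ab_group_add \<Rightarrow> 'g" +
  fixes bracket :: "'g \<Rightarrow> 'g \<Rightarrow> 'g"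
    and incl :: "'t \<Rightarrow> 'g"
    and chev_e chev_f :: "'i \<Rightarrow> 'g"
  \<comment> \<open>a (minimal) realization of a generalized Cartan matrix\<close>
  assumes finite_index: "finite (index D)"
    and finite_dim: "\<exists>b. finite b \<and> t.span b = UNIV"
    and root_dual: "i \<in> index D \<Longrightarrow> root D i \<in> t_dual D"
    and coroot_independent:
      "(\<Sum>i\<in>index D. t_scale D (c i) (coroot D i)) = 0 \<Longrightarrow> i \<in> index D \<Longrightarrow> c i = 0"
    and root_independent:
      "(\<And>x. (\<Sum>i\<in>index D. c i * root D i x) = 0) \<Longrightarrow> i \<in> index D \<Longrightarrow> c i = 0"
    and cartan_diag: "i \<in> index D \<Longrightarrow> root D i (coroot D i) = 2"
    and cartan_int: "i \<in> index D \<Longrightarrow> j \<in> index D \<Longrightarrow> root D j (coroot D i) \<in> \<int>"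
    and cartan_nonpos: "i \<in> index D \<Longrightarrow> j \<in> index D \<Longrightarrow> i \<noteq> j \<Longrightarrow> root D j (coroot D i) \<le> 0"
    and cartan_zero:
      "i \<in> index D \<Longrightarrow> j \<in> index D \<Longrightarrow> root D j (coroot D i) = 0 \<Longrightarrow> root D i (coroot D j) = 0"
    and minimal:
      "t.dim UNIV + column_rank (index D) (\<lambda>i j. root D j (coroot D i)) = 2 * card (index D)"
  \<comment> \<open>a Lie algebra generated by the Cartan subalgebra and the Chevalley generators, without nonzero
      ideals meeting the Cartan subalgebra trivially\<close>
    and bracket_linear_right: "Vector_Spaces.linear g_scale g_scale (bracket x)"
    and bracket_linear_left: "Vector_Spaces.linear g_scale g_scale (\<lambda>x. bracket x y)"
    and bracket_alternating: "bracket x x = 0"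
    and jacobi: "bracket x (bracket y z) + bracket y (bracket z x) + bracket z (bracket x y) = 0"
    and incl_linear: "Vector_Spaces.linear (t_scale D) g_scale incl"
    and incl_inj: "inj incl"
    and bracket_tt: "bracket (incl h) (incl h') = 0"
    and bracket_ef: "i \<in> index D \<Longrightarrow> j \<in> index D \<Longrightarrow>
      bracket (chev_e i) (chev_f j) = (if i = j then incl (coroot D i) else 0)"
    and bracket_te: "i \<in> index D \<Longrightarrow> bracket (incl h) (chev_e i) = g_scale (root D i h) (chev_e i)"
    and bracket_tf: "i \<in> index D \<Longrightarrow> bracket (incl h) (chev_f i) = g_scale (- root D i h) (chev_f i)"
    and generated:
      "g.subspace S \<Longrightarrow> (\<And>x y. x \<in> S \<Longrightarrow> y \<in> S \<Longrightarrow> bracket x y \<in> S) \<Longrightarrow>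
       range incl \<union> chev_e ` index D \<union> chev_f ` index D \<subseteq> S \<Longrightarrow> S = UNIV"
    and no_ideals:
      "g.subspace S \<Longrightarrow> (\<And>x y. y \<in> S \<Longrightarrow> bracket x y \<in> S) \<Longrightarrow> S \<inter> range incl = {0} \<Longrightarrow> S = {0}"

locale symmetrizable_kac_moody_algebra = kac_moody_algebra +
  assumes form_sym: "\<mu> \<in> t_dual D \<Longrightarrow> \<nu> \<in> t_dual D \<Longrightarrow> form D \<mu> \<nu> = form D \<nu> \<mu>"
    and form_add: "\<mu> \<in> t_dual D \<Longrightarrow> \<mu>' \<in> t_dual D \<Longrightarrow> \<nu> \<in> t_dual D \<Longrightarrow>
      form D (\<lambda>x. \<mu> x + \<mu>' x) \<nu> = form D \<mu> \<nu> + form D \<mu>' \<nu>"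
    and form_scale: "\<mu> \<in> t_dual D \<Longrightarrow> \<nu> \<in> t_dual D \<Longrightarrow> form D (\<lambda>x. c * \<mu> x) \<nu> = c * form D \<mu> \<nu>"
    and form_nondegenerate:
      "\<mu> \<in> t_dual D \<Longrightarrow> (\<And>\<nu>. \<nu> \<in> t_dual D \<Longrightarrow> form D \<mu> \<nu> = 0) \<Longrightarrow> \<mu> = (\<lambda>x. 0)"
    and form_even: "i \<in> index D \<Longrightarrow> \<exists>n::nat. 0 < n \<and> form D (root D i) (root D i) = 2 * of_nat n"
    and coroot_form: "i \<in> index D \<Longrightarrow> \<mu> \<in> t_dual D \<Longrightarrow>
      \<mu> (coroot D i) = 2 * form D (root D i) \<mu> / form D (root D i) (root D i)"


section \<open>The Kashiwara algebra and the two quantized enveloping algebras\<close>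

definition coroot_lattice :: "('i, 't::ab_group_add) root_datum \<Rightarrow> 't set" where
  "coroot_lattice D = {\<Sum>i\<in>index D. t_scale D (of_int (n i)) (coroot D i) |n. True}"

text \<open>\<open>qpow x\<close> is \<open>q\<^sup>x = exp (x \<hbar>)\<close> in the ring of formal power series in \<open>\<hbar>\<close>.\<close>

abbreviation qpow :: "rat \<Rightarrow> rat fps" where
  "qpow x \<equiv> fps_exp x"

definition half_norm :: "('i, 't) root_datum \<Rightarrow> 'i \<Rightarrow> rat" where
  "half_norm D i = form D (root D i) (root D i) / 2"

definition q_int :: "('i, 't) root_datum \<Rightarrow> 'i \<Rightarrow> nat \<Rightarrow> rat fps" where
  "q_int D i n =
     (qpow (half_norm D i * of_nat n) - qpow (- half_norm D i * of_nat n)) /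
     (qpow (half_norm D i) - qpow (- half_norm D i))"

definition q_fact :: "('i, 't) root_datum \<Rightarrow> 'i \<Rightarrow> nat \<Rightarrow> rat fps" where
  "q_fact D i n = (\<Prod>k=1..n. q_int D i k)"

text \<open>The constructors stand for \<open>e'\<^sub>i\<close>, \<open>f\<^sub>i\<close> and \<open>q\<^sup>h\<close>, and for their counterparts in the other two
  algebras.\<close>

datatype ('i, 't) gen = E 'i | F 'i | Q 't

type_synonym ('i, 't) elt = "(('i, 't) gen list \<Rightarrow>\<^sub>0 rat fps) set"

definition gens :: "('i, 't::ab_group_add) root_datum \<Rightarrow> ('i, 't) gen set" where
  "gens D = E ` index D \<union> F ` index D \<union> Q ` coroot_lattice D"

text \<open>\<open>t\<^sub>i = q\<^bsup>t_exp D i\<^esup>\<close>\<close>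

definition t_exp :: "('i, 't) root_datum \<Rightarrow> 'i \<Rightarrow> 't" where
  "t_exp D i = t_scale D (half_norm D i) (coroot D i)"

definition divided_power ::
    "('i, 't) root_datum \<Rightarrow> 'i \<Rightarrow> nat \<Rightarrow> ('g list \<Rightarrow>\<^sub>0 rat fps) \<Rightarrow> 'g list \<Rightarrow>\<^sub>0 rat fps" where
  "divided_power D i n x = scalar (inverse (q_fact D i n)) * x ^ n"

definition serre ::
    "('i, 't) root_datum \<Rightarrow> ('i \<Rightarrow> 'g list \<Rightarrow>\<^sub>0 rat fps) \<Rightarrow> 'i \<Rightarrow> 'i \<Rightarrow> 'g list \<Rightarrow>\<^sub>0 rat fps" where
  "serre D Y i j =
     (let N = nat \<lfloor>1 - root D j (coroot D i)\<rfloor> in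
      \<Sum>k=0..N. (- 1) ^ k * divided_power D i k (Y i) * Y j * divided_power D i (N - k) (Y i))"

definition common_rels ::
    "('i, 't::ab_group_add) root_datum \<Rightarrow> (('i, 't) gen list \<Rightarrow>\<^sub>0 rat fps) set" where
  "common_rels D =
     {letter (Q 0) - 1} \<union>
     {letter (Q h) * letter (Q h') - letter (Q (h + h')) |h h'. h \<in> coroot_lattice D \<and> h' \<in> coroot_lattice D} \<union>
     {letter (Q h) * letter (E i) * letter (Q (- h)) - scalar (qpow (root D i h)) * letter (E i) |h i.
        h \<in> coroot_lattice D \<and> i \<in> index D} \<union>
     {letter (Q h) * letter (F i) * letter (Q (- h)) - scalar (qpow (- root D i h)) * letter (F i) |h i.
        h \<in> coroot_lattice D \<and> i \<in> index D} \<union>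
     {serre D (\<lambda>k. letter (E k)) i j |i j. i \<in> index D \<and> j \<in> index D \<and> i \<noteq> j} \<union>
     {serre D (\<lambda>k. letter (F k)) i j |i j. i \<in> index D \<and> j \<in> index D \<and> i \<noteq> j}"

definition kashiwara_rels ::
    "('i, 't::ab_group_add) root_datum \<Rightarrow> (('i, 't) gen list \<Rightarrow>\<^sub>0 rat fps) set" where
  "kashiwara_rels D = common_rels D \<union>
     {letter (E i) * letter (F j) -
        (scalar (qpow (half_norm D i * root D j (coroot D i))) * letter (F j) * letter (E i) +
         (if i = j then 1 else 0)) |i j. i \<in> index D \<and> j \<in> index D}"

definition U_hat_rels ::
    "('i, 't::ab_group_add) root_datum \<Rightarrow> (('i, 't) gen list \<Rightarrow>\<^sub>0 rat fps) set" where
  "U_hat_rels D = common_rels D \<union>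
     {letter (E i) * letter (F j) - letter (F j) * letter (E i) -
        (if i = j then letter (Q (t_exp D i)) - letter (Q (- t_exp D i)) else 0) |i j.
        i \<in> index D \<and> j \<in> index D}"

definition U_prime_rels ::
    "('i, 't::ab_group_add) root_datum \<Rightarrow> (('i, 't) gen list \<Rightarrow>\<^sub>0 rat fps) set" where
  "U_prime_rels D = common_rels D \<union>
     {letter (E i) * letter (F j) -
        scalar (qpow (- half_norm D i * root D j (coroot D i))) * letter (F j) * letter (E i) |i j.
        i \<in> index D \<and> j \<in> index D}"

definition kashiwara :: "('i, 't::ab_group_add) root_datum \<Rightarrow> (rat fps, ('i, 't) elt) module" where
  "kashiwara D = presented_algebra (gens D) (kashiwara_rels D)"

definition U_hat_alg :: "('i, 't::ab_group_add) root_datum \<Rightarrow> (rat fps, ('i, 't) elt) module" where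
  "U_hat_alg D = presented_algebra (gens D) (U_hat_rels D)"

definition U_prime_alg :: "('i, 't::ab_group_add) root_datum \<Rightarrow> (rat fps, ('i, 't) elt) module" where
  "U_prime_alg D = presented_algebra (gens D) (U_prime_rels D)"

definition kashiwara_gen :: "('i, 't::ab_group_add) root_datum \<Rightarrow> ('i, 't) gen \<Rightarrow> ('i, 't) elt" where
  "kashiwara_gen D = generator (gens D) (kashiwara_rels D)"

definition U_hat_gen :: "('i, 't::ab_group_add) root_datum \<Rightarrow> ('i, 't) gen \<Rightarrow> ('i, 't) elt" where
  "U_hat_gen D = generator (gens D) (U_hat_rels D)"

definition U_prime_gen :: "('i, 't::ab_group_add) root_datum \<Rightarrow> ('i, 't) gen \<Rightarrow> ('i, 't) elt" where
  "U_prime_gen D = generator (gens D) (U_prime_rels D)"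


subsection \<open>The Hopf algebra structures\<close>

fun U_counit_on :: "('i, 't) gen \<Rightarrow> rat fps" where
  "U_counit_on (E i) = 0"
| "U_counit_on (F i) = 0"
| "U_counit_on (Q h) = 1"

abbreviation kashiwara_op :: "('i, 't::ab_group_add) root_datum \<Rightarrow> (rat fps, ('i, 't) elt) module" where
  "kashiwara_op D \<equiv> op_algebra (kashiwara D)"

context
  fixes D :: "('i, 't::ab_group_add) root_datum"
begin

private abbreviation (input) "\<V>\<^sub>0 \<equiv> U_hat_alg D"
private abbreviation (input) "e\<^sub>V i \<equiv> U_hat_gen D (E i)"
private abbreviation (input) "f\<^sub>V i \<equiv> U_hat_gen D (F i)"
private abbreviation (input) "q\<^sub>V h \<equiv> U_hat_gen D (Q h)"
private abbreviation (input) "t\<^sub>V i \<equiv> q\<^sub>V (t_exp D i)"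
private abbreviation (input) "u\<^sub>V i \<equiv> q\<^sub>V (- t_exp D i)" \<comment> \<open>the inverse of \<open>t\<^sub>i\<close>\<close>

private abbreviation (input) "\<W>\<^sub>0 \<equiv> U_prime_alg D"
private abbreviation (input) "e\<^sub>W i \<equiv> U_prime_gen D (E i)"
private abbreviation (input) "f\<^sub>W i \<equiv> U_prime_gen D (F i)"
private abbreviation (input) "q\<^sub>W h \<equiv> U_prime_gen D (Q h)"
private abbreviation (input) "t\<^sub>W i \<equiv> q\<^sub>W (t_exp D i)"
private abbreviation (input) "u\<^sub>W i \<equiv> q\<^sub>W (- t_exp D i)"

fun U_hat_comult_on :: "('i, 't) gen \<Rightarrow> ((('i, 't) elt \<times> ('i, 't) elt) \<Rightarrow>\<^sub>0 rat fps) set" where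
  "U_hat_comult_on (E i) = e\<^sub>V i \<boxtimes>\<^bsub>\<V>\<^sub>0,\<V>\<^sub>0\<^esub> \<one>\<^bsub>\<V>\<^sub>0\<^esub> \<oplus>\<^bsub>\<V>\<^sub>0 \<boxtimes> \<V>\<^sub>0\<^esub> t\<^sub>V i \<boxtimes>\<^bsub>\<V>\<^sub>0,\<V>\<^sub>0\<^esub> e\<^sub>V i"
| "U_hat_comult_on (F i) = f\<^sub>V i \<boxtimes>\<^bsub>\<V>\<^sub>0,\<V>\<^sub>0\<^esub> u\<^sub>V i \<oplus>\<^bsub>\<V>\<^sub>0 \<boxtimes> \<V>\<^sub>0\<^esub> \<one>\<^bsub>\<V>\<^sub>0\<^esub> \<boxtimes>\<^bsub>\<V>\<^sub>0,\<V>\<^sub>0\<^esub> f\<^sub>V i"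
| "U_hat_comult_on (Q h) = q\<^sub>V h \<boxtimes>\<^bsub>\<V>\<^sub>0,\<V>\<^sub>0\<^esub> q\<^sub>V h"

fun U_hat_antipode_on :: "('i, 't) gen \<Rightarrow> ('i, 't) elt" where
  "U_hat_antipode_on (E i) = \<ominus>\<^bsub>\<V>\<^sub>0\<^esub> (u\<^sub>V i \<otimes>\<^bsub>\<V>\<^sub>0\<^esub> e\<^sub>V i)"
| "U_hat_antipode_on (F i) = \<ominus>\<^bsub>\<V>\<^sub>0\<^esub> (f\<^sub>V i \<otimes>\<^bsub>\<V>\<^sub>0\<^esub> t\<^sub>V i)"
| "U_hat_antipode_on (Q h) = q\<^sub>V (- h)"

fun U_prime_comult_on :: "('i, 't) gen \<Rightarrow> ((('i, 't) elt \<times> ('i, 't) elt) \<Rightarrow>\<^sub>0 rat fps) set" where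
  "U_prime_comult_on (E i) = e\<^sub>W i \<boxtimes>\<^bsub>\<W>\<^sub>0,\<W>\<^sub>0\<^esub> \<one>\<^bsub>\<W>\<^sub>0\<^esub> \<oplus>\<^bsub>\<W>\<^sub>0 \<boxtimes> \<W>\<^sub>0\<^esub> t\<^sub>W i \<boxtimes>\<^bsub>\<W>\<^sub>0,\<W>\<^sub>0\<^esub> e\<^sub>W i"
| "U_prime_comult_on (F i) = f\<^sub>W i \<boxtimes>\<^bsub>\<W>\<^sub>0,\<W>\<^sub>0\<^esub> \<one>\<^bsub>\<W>\<^sub>0\<^esub> \<oplus>\<^bsub>\<W>\<^sub>0 \<boxtimes> \<W>\<^sub>0\<^esub> t\<^sub>W i \<boxtimes>\<^bsub>\<W>\<^sub>0,\<W>\<^sub>0\<^esub> f\<^sub>W i"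
| "U_prime_comult_on (Q h) = q\<^sub>W h \<boxtimes>\<^bsub>\<W>\<^sub>0,\<W>\<^sub>0\<^esub> q\<^sub>W h"

fun U_prime_antipode_on :: "('i, 't) gen \<Rightarrow> ('i, 't) elt" where
  "U_prime_antipode_on (E i) = \<ominus>\<^bsub>\<W>\<^sub>0\<^esub> (u\<^sub>W i \<otimes>\<^bsub>\<W>\<^sub>0\<^esub> e\<^sub>W i)"
| "U_prime_antipode_on (F i) = \<ominus>\<^bsub>\<W>\<^sub>0\<^esub> (u\<^sub>W i \<otimes>\<^bsub>\<W>\<^sub>0\<^esub> f\<^sub>W i)"
| "U_prime_antipode_on (Q h) = q\<^sub>W (- h)"

definition U_hat :: "(rat fps, ('i, 't) elt) bialgebra" where
  "U_hat = module.extend \<V>\<^sub>0 (bialgebra.fields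
     (induced_hom \<V>\<^sub>0 (gens D) (U_hat_gen D) (\<V>\<^sub>0 \<boxtimes> \<V>\<^sub>0) U_hat_comult_on)
     (induced_hom \<V>\<^sub>0 (gens D) (U_hat_gen D) ground_algebra U_counit_on))"

definition U_prime :: "(rat fps, ('i, 't) elt) bialgebra" where
  "U_prime = module.extend \<W>\<^sub>0 (bialgebra.fields
     (induced_hom \<W>\<^sub>0 (gens D) (U_prime_gen D) (\<W>\<^sub>0 \<boxtimes> \<W>\<^sub>0) U_prime_comult_on)
     (induced_hom \<W>\<^sub>0 (gens D) (U_prime_gen D) ground_algebra U_counit_on))"

text \<open>Antipodes are morphisms to the opposite algebra.\<close>

definition U_hat_antipode :: "('i, 't) elt \<Rightarrow> ('i, 't) elt" where
  "U_hat_antipode = induced_hom \<V>\<^sub>0 (gens D) (U_hat_gen D) (op_algebra \<V>\<^sub>0) U_hat_antipode_on"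

definition U_prime_antipode :: "('i, 't) elt \<Rightarrow> ('i, 't) elt" where
  "U_prime_antipode = induced_hom \<W>\<^sub>0 (gens D) (U_prime_gen D) (op_algebra \<W>\<^sub>0) U_prime_antipode_on"


subsection \<open>The structure maps of the Hopf-Galois system\<close>

text \<open>Throughout, \<open>\<otimes>\<^bsub>\<B>\<^esub>\<close> is the product of the Kashiwara algebra \<open>\<B>\<close>, also in tensor factors
  that carry the opposite algebra \<open>\<O>\<close>.\<close>

private abbreviation (input) "\<B> \<equiv> kashiwara D"
private abbreviation (input) "\<O> \<equiv> kashiwara_op D"
private abbreviation (input) "e i \<equiv> kashiwara_gen D (E i)"
private abbreviation (input) "f i \<equiv> kashiwara_gen D (F i)"
private abbreviation (input) "q h \<equiv> kashiwara_gen D (Q h)"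
private abbreviation (input) "t i \<equiv> q (t_exp D i)"
private abbreviation (input) "u i \<equiv> q (- t_exp D i)" \<comment> \<open>the inverse of \<open>t\<^sub>i\<close>\<close>

private abbreviation (input) "\<V> \<equiv> U_hat"
private abbreviation (input) "\<W> \<equiv> U_prime"

fun alpha_B_on :: "('i, 't) gen \<Rightarrow> ((('i, 't) elt \<times> ('i, 't) elt) \<Rightarrow>\<^sub>0 rat fps) set" where
  "alpha_B_on (E i) =
     \<one>\<^bsub>\<W>\<^esub> \<boxtimes>\<^bsub>\<W>,\<B>\<^esub> e i \<oplus>\<^bsub>\<W> \<boxtimes> \<B>\<^esub> (u\<^sub>W i \<otimes>\<^bsub>\<W>\<^esub> e\<^sub>W i) \<boxtimes>\<^bsub>\<W>,\<B>\<^esub> u i"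
| "alpha_B_on (F i) =
     \<one>\<^bsub>\<W>\<^esub> \<boxtimes>\<^bsub>\<W>,\<B>\<^esub> f i \<oplus>\<^bsub>\<W> \<boxtimes> \<B>\<^esub> (u\<^sub>W i \<otimes>\<^bsub>\<W>\<^esub> f\<^sub>W i) \<boxtimes>\<^bsub>\<W>,\<B>\<^esub> u i"
| "alpha_B_on (Q h) = q\<^sub>W h \<boxtimes>\<^bsub>\<W>,\<B>\<^esub> q h"

fun beta_B_on :: "('i, 't) gen \<Rightarrow> ((('i, 't) elt \<times> ('i, 't) elt) \<Rightarrow>\<^sub>0 rat fps) set" where
  "beta_B_on (E i) =
     \<one>\<^bsub>\<B>\<^esub> \<boxtimes>\<^bsub>\<B>,\<V>\<^esub> (u\<^sub>V i \<otimes>\<^bsub>\<V>\<^esub> e\<^sub>V i) \<oplus>\<^bsub>\<B> \<boxtimes> \<V>\<^esub> e i \<boxtimes>\<^bsub>\<B>,\<V>\<^esub> u\<^sub>V i"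
| "beta_B_on (F i) =
     f i \<boxtimes>\<^bsub>\<B>,\<V>\<^esub> u\<^sub>V i \<oplus>\<^bsub>\<B> \<boxtimes> \<V>\<^esub> \<one>\<^bsub>\<B>\<^esub> \<boxtimes>\<^bsub>\<B>,\<V>\<^esub> f\<^sub>V i"
| "beta_B_on (Q h) = q h \<boxtimes>\<^bsub>\<B>,\<V>\<^esub> q\<^sub>V h"

fun alpha_Bop_on :: "('i, 't) gen \<Rightarrow> ((('i, 't) elt \<times> ('i, 't) elt) \<Rightarrow>\<^sub>0 rat fps) set" where
  "alpha_Bop_on (E i) =
     t\<^sub>V i \<boxtimes>\<^bsub>\<V>,\<O>\<^esub> e i \<ominus>\<^bsub>\<V> \<boxtimes> \<O>\<^esub> e\<^sub>V i \<boxtimes>\<^bsub>\<V>,\<O>\<^esub> \<one>\<^bsub>\<O>\<^esub>"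
| "alpha_Bop_on (F i) =
     (\<ominus>\<^bsub>\<V> \<boxtimes> \<O>\<^esub> ((t\<^sub>V i \<otimes>\<^bsub>\<V>\<^esub> f\<^sub>V i) \<boxtimes>\<^bsub>\<V>,\<O>\<^esub> \<one>\<^bsub>\<O>\<^esub>)) \<oplus>\<^bsub>\<V> \<boxtimes> \<O>\<^esub> t\<^sub>V i \<boxtimes>\<^bsub>\<V>,\<O>\<^esub> f i"
| "alpha_Bop_on (Q h) = q\<^sub>V (- h) \<boxtimes>\<^bsub>\<V>,\<O>\<^esub> q h"

fun beta_Bop_on :: "('i, 't) gen \<Rightarrow> ((('i, 't) elt \<times> ('i, 't) elt) \<Rightarrow>\<^sub>0 rat fps) set" where
  "beta_Bop_on (E i) =
     (\<ominus>\<^bsub>\<O> \<boxtimes> \<W>\<^esub> (u i \<boxtimes>\<^bsub>\<O>,\<W>\<^esub> e\<^sub>W i)) \<oplus>\<^bsub>\<O> \<boxtimes> \<W>\<^esub> e i \<boxtimes>\<^bsub>\<O>,\<W>\<^esub> \<one>\<^bsub>\<W>\<^esub>"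
| "beta_Bop_on (F i) =
     (\<ominus>\<^bsub>\<O> \<boxtimes> \<W>\<^esub> (u i \<boxtimes>\<^bsub>\<O>,\<W>\<^esub> f\<^sub>W i)) \<oplus>\<^bsub>\<O> \<boxtimes> \<W>\<^esub> f i \<boxtimes>\<^bsub>\<O>,\<W>\<^esub> \<one>\<^bsub>\<W>\<^esub>"
| "beta_Bop_on (Q h) = q h \<boxtimes>\<^bsub>\<O>,\<W>\<^esub> q\<^sub>W (- h)"

fun gamma_on :: "('i, 't) gen \<Rightarrow> ((('i, 't) elt \<times> ('i, 't) elt) \<Rightarrow>\<^sub>0 rat fps) set" where
  "gamma_on (E i) =
     (t i \<otimes>\<^bsub>\<B>\<^esub> e i) \<boxtimes>\<^bsub>\<B>,\<O>\<^esub> \<one>\<^bsub>\<O>\<^esub> \<ominus>\<^bsub>\<B> \<boxtimes> \<O>\<^esub> t i \<boxtimes>\<^bsub>\<B>,\<O>\<^esub> e i"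
| "gamma_on (F i) =
     (t i \<otimes>\<^bsub>\<B>\<^esub> f i) \<boxtimes>\<^bsub>\<B>,\<O>\<^esub> \<one>\<^bsub>\<O>\<^esub> \<ominus>\<^bsub>\<B> \<boxtimes> \<O>\<^esub> t i \<boxtimes>\<^bsub>\<B>,\<O>\<^esub> f i"
| "gamma_on (Q h) = q h \<boxtimes>\<^bsub>\<B>,\<O>\<^esub> q (- h)"

fun delta_on :: "('i, 't) gen \<Rightarrow> ((('i, 't) elt \<times> ('i, 't) elt) \<Rightarrow>\<^sub>0 rat fps) set" where
  "delta_on (E i) =
     u i \<boxtimes>\<^bsub>\<O>,\<B>\<^esub> (t i \<otimes>\<^bsub>\<B>\<^esub> e i) \<ominus>\<^bsub>\<O> \<boxtimes> \<B>\<^esub> e i \<boxtimes>\<^bsub>\<O>,\<B>\<^esub> \<one>\<^bsub>\<B>\<^esub>"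
| "delta_on (F i) =
     \<one>\<^bsub>\<O>\<^esub> \<boxtimes>\<^bsub>\<O>,\<B>\<^esub> f i \<ominus>\<^bsub>\<O> \<boxtimes> \<B>\<^esub> (f i \<otimes>\<^bsub>\<B>\<^esub> t i) \<boxtimes>\<^bsub>\<O>,\<B>\<^esub> u i"
| "delta_on (Q h) = q (- h) \<boxtimes>\<^bsub>\<O>,\<B>\<^esub> q h"

fun theta_B_on :: "('i, 't) gen \<Rightarrow> ('i, 't) elt" where
  "theta_B_on (E i) = u i \<otimes>\<^bsub>\<B>\<^esub> e i \<otimes>\<^bsub>\<B>\<^esub> t i"
| "theta_B_on (F i) = u i \<otimes>\<^bsub>\<B>\<^esub> f i \<otimes>\<^bsub>\<B>\<^esub> t i"
| "theta_B_on (Q h) = q h"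

definition alpha_B where
  "alpha_B = induced_hom \<B> (gens D) (kashiwara_gen D) (\<W> \<boxtimes> \<B>) alpha_B_on"

definition beta_B where
  "beta_B = induced_hom \<B> (gens D) (kashiwara_gen D) (\<B> \<boxtimes> \<V>) beta_B_on"

definition alpha_Bop where
  "alpha_Bop = induced_hom \<O> (gens D) (kashiwara_gen D) (\<V> \<boxtimes> \<O>) alpha_Bop_on"

definition beta_Bop where
  "beta_Bop = induced_hom \<O> (gens D) (kashiwara_gen D) (\<O> \<boxtimes> \<W>) beta_Bop_on"

definition gamma_B where
  "gamma_B = induced_hom \<W> (gens D) (U_prime_gen D) (\<B> \<boxtimes> \<O>) gamma_on"

definition delta_B where
  "delta_B = induced_hom \<V> (gens D) (U_hat_gen D) (\<O> \<boxtimes> \<B>) delta_on"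

definition S_B where
  "S_B = induced_hom \<B> (gens D) (kashiwara_gen D) (op_algebra \<O>) theta_B_on"

definition S_Bop :: "('i, 't) elt \<Rightarrow> ('i, 't) elt" where
  "S_Bop = (\<lambda>x. x)"

end

end

theory Submission imports Defs begin

text \<open>
  The four algebras of the statement belong to one family. For scalars \<open>a\<close> and \<open>b\<close> let \<open>H[a,b]\<close> be the
  algebra on \<open>E i\<close>, \<open>F i\<close>, \<open>Q h\<close> with the usual weight and Serre relations and
  \<open>E i F j - F j E i = \<delta>\<^sub>i\<^sub>j (b T i - a T i\<inverse>)\<close>, where \<open>T i = Q (t_exp D i)\<close>. The algebra \<open>U_hat\<close> is
  \<open>H[1,1]\<close>, and an invertible change of generators identifies \<open>U_prime\<close> with \<open>H[0,0]\<close>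
  (\<open>E = e'\<close>, \<open>F = t\<inverse> f'\<close>), the Kashiwara algebra with \<open>H[0,1]\<close> (\<open>E = t e'\<close>, \<open>F = f\<close>) and its opposite
  with \<open>H[1,0]\<close> (\<open>E = - e'\<close>, \<open>F = - f t\<close>, \<open>Q h = q\<^bsup>-h\<^esup>\<close>, products in the Kashiwara algebra).

  The standard Hopf algebra formulas make sense for the whole family and give morphisms
  \<open>H[a,c] \<rightarrow> H[a,b] \<otimes> H[b,c]\<close>, counits \<open>H[a,a] \<rightarrow> R\<close> and anti-morphisms \<open>H[a,b] \<rightarrow> H[b,a]\<close>: in the
  commutator of \<open>E i \<otimes> 1 + T i \<otimes> E i\<close> and \<open>F i \<otimes> T i\<inverse> + 1 \<otimes> F i\<close> the two terms with the middle scalar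
  cancel, and inverting the group-like elements exchanges the two scalars. In other words, the algebras
  \<open>H[a,b]\<close> form a cogroupoid whose objects are scalars. In the coordinates above every structure map of
  the statement is one of these morphisms, and every compatibility in a complete Hopf-Galois system is an
  instance of coassociativity, the counit law, the antipode law or the rule that the antipode reverses
  comultiplication. Each of these laws is checked on the coordinates \<open>E i\<close>, \<open>F i\<close>, \<open>Q h\<close>
  (\<open>coassociativity\<close>, \<open>counit_left\<close>, \<open>counit_right\<close>, \<open>antipode_left\<close>, \<open>antipode_right\<close>,
  \<open>antipode_anticomultiplicative\<close>); for the antipode laws one needs that the elements satisfying them
  form a subalgebra.

  The substance of well-definedness is that the formulas respect the Serre relations
  (\<open>product_relations\<close>, \<open>antipode_relations\<close>). By the q-binomial theorem a Serre polynomial is, up to a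
  unit, an iterated q-commutator (\<open>serre_eq_qchain\<close>). In this form it is easy to see how it behaves when
  a q-commuting term is added (\<open>qchain_add_q_commuting\<close>, \<open>qchain_q_seq_sum\<close>), when the variables are
  multiplied by group-like elements (\<open>qchain_twist\<close>) and in the opposite algebra (\<open>qchain_op\<close>).

  The algebras \<open>U_prime\<close> and \<open>U_hat\<close> are nonzero since they have counits; the Kashiwara algebra is
  nonzero since at \<open>q = 1\<close> it acts on power series by derivatives and multiplications. The system is
  autonomous since the torsor map rescales the coordinates by powers of \<open>q\<close>.
\<close>

section \<open>Associative algebras and their homomorphisms\<close>

lemma ring_of_type_algebra_simps [simp]:
  "carrier ring_of_type_algebra = UNIV"
  "x \<otimes>\<^bsub>ring_of_type_algebra\<^esub> y = x * y"
  "x \<oplus>\<^bsub>ring_of_type_algebra\<^esub> y = x + y"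
  "\<one>\<^bsub>ring_of_type_algebra\<^esub> = 1"
  "\<zero>\<^bsub>ring_of_type_algebra\<^esub> = 0"
  by (simp_all add: ring_of_type_algebra_def)

lemma assoc_algebraI:
  fixes A :: "('k::comm_ring_1, 'a, 'm) module_scheme" (structure)
  assumes "ring A"
    and "\<And>r x. x \<in> carrier A \<Longrightarrow> r \<odot> x \<in> carrier A"
    and "\<And>r s x. x \<in> carrier A \<Longrightarrow> (r + s) \<odot> x = r \<odot> x \<oplus> s \<odot> x"
    and "\<And>r x y. x \<in> carrier A \<Longrightarrow> y \<in> carrier A \<Longrightarrow> r \<odot> (x \<oplus> y) = r \<odot> x \<oplus> r \<odot> y"
    and "\<And>r s x. x \<in> carrier A \<Longrightarrow> (r * s) \<odot> x = r \<odot> (s \<odot> x)"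
    and "\<And>x. x \<in> carrier A \<Longrightarrow> 1 \<odot> x = x"
    and "\<And>r x y. x \<in> carrier A \<Longrightarrow> y \<in> carrier A \<Longrightarrow> (r \<odot> x) \<otimes> y = r \<odot> (x \<otimes> y)"
    and "\<And>r x y. x \<in> carrier A \<Longrightarrow> y \<in> carrier A \<Longrightarrow> x \<otimes> (r \<odot> y) = r \<odot> (x \<otimes> y)"
  shows "assoc_algebra A"
  unfolding assoc_algebra_def
  using assms by (auto intro!: moduleI cring_from_type_algebra ring.is_abelian_group)

locale assoc_alg =
  fixes A :: "('k::comm_ring_1, 'a, 'm) module_scheme" (structure)
  assumes assoc_algebra: "assoc_algebra A"
begin

sublocale ring A
  using assoc_algebra by (simp add: assoc_algebra_def)

lemma module: "module ring_of_type_algebra A"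
  using assoc_algebra by (simp add: assoc_algebra_def)

lemma smult_closed [simp, intro]: "x \<in> carrier A \<Longrightarrow> r \<odot> x \<in> carrier A"
  using module.smult_closed[OF module] by simp

lemma smult_l_distr: "x \<in> carrier A \<Longrightarrow> (r + s) \<odot> x = r \<odot> x \<oplus> s \<odot> x"
  using module.smult_l_distr[OF module] by simp

lemma smult_r_distr: "x \<in> carrier A \<Longrightarrow> y \<in> carrier A \<Longrightarrow> r \<odot> (x \<oplus> y) = r \<odot> x \<oplus> r \<odot> y"
  using module.smult_r_distr[OF module] by simp

lemma smult_smult [simp]: "x \<in> carrier A \<Longrightarrow> r \<odot> (s \<odot> x) = (r * s) \<odot> x"
  using module.smult_assoc1[OF module] by simp

lemma smult_one [simp]: "x \<in> carrier A \<Longrightarrow> 1 \<odot> x = x"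
  using module.smult_one[OF module] by simp

lemma mult_smult_left [simp]:
  "x \<in> carrier A \<Longrightarrow> y \<in> carrier A \<Longrightarrow> (r \<odot> x) \<otimes> y = r \<odot> (x \<otimes> y)"
  using assoc_algebra by (simp add: assoc_algebra_def)

lemma mult_smult_right [simp]:
  "x \<in> carrier A \<Longrightarrow> y \<in> carrier A \<Longrightarrow> x \<otimes> (r \<odot> y) = r \<odot> (x \<otimes> y)"
  using assoc_algebra by (simp add: assoc_algebra_def)

lemma smult_zero_left [simp]: "x \<in> carrier A \<Longrightarrow> 0 \<odot> x = \<zero>"
  using module.smult_l_null[OF module] by simp

lemma smult_zero_right [simp]: "r \<odot> \<zero> = \<zero>"
  using module.smult_r_null[OF module] by simp

lemma smult_minus_right: "x \<in> carrier A \<Longrightarrow> r \<odot> (\<ominus> x) = \<ominus> (r \<odot> x)"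
  using module.smult_r_minus[OF module] by simp

lemma smult_minus_left: "x \<in> carrier A \<Longrightarrow> (- r) \<odot> x = \<ominus> (r \<odot> x)"
  using minus_equality[of "(- r) \<odot> x" "r \<odot> x"] smult_l_distr[of x "- r" r] by simp

lemma minus_eq_smult: "x \<in> carrier A \<Longrightarrow> \<ominus> x = (- 1) \<odot> x"
  by (simp add: smult_minus_left)

lemma smult_diff_right:
  "x \<in> carrier A \<Longrightarrow> y \<in> carrier A \<Longrightarrow> r \<odot> (x \<ominus> y) = r \<odot> x \<ominus> r \<odot> y"
  by (simp add: a_minus_def smult_r_distr smult_minus_right)

end

lemma alg_homI:
  assumes "\<And>x. x \<in> carrier A \<Longrightarrow> f x \<in> carrier C"
    and "\<And>x y. x \<in> carrier A \<Longrightarrow> y \<in> carrier A \<Longrightarrow> f (x \<otimes>\<^bsub>A\<^esub> y) = f x \<otimes>\<^bsub>C\<^esub> f y"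
    and "\<And>x y. x \<in> carrier A \<Longrightarrow> y \<in> carrier A \<Longrightarrow> f (x \<oplus>\<^bsub>A\<^esub> y) = f x \<oplus>\<^bsub>C\<^esub> f y"
    and "f \<one>\<^bsub>A\<^esub> = \<one>\<^bsub>C\<^esub>"
    and "\<And>r x. x \<in> carrier A \<Longrightarrow> f (r \<odot>\<^bsub>A\<^esub> x) = r \<odot>\<^bsub>C\<^esub> f x"
  shows "alg_hom A C f"
  using assms by (auto simp: alg_hom_def intro!: ring_hom_memI)

lemma alg_homD:
  assumes "alg_hom A C f"
  shows "x \<in> carrier A \<Longrightarrow> f x \<in> carrier C"
    and "x \<in> carrier A \<Longrightarrow> y \<in> carrier A \<Longrightarrow> f (x \<otimes>\<^bsub>A\<^esub> y) = f x \<otimes>\<^bsub>C\<^esub> f y"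
    and "x \<in> carrier A \<Longrightarrow> y \<in> carrier A \<Longrightarrow> f (x \<oplus>\<^bsub>A\<^esub> y) = f x \<oplus>\<^bsub>C\<^esub> f y"
    and "f \<one>\<^bsub>A\<^esub> = \<one>\<^bsub>C\<^esub>"
    and "x \<in> carrier A \<Longrightarrow> f (r \<odot>\<^bsub>A\<^esub> x) = r \<odot>\<^bsub>C\<^esub> f x"
  using assms by (auto simp: alg_hom_def ring_hom_closed ring_hom_mult ring_hom_add ring_hom_one)

lemma linear_mapI:
  assumes "\<And>x. x \<in> carrier A \<Longrightarrow> f x \<in> carrier C"
    and "\<And>x y. x \<in> carrier A \<Longrightarrow> y \<in> carrier A \<Longrightarrow> f (x \<oplus>\<^bsub>A\<^esub> y) = f x \<oplus>\<^bsub>C\<^esub> f y"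
    and "\<And>r x. x \<in> carrier A \<Longrightarrow> f (r \<odot>\<^bsub>A\<^esub> x) = r \<odot>\<^bsub>C\<^esub> f x"
  shows "linear_map A C f"
  using assms by (auto simp: linear_map_def)

lemma linear_mapD:
  assumes "linear_map A C f"
  shows "x \<in> carrier A \<Longrightarrow> f x \<in> carrier C"
    and "x \<in> carrier A \<Longrightarrow> y \<in> carrier A \<Longrightarrow> f (x \<oplus>\<^bsub>A\<^esub> y) = f x \<oplus>\<^bsub>C\<^esub> f y"
    and "x \<in> carrier A \<Longrightarrow> f (r \<odot>\<^bsub>A\<^esub> x) = r \<odot>\<^bsub>C\<^esub> f x"
  using assms by (auto simp: linear_map_def)

lemma alg_hom_linear: "alg_hom A C f \<Longrightarrow> linear_map A C f"
  by (rule linear_mapI) (simp_all add: alg_homD)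

lemma alg_hom_id: "alg_hom A A (\<lambda>x. x)"
  by (rule alg_homI) simp_all

lemma alg_hom_comp: "alg_hom A C f \<Longrightarrow> alg_hom C D g \<Longrightarrow> alg_hom A D (\<lambda>x. g (f x))"
  by (rule alg_homI) (simp_all add: alg_homD)

lemma linear_map_zero:
  assumes "linear_map A C f" "assoc_algebra A" "assoc_algebra C"
  shows "f \<zero>\<^bsub>A\<^esub> = \<zero>\<^bsub>C\<^esub>"
proof -
  interpret A: assoc_alg A by (rule assoc_alg.intro) fact
  interpret C: assoc_alg C by (rule assoc_alg.intro) fact
  have "f (0 \<odot>\<^bsub>A\<^esub> \<zero>\<^bsub>A\<^esub>) = 0 \<odot>\<^bsub>C\<^esub> f \<zero>\<^bsub>A\<^esub>"
    by (rule linear_mapD(3)[OF assms(1)]) simp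
  then show ?thesis
    using linear_mapD(1)[OF assms(1), of "\<zero>\<^bsub>A\<^esub>"] by simp
qed

lemma linear_map_minus:
  assumes "linear_map A C f" "assoc_algebra A" "assoc_algebra C" "x \<in> carrier A"
  shows "f (\<ominus>\<^bsub>A\<^esub> x) = \<ominus>\<^bsub>C\<^esub> f x"
proof -
  interpret A: assoc_alg A by (rule assoc_alg.intro) fact
  interpret C: assoc_alg C by (rule assoc_alg.intro) fact
  show ?thesis
    using assms by (simp add: A.minus_eq_smult C.minus_eq_smult linear_mapD[OF assms(1)])
qed

lemma linear_map_diff:
  assumes "linear_map A C f" "assoc_algebra A" "assoc_algebra C" "x \<in> carrier A" "y \<in> carrier A"
  shows "f (x \<ominus>\<^bsub>A\<^esub> y) = f x \<ominus>\<^bsub>C\<^esub> f y"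
proof -
  interpret A: assoc_alg A by (rule assoc_alg.intro) fact
  show ?thesis
    using assms by (simp add: a_minus_def linear_mapD linear_map_minus)
qed

lemmas alg_hom_zero = linear_map_zero[OF alg_hom_linear]
lemmas alg_hom_minus = linear_map_minus[OF alg_hom_linear]
lemmas alg_hom_diff = linear_map_diff[OF alg_hom_linear]

lemma ground_algebra_simps [simp]:
  "carrier ground_algebra = UNIV"
  "x \<otimes>\<^bsub>ground_algebra\<^esub> y = x * y"
  "x \<oplus>\<^bsub>ground_algebra\<^esub> y = x + y"
  "\<one>\<^bsub>ground_algebra\<^esub> = 1"
  "\<zero>\<^bsub>ground_algebra\<^esub> = 0"
  "r \<odot>\<^bsub>ground_algebra\<^esub> y = r * y"
  by (simp_all add: ground_algebra_def ring_of_type_algebra_def ring.extend_def module.fields_def)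

lemma ring_cong:
  assumes "ring A" "carrier A = carrier B" "monoid.mult A = monoid.mult B" "one A = one B"
    "zero A = zero B" "add A = add B"
  shows "ring B"
proof -
  interpret ring A by fact
  have [simp]: "carrier B = carrier A" "monoid.mult B = monoid.mult A" "one B = one A"
    "zero B = zero A" "add B = add A"
    using assms(2-6) by simp_all
  show ?thesis
    by (rule ringI; (rule abelian_groupI)?; (rule monoidI)?)
      (auto simp: a_ac m_assoc l_distr r_distr intro: bexI[of _ "\<ominus>\<^bsub>A\<^esub> x" for x] l_neg)
qed

lemma assoc_algebra_ground: "assoc_algebra ground_algebra"
proof (rule assoc_algebraI)
  show "ring (ground_algebra :: ('a, 'a) module)"
    by (rule ringI; (rule abelian_groupI)?; (rule monoidI)?)
      (auto simp: algebra_simps intro: exI[of _ "- x" for x])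
qed (simp_all add: algebra_simps)

lemma op_algebra_simps [simp]:
  "carrier (op_algebra A) = carrier A"
  "x \<otimes>\<^bsub>op_algebra A\<^esub> y = y \<otimes>\<^bsub>A\<^esub> x"
  "x \<oplus>\<^bsub>op_algebra A\<^esub> y = x \<oplus>\<^bsub>A\<^esub> y"
  "\<one>\<^bsub>op_algebra A\<^esub> = \<one>\<^bsub>A\<^esub>"
  "\<zero>\<^bsub>op_algebra A\<^esub> = \<zero>\<^bsub>A\<^esub>"
  "r \<odot>\<^bsub>op_algebra A\<^esub> y = r \<odot>\<^bsub>A\<^esub> y"
  by (simp_all add: op_algebra_def)

lemma op_op_algebra [simp]: "op_algebra (op_algebra A) = A"
  by (simp add: op_algebra_def)

lemma a_inv_op_algebra [simp]: "\<ominus>\<^bsub>op_algebra A\<^esub> x = \<ominus>\<^bsub>A\<^esub> x"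
  by (simp add: op_algebra_def a_inv_def m_inv_def)

lemma a_minus_op_algebra [simp]: "x \<ominus>\<^bsub>op_algebra A\<^esub> y = x \<ominus>\<^bsub>A\<^esub> y"
  by (simp add: a_minus_def)

lemma assoc_algebra_op:
  assumes "assoc_algebra A"
  shows "assoc_algebra (op_algebra A)"
proof -
  interpret assoc_alg A by (rule assoc_alg.intro) fact
  have "ring (op_algebra A)"
    by (rule ringI; (rule abelian_groupI)?; (rule monoidI)?)
      (auto simp: a_ac m_assoc l_distr r_distr intro: bexI[of _ "\<ominus>\<^bsub>A\<^esub> x" for x] l_neg)
  then show ?thesis
    by (rule assoc_algebraI) (simp_all add: smult_l_distr smult_r_distr)
qed

lemma alg_hom_op: "alg_hom A C f \<Longrightarrow> alg_hom (op_algebra A) (op_algebra C) f"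
  by (rule alg_homI) (simp_all add: alg_homD)

text \<open>The closure conditions on \<open>S\<close> concern elements of the carrier only, so that membership in the carrier is
available in every case of the induction principle.\<close>

definition generates :: "('k::comm_ring_1, 'a, 'm) module_scheme \<Rightarrow> 'a set \<Rightarrow> bool" where
  "generates A M \<longleftrightarrow>
     (\<forall>S. M \<subseteq> S \<longrightarrow> \<one>\<^bsub>A\<^esub> \<in> S \<longrightarrow>
        (\<forall>x\<in>carrier A \<inter> S. \<forall>y\<in>carrier A \<inter> S. x \<oplus>\<^bsub>A\<^esub> y \<in> S \<and> x \<otimes>\<^bsub>A\<^esub> y \<in> S) \<longrightarrow>
        (\<forall>r. \<forall>x\<in>carrier A \<inter> S. r \<odot>\<^bsub>A\<^esub> x \<in> S) \<longrightarrow> carrier A \<subseteq> S)"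

lemma generates_induct [consumes 2, case_names gen one add mult smult]:
  assumes "generates A M" "x \<in> carrier A"
    and "\<And>x. x \<in> M \<Longrightarrow> P x"
    and "P \<one>\<^bsub>A\<^esub>"
    and "\<And>x y. x \<in> carrier A \<Longrightarrow> y \<in> carrier A \<Longrightarrow> P x \<Longrightarrow> P y \<Longrightarrow> P (x \<oplus>\<^bsub>A\<^esub> y)"
    and "\<And>x y. x \<in> carrier A \<Longrightarrow> y \<in> carrier A \<Longrightarrow> P x \<Longrightarrow> P y \<Longrightarrow> P (x \<otimes>\<^bsub>A\<^esub> y)"
    and "\<And>r x. x \<in> carrier A \<Longrightarrow> P x \<Longrightarrow> P (r \<odot>\<^bsub>A\<^esub> x)"
  shows "P x"
  using assms(1)[unfolded generates_def, rule_format, of "{x. P x}"] assms(2-) by blast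

lemma alg_hom_eqI:
  assumes "generates A M" "alg_hom A C f" "alg_hom A C g" "\<And>x. x \<in> M \<Longrightarrow> f x = g x" "a \<in> carrier A"
  shows "f a = g a"
  using assms(1,5)
  by (induction rule: generates_induct) (simp_all add: assms(4) alg_homD[OF assms(2)] alg_homD[OF assms(3)])

lemma generates_op: "generates A M \<Longrightarrow> generates (op_algebra A) M"
  unfolding generates_def by simp

section \<open>Quotients, free algebras and presentations\<close>

lemma carrier_quotient_algebra: "carrier (quotient_algebra A J) = (\<lambda>x. J +>\<^bsub>A\<^esub> x) ` carrier A"
  by (auto simp: quotient_algebra_def FactRing_def ring.extend_def A_RCOSETS_defs a_r_coset_def r_coset_def)

lemma quotient_algebra_simps:
  "one (quotient_algebra A J) = J +>\<^bsub>A\<^esub> \<one>\<^bsub>A\<^esub>"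
  "zero (quotient_algebra A J) = J"
  "monoid.mult (quotient_algebra A J) = monoid.mult (A Quot J)"
  "add (quotient_algebra A J) = add (A Quot J)"
  "carrier (quotient_algebra A J) = carrier (A Quot J)"
  "r \<odot>\<^bsub>quotient_algebra A J\<^esub> Y = (\<Union>x\<in>Y. J +>\<^bsub>A\<^esub> (r \<odot>\<^bsub>A\<^esub> x))"
  by (simp_all add: quotient_algebra_def FactRing_def ring.extend_def module.fields_def)

locale alg_ideal = assoc_alg + ideal J A for J
begin

lemma coset_eq_iff: "x \<in> carrier A \<Longrightarrow> y \<in> carrier A \<Longrightarrow> J +> x = J +> y \<longleftrightarrow> x \<ominus> y \<in> J"
  using quotient_eq_iff_same_a_r_cos[OF ideal_axioms] by metis

lemma ideal_smult: assumes "x \<in> J" shows "r \<odot> x \<in> J"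
proof -
  have "(r \<odot> \<one>) \<otimes> x \<in> J"
    using assms by (intro I_l_closed) auto
  then show ?thesis
    using assms a_Hcarr by simp
qed

lemma coset_smult: assumes "x \<in> carrier A" shows "(\<Union>y\<in>J +> x. J +> (r \<odot> y)) = J +> (r \<odot> x)"
proof -
  have "J +> (r \<odot> y) = J +> (r \<odot> x)" if "y \<in> J +> x" for y
  proof -
    have y: "y \<in> carrier A" using that assms a_r_coset_subset_G[OF a_subset] by blast
    have "J +> y = J +> x" using that assms a_repr_independence[OF _ _ a_subgroup] by metis
    then have "y \<ominus> x \<in> J" using coset_eq_iff y assms by simp
    then have "r \<odot> (y \<ominus> x) \<in> J" by (rule ideal_smult)
    then show ?thesis using y assms by (simp add: coset_eq_iff smult_diff_right)
  qed
  moreover have "x \<in> J +> x" using assms a_rcos_self by simp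
  ultimately show ?thesis by blast
qed

lemma coset_hom: "alg_hom A (quotient_algebra A J) (\<lambda>x. J +> x)"
  using rcos_ring_hom
  by (auto simp: alg_hom_def quotient_algebra_simps coset_smult ring_hom_def FactRing_def)

lemma assoc_algebra_quotient: "assoc_algebra (quotient_algebra A J)"
proof (rule assoc_algebraI)
  show "ring (quotient_algebra A J)"
    by (rule ring_cong[OF quotient_is_ring]) (simp_all add: quotient_algebra_simps FactRing_def)
qed (auto simp: carrier_quotient_algebra alg_homD(2-5)[OF coset_hom, symmetric] smult_l_distr smult_r_distr)

lemma quotient_lift:
  assumes "assoc_algebra C" "linear_map A C f" "\<And>x. x \<in> J \<Longrightarrow> f x = \<zero>\<^bsub>C\<^esub>" "x \<in> carrier A"
    "y \<in> J +> x"
  shows "f y = f x"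
proof -
  interpret C: assoc_alg C by (rule assoc_alg.intro) fact
  have y: "y \<in> carrier A" using assms a_r_coset_subset_G[OF a_subset] by blast
  have "J +> y = J +> x" using assms(4,5) a_repr_independence[OF _ _ a_subgroup] by metis
  then have "y \<ominus> x \<in> J" using coset_eq_iff y assms by simp
  then have "f y \<ominus>\<^bsub>C\<^esub> f x = \<zero>\<^bsub>C\<^esub>" 
    using assms y linear_map_diff[OF assms(2) assoc_algebra assms(1) y assms(4)] by simp
  then show ?thesis using y assms by (simp add: linear_mapD C.r_right_minus_eq)
qed

text \<open>The factor map evaluates \<open>f\<close> at an arbitrary representative; by \<open>quotient_lift\<close> the choice is immaterial.\<close>

lemma quotient_alg_hom:
  assumes "assoc_algebra C" "alg_hom A C f" "\<And>x. x \<in> J \<Longrightarrow> f x = \<zero>\<^bsub>C\<^esub>"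
  defines "g \<equiv> \<lambda>Y. f (SOME y. y \<in> Y)"
  shows "alg_hom (quotient_algebra A J) C g" and "\<And>x. x \<in> carrier A \<Longrightarrow> g (J +> x) = f x"
proof -
  show *: "g (J +> x) = f x" if "x \<in> carrier A" for x
  proof -
    have "(SOME y. y \<in> J +> x) \<in> J +> x"
      using a_rcos_self[OF that] by (rule someI)
    then show ?thesis
      unfolding g_def using that assms by (intro quotient_lift[OF assms(1)]) (auto intro: alg_hom_linear)
  qed
  show "alg_hom (quotient_algebra A J) C g"
    by (rule alg_homI)
      (auto simp: carrier_quotient_algebra quotient_algebra_simps(1) * alg_homD[OF assms(2)]
        simp flip: alg_homD(2-5)[OF coset_hom])
qed

end

text \<open>The linear extension to finitely supported formal combinations underlies both the evaluation of
  noncommutative polynomials and the maps out of tensor products.\<close>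

definition lin_ext :: "('k::comm_ring_1, 'c, 'm) module_scheme \<Rightarrow> ('x \<Rightarrow> 'c) \<Rightarrow> ('x \<Rightarrow>\<^sub>0 'k) \<Rightarrow> 'c" where
  "lin_ext C \<psi> p = (\<Oplus>\<^bsub>C\<^esub>x\<in>Poly_Mapping.keys p. Poly_Mapping.lookup p x \<odot>\<^bsub>C\<^esub> \<psi> x)"

lemma poly_mapping_eq_sum_single:
  "p = (\<Sum>x\<in>Poly_Mapping.keys p. Poly_Mapping.single x (Poly_Mapping.lookup p x))"
  by (rule poly_mapping_eqI)
    (auto simp: lookup_sum lookup_single when_def sum.delta in_keys_iff)

text \<open>Linear statements about formal combinations supported in \<open>S\<close> are reduced to single terms; the support
condition matters because carriers are proper subsets of their types.\<close>

lemma poly_mapping_span_induct [consumes 1, case_names zero single add]: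
  fixes p :: "'x \<Rightarrow>\<^sub>0 'k::comm_ring_1"
  assumes "Poly_Mapping.keys p \<subseteq> S" and "P 0"
    and "\<And>x r. x \<in> S \<Longrightarrow> P (Poly_Mapping.single x r)"
    and "\<And>p q. Poly_Mapping.keys p \<subseteq> S \<Longrightarrow> Poly_Mapping.keys q \<subseteq> S \<Longrightarrow> P p \<Longrightarrow> P q \<Longrightarrow> P (p + q)"
  shows "P p"
proof -
  have "P (\<Sum>x\<in>K. Poly_Mapping.single x (c x)) \<and>
      Poly_Mapping.keys (\<Sum>x\<in>K. Poly_Mapping.single x (c x)) \<subseteq> S" if "finite K" "K \<subseteq> S" for K c
    using that
  proof (induction K)
    case (insert x K)
    have "Poly_Mapping.keys (Poly_Mapping.single x (c x) + (\<Sum>x\<in>K. Poly_Mapping.single x (c x))) \<subseteq> S"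
      using insert by (intro subset_trans[OF Poly_Mapping.keys_add]) (auto split: if_splits)
    then show ?case
      using insert by (auto intro!: assms(3,4) split: if_splits)
  qed (simp add: assms(2))
  from this[OF _ assms(1), of "Poly_Mapping.lookup p"] show ?thesis
    by (subst poly_mapping_eq_sum_single) simp
qed

context assoc_alg
begin

text \<open>Over a common finite support, additivity of the linear extension becomes additivity of a finite sum.\<close>

lemma lin_ext_superset:
  assumes "\<And>x. x \<in> S \<Longrightarrow> \<psi> x \<in> carrier A" "finite K" "Poly_Mapping.keys p \<subseteq> K" "K \<subseteq> S"
  shows "lin_ext A \<psi> p = (\<Oplus>x\<in>K. Poly_Mapping.lookup p x \<odot> \<psi> x)"
proof -
  have cl: "\<psi> x \<in> carrier A" if "x \<in> K" for x
    using that assms by blast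
  show ?thesis
    unfolding lin_ext_def using assms(2,3) cl
    by (intro add.finprod_mono_neutral_cong_left) (auto simp: not_in_keys_iff_lookup_eq_zero)
qed

lemma lin_ext_closed:
  assumes "\<And>x. x \<in> S \<Longrightarrow> \<psi> x \<in> carrier A" "Poly_Mapping.keys p \<subseteq> S"
  shows "lin_ext A \<psi> p \<in> carrier A"
  unfolding lin_ext_def using assms by (intro finsum_closed) auto

lemma lin_ext_add:
  assumes "\<And>x. x \<in> S \<Longrightarrow> \<psi> x \<in> carrier A" "Poly_Mapping.keys p \<subseteq> S" "Poly_Mapping.keys q \<subseteq> S"
  shows "lin_ext A \<psi> (p + q) = lin_ext A \<psi> p \<oplus> lin_ext A \<psi> q"
proof -
  let ?K = "Poly_Mapping.keys p \<union> Poly_Mapping.keys q"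
  have K: "finite ?K" "?K \<subseteq> S" using assms by auto
  have c: "\<psi> x \<in> carrier A" if "x \<in> ?K" for x
    using that K(2) assms(1) by blast
  then have cl: "(\<lambda>x. Poly_Mapping.lookup f x \<odot> \<psi> x) \<in> ?K \<rightarrow> carrier A" for f
    by blast
  have "lin_ext A \<psi> (p + q) = (\<Oplus>x\<in>?K. Poly_Mapping.lookup (p + q) x \<odot> \<psi> x)"
    by (rule lin_ext_superset[OF assms(1) K(1) Poly_Mapping.keys_add K(2)])
  also have "\<dots> = (\<Oplus>x\<in>?K. Poly_Mapping.lookup p x \<odot> \<psi> x \<oplus> Poly_Mapping.lookup q x \<odot> \<psi> x)"
    using c by (intro finsum_cong') (auto simp: lookup_add smult_l_distr)
  also have "\<dots> = lin_ext A \<psi> p \<oplus> lin_ext A \<psi> q"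
    unfolding finsum_addf[OF cl cl]
    using lin_ext_superset[OF assms(1) K(1) _ K(2), where p=p] lin_ext_superset[OF assms(1) K(1) _ K(2), where p=q]
    by simp
  finally show ?thesis .
qed

lemma lin_ext_zero [simp]: "lin_ext A \<psi> 0 = \<zero>"
  unfolding lin_ext_def keys_zero by (rule finsum_empty)

lemma lin_ext_single [simp]:
  assumes "\<psi> x \<in> carrier A"
  shows "lin_ext A \<psi> (Poly_Mapping.single x r) = r \<odot> \<psi> x"
proof (cases "r = 0")
  case False
  then show ?thesis
    using assms finsum_insert[of "{}" x "\<lambda>y. Poly_Mapping.lookup (Poly_Mapping.single x r) y \<odot> \<psi> y"]
    by (simp add: lin_ext_def)
qed (use assms in simp)

end

subsection \<open>Free algebras and presentations\<close>

lemma free_algebra_simps [simp]: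
  "x \<otimes>\<^bsub>free_algebra G\<^esub> y = x * y"
  "x \<oplus>\<^bsub>free_algebra G\<^esub> y = x + y"
  "\<one>\<^bsub>free_algebra G\<^esub> = 1"
  "\<zero>\<^bsub>free_algebra G\<^esub> = 0"
  "r \<odot>\<^bsub>free_algebra G\<^esub> y = scalar r * y"
  by (simp_all add: free_algebra_def)

lemma carrier_free_algebra: "p \<in> carrier (free_algebra G) \<longleftrightarrow> Poly_Mapping.keys p \<subseteq> lists G"
  by (auto simp: free_algebra_def)

lemma scalar_simps:
  "scalar (r + s) = scalar r + scalar s"
  "scalar (r * s) = scalar r * scalar s"
  "scalar 0 = 0"
  "scalar 1 = 1"
  by (simp_all add: scalar_def single_add mult_single flip: zero_list_def)

lemma free_algebra_closed:
  "scalar r \<in> carrier (free_algebra G)"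
  "g \<in> G \<Longrightarrow> letter g \<in> carrier (free_algebra G)"
  "0 \<in> carrier (free_algebra G)"
  "1 \<in> carrier (free_algebra G)"
  "p \<in> carrier (free_algebra G) \<Longrightarrow> q \<in> carrier (free_algebra G) \<Longrightarrow> p + q \<in> carrier (free_algebra G)"
  "p \<in> carrier (free_algebra G) \<Longrightarrow> q \<in> carrier (free_algebra G) \<Longrightarrow> p * q \<in> carrier (free_algebra G)"
  "p \<in> carrier (free_algebra G) \<Longrightarrow> - p \<in> carrier (free_algebra G)"
proof -
  show "p \<in> carrier (free_algebra G) \<Longrightarrow> q \<in> carrier (free_algebra G) \<Longrightarrow> p + q \<in> carrier (free_algebra G)"
    using Poly_Mapping.keys_add[of p q] by (auto simp: carrier_free_algebra)
  show "p \<in> carrier (free_algebra G) \<Longrightarrow> q \<in> carrier (free_algebra G) \<Longrightarrow> p * q \<in> carrier (free_algebra G)"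
    using keys_mult[of p q] by (fastforce simp: carrier_free_algebra plus_list_def)
  show "p \<in> carrier (free_algebra G) \<Longrightarrow> - p \<in> carrier (free_algebra G)"
    by (simp add: carrier_free_algebra in_keys_iff subset_iff)
qed (auto simp: carrier_free_algebra scalar_def letter_def zero_list_def)

lemma free_algebra_closed_more:
  "p \<in> carrier (free_algebra G) \<Longrightarrow> q \<in> carrier (free_algebra G) \<Longrightarrow> p - q \<in> carrier (free_algebra G)"
  "p \<in> carrier (free_algebra G) \<Longrightarrow> p ^ n \<in> carrier (free_algebra G)"
  "(\<And>k. k \<in> K \<Longrightarrow> h k \<in> carrier (free_algebra G)) \<Longrightarrow> sum h K \<in> carrier (free_algebra G)"
proof -
  show "p \<in> carrier (free_algebra G) \<Longrightarrow> q \<in> carrier (free_algebra G) \<Longrightarrow> p - q \<in> carrier (free_algebra G)"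
    using free_algebra_closed(5)[of p G "- q"] free_algebra_closed(7)[of q] by simp
  show "p \<in> carrier (free_algebra G) \<Longrightarrow> p ^ n \<in> carrier (free_algebra G)"
    by (induction n) (simp_all add: free_algebra_closed)
  show "(\<And>k. k \<in> K \<Longrightarrow> h k \<in> carrier (free_algebra G)) \<Longrightarrow> sum h K \<in> carrier (free_algebra G)"
    by (induction K rule: infinite_finite_induct) (simp_all add: free_algebra_closed)
qed

lemma free_algebra_span_induct [consumes 1, case_names word add]:
  assumes "p \<in> carrier (free_algebra G)"
    and "\<And>w r. set w \<subseteq> G \<Longrightarrow> P (Poly_Mapping.single w r)"
    and "\<And>p q. p \<in> carrier (free_algebra G) \<Longrightarrow> q \<in> carrier (free_algebra G) \<Longrightarrow> P p \<Longrightarrow> P q \<Longrightarrow> P (p + q)"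
  shows "P p"
proof -
  have "Poly_Mapping.keys p \<subseteq> lists G" using assms(1) by (simp add: carrier_free_algebra)
  then show ?thesis
  proof (induction rule: poly_mapping_span_induct)
    case zero
    show ?case using assms(2)[of "[]" 0] by simp
  qed (use assms in \<open>auto simp: carrier_free_algebra in_lists_conv_set subset_iff\<close>)
qed

lemma scalar_central: "p * scalar r = scalar r * p"
proof -
  have "p \<in> carrier (free_algebra UNIV)" by (simp add: carrier_free_algebra)
  then show ?thesis
    by (induction rule: free_algebra_span_induct)
      (simp_all add: scalar_def mult_single distrib_left distrib_right mult.commute flip: zero_list_def)
qed

lemma assoc_algebra_free: "assoc_algebra (free_algebra G)"
proof (rule assoc_algebraI)
  show "ring (free_algebra G)"
    by (rule ringI; (rule abelian_groupI)?; (rule monoidI)?)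
      (auto simp: free_algebra_closed algebra_simps intro: bexI[of _ "- x" for x])
qed (auto simp: free_algebra_closed scalar_simps distrib_left distrib_right mult.assoc,
    simp add: scalar_central flip: mult.assoc)

definition word_value :: "('k, 'c, 'm) module_scheme \<Rightarrow> ('g \<Rightarrow> 'c) \<Rightarrow> 'g list \<Rightarrow> 'c" where
  "word_value C \<phi> w = foldr (\<lambda>g x. \<phi> g \<otimes>\<^bsub>C\<^esub> x) w \<one>\<^bsub>C\<^esub>"

definition eval_free :: "('k::comm_ring_1, 'c, 'm) module_scheme \<Rightarrow> ('g \<Rightarrow> 'c) \<Rightarrow> ('g list \<Rightarrow>\<^sub>0 'k) \<Rightarrow> 'c" where
  "eval_free C \<phi> = lin_ext C (word_value C \<phi>)"

context assoc_alg
begin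

lemma word_value_closed:
  "(\<And>g. g \<in> G \<Longrightarrow> \<phi> g \<in> carrier A) \<Longrightarrow> set w \<subseteq> G \<Longrightarrow> word_value A \<phi> w \<in> carrier A"
  by (induction w) (simp_all add: word_value_def)

lemma word_value_append:
  "(\<And>g. g \<in> G \<Longrightarrow> \<phi> g \<in> carrier A) \<Longrightarrow> set v \<subseteq> G \<Longrightarrow> set w \<subseteq> G \<Longrightarrow>
   word_value A \<phi> (v @ w) = word_value A \<phi> v \<otimes> word_value A \<phi> w"
proof (induction v)
  case (Cons g v)
  moreover have "word_value A \<phi> v \<in> carrier A" "word_value A \<phi> w \<in> carrier A"
    using Cons.prems by (auto intro!: word_value_closed[of G])
  ultimately show ?case
    by (simp add: word_value_def m_assoc)
qed (use word_value_closed[of G \<phi> w] in \<open>simp_all add: word_value_def\<close>)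

lemma eval_free_hom:
  assumes "\<And>g. g \<in> G \<Longrightarrow> \<phi> g \<in> carrier A"
  shows "alg_hom (free_algebra G) A (eval_free A \<phi>)"
proof -
  have cl: "word_value A \<phi> w \<in> carrier A" if "w \<in> lists G" for w
    using that by (intro word_value_closed[OF assms]) auto
  have cl': "word_value A \<phi> w \<in> carrier A" if "set w \<subseteq> G" for w
    by (rule word_value_closed[OF assms that])
  have ev_add: "eval_free A \<phi> (p + q) = eval_free A \<phi> p \<oplus> eval_free A \<phi> q"
    if "p \<in> carrier (free_algebra G)" "q \<in> carrier (free_algebra G)" for p q
    unfolding eval_free_def using that
    by (intro lin_ext_add[where S = "lists G"]) (simp_all add: carrier_free_algebra cl)
  have closed: "eval_free A \<phi> p \<in> carrier A" if "p \<in> carrier (free_algebra G)" for p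
    unfolding eval_free_def using that
    by (intro lin_ext_closed[where S = "lists G"]) (simp_all add: carrier_free_algebra cl)
  have single: "eval_free A \<phi> (Poly_Mapping.single w r) = r \<odot> word_value A \<phi> w" if "set w \<subseteq> G" for w r
    using cl'[OF that] by (simp add: eval_free_def)
  have wcl: "Poly_Mapping.single w r \<in> carrier (free_algebra G)" if "set w \<subseteq> G" for w r
    using that by (auto simp: carrier_free_algebra)
  have mult1: "eval_free A \<phi> (Poly_Mapping.single v r * q) = eval_free A \<phi> (Poly_Mapping.single v r) \<otimes> eval_free A \<phi> q"
    if "set v \<subseteq> G" "q \<in> carrier (free_algebra G)" for v r q
    using that(2)
  proof (induction rule: free_algebra_span_induct)
    case (word w s)
    then show ?case
      using that(1) cl'[of v] cl'[of w]
      by (simp add: mult_single single plus_list_def word_value_append[OF assms] mult.commute)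
  next
    case (add p q)
    have "eval_free A \<phi> (Poly_Mapping.single v r * (p + q)) =
        eval_free A \<phi> (Poly_Mapping.single v r * p) \<oplus> eval_free A \<phi> (Poly_Mapping.single v r * q)"
      unfolding distrib_left using add(1,2) that(1) by (intro ev_add free_algebra_closed wcl)
    then show ?case
      using add closed closed[OF wcl[OF that(1)]] by (simp add: ev_add r_distr)
  qed
  have mult: "eval_free A \<phi> (p * q) = eval_free A \<phi> p \<otimes> eval_free A \<phi> q"
    if "p \<in> carrier (free_algebra G)" "q \<in> carrier (free_algebra G)" for p q
    using that(1)
  proof (induction rule: free_algebra_span_induct)
    case (word w s)
    then show ?case using that by (simp add: mult1)
  next
    case (add p p')
    have "eval_free A \<phi> ((p + p') * q) = eval_free A \<phi> (p * q) \<oplus> eval_free A \<phi> (p' * q)"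
      unfolding distrib_right using add(1,2) that(2) by (intro ev_add free_algebra_closed)
    then show ?case
      using add that(2) closed by (simp add: ev_add l_distr)
  qed
  have sc: "eval_free A \<phi> (scalar r) = r \<odot> \<one>" for r
    using single[of "[]" r] by (simp add: scalar_def word_value_def)
  show ?thesis
  proof (rule alg_homI)
    show "eval_free A \<phi> \<one>\<^bsub>free_algebra G\<^esub> = \<one>"
      using sc[of 1] by (simp add: scalar_simps)
  qed (simp_all add: closed ev_add mult sc free_algebra_closed)
qed

lemma eval_free_letter [simp]: "\<phi> g \<in> carrier A \<Longrightarrow> eval_free A \<phi> (letter g) = \<phi> g"
  by (simp add: eval_free_def letter_def word_value_def)

end

lemma generates_free:
  fixes G :: "'g set"
  shows "generates (free_algebra G :: ('k::comm_ring_1, 'g list \<Rightarrow>\<^sub>0 'k) module) (letter ` G)"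
  unfolding generates_def
proof (intro allI impI subsetI, goal_cases)
  case (1 S p)
  note closed = 1(3)[rule_format]
  have w: "Poly_Mapping.single w 1 \<in> S \<inter> carrier (free_algebra G)" if "set w \<subseteq> G" for w
    using that
  proof (induction w)
    case Nil
    then show ?case using 1(2) free_algebra_closed(4) by (simp flip: zero_list_def)
  next
    case (Cons g w)
    have "Poly_Mapping.single (g # w) (1 :: 'k) = letter g * Poly_Mapping.single w 1"
      by (simp add: letter_def mult_single plus_list_def)
    moreover have "(letter g :: 'g list \<Rightarrow>\<^sub>0 'k) \<in> S \<inter> carrier (free_algebra G)" using 1(1) Cons by (auto intro: free_algebra_closed)
    ultimately show ?case
      using Cons closed[of "letter g" "Poly_Mapping.single w 1"] by (auto intro: free_algebra_closed)
  qed
  from 1(5) show ?case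
  proof (induction rule: free_algebra_span_induct)
    case (word w r)
    have "Poly_Mapping.single w r = scalar r * Poly_Mapping.single w 1"
      by (simp add: scalar_def mult_single flip: zero_list_def)
    then show ?case using w[OF word] 1(4) by auto
  next
    case (add p q)
    then show ?case using closed[of p q] by simp
  qed
qed

locale presentation =
  fixes G :: "'g set" and Rels :: "('g list \<Rightarrow>\<^sub>0 'k::comm_ring_1) set"
  assumes Rels_subset: "Rels \<subseteq> carrier (free_algebra G)"
begin

abbreviation "rel_ideal \<equiv> Idl\<^bsub>free_algebra G\<^esub> Rels"

sublocale alg_ideal "free_algebra G :: ('k, 'g list \<Rightarrow>\<^sub>0 'k) module" rel_ideal
proof -
  interpret assoc_alg "free_algebra G :: ('k, 'g list \<Rightarrow>\<^sub>0 'k) module"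
    by (rule assoc_alg.intro) (rule assoc_algebra_free)
  show "alg_ideal (free_algebra G :: ('k, 'g list \<Rightarrow>\<^sub>0 'k) module) rel_ideal"
    by (intro alg_ideal.intro assoc_alg_axioms genideal_ideal Rels_subset)
qed

lemma assoc_algebra_presented: "assoc_algebra (presented_algebra G Rels)"
  unfolding presented_algebra_def by (rule assoc_algebra_quotient)

lemma coset_hom_presented: "alg_hom (free_algebra G) (presented_algebra G Rels) (\<lambda>p. rel_ideal +>\<^bsub>free_algebra G\<^esub> p)"
  unfolding presented_algebra_def by (rule coset_hom)

lemma generator_closed: "g \<in> G \<Longrightarrow> generator G Rels g \<in> carrier (presented_algebra G Rels)"
  unfolding generator_def by (rule alg_homD(1)[OF coset_hom_presented]) (rule free_algebra_closed)

lemma generates_presented: "generates (presented_algebra G Rels) (generator G Rels ` G)"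
  unfolding generates_def
proof (intro allI impI subsetI, goal_cases)
  case (1 S Y)
  let ?\<pi> = "\<lambda>p. rel_ideal +>\<^bsub>free_algebra G\<^esub> p"
  note hom = alg_homD[OF coset_hom_presented]
  obtain p where p: "p \<in> carrier (free_algebra G)" "Y = ?\<pi> p"
    using 1(5) by (auto simp: presented_algebra_def carrier_quotient_algebra)
  have "?\<pi> p \<in> S"
    using generates_free p(1)
  proof (induction rule: generates_induct)
    case (gen x)
    then show ?case using 1(1) by (auto simp: generator_def)
  next
    case one
    then show ?case using 1(2) hom(4) by simp
  next
    case (add x y)
    then show ?case using 1(3) hom(1,3) by (metis IntI)
  next
    case (mult x y)
    then show ?case using 1(3) hom(1,2) by (metis IntI)
  next
    case (smult r x)
    then show ?case using 1(4) hom(1,5) by (metis IntI)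
  qed
  then show ?case using p by simp
qed

lemma eval_free_generator:
  assumes "p \<in> carrier (free_algebra G)"
  shows "eval_free (presented_algebra G Rels) (generator G Rels) p = rel_ideal +>\<^bsub>free_algebra G\<^esub> p"
proof -
  interpret P: assoc_alg "presented_algebra G Rels"
    by (rule assoc_alg.intro) (rule assoc_algebra_presented)
  show ?thesis
  proof (rule alg_hom_eqI[OF generates_free _ coset_hom_presented _ assms])
    show "alg_hom (free_algebra G) (presented_algebra G Rels) (eval_free (presented_algebra G Rels) (generator G Rels))"
      by (rule P.eval_free_hom) (rule generator_closed)
    show "eval_free (presented_algebra G Rels) (generator G Rels) x = rel_ideal +>\<^bsub>free_algebra G\<^esub> x"
      if "x \<in> letter ` G" for x
      using that generator_closed by (auto simp: generator_def)
  qed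
qed

lemma eval_free_relation:
  assumes "r \<in> Rels"
  shows "eval_free (presented_algebra G Rels) (generator G Rels) r = \<zero>\<^bsub>presented_algebra G Rels\<^esub>"
proof -
  have "r \<in> rel_ideal" using genideal_self[OF Rels_subset] assms by blast
  then have "rel_ideal +>\<^bsub>free_algebra G\<^esub> r = rel_ideal"
    using a_rcos_const by simp
  then show ?thesis
    using assms Rels_subset eval_free_generator[of r]
    by (simp add: presented_algebra_def quotient_algebra_simps subset_iff)
qed

text \<open>Evaluation of noncommutative polynomials kills the relators, hence the ideal that they generate, and so
factors through the quotient.\<close>

lemma presented_hom_exists:
  assumes "assoc_algebra C" "\<And>g. g \<in> G \<Longrightarrow> \<phi> g \<in> carrier C"
    and "\<And>r. r \<in> Rels \<Longrightarrow> eval_free C \<phi> r = \<zero>\<^bsub>C\<^esub>"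
  shows "\<exists>f. alg_hom (presented_algebra G Rels) C f \<and> (\<forall>g\<in>G. f (generator G Rels g) = \<phi> g)"
proof -
  interpret C: assoc_alg C by (rule assoc_alg.intro) fact
  have hom: "alg_hom (free_algebra G) C (eval_free C \<phi>)"
    by (rule C.eval_free_hom) (rule assms)
  then have "ring_hom_ring (free_algebra G) C (eval_free C \<phi>)"
    by (intro ring_hom_ringI2 ring_axioms C.ring_axioms) (simp add: alg_hom_def)
  then have "ideal (a_kernel (free_algebra G) C (eval_free C \<phi>)) (free_algebra G)"
    by (rule ring_hom_ring.kernel_is_ideal)
  moreover have "Rels \<subseteq> a_kernel (free_algebra G) C (eval_free C \<phi>)"
    using assms(3) Rels_subset by (auto simp: a_kernel_def')
  ultimately have "rel_ideal \<subseteq> a_kernel (free_algebra G) C (eval_free C \<phi>)"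
    by (rule genideal_minimal)
  then have "\<And>x. x \<in> rel_ideal \<Longrightarrow> eval_free C \<phi> x = \<zero>\<^bsub>C\<^esub>"
    by (auto simp: a_kernel_def')
  note lift = quotient_alg_hom[OF assms(1) hom this]
  show ?thesis
  proof (intro exI conjI ballI)
    show "alg_hom (presented_algebra G Rels) C (\<lambda>Y. eval_free C \<phi> (SOME y. y \<in> Y))"
      unfolding presented_algebra_def by (rule lift(1))
    show "eval_free C \<phi> (SOME y. y \<in> generator G Rels g) = \<phi> g" if "g \<in> G" for g
      using lift(2)[OF _ free_algebra_closed(2)[OF that]] assms(2)[OF that] by (simp add: generator_def)
  qed
qed

end

lemma is_extension_restrict:
  assumes "alg_hom A C f" "\<And>g. g \<in> G \<Longrightarrow> \<iota> g \<in> carrier A" "\<And>g. g \<in> G \<Longrightarrow> f (\<iota> g) = \<phi> g" "assoc_algebra A"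
  shows "is_extension A G \<iota> C \<phi> (restrict f (carrier A))"
proof -
  interpret assoc_alg A by (rule assoc_alg.intro) fact
  have "alg_hom A C (restrict f (carrier A))"
    by (rule alg_homI) (simp_all add: alg_homD[OF assms(1)])
  then show ?thesis unfolding is_extension_def by (simp add: assms(2,3))
qed

text \<open>Extensions are required to be extensional, so any morphism with the prescribed values has to be restricted
to the carrier; two extensions agree on generators and therefore everywhere.\<close>

lemma well_defined_homI:
  assumes "generates A (\<iota> ` G)" "assoc_algebra A" "\<And>g. g \<in> G \<Longrightarrow> \<iota> g \<in> carrier A"
    and "alg_hom A C f" "\<And>g. g \<in> G \<Longrightarrow> f (\<iota> g) = \<phi> g"
  shows "well_defined_hom A G \<iota> C \<phi>"
    and "alg_hom A C (induced_hom A G \<iota> C \<phi>)"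
    and "\<And>x. x \<in> carrier A \<Longrightarrow> induced_hom A G \<iota> C \<phi> x = f x"
proof -
  let ?f = "restrict f (carrier A)"
  have f: "is_extension A G \<iota> C \<phi> ?f"
    using assms by (intro is_extension_restrict)
  have u: "g = ?f" if "is_extension A G \<iota> C \<phi> g" for g
  proof (rule extensionalityI[of _ "carrier A"])
    show "g x = ?f x" if "x \<in> carrier A" for x
    proof (rule alg_hom_eqI[OF assms(1) _ _ _ \<open>x \<in> carrier A\<close>])
      show "alg_hom A C g" "alg_hom A C ?f"
        using f \<open>is_extension A G \<iota> C \<phi> g\<close> by (simp_all add: is_extension_def)
      show "g y = ?f y" if "y \<in> \<iota> ` G" for y
      proof -
        obtain k where "k \<in> G" "y = \<iota> k" using \<open>y \<in> \<iota> ` G\<close> by blast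
        then show ?thesis
          using f \<open>is_extension A G \<iota> C \<phi> g\<close> unfolding is_extension_def by metis
      qed
    qed
  qed (use f that in \<open>simp_all add: is_extension_def\<close>)
  show "well_defined_hom A G \<iota> C \<phi>"
    unfolding well_defined_hom_def by (rule ex1I, rule f, rule u)
  have eq: "induced_hom A G \<iota> C \<phi> = ?f"
    unfolding induced_hom_def by (rule the_equality, rule f, rule u)
  then show "alg_hom A C (induced_hom A G \<iota> C \<phi>)"
    using f by (simp add: is_extension_def)
  show "\<And>x. x \<in> carrier A \<Longrightarrow> induced_hom A G \<iota> C \<phi> x = f x"
    by (simp add: eq)
qed

section \<open>Tensor products of algebras\<close>

lemma (in ring) add_diff_diff:
  assumes "x \<in> carrier R" "y \<in> carrier R"
  shows "x \<oplus> y \<ominus> x \<ominus> y = \<zero>"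
  using assms by algebra

text \<open>The product on formal combinations of elements of a magma; the product on \<open>free_on_pairs\<close> is the instance
for componentwise multiplication of pairs.\<close>

definition conv ::
    "('x \<Rightarrow> 'x \<Rightarrow> 'x) \<Rightarrow> ('x \<Rightarrow>\<^sub>0 'k::comm_ring_1) \<Rightarrow> ('x \<Rightarrow>\<^sub>0 'k) \<Rightarrow> 'x \<Rightarrow>\<^sub>0 'k" where
  "conv f p q = (\<Sum>x\<in>Poly_Mapping.keys p. \<Sum>y\<in>Poly_Mapping.keys q.
     Poly_Mapping.single (f x y) (Poly_Mapping.lookup p x * Poly_Mapping.lookup q y))"

lemma conv_superset:
  assumes "finite K" "finite L" "Poly_Mapping.keys p \<subseteq> K" "Poly_Mapping.keys q \<subseteq> L"
  shows "conv f p q = (\<Sum>x\<in>K. \<Sum>y\<in>L.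
     Poly_Mapping.single (f x y) (Poly_Mapping.lookup p x * Poly_Mapping.lookup q y))"
proof -
  have "conv f p q = (\<Sum>x\<in>Poly_Mapping.keys p. \<Sum>y\<in>L.
     Poly_Mapping.single (f x y) (Poly_Mapping.lookup p x * Poly_Mapping.lookup q y))"
    unfolding conv_def using assms
    by (intro sum.cong refl sum.mono_neutral_left) (auto simp: not_in_keys_iff_lookup_eq_zero)
  also have "\<dots> = (\<Sum>x\<in>K. \<Sum>y\<in>L.
     Poly_Mapping.single (f x y) (Poly_Mapping.lookup p x * Poly_Mapping.lookup q y))"
    using assms by (intro sum.mono_neutral_left) (auto simp: not_in_keys_iff_lookup_eq_zero)
  finally show ?thesis .
qed

lemma conv_add_left: "conv f (p + p') q = conv f p q + conv f p' q"
proof -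
  let ?K = "Poly_Mapping.keys p \<union> Poly_Mapping.keys p'" and ?L = "Poly_Mapping.keys q"
  have "conv f r q = (\<Sum>x\<in>?K. \<Sum>y\<in>?L.
      Poly_Mapping.single (f x y) (Poly_Mapping.lookup r x * Poly_Mapping.lookup q y))"
    if "Poly_Mapping.keys r \<subseteq> ?K" for r
    using that by (intro conv_superset) auto
  then show ?thesis
    using Poly_Mapping.keys_add[of p p']
    by (simp add: lookup_add distrib_right single_add sum.distrib)
qed

lemma conv_add_right: "conv f p (q + q') = conv f p q + conv f p q'"
proof -
  let ?K = "Poly_Mapping.keys q \<union> Poly_Mapping.keys q'" and ?L = "Poly_Mapping.keys p"
  have "conv f p r = (\<Sum>x\<in>?L. \<Sum>y\<in>?K.
      Poly_Mapping.single (f x y) (Poly_Mapping.lookup p x * Poly_Mapping.lookup r y))"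
    if "Poly_Mapping.keys r \<subseteq> ?K" for r
    using that by (intro conv_superset) auto
  then show ?thesis
    using Poly_Mapping.keys_add[of q q']
    by (simp add: lookup_add distrib_left single_add sum.distrib)
qed

lemma conv_zero [simp]: "conv f 0 q = 0" "conv f p 0 = 0"
  by (simp_all add: conv_def)

lemma conv_diff_left: "conv f (p - p') q = conv f p q - conv f p' q"
  using conv_add_left[of f "p - p'" p' q] by simp

lemma conv_diff_right: "conv f p (q - q') = conv f p q - conv f p q'"
  using conv_add_right[of f p "q - q'" q'] by simp

lemma conv_single [simp]:
  "conv f (Poly_Mapping.single x r) (Poly_Mapping.single y s) = Poly_Mapping.single (f x y) (r * s)"
  by (subst conv_superset[of "{x}" "{y}"]) auto

lemma conv_keys:
  assumes "Poly_Mapping.keys p \<subseteq> S" "Poly_Mapping.keys q \<subseteq> S" "\<And>x y. x \<in> S \<Longrightarrow> y \<in> S \<Longrightarrow> f x y \<in> S"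
  shows "Poly_Mapping.keys (conv f p q) \<subseteq> S"
  using assms(1)
proof (induction rule: poly_mapping_span_induct)
  case (single x r)
  from assms(2) show ?case
  proof (induction rule: poly_mapping_span_induct)
    case (add q q')
    show ?case
      unfolding conv_add_right by (rule subset_trans[OF Poly_Mapping.keys_add Un_least]) fact+
  qed (use single assms(3) in auto)
next
  case (add p p')
  show ?case
    unfolding conv_add_left by (rule subset_trans[OF Poly_Mapping.keys_add Un_least]) fact+
qed simp

lemma conv_assoc:
  assumes "Poly_Mapping.keys p \<subseteq> S" "Poly_Mapping.keys q \<subseteq> S" "Poly_Mapping.keys r \<subseteq> S"
    and f: "\<And>x y z. x \<in> S \<Longrightarrow> y \<in> S \<Longrightarrow> z \<in> S \<Longrightarrow> f (f x y) z = f x (f y z)"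
  shows "conv f (conv f p q) r = conv f p (conv f q r)"
  using assms(1)
proof (induction rule: poly_mapping_span_induct)
  case (single x c)
  from assms(2) show ?case
  proof (induction rule: poly_mapping_span_induct)
    case (single y d)
    from assms(3) show ?case
    proof (induction rule: poly_mapping_span_induct)
      case (single z e)
      then show ?case using \<open>x \<in> S\<close> \<open>y \<in> S\<close> by (simp add: f mult.assoc)
    qed (simp_all add: conv_add_right)
  qed (simp_all add: conv_add_left conv_add_right)
qed (simp_all add: conv_add_left)

lemma conv_one:
  assumes "Poly_Mapping.keys p \<subseteq> S" "\<And>x. x \<in> S \<Longrightarrow> f e x = x" "\<And>x. x \<in> S \<Longrightarrow> f x e = x"
  shows "conv f (Poly_Mapping.single e 1) p = p" "conv f p (Poly_Mapping.single e 1) = p"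
  using assms(1)
  by (induction rule: poly_mapping_span_induct)
    (simp_all add: assms(2,3) conv_add_left conv_add_right)

lemma lookup_map_mult [simp]:
  "Poly_Mapping.lookup (Poly_Mapping.map ((*) (r :: 'k::comm_ring_1)) p) x = r * Poly_Mapping.lookup p x"
  by (simp add: Poly_Mapping.map.rep_eq when_def)

lemma map_mult_simps:
  fixes r s :: "'k::comm_ring_1" and p q :: "'x \<Rightarrow>\<^sub>0 'k"
  shows "Poly_Mapping.map ((*) r) (Poly_Mapping.single x s) = Poly_Mapping.single x (r * s)"
    and "Poly_Mapping.map ((*) (r + s)) p = Poly_Mapping.map ((*) r) p + Poly_Mapping.map ((*) s) p"
    and "Poly_Mapping.map ((*) r) (p + q) = Poly_Mapping.map ((*) r) p + Poly_Mapping.map ((*) r) q"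
    and "Poly_Mapping.map ((*) r) (p - q) = Poly_Mapping.map ((*) r) p - Poly_Mapping.map ((*) r) q"
    and "Poly_Mapping.map ((*) (r * s)) p = Poly_Mapping.map ((*) r) (Poly_Mapping.map ((*) s) p)"
    and "Poly_Mapping.map ((*) 1) p = p"
    and "Poly_Mapping.map ((*) r) 0 = (0 :: 'x \<Rightarrow>\<^sub>0 'k)"
    and "Poly_Mapping.map ((*) (- 1)) p = - p"
  by (rule poly_mapping_eqI; simp add: lookup_add lookup_minus lookup_single when_def algebra_simps)+

lemma conv_smult:
  "conv f (Poly_Mapping.map ((*) r) p) q = Poly_Mapping.map ((*) r) (conv f p q)"
  "conv f p (Poly_Mapping.map ((*) r) q) = Poly_Mapping.map ((*) r) (conv f p q)"
proof -
  have *: "Poly_Mapping.keys p \<subseteq> UNIV" for p :: "'a \<Rightarrow>\<^sub>0 'b" by simp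
  show "conv f (Poly_Mapping.map ((*) r) p) q = Poly_Mapping.map ((*) r) (conv f p q)"
    using *[of p]
  proof (induction rule: poly_mapping_span_induct)
    case (single x s)
    from *[of q] show ?case
      by (induction rule: poly_mapping_span_induct)
        (simp_all add: map_mult_simps conv_add_right mult.assoc)
  qed (simp_all add: map_mult_simps conv_add_left)
  show "conv f p (Poly_Mapping.map ((*) r) q) = Poly_Mapping.map ((*) r) (conv f p q)"
    using *[of p]
  proof (induction rule: poly_mapping_span_induct)
    case (single x s)
    from *[of q] show ?case
      by (induction rule: poly_mapping_span_induct)
        (simp_all add: map_mult_simps conv_add_right mult.left_commute)
  qed (simp_all add: map_mult_simps conv_add_left)
qed

definition pair_mult ::
    "('k::comm_ring_1, 'a, 'm) module_scheme \<Rightarrow> ('k, 'b, 'n) module_scheme \<Rightarrow> 'a \<times> 'b \<Rightarrow> 'a \<times> 'b \<Rightarrow> 'a \<times> 'b" where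
  "pair_mult A B x y = (fst x \<otimes>\<^bsub>A\<^esub> fst y, snd x \<otimes>\<^bsub>B\<^esub> snd y)"

lemma free_on_pairs_simps:
  "x \<otimes>\<^bsub>free_on_pairs A B\<^esub> y = conv (pair_mult A B) x y"
  "x \<oplus>\<^bsub>free_on_pairs A B\<^esub> y = x + y"
  "\<one>\<^bsub>free_on_pairs A B\<^esub> = Poly_Mapping.single (\<one>\<^bsub>A\<^esub>, \<one>\<^bsub>B\<^esub>) 1"
  "\<zero>\<^bsub>free_on_pairs A B\<^esub> = 0"
  "r \<odot>\<^bsub>free_on_pairs A B\<^esub> y = Poly_Mapping.map ((*) r) y"
  "p \<in> carrier (free_on_pairs A B) \<longleftrightarrow> Poly_Mapping.keys p \<subseteq> carrier A \<times> carrier B"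
  by (simp_all add: free_on_pairs_def conv_def pair_mult_def case_prod_unfold)

locale tensor_pair = A: assoc_alg A + B: assoc_alg B
  for A :: "('k::comm_ring_1, 'a, 'm) module_scheme" and B :: "('k, 'b, 'n) module_scheme"
begin

abbreviation "FP \<equiv> free_on_pairs A B"
abbreviation "K \<equiv> tensor_ker A B"

lemma FP_closed:
  "a \<in> carrier A \<Longrightarrow> b \<in> carrier B \<Longrightarrow> Poly_Mapping.single (a, b) r \<in> carrier FP"
  "p \<in> carrier FP \<Longrightarrow> q \<in> carrier FP \<Longrightarrow> p + q \<in> carrier FP"
  "p \<in> carrier FP \<Longrightarrow> q \<in> carrier FP \<Longrightarrow> p - q \<in> carrier FP"
  "p \<in> carrier FP \<Longrightarrow> - p \<in> carrier FP"
  "p \<in> carrier FP \<Longrightarrow> q \<in> carrier FP \<Longrightarrow> conv (pair_mult A B) p q \<in> carrier FP"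
  "p \<in> carrier FP \<Longrightarrow> Poly_Mapping.map ((*) r) p \<in> carrier FP"
  "0 \<in> carrier FP"
proof -
  show "p \<in> carrier FP \<Longrightarrow> q \<in> carrier FP \<Longrightarrow> conv (pair_mult A B) p q \<in> carrier FP"
    unfolding free_on_pairs_simps by (rule conv_keys) (auto simp: pair_mult_def)
  show "p \<in> carrier FP \<Longrightarrow> q \<in> carrier FP \<Longrightarrow> p + q \<in> carrier FP"
    using Poly_Mapping.keys_add[of p q] by (auto simp: free_on_pairs_simps)
  show "p \<in> carrier FP \<Longrightarrow> q \<in> carrier FP \<Longrightarrow> p - q \<in> carrier FP"
    using keys_diff[of p q] by (auto simp: free_on_pairs_simps)
  show "p \<in> carrier FP \<Longrightarrow> - p \<in> carrier FP"
    by (simp add: free_on_pairs_simps in_keys_iff subset_iff)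
  show "p \<in> carrier FP \<Longrightarrow> Poly_Mapping.map ((*) r) p \<in> carrier FP"
  proof -
    have "Poly_Mapping.keys (Poly_Mapping.map ((*) r) p) \<subseteq> Poly_Mapping.keys p"
      by (auto simp: in_keys_iff)
    then show "p \<in> carrier FP \<Longrightarrow> Poly_Mapping.map ((*) r) p \<in> carrier FP"
      unfolding free_on_pairs_simps by (rule subset_trans)
  qed
qed (auto simp: free_on_pairs_simps)

lemma FP_induct [consumes 1, case_names single add]:
  assumes "p \<in> carrier FP"
    and "\<And>a b r. a \<in> carrier A \<Longrightarrow> b \<in> carrier B \<Longrightarrow> P (Poly_Mapping.single (a, b) r)"
    and "\<And>p q. p \<in> carrier FP \<Longrightarrow> q \<in> carrier FP \<Longrightarrow> P p \<Longrightarrow> P q \<Longrightarrow> P (p + q)"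
  shows "P p"
  using assms(1)[unfolded free_on_pairs_simps]
proof (induction rule: poly_mapping_span_induct)
  case zero
  show ?case using assms(2)[of "\<zero>\<^bsub>A\<^esub>" "\<zero>\<^bsub>B\<^esub>" 0] by simp
qed (use assms(2,3) in \<open>auto simp: free_on_pairs_simps\<close>)

lemma assoc_algebra_free_on_pairs: "assoc_algebra FP"
proof (rule assoc_algebraI)
  have one: "x \<otimes>\<^bsub>FP\<^esub> \<one>\<^bsub>FP\<^esub> = x" "\<one>\<^bsub>FP\<^esub> \<otimes>\<^bsub>FP\<^esub> x = x" if "x \<in> carrier FP" for x
    unfolding free_on_pairs_simps
    by (rule conv_one[OF that[unfolded free_on_pairs_simps]]; auto simp: pair_mult_def)+
  have assoc: "x \<otimes>\<^bsub>FP\<^esub> y \<otimes>\<^bsub>FP\<^esub> z = x \<otimes>\<^bsub>FP\<^esub> (y \<otimes>\<^bsub>FP\<^esub> z)"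
    if "x \<in> carrier FP" "y \<in> carrier FP" "z \<in> carrier FP" for x y z
    unfolding free_on_pairs_simps
    by (rule conv_assoc[OF that[unfolded free_on_pairs_simps]]) (auto simp: pair_mult_def A.m_assoc B.m_assoc)
  show "ring FP"
  proof (rule ringI)
    show "abelian_group FP"
    proof (rule abelian_groupI)
      show "\<exists>y\<in>carrier FP. y \<oplus>\<^bsub>FP\<^esub> x = \<zero>\<^bsub>FP\<^esub>" if "x \<in> carrier FP" for x
        using FP_closed(4)[OF that] by (intro bexI[of _ "- x"]) (simp_all add: free_on_pairs_simps(2,4))
    qed (simp_all add: FP_closed free_on_pairs_simps(2,4) ac_simps)
    show "Group.monoid FP"
    proof (rule monoidI)
      show "\<one>\<^bsub>FP\<^esub> \<in> carrier FP" by (simp add: FP_closed free_on_pairs_simps(3))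
      show "x \<otimes>\<^bsub>FP\<^esub> y \<in> carrier FP" if "x \<in> carrier FP" "y \<in> carrier FP" for x y
        using that by (simp add: FP_closed free_on_pairs_simps(1))
    qed (rule one assoc; assumption)+
  qed (simp_all add: free_on_pairs_simps(1,2) conv_add_left conv_add_right)
qed (simp_all only: FP_closed free_on_pairs_simps(1-5) conv_smult map_mult_simps(2,3,5,6))

sublocale FP: assoc_alg FP
  by (rule assoc_alg.intro) (rule assoc_algebra_free_on_pairs)

lemma FP_minus: assumes "p \<in> carrier FP" shows "\<ominus>\<^bsub>FP\<^esub> p = - p"
  using FP.minus_eq_smult[OF assms] by (simp add: free_on_pairs_simps map_mult_simps)

lemma FP_diff: assumes "q \<in> carrier FP" shows "p \<ominus>\<^bsub>FP\<^esub> q = p - q"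
  using assms by (simp add: a_minus_def FP_minus free_on_pairs_simps)

lemma FP_submoduleI:
  assumes "H \<subseteq> carrier FP" "0 \<in> H" "\<And>p q. p \<in> H \<Longrightarrow> q \<in> H \<Longrightarrow> p + q \<in> H"
    "\<And>r p. p \<in> H \<Longrightarrow> Poly_Mapping.map ((*) r) p \<in> H"
  shows "submodule H ring_of_type_algebra FP"
proof (rule module.submoduleI[OF FP.module])
  show "\<ominus>\<^bsub>FP\<^esub> p \<in> H" if "p \<in> H" for p
    using assms(1) assms(4)[OF that, of "- 1"] that by (auto simp: FP_minus map_mult_simps)
qed (use assms in \<open>simp_all add: free_on_pairs_simps\<close>)

lemma bilinear_relators_subset: "bilinear_relators A B \<subseteq> carrier FP"
  unfolding bilinear_relators_def by (auto intro!: FP_closed)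

lemma K_closed:
  "K \<subseteq> carrier FP"
  "0 \<in> K"
  "p \<in> K \<Longrightarrow> q \<in> K \<Longrightarrow> p + q \<in> K"
  "p \<in> K \<Longrightarrow> Poly_Mapping.map ((*) r) p \<in> K"
proof -
  note sub = module.submoduleE[OF FP.module]
  show "K \<subseteq> carrier FP"
    unfolding tensor_ker_def
    by (rule hull_minimal, rule bilinear_relators_subset, rule module.carrier_is_submodule[OF FP.module])
  show "p \<in> K \<Longrightarrow> q \<in> K \<Longrightarrow> p + q \<in> K"
    unfolding tensor_ker_def hull_def using sub(5) by (fastforce simp: free_on_pairs_simps)
  show K4: "p \<in> K \<Longrightarrow> Poly_Mapping.map ((*) r) p \<in> K" for p r
    unfolding tensor_ker_def hull_def using sub(4) by (fastforce simp: free_on_pairs_simps)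
  have "bilinear_relators A B \<noteq> {}"
    unfolding bilinear_relators_def using A.zero_closed B.zero_closed by blast
  then obtain p where "p \<in> K"
    unfolding tensor_ker_def hull_def by blast
  from K4[OF this, of 0] have "Poly_Mapping.map ((*) 0) p \<in> K" .
  moreover have "Poly_Mapping.map ((*) 0) p = 0"
    by (rule poly_mapping_eqI) simp
  ultimately show "0 \<in> K" by simp
qed

lemma K_least:
  assumes "submodule H ring_of_type_algebra FP" "bilinear_relators A B \<subseteq> H"
  shows "K \<subseteq> H"
  unfolding tensor_ker_def using assms by (intro hull_minimal)

lemma K_relators:
  "a \<in> carrier A \<Longrightarrow> a' \<in> carrier A \<Longrightarrow> b \<in> carrier B \<Longrightarrow>
    Poly_Mapping.single (a \<oplus>\<^bsub>A\<^esub> a', b) s - Poly_Mapping.single (a, b) s - Poly_Mapping.single (a', b) s \<in> K"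
  "a \<in> carrier A \<Longrightarrow> b \<in> carrier B \<Longrightarrow> b' \<in> carrier B \<Longrightarrow>
    Poly_Mapping.single (a, b \<oplus>\<^bsub>B\<^esub> b') s - Poly_Mapping.single (a, b) s - Poly_Mapping.single (a, b') s \<in> K"
  "a \<in> carrier A \<Longrightarrow> b \<in> carrier B \<Longrightarrow>
    Poly_Mapping.single (r \<odot>\<^bsub>A\<^esub> a, b) s - Poly_Mapping.single (a, b) (s * r) \<in> K"
  "a \<in> carrier A \<Longrightarrow> b \<in> carrier B \<Longrightarrow>
    Poly_Mapping.single (a, r \<odot>\<^bsub>B\<^esub> b) s - Poly_Mapping.single (a, b) (s * r) \<in> K"
proof -
  have *: "Poly_Mapping.map ((*) s) p \<in> K" if "p \<in> bilinear_relators A B" for p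
    using that by (intro K_closed(4)) (simp add: tensor_ker_def hull_inc)
  show "a \<in> carrier A \<Longrightarrow> a' \<in> carrier A \<Longrightarrow> b \<in> carrier B \<Longrightarrow>
    Poly_Mapping.single (a \<oplus>\<^bsub>A\<^esub> a', b) s - Poly_Mapping.single (a, b) s - Poly_Mapping.single (a', b) s \<in> K"
    using *[of "Poly_Mapping.single (a \<oplus>\<^bsub>A\<^esub> a', b) 1 - Poly_Mapping.single (a, b) 1 - Poly_Mapping.single (a', b) 1"]
    unfolding bilinear_relators_def by (simp add: map_mult_simps) blast
  show "a \<in> carrier A \<Longrightarrow> b \<in> carrier B \<Longrightarrow> b' \<in> carrier B \<Longrightarrow>
    Poly_Mapping.single (a, b \<oplus>\<^bsub>B\<^esub> b') s - Poly_Mapping.single (a, b) s - Poly_Mapping.single (a, b') s \<in> K"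
    using *[of "Poly_Mapping.single (a, b \<oplus>\<^bsub>B\<^esub> b') 1 - Poly_Mapping.single (a, b) 1 - Poly_Mapping.single (a, b') 1"]
    unfolding bilinear_relators_def by (simp add: map_mult_simps) blast
  show "a \<in> carrier A \<Longrightarrow> b \<in> carrier B \<Longrightarrow>
    Poly_Mapping.single (r \<odot>\<^bsub>A\<^esub> a, b) s - Poly_Mapping.single (a, b) (s * r) \<in> K"
    using *[of "Poly_Mapping.single (r \<odot>\<^bsub>A\<^esub> a, b) 1 - Poly_Mapping.single (a, b) r"]
    unfolding bilinear_relators_def by (simp add: map_mult_simps) blast
  show "a \<in> carrier A \<Longrightarrow> b \<in> carrier B \<Longrightarrow>
    Poly_Mapping.single (a, r \<odot>\<^bsub>B\<^esub> b) s - Poly_Mapping.single (a, b) (s * r) \<in> K"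
    using *[of "Poly_Mapping.single (a, r \<odot>\<^bsub>B\<^esub> b) 1 - Poly_Mapping.single (a, b) r"]
    unfolding bilinear_relators_def by (simp add: map_mult_simps) blast
qed

text \<open>The elements of the kernel whose products with all formal combinations stay in the kernel form a
submodule, so only products of a bilinearity relator with a single pair have to be computed.\<close>

lemma K_mult:
  assumes "x \<in> K" "p \<in> carrier FP"
  shows "conv (pair_mult A B) p x \<in> K \<and> conv (pair_mult A B) x p \<in> K"
proof -
  let ?M = "conv (pair_mult A B)"
  let ?H = "{x \<in> K. \<forall>p\<in>carrier FP. ?M p x \<in> K \<and> ?M x p \<in> K}"
  have rel: "?M p x \<in> K \<and> ?M x p \<in> K" if x: "x \<in> bilinear_relators A B" and p: "p \<in> carrier FP" for x p
    using p
  proof (induction rule: FP_induct)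
    case (single c d s)
    from x show ?case
      unfolding bilinear_relators_def
      using single
      by (elim UnE CollectE exE conjE)
        (simp_all add: conv_diff_left conv_diff_right pair_mult_def K_relators A.r_distr A.l_distr B.r_distr B.l_distr
          mult.commute[of _ s])
  next
    case (add p q)
    then show ?case by (simp add: conv_add_left conv_add_right K_closed)
  qed
  have "submodule ?H ring_of_type_algebra FP"
    by (rule FP_submoduleI) (use K_closed in \<open>auto simp: conv_add_left conv_add_right conv_smult\<close>)
  moreover have "bilinear_relators A B \<subseteq> ?H"
    using rel by (auto simp: tensor_ker_def hull_inc)
  ultimately have "K \<subseteq> ?H" by (rule K_least)
  then show ?thesis using assms by blast
qed

sublocale T: alg_ideal FP K
proof (intro alg_ideal.intro FP.assoc_alg_axioms idealI FP.ring_axioms)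
  show "subgroup K (add_monoid FP)"
  proof -
    have "submodule K ring_of_type_algebra FP"
      by (rule FP_submoduleI) (simp_all add: K_closed)
    then show ?thesis by (rule submodule.axioms)
  qed
qed (use K_mult in \<open>auto simp: free_on_pairs_simps(1)\<close>)

sublocale AB: assoc_alg "A \<boxtimes> B"
  unfolding tensor_def by (rule assoc_alg.intro) (rule T.assoc_algebra_quotient)

abbreviation pt (infix \<open>\<otimes>\<^sub>p\<close> 72) where "a \<otimes>\<^sub>p b \<equiv> a \<boxtimes>\<^bsub>A,B\<^esub> b"

lemma coset_hom_tensor: "alg_hom FP (A \<boxtimes> B) (\<lambda>p. K +>\<^bsub>FP\<^esub> p)"
  unfolding tensor_def by (rule T.coset_hom)

lemma pure_tensor_closed [simp, intro]: "a \<in> carrier A \<Longrightarrow> b \<in> carrier B \<Longrightarrow> a \<otimes>\<^sub>p b \<in> carrier (A \<boxtimes> B)"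
  unfolding pure_tensor_def by (intro alg_homD(1)[OF coset_hom_tensor] FP_closed)

lemma coset_single:
  assumes "a \<in> carrier A" "b \<in> carrier B"
  shows "K +>\<^bsub>FP\<^esub> Poly_Mapping.single (a, b) r = r \<odot>\<^bsub>A \<boxtimes> B\<^esub> (a \<otimes>\<^sub>p b)"
  using alg_homD(5)[OF coset_hom_tensor FP_closed(1)[OF assms], of r 1]
  by (simp add: pure_tensor_def free_on_pairs_simps map_mult_simps)

lemma coset_eqI:
  assumes "x \<in> carrier FP" "y \<in> carrier FP" "x - y \<in> K"
  shows "K +>\<^bsub>FP\<^esub> x = K +>\<^bsub>FP\<^esub> y"
  using assms by (simp add: T.coset_eq_iff FP_diff)

lemma pure_tensor_add_left:
  assumes "a \<in> carrier A" "a' \<in> carrier A" "b \<in> carrier B"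
  shows "(a \<oplus>\<^bsub>A\<^esub> a') \<otimes>\<^sub>p b = a \<otimes>\<^sub>p b \<oplus>\<^bsub>A \<boxtimes> B\<^esub> a' \<otimes>\<^sub>p b"
proof -
  have "(a \<oplus>\<^bsub>A\<^esub> a') \<otimes>\<^sub>p b = K +>\<^bsub>FP\<^esub> (Poly_Mapping.single (a, b) 1 + Poly_Mapping.single (a', b) 1)"
    unfolding pure_tensor_def
    by (rule coset_eqI) (use assms K_relators(1)[OF assms, of 1] in \<open>simp_all add: FP_closed diff_diff_eq\<close>)
  also have "\<dots> = a \<otimes>\<^sub>p b \<oplus>\<^bsub>A \<boxtimes> B\<^esub> a' \<otimes>\<^sub>p b"
    unfolding pure_tensor_def
    using alg_homD(3)[OF coset_hom_tensor FP_closed(1) FP_closed(1)] assms by (simp add: free_on_pairs_simps(2))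
  finally show ?thesis .
qed

lemma pure_tensor_add_right:
  assumes "a \<in> carrier A" "b \<in> carrier B" "b' \<in> carrier B"
  shows "a \<otimes>\<^sub>p (b \<oplus>\<^bsub>B\<^esub> b') = a \<otimes>\<^sub>p b \<oplus>\<^bsub>A \<boxtimes> B\<^esub> a \<otimes>\<^sub>p b'"
proof -
  have "a \<otimes>\<^sub>p (b \<oplus>\<^bsub>B\<^esub> b') = K +>\<^bsub>FP\<^esub> (Poly_Mapping.single (a, b) 1 + Poly_Mapping.single (a, b') 1)"
    unfolding pure_tensor_def
    by (rule coset_eqI) (use assms K_relators(2)[OF assms, of 1] in \<open>simp_all add: FP_closed diff_diff_eq\<close>)
  also have "\<dots> = a \<otimes>\<^sub>p b \<oplus>\<^bsub>A \<boxtimes> B\<^esub> a \<otimes>\<^sub>p b'"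
    unfolding pure_tensor_def
    using alg_homD(3)[OF coset_hom_tensor FP_closed(1) FP_closed(1)] assms by (simp add: free_on_pairs_simps(2))
  finally show ?thesis .
qed

lemma pure_tensor_smult_left:
  assumes "a \<in> carrier A" "b \<in> carrier B"
  shows "(r \<odot>\<^bsub>A\<^esub> a) \<otimes>\<^sub>p b = r \<odot>\<^bsub>A \<boxtimes> B\<^esub> (a \<otimes>\<^sub>p b)"
proof -
  have "(r \<odot>\<^bsub>A\<^esub> a) \<otimes>\<^sub>p b = K +>\<^bsub>FP\<^esub> Poly_Mapping.single (a, b) r"
    unfolding pure_tensor_def
    by (rule coset_eqI) (use assms K_relators(3)[OF assms, of r 1] in \<open>simp_all add: FP_closed\<close>)
  then show ?thesis using coset_single[OF assms] by simp
qed

lemma pure_tensor_smult_right: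
  assumes "a \<in> carrier A" "b \<in> carrier B"
  shows "a \<otimes>\<^sub>p (r \<odot>\<^bsub>B\<^esub> b) = r \<odot>\<^bsub>A \<boxtimes> B\<^esub> (a \<otimes>\<^sub>p b)"
proof -
  have "a \<otimes>\<^sub>p (r \<odot>\<^bsub>B\<^esub> b) = K +>\<^bsub>FP\<^esub> Poly_Mapping.single (a, b) r"
    unfolding pure_tensor_def
    by (rule coset_eqI) (use assms K_relators(4)[OF assms, of r 1] in \<open>simp_all add: FP_closed\<close>)
  then show ?thesis using coset_single[OF assms] by simp
qed

lemma pure_tensor_mult [simp]:
  assumes "a \<in> carrier A" "a' \<in> carrier A" "b \<in> carrier B" "b' \<in> carrier B"
  shows "(a \<otimes>\<^sub>p b) \<otimes>\<^bsub>A \<boxtimes> B\<^esub> (a' \<otimes>\<^sub>p b') = (a \<otimes>\<^bsub>A\<^esub> a') \<otimes>\<^sub>p (b \<otimes>\<^bsub>B\<^esub> b')"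
  unfolding pure_tensor_def using assms
  by (subst alg_homD(2)[OF coset_hom_tensor, symmetric])
    (simp_all add: FP_closed free_on_pairs_simps(1) pair_mult_def)

lemma tensor_one: "\<one>\<^bsub>A \<boxtimes> B\<^esub> = \<one>\<^bsub>A\<^esub> \<otimes>\<^sub>p \<one>\<^bsub>B\<^esub>"
  unfolding pure_tensor_def by (subst alg_homD(4)[OF coset_hom_tensor, symmetric]) (simp add: free_on_pairs_simps)

lemma tensor_induct [consumes 1, case_names pure add]:
  assumes "x \<in> carrier (A \<boxtimes> B)"
    and "\<And>a b. a \<in> carrier A \<Longrightarrow> b \<in> carrier B \<Longrightarrow> P (a \<otimes>\<^sub>p b)"
    and "\<And>x y. x \<in> carrier (A \<boxtimes> B) \<Longrightarrow> y \<in> carrier (A \<boxtimes> B) \<Longrightarrow> P x \<Longrightarrow> P y \<Longrightarrow> P (x \<oplus>\<^bsub>A \<boxtimes> B\<^esub> y)"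
  shows "P x"
proof -
  obtain p where p: "p \<in> carrier FP" "x = K +>\<^bsub>FP\<^esub> p"
    using assms(1) by (auto simp: tensor_def carrier_quotient_algebra)
  have "P (K +>\<^bsub>FP\<^esub> p)"
    using p(1)
  proof (induction rule: FP_induct)
    case (single a b r)
    then show ?case using assms(2)[of "r \<odot>\<^bsub>A\<^esub> a" b] by (simp add: coset_single pure_tensor_smult_left)
  next
    case (add p q)
    then show ?case
      using assms(3) alg_homD(1,3)[OF coset_hom_tensor] by (metis free_on_pairs_simps(2))
  qed
  then show ?thesis using p by simp
qed

end

definition bilinear_map ::
    "('k::comm_ring_1, 'a, 'm) module_scheme \<Rightarrow> ('k, 'b, 'n) module_scheme \<Rightarrow> ('k, 'c, 'l) module_scheme \<Rightarrow>
     ('a \<Rightarrow> 'b \<Rightarrow> 'c) \<Rightarrow> bool" where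
  "bilinear_map A B C \<phi> \<longleftrightarrow>
     (\<forall>b\<in>carrier B. linear_map A C (\<lambda>a. \<phi> a b)) \<and> (\<forall>a\<in>carrier A. linear_map B C (\<phi> a))"

lemma bilinear_mapD:
  assumes "bilinear_map A B C \<phi>" "a \<in> carrier A" "b \<in> carrier B"
  shows "\<phi> a b \<in> carrier C"
    and "a' \<in> carrier A \<Longrightarrow> \<phi> (a \<oplus>\<^bsub>A\<^esub> a') b = \<phi> a b \<oplus>\<^bsub>C\<^esub> \<phi> a' b"
    and "b' \<in> carrier B \<Longrightarrow> \<phi> a (b \<oplus>\<^bsub>B\<^esub> b') = \<phi> a b \<oplus>\<^bsub>C\<^esub> \<phi> a b'"
    and "\<phi> (r \<odot>\<^bsub>A\<^esub> a) b = r \<odot>\<^bsub>C\<^esub> \<phi> a b"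
    and "\<phi> a (r \<odot>\<^bsub>B\<^esub> b) = r \<odot>\<^bsub>C\<^esub> \<phi> a b"
proof -
  have l: "linear_map A C (\<lambda>a. \<phi> a b)" "linear_map B C (\<phi> a)"
    using assms by (simp_all add: bilinear_map_def)
  show "\<phi> a b \<in> carrier C"
    and "a' \<in> carrier A \<Longrightarrow> \<phi> (a \<oplus>\<^bsub>A\<^esub> a') b = \<phi> a b \<oplus>\<^bsub>C\<^esub> \<phi> a' b"
    and "b' \<in> carrier B \<Longrightarrow> \<phi> a (b \<oplus>\<^bsub>B\<^esub> b') = \<phi> a b \<oplus>\<^bsub>C\<^esub> \<phi> a b'"
    and "\<phi> (r \<odot>\<^bsub>A\<^esub> a) b = r \<odot>\<^bsub>C\<^esub> \<phi> a b"
    and "\<phi> a (r \<odot>\<^bsub>B\<^esub> b) = r \<odot>\<^bsub>C\<^esub> \<phi> a b"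
    using linear_mapD[OF l(1)] linear_mapD[OF l(2)] assms(2,3) by simp_all
qed

lemma bilinear_mapI:
  assumes "\<And>a b. a \<in> carrier A \<Longrightarrow> b \<in> carrier B \<Longrightarrow> \<phi> a b \<in> carrier C"
    and "\<And>a a' b. a \<in> carrier A \<Longrightarrow> a' \<in> carrier A \<Longrightarrow> b \<in> carrier B \<Longrightarrow> \<phi> (a \<oplus>\<^bsub>A\<^esub> a') b = \<phi> a b \<oplus>\<^bsub>C\<^esub> \<phi> a' b"
    and "\<And>a b b'. a \<in> carrier A \<Longrightarrow> b \<in> carrier B \<Longrightarrow> b' \<in> carrier B \<Longrightarrow> \<phi> a (b \<oplus>\<^bsub>B\<^esub> b') = \<phi> a b \<oplus>\<^bsub>C\<^esub> \<phi> a b'"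
    and "\<And>r a b. a \<in> carrier A \<Longrightarrow> b \<in> carrier B \<Longrightarrow> \<phi> (r \<odot>\<^bsub>A\<^esub> a) b = r \<odot>\<^bsub>C\<^esub> \<phi> a b"
    and "\<And>r a b. a \<in> carrier A \<Longrightarrow> b \<in> carrier B \<Longrightarrow> \<phi> a (r \<odot>\<^bsub>B\<^esub> b) = r \<odot>\<^bsub>C\<^esub> \<phi> a b"
  shows "bilinear_map A B C \<phi>"
  using assms by (simp add: bilinear_map_def linear_map_def)

context tensor_pair
begin

text \<open>The linear extension of a bilinear map to formal combinations of pairs kills the bilinearity relators.\<close>

lemma tensor_lift:
  assumes "assoc_algebra C" "bilinear_map A B C \<phi>"
  shows "linear_map (A \<boxtimes> B) C (tensor_lift C \<phi>)"
    and "\<And>a b. a \<in> carrier A \<Longrightarrow> b \<in> carrier B \<Longrightarrow> tensor_lift C \<phi> (a \<otimes>\<^sub>p b) = \<phi> a b"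
proof -
  interpret C: assoc_alg C by (rule assoc_alg.intro) fact
  note bl = bilinear_mapD[OF assms(2)]
  define L where "L = lin_ext C (\<lambda>x. \<phi> (fst x) (snd x))"
  have cl: "\<phi> (fst x) (snd x) \<in> carrier C" if "x \<in> carrier A \<times> carrier B" for x
    using that bl(1) by auto
  have L_closed: "L p \<in> carrier C" if "p \<in> carrier FP" for p
    unfolding L_def by (rule C.lin_ext_closed[where S = "carrier A \<times> carrier B"]) (use that cl in \<open>auto simp: free_on_pairs_simps\<close>)
  have L_add: "L (p + q) = L p \<oplus>\<^bsub>C\<^esub> L q" if "p \<in> carrier FP" "q \<in> carrier FP" for p q
    unfolding L_def by (rule C.lin_ext_add[where S = "carrier A \<times> carrier B"]) (use that cl in \<open>auto simp: free_on_pairs_simps\<close>)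
  have L_single: "L (Poly_Mapping.single (a, b) r) = r \<odot>\<^bsub>C\<^esub> \<phi> a b" if "a \<in> carrier A" "b \<in> carrier B" for a b r
    using that bl(1) by (simp add: L_def)
  have L_smult: "L (Poly_Mapping.map ((*) r) p) = r \<odot>\<^bsub>C\<^esub> L p" if "p \<in> carrier FP" for p r
    using that
    by (induction rule: FP_induct)
      (simp_all add: map_mult_simps L_single bl(1) L_add FP_closed C.smult_r_distr L_closed)
  have L: "linear_map FP C L"
    by (rule linear_mapI) (simp_all add: L_closed L_add L_smult free_on_pairs_simps(2,5))
  have L_diff: "L (p - q) = L p \<ominus>\<^bsub>C\<^esub> L q" if "p \<in> carrier FP" "q \<in> carrier FP" for p q
    using linear_map_diff[OF L assoc_algebra_free_on_pairs assms(1) that] that by (simp add: FP_diff)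
  let ?H = "{p \<in> carrier FP. L p = \<zero>\<^bsub>C\<^esub>}"
  have "submodule ?H ring_of_type_algebra FP"
    by (rule FP_submoduleI) (auto simp: FP_closed L_add L_smult, simp add: L_def)
  moreover have "bilinear_relators A B \<subseteq> ?H"
  proof
    fix p assume p: "p \<in> bilinear_relators A B"
    then have "L p = \<zero>\<^bsub>C\<^esub>"
      unfolding bilinear_relators_def
      by (elim UnE CollectE exE conjE)
        (simp_all add: L_diff FP_closed L_single bl C.add_diff_diff C.r_right_minus_eq)
    then show "p \<in> ?H" using p bilinear_relators_subset by blast
  qed
  ultimately have K: "L p = \<zero>\<^bsub>C\<^esub>" if "p \<in> K" for p
    using that K_least by blast
  have TL: "tensor_lift C \<phi> Y = L (SOME p. p \<in> Y)" for Y
    by (simp add: tensor_lift_def L_def lin_ext_def Let_def)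
  have TLp: "tensor_lift C \<phi> (K +>\<^bsub>FP\<^esub> p) = L p" if "p \<in> carrier FP" for p
  proof -
    have "(SOME y. y \<in> K +>\<^bsub>FP\<^esub> p) \<in> K +>\<^bsub>FP\<^esub> p"
      using T.a_rcos_self[OF that] by (rule someI)
    then show ?thesis unfolding TL using that by (intro T.quotient_lift[OF assms(1) L K])
  qed
  show "linear_map (A \<boxtimes> B) C (tensor_lift C \<phi>)"
  proof (rule linear_mapI)
    fix x y r assume "x \<in> carrier (A \<boxtimes> B)" "y \<in> carrier (A \<boxtimes> B)"
    then obtain p q where "p \<in> carrier FP" "x = K +>\<^bsub>FP\<^esub> p" "q \<in> carrier FP" "y = K +>\<^bsub>FP\<^esub> q"
      by (auto simp: tensor_def carrier_quotient_algebra)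
    then show "tensor_lift C \<phi> x \<in> carrier C" "tensor_lift C \<phi> (x \<oplus>\<^bsub>A \<boxtimes> B\<^esub> y) = tensor_lift C \<phi> x \<oplus>\<^bsub>C\<^esub> tensor_lift C \<phi> y"
      "tensor_lift C \<phi> (r \<odot>\<^bsub>A \<boxtimes> B\<^esub> x) = r \<odot>\<^bsub>C\<^esub> tensor_lift C \<phi> x"
      by (simp_all add: TLp L_closed L_add L_smult FP_closed free_on_pairs_simps(2,5)
          flip: alg_homD(3,5)[OF coset_hom_tensor])
  qed
  show "tensor_lift C \<phi> (a \<otimes>\<^sub>p b) = \<phi> a b" if "a \<in> carrier A" "b \<in> carrier B" for a b
    unfolding pure_tensor_def using that bl(1) by (simp add: TLp FP_closed L_single)
qed

text \<open>Every tensor is a sum of pure tensors, so multiplicativity may be tested on these.\<close>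

lemma linear_map_multiplicativeI:
  assumes "assoc_algebra C" "linear_map (A \<boxtimes> B) C f" "f (\<one>\<^bsub>A\<^esub> \<otimes>\<^sub>p \<one>\<^bsub>B\<^esub>) = \<one>\<^bsub>C\<^esub>"
    and "\<And>a b a' b'. a \<in> carrier A \<Longrightarrow> b \<in> carrier B \<Longrightarrow> a' \<in> carrier A \<Longrightarrow> b' \<in> carrier B \<Longrightarrow>
      f ((a \<otimes>\<^bsub>A\<^esub> a') \<otimes>\<^sub>p (b \<otimes>\<^bsub>B\<^esub> b')) = f (a \<otimes>\<^sub>p b) \<otimes>\<^bsub>C\<^esub> f (a' \<otimes>\<^sub>p b')"
  shows "alg_hom (A \<boxtimes> B) C f"
proof (rule alg_homI)
  interpret C: assoc_alg C by (rule assoc_alg.intro) fact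
  note f = linear_mapD[OF assms(2)]
  have 1: "f (a \<otimes>\<^sub>p b \<otimes>\<^bsub>A \<boxtimes> B\<^esub> y) = f (a \<otimes>\<^sub>p b) \<otimes>\<^bsub>C\<^esub> f y"
    if "a \<in> carrier A" "b \<in> carrier B" "y \<in> carrier (A \<boxtimes> B)" for a b y
    using that(3)
    by (induction rule: tensor_induct) (use that in \<open>simp_all add: assms(4) AB.r_distr C.r_distr f\<close>)
  show "f (x \<otimes>\<^bsub>A \<boxtimes> B\<^esub> y) = f x \<otimes>\<^bsub>C\<^esub> f y" if "x \<in> carrier (A \<boxtimes> B)" "y \<in> carrier (A \<boxtimes> B)" for x y
    using that(1)
    by (induction rule: tensor_induct) (use that in \<open>simp_all add: 1 AB.l_distr C.l_distr f\<close>)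
qed (simp_all add: linear_mapD[OF assms(2)] assms(3) tensor_one)

lemma bilinear_pure_tensor: "bilinear_map A B (A \<boxtimes> B) (\<lambda>a b. a \<otimes>\<^sub>p b)"
  by (rule bilinear_mapI)
    (simp_all add: pure_tensor_add_left pure_tensor_add_right pure_tensor_smult_left pure_tensor_smult_right)

lemma bilinear_tensor_map:
  assumes "assoc_algebra C" "assoc_algebra D" "linear_map A C f" "linear_map B D g"
  shows "bilinear_map A B (C \<boxtimes> D) (\<lambda>a b. f a \<boxtimes>\<^bsub>C,D\<^esub> g b)"
proof -
  interpret CD: tensor_pair C D by (intro tensor_pair.intro assoc_alg.intro assms)
  show ?thesis
    by (rule bilinear_mapI)
      (simp_all add: linear_mapD[OF assms(3)] linear_mapD[OF assms(4)] CD.pure_tensor_add_left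
        CD.pure_tensor_add_right CD.pure_tensor_smult_left CD.pure_tensor_smult_right)
qed

lemma tensor_map_linear:
  assumes "assoc_algebra C" "assoc_algebra D" "linear_map A C f" "linear_map B D g"
  shows "linear_map (A \<boxtimes> B) (C \<boxtimes> D) (tensor_map C D f g)"
    and "\<And>a b. a \<in> carrier A \<Longrightarrow> b \<in> carrier B \<Longrightarrow> tensor_map C D f g (a \<otimes>\<^sub>p b) = f a \<boxtimes>\<^bsub>C,D\<^esub> g b"
proof -
  interpret CD: tensor_pair C D by (intro tensor_pair.intro assoc_alg.intro assms)
  note l = tensor_lift[OF CD.AB.assoc_algebra bilinear_tensor_map[OF assms]]
  show "linear_map (A \<boxtimes> B) (C \<boxtimes> D) (tensor_map C D f g)"
    and "\<And>a b. a \<in> carrier A \<Longrightarrow> b \<in> carrier B \<Longrightarrow> tensor_map C D f g (a \<otimes>\<^sub>p b) = f a \<boxtimes>\<^bsub>C,D\<^esub> g b"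
    unfolding tensor_map_def using l by auto
qed

lemma tensor_map_hom:
  assumes "assoc_algebra C" "assoc_algebra D" "alg_hom A C f" "alg_hom B D g"
  shows "alg_hom (A \<boxtimes> B) (C \<boxtimes> D) (tensor_map C D f g)"
proof -
  interpret CD: tensor_pair C D by (intro tensor_pair.intro assoc_alg.intro assms)
  note t = tensor_map_linear[OF assms(1,2) alg_hom_linear alg_hom_linear, OF assms(3,4)]
  show ?thesis
    by (rule linear_map_multiplicativeI[OF CD.AB.assoc_algebra t(1)])
      (simp_all add: t(2) alg_homD[OF assms(3)] alg_homD[OF assms(4)] CD.tensor_one)
qed

lemma flip_map_hom:
  shows "alg_hom (A \<boxtimes> B) (B \<boxtimes> A) (flip_map A B)"
    and "\<And>a b. a \<in> carrier A \<Longrightarrow> b \<in> carrier B \<Longrightarrow> flip_map A B (a \<otimes>\<^sub>p b) = b \<boxtimes>\<^bsub>B,A\<^esub> a"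
proof -
  interpret BA: tensor_pair B A by unfold_locales
  have bl: "bilinear_map A B (B \<boxtimes> A) (\<lambda>a b. b \<boxtimes>\<^bsub>B,A\<^esub> a)"
    using BA.bilinear_pure_tensor by (simp add: bilinear_map_def)
  note l = tensor_lift[OF BA.AB.assoc_algebra bl, folded flip_map_def]
  show "alg_hom (A \<boxtimes> B) (B \<boxtimes> A) (flip_map A B)"
    by (rule linear_map_multiplicativeI[OF BA.AB.assoc_algebra l(1)]) (simp_all add: l(2) BA.tensor_one)
  show "\<And>a b. a \<in> carrier A \<Longrightarrow> b \<in> carrier B \<Longrightarrow> flip_map A B (a \<otimes>\<^sub>p b) = b \<boxtimes>\<^bsub>B,A\<^esub> a"
    by (rule l(2))
qed

end

lemma tensor_pairI: "assoc_algebra A \<Longrightarrow> assoc_algebra B \<Longrightarrow> tensor_pair A B"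
  by (intro tensor_pair.intro assoc_alg.intro)

text \<open>The associator is lifted twice: for each \<open>c\<close> the inner lift is a linear map on \<open>A \<boxtimes> B\<close>, and its linear
dependence on \<open>c\<close> is again tested on pure tensors.\<close>

lemma assoc_map_hom:
  assumes "assoc_algebra A" "assoc_algebra B" "assoc_algebra C"
  shows "alg_hom ((A \<boxtimes> B) \<boxtimes> C) (A \<boxtimes> (B \<boxtimes> C)) (assoc_map A B C)"
    and "\<And>a b c. a \<in> carrier A \<Longrightarrow> b \<in> carrier B \<Longrightarrow> c \<in> carrier C \<Longrightarrow>
      assoc_map A B C ((a \<boxtimes>\<^bsub>A,B\<^esub> b) \<boxtimes>\<^bsub>A \<boxtimes> B,C\<^esub> c) = a \<boxtimes>\<^bsub>A,B \<boxtimes> C\<^esub> (b \<boxtimes>\<^bsub>B,C\<^esub> c)"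
proof -
  interpret AB: tensor_pair A B by (rule tensor_pairI) fact+
  interpret BC: tensor_pair B C by (rule tensor_pairI) fact+
  interpret L: tensor_pair "A \<boxtimes> B" C by (rule tensor_pairI) (rule AB.AB.assoc_algebra, fact)
  interpret R: tensor_pair A "B \<boxtimes> C" by (rule tensor_pairI) (fact, rule BC.AB.assoc_algebra)
  let ?T = "A \<boxtimes> (B \<boxtimes> C)"
  let ?\<phi> = "\<lambda>x c. tensor_lift ?T (\<lambda>a b. a \<boxtimes>\<^bsub>A,B \<boxtimes> C\<^esub> (b \<boxtimes>\<^bsub>B,C\<^esub> c)) x"
  have bl: "bilinear_map A B ?T (\<lambda>a b. a \<boxtimes>\<^bsub>A,B \<boxtimes> C\<^esub> (b \<boxtimes>\<^bsub>B,C\<^esub> c))" if "c \<in> carrier C" for c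
    by (rule bilinear_mapI)
      (use that in \<open>simp_all add: R.pure_tensor_add_left R.pure_tensor_add_right R.pure_tensor_smult_left
        R.pure_tensor_smult_right BC.pure_tensor_add_left BC.pure_tensor_smult_left\<close>)
  note l = AB.tensor_lift[OF R.AB.assoc_algebra bl]
  have cl: "?\<phi> x c \<in> carrier ?T" if "x \<in> carrier (A \<boxtimes> B)" "c \<in> carrier C" for x c
    using linear_mapD(1)[OF l(1)] that by blast
  have add: "?\<phi> x (c \<oplus>\<^bsub>C\<^esub> c') = ?\<phi> x c \<oplus>\<^bsub>?T\<^esub> ?\<phi> x c'"
    if "x \<in> carrier (A \<boxtimes> B)" "c \<in> carrier C" "c' \<in> carrier C" for x c c'
    using that(1)
  proof (induction rule: AB.tensor_induct)
    case (pure a b)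
    then show ?case using that by (simp add: l(2) BC.pure_tensor_add_right R.pure_tensor_add_right)
  next
    case (add x y)
    then show ?case using that by (simp add: linear_mapD(2)[OF l(1)] cl R.AB.a_ac)
  qed
  have smult: "?\<phi> x (r \<odot>\<^bsub>C\<^esub> c) = r \<odot>\<^bsub>?T\<^esub> ?\<phi> x c"
    if "x \<in> carrier (A \<boxtimes> B)" "c \<in> carrier C" for x c r
    using that(1)
  proof (induction rule: AB.tensor_induct)
    case (pure a b)
    then show ?case using that by (simp add: l(2) BC.pure_tensor_smult_right R.pure_tensor_smult_right)
  next
    case (add x y)
    then show ?case using that by (simp add: linear_mapD(2)[OF l(1)] cl R.AB.smult_r_distr)
  qed
  have "bilinear_map (A \<boxtimes> B) C ?T ?\<phi>"
    unfolding bilinear_map_def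
    by (intro conjI ballI linear_mapI) (simp_all add: l(1) linear_mapD[OF l(1)] cl add smult)
  note t = L.tensor_lift[OF R.AB.assoc_algebra this, folded assoc_map_def]
  show pure: "assoc_map A B C ((a \<boxtimes>\<^bsub>A,B\<^esub> b) \<boxtimes>\<^bsub>A \<boxtimes> B,C\<^esub> c) = a \<boxtimes>\<^bsub>A,B \<boxtimes> C\<^esub> (b \<boxtimes>\<^bsub>B,C\<^esub> c)"
    if "a \<in> carrier A" "b \<in> carrier B" "c \<in> carrier C" for a b c
    using that by (simp add: t(2) l(2))
  have pure': "assoc_map A B C (x \<boxtimes>\<^bsub>A \<boxtimes> B,C\<^esub> c) = ?\<phi> x c" if "x \<in> carrier (A \<boxtimes> B)" "c \<in> carrier C" for x c
    using that by (rule t(2))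
  have m1: "?\<phi> (a \<boxtimes>\<^bsub>A,B\<^esub> b \<otimes>\<^bsub>A \<boxtimes> B\<^esub> y) (c \<otimes>\<^bsub>C\<^esub> c') = ?\<phi> (a \<boxtimes>\<^bsub>A,B\<^esub> b) c \<otimes>\<^bsub>?T\<^esub> ?\<phi> y c'"
    if "a \<in> carrier A" "b \<in> carrier B" "y \<in> carrier (A \<boxtimes> B)" "c \<in> carrier C" "c' \<in> carrier C" for a b y c c'
    using that(3)
    by (induction rule: AB.tensor_induct)
      (use that in \<open>simp_all add: l(2) linear_mapD(2)[OF l(1)] cl AB.AB.r_distr R.AB.r_distr\<close>)
  have m2: "?\<phi> (x \<otimes>\<^bsub>A \<boxtimes> B\<^esub> y) (c \<otimes>\<^bsub>C\<^esub> c') = ?\<phi> x c \<otimes>\<^bsub>?T\<^esub> ?\<phi> y c'"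
    if "x \<in> carrier (A \<boxtimes> B)" "y \<in> carrier (A \<boxtimes> B)" "c \<in> carrier C" "c' \<in> carrier C" for x y c c'
    using that(1)
    by (induction rule: AB.tensor_induct)
      (use that in \<open>simp_all add: m1 linear_mapD(2)[OF l(1)] cl AB.AB.l_distr R.AB.l_distr\<close>)
  show "alg_hom ((A \<boxtimes> B) \<boxtimes> C) ?T (assoc_map A B C)"
    by (rule L.linear_map_multiplicativeI[OF R.AB.assoc_algebra t(1)])
      (simp_all add: pure' m2, simp add: AB.tensor_one l(2) R.tensor_one BC.tensor_one)
qed

lemma mult_map_linear:
  assumes "assoc_algebra A"
  shows "linear_map (A \<boxtimes> A) A (mult_map A)"
    and "\<And>x y. x \<in> carrier A \<Longrightarrow> y \<in> carrier A \<Longrightarrow> mult_map A (x \<boxtimes>\<^bsub>A,A\<^esub> y) = x \<otimes>\<^bsub>A\<^esub> y"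
proof -
  interpret AA: tensor_pair A A by (rule tensor_pairI) fact+
  have "bilinear_map A A A (\<lambda>x y. x \<otimes>\<^bsub>A\<^esub> y)"
    by (rule bilinear_mapI) (simp_all add: AA.A.l_distr AA.A.r_distr)
  from AA.tensor_lift[OF assms this, folded mult_map_def]
  show "linear_map (A \<boxtimes> A) A (mult_map A)"
    and "\<And>x y. x \<in> carrier A \<Longrightarrow> y \<in> carrier A \<Longrightarrow> mult_map A (x \<boxtimes>\<^bsub>A,A\<^esub> y) = x \<otimes>\<^bsub>A\<^esub> y"
    by auto
qed

lemma linear_map_comp: "linear_map A C f \<Longrightarrow> linear_map C D g \<Longrightarrow> linear_map A D (\<lambda>x. g (f x))"
  by (rule linear_mapI) (simp_all add: linear_mapD)

lemma anti_hom_linear: "alg_hom Z (op_algebra T) S \<Longrightarrow> linear_map Z T S"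
  using alg_hom_linear[of Z "op_algebra T" S] by (simp add: linear_map_def)

text \<open>For an anti-morphism \<open>S\<close> the map \<open>m = mult (T \<otimes> S)\<close> satisfies \<open>m ((t \<otimes> z) w) = t (m w) S z\<close>. If \<open>m w\<close> is
a scalar it moves out of the middle, so the elements on which the identity holds are closed under
products, and generators suffice.\<close>

lemma convolution_inverse_right:
  assumes "assoc_algebra T" "assoc_algebra Z" "assoc_algebra A"
    and \<gamma>: "alg_hom A (T \<boxtimes> Z) \<gamma>" and S: "alg_hom Z (op_algebra T) S" and \<epsilon>: "alg_hom A ground_algebra \<epsilon>"
    and gen: "generates A M"
    and M: "\<And>x. x \<in> M \<Longrightarrow> mult_map T (tensor_map T T (\<lambda>y. y) S (\<gamma> x)) = \<epsilon> x \<odot>\<^bsub>T\<^esub> \<one>\<^bsub>T\<^esub>"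
    and a: "a \<in> carrier A"
  shows "mult_map T (tensor_map T T (\<lambda>y. y) S (\<gamma> a)) = \<epsilon> a \<odot>\<^bsub>T\<^esub> \<one>\<^bsub>T\<^esub>"
proof -
  interpret TZ: tensor_pair T Z by (rule tensor_pairI) fact+
  interpret TT: tensor_pair T T by (rule tensor_pairI) fact+
  define m where "m = (\<lambda>w. mult_map T (tensor_map T T (\<lambda>y. y) S w))"
  note S' = anti_hom_linear[OF S]
  note tm = TZ.tensor_map_linear[OF assms(1,1) alg_hom_linear[OF alg_hom_id] S']
  note mm = mult_map_linear[OF assms(1)]
  have m: "linear_map (T \<boxtimes> Z) T m"
    unfolding m_def by (rule linear_map_comp[OF tm(1) mm(1)])
  note Scl = linear_mapD(1)[OF S']
  have pure: "m (t \<boxtimes>\<^bsub>T,Z\<^esub> z) = t \<otimes>\<^bsub>T\<^esub> S z" if "t \<in> carrier T" "z \<in> carrier Z" for t z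
    using that Scl by (simp add: m_def tm(2) mm(2))
  have 1: "m (t \<boxtimes>\<^bsub>T,Z\<^esub> z \<otimes>\<^bsub>T \<boxtimes> Z\<^esub> w) = t \<otimes>\<^bsub>T\<^esub> m w \<otimes>\<^bsub>T\<^esub> S z"
    if "t \<in> carrier T" "z \<in> carrier Z" "w \<in> carrier (T \<boxtimes> Z)" for t z w
    using that(3)
    by (induction rule: TZ.tensor_induct)
      (use that Scl alg_homD(2)[OF S] in \<open>simp_all add: pure linear_mapD[OF m] TZ.AB.r_distr TZ.A.r_distr TZ.A.l_distr TZ.A.m_assoc\<close>)
  \<comment> \<open>The scalar value of \<open>m w\<close> leaves the middle of the product.\<close>
  have 2: "m (v \<otimes>\<^bsub>T \<boxtimes> Z\<^esub> w) = c \<odot>\<^bsub>T\<^esub> m v"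
    if "v \<in> carrier (T \<boxtimes> Z)" "w \<in> carrier (T \<boxtimes> Z)" "m w = c \<odot>\<^bsub>T\<^esub> \<one>\<^bsub>T\<^esub>" for v w c
    using that(1)
    by (induction rule: TZ.tensor_induct)
      (use that Scl in \<open>simp_all add: 1 pure linear_mapD[OF m] TZ.AB.l_distr TZ.A.smult_r_distr\<close>)
  note \<gamma>D = alg_homD[OF \<gamma>] and \<epsilon>D = alg_homD[OF \<epsilon>]
  have "m (\<gamma> a) = \<epsilon> a \<odot>\<^bsub>T\<^esub> \<one>\<^bsub>T\<^esub>"
    using gen a
  proof (induction rule: generates_induct)
    case (gen x)
    then show ?case using M by (simp add: m_def)
  next
    case one
    then show ?case using alg_homD(4)[OF S] by (simp add: \<gamma>D \<epsilon>D TZ.tensor_one pure)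
  next
    case (add x y)
    then show ?case by (simp add: \<gamma>D \<epsilon>D linear_mapD[OF m] TZ.A.smult_l_distr)
  next
    case (mult x y)
    then show ?case by (simp add: \<gamma>D \<epsilon>D 2[OF _ _ mult(4)] mult.commute)
  next
    case (smult r x)
    then show ?case by (simp add: \<gamma>D \<epsilon>D linear_mapD[OF m])
  qed
  then show ?thesis by (simp add: m_def)
qed

lemma convolution_inverse_left:
  assumes "assoc_algebra T" "assoc_algebra Z" "assoc_algebra A"
    and \<delta>: "alg_hom A (Z \<boxtimes> T) \<delta>" and S: "alg_hom Z (op_algebra T) S" and \<epsilon>: "alg_hom A ground_algebra \<epsilon>"
    and gen: "generates A M"
    and M: "\<And>x. x \<in> M \<Longrightarrow> mult_map T (tensor_map T T S (\<lambda>y. y) (\<delta> x)) = \<epsilon> x \<odot>\<^bsub>T\<^esub> \<one>\<^bsub>T\<^esub>"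
    and a: "a \<in> carrier A"
  shows "mult_map T (tensor_map T T S (\<lambda>y. y) (\<delta> a)) = \<epsilon> a \<odot>\<^bsub>T\<^esub> \<one>\<^bsub>T\<^esub>"
proof -
  interpret ZT: tensor_pair Z T by (rule tensor_pairI) fact+
  interpret TT: tensor_pair T T by (rule tensor_pairI) fact+
  define m where "m = (\<lambda>w. mult_map T (tensor_map T T S (\<lambda>y. y) w))"
  note S' = anti_hom_linear[OF S]
  note tm = ZT.tensor_map_linear[OF assms(1,1) S' alg_hom_linear[OF alg_hom_id]]
  note mm = mult_map_linear[OF assms(1)]
  have m: "linear_map (Z \<boxtimes> T) T m"
    unfolding m_def by (rule linear_map_comp[OF tm(1) mm(1)])
  note Scl = linear_mapD(1)[OF S']
  have pure: "m (z \<boxtimes>\<^bsub>Z,T\<^esub> t) = S z \<otimes>\<^bsub>T\<^esub> t" if "t \<in> carrier T" "z \<in> carrier Z" for t z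
    using that Scl by (simp add: m_def tm(2) mm(2))
  have 1: "m (w \<otimes>\<^bsub>Z \<boxtimes> T\<^esub> z \<boxtimes>\<^bsub>Z,T\<^esub> t) = S z \<otimes>\<^bsub>T\<^esub> m w \<otimes>\<^bsub>T\<^esub> t"
    if "t \<in> carrier T" "z \<in> carrier Z" "w \<in> carrier (Z \<boxtimes> T)" for t z w
    using that(3)
    by (induction rule: ZT.tensor_induct)
      (use that Scl alg_homD(2)[OF S] in \<open>simp_all add: pure linear_mapD[OF m] ZT.AB.l_distr ZT.B.r_distr ZT.B.l_distr ZT.B.m_assoc\<close>)
  have 2: "m (w \<otimes>\<^bsub>Z \<boxtimes> T\<^esub> v) = c \<odot>\<^bsub>T\<^esub> m v"
    if "v \<in> carrier (Z \<boxtimes> T)" "w \<in> carrier (Z \<boxtimes> T)" "m w = c \<odot>\<^bsub>T\<^esub> \<one>\<^bsub>T\<^esub>" for v w c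
    using that(1)
    by (induction rule: ZT.tensor_induct)
      (use that Scl in \<open>simp_all add: 1 pure linear_mapD[OF m] ZT.AB.r_distr ZT.B.smult_r_distr\<close>)
  note \<delta>D = alg_homD[OF \<delta>] and \<epsilon>D = alg_homD[OF \<epsilon>]
  have "m (\<delta> a) = \<epsilon> a \<odot>\<^bsub>T\<^esub> \<one>\<^bsub>T\<^esub>"
    using gen a
  proof (induction rule: generates_induct)
    case (gen x)
    then show ?case using M by (simp add: m_def)
  next
    case one
    then show ?case using alg_homD(4)[OF S] by (simp add: \<delta>D \<epsilon>D ZT.tensor_one pure)
  next
    case (add x y)
    then show ?case by (simp add: \<delta>D \<epsilon>D linear_mapD[OF m] ZT.B.smult_l_distr)
  next
    case (mult x y)
    then show ?case by (simp add: \<delta>D \<epsilon>D 2[OF _ _ mult(3)])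
  next
    case (smult r x)
    then show ?case by (simp add: \<delta>D \<epsilon>D linear_mapD[OF m])
  qed
  then show ?thesis by (simp add: m_def)
qed

text \<open>A bialgebra record and its underlying algebra differ only in the record extension; all constructions
  below see only the algebra operations.\<close>

definition same_algebra :: "('k::comm_ring_1, 'a, 'm) module_scheme \<Rightarrow> ('k, 'a, 'n) module_scheme \<Rightarrow> bool" where
  "same_algebra A B \<longleftrightarrow> carrier A = carrier B \<and> monoid.mult A = monoid.mult B \<and> one A = one B \<and>
     zero A = zero B \<and> add A = add B \<and> module.smult A = module.smult B"

lemma same_algebra_simps:
  assumes "same_algebra A B"
  shows "carrier A = carrier B" "x \<otimes>\<^bsub>A\<^esub> y = x \<otimes>\<^bsub>B\<^esub> y" "\<one>\<^bsub>A\<^esub> = \<one>\<^bsub>B\<^esub>" "\<zero>\<^bsub>A\<^esub> = \<zero>\<^bsub>B\<^esub>"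
    "x \<oplus>\<^bsub>A\<^esub> y = x \<oplus>\<^bsub>B\<^esub> y" "r \<odot>\<^bsub>A\<^esub> x = r \<odot>\<^bsub>B\<^esub> x" "\<ominus>\<^bsub>A\<^esub> x = \<ominus>\<^bsub>B\<^esub> x" "x \<ominus>\<^bsub>A\<^esub> y = x \<ominus>\<^bsub>B\<^esub> y"
  using assms by (simp_all add: same_algebra_def a_minus_def a_inv_def m_inv_def)

lemma same_algebra_free_on_pairs:
  assumes "same_algebra A A'" "same_algebra B B'"
  shows "free_on_pairs A B = free_on_pairs A' B'"
  unfolding free_on_pairs_def by (simp add: same_algebra_simps[OF assms(1)] same_algebra_simps[OF assms(2)])

lemma same_algebra_tensor_ker:
  assumes "same_algebra A A'" "same_algebra B B'"
  shows "tensor_ker A B = tensor_ker A' B'"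
  unfolding tensor_ker_def bilinear_relators_def
  by (simp add: same_algebra_simps[OF assms(1)] same_algebra_simps[OF assms(2)] same_algebra_free_on_pairs[OF assms])

lemma same_algebra_tensor:
  assumes "same_algebra A A'" "same_algebra B B'"
  shows "A \<boxtimes> B = A' \<boxtimes> B'" "a \<boxtimes>\<^bsub>A,B\<^esub> b = a \<boxtimes>\<^bsub>A',B'\<^esub> b"
  unfolding tensor_def pure_tensor_def
  by (simp_all add: same_algebra_free_on_pairs[OF assms] same_algebra_tensor_ker[OF assms])

lemma same_algebra_alg_hom:
  assumes "same_algebra A A'"
  shows "alg_hom A C f = alg_hom A' C f"
  by (simp add: alg_hom_def ring_hom_def same_algebra_simps[OF assms])

lemma same_algebra_generates:
  assumes "same_algebra A A'"
  shows "generates A M = generates A' M"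
  by (simp add: generates_def same_algebra_simps[OF assms])

lemma same_algebra_induced_hom:
  assumes "same_algebra A A'"
  shows "induced_hom A G \<iota> C \<phi> = induced_hom A' G \<iota> C \<phi>"
    and "well_defined_hom A G \<iota> C \<phi> = well_defined_hom A' G \<iota> C \<phi>"
  by (simp_all add: induced_hom_def well_defined_hom_def is_extension_def same_algebra_alg_hom[OF assms]
      same_algebra_simps[OF assms])

lemma same_algebra_assoc_algebra:
  assumes "same_algebra A A'" "assoc_algebra A'"
  shows "assoc_algebra A"
proof -
  interpret assoc_alg A' by (rule assoc_alg.intro) fact
  note s = same_algebra_simps[OF assms(1)]
  have "ring A"
    by (rule ring_cong[OF ring_axioms]) (use assms(1) in \<open>simp_all add: same_algebra_def\<close>)
  then show ?thesis
    by (rule assoc_algebraI) (simp_all add: s smult_l_distr smult_r_distr)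
qed

section \<open>Quantum Serre relations as iterated q-commutators\<close>

text \<open>With \<open>[x, z]\<^bsub>r\<^esub> = x z - r z x\<close> this is \<open>[x, \<dots> [x, [x, y]\<^bsub>c 0\<^esub>]\<^bsub>c 1\<^esub> \<dots>]\<^bsub>c (m - 1)\<^esub>\<close>. The recursive form is what makes the
effect of a change of variables on a Serre polynomial tractable.\<close>

fun qchain :: "('k::comm_ring_1, 'c, 'm) module_scheme \<Rightarrow> (nat \<Rightarrow> 'k) \<Rightarrow> 'c \<Rightarrow> 'c \<Rightarrow> nat \<Rightarrow> 'c" where
  "qchain C c x y 0 = y"
| "qchain C c x y (Suc m) = x \<otimes>\<^bsub>C\<^esub> qchain C c x y m \<ominus>\<^bsub>C\<^esub> c m \<odot>\<^bsub>C\<^esub> (qchain C c x y m \<otimes>\<^bsub>C\<^esub> x)"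

lemma (in assoc_alg) qchain_closed [simp, intro]:
  "x \<in> carrier A \<Longrightarrow> y \<in> carrier A \<Longrightarrow> qchain A c x y m \<in> carrier A"
  by (induction m) simp_all

lemma alg_hom_qchain:
  assumes "alg_hom A C f" "assoc_algebra A" "assoc_algebra C" "x \<in> carrier A" "y \<in> carrier A"
  shows "f (qchain A c x y m) = qchain C c (f x) (f y) m"
proof -
  interpret assoc_alg A by (rule assoc_alg.intro) fact
  show ?thesis
    using assms(4,5) by (induction m) (simp_all add: alg_hom_diff[OF assms(1-3)] alg_homD[OF assms(1)])
qed

lemma scalar_left_commute: "p * (scalar r * p') = scalar r * (p * p')"
  by (metis scalar_central mult.assoc)

lemma scalar_diff: "scalar (r - s) = scalar r - scalar s"
  by (simp add: scalar_def single_diff)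

lemma scalar_minus: "scalar (- r) = - scalar r"
  by (simp add: scalar_def single_uminus)

text \<open>The coefficients of the polynomial \<open>(X - c 0) \<dots> (X - c (m - 1))\<close>.\<close>

fun chain_coeff :: "(nat \<Rightarrow> 'k::comm_ring_1) \<Rightarrow> nat \<Rightarrow> nat \<Rightarrow> 'k" where
  "chain_coeff c 0 k = (if k = 0 then 1 else 0)"
| "chain_coeff c (Suc m) 0 = - c m * chain_coeff c m 0"
| "chain_coeff c (Suc m) (Suc k) = chain_coeff c m k - c m * chain_coeff c m (Suc k)"

lemma chain_coeff_eq_0: "k > m \<Longrightarrow> chain_coeff c m k = 0"
proof (induction m arbitrary: k)
  case (Suc m)
  then show ?case by (cases k) simp_all
qed simp

text \<open>Left multiplication \<open>L\<close> and right multiplication \<open>R\<close> by \<open>x\<close> commute, so the iterated q-commutator is the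
homogeneous polynomial \<open>(L - c 0 R) \<dots> (L - c (m - 1) R)\<close> applied to \<open>y\<close>.\<close>

lemma qchain_free_expand:
  fixes x y :: "'g list \<Rightarrow>\<^sub>0 'k::comm_ring_1"
  assumes "x \<in> carrier (free_algebra G)" "y \<in> carrier (free_algebra G)"
  shows "qchain (free_algebra G) c x y m = (\<Sum>k\<le>m. scalar (chain_coeff c m k) * (x ^ k * y * x ^ (m - k)))"
proof (induction m)
  case (Suc m)
  interpret assoc_alg "free_algebra G :: ('k, 'g list \<Rightarrow>\<^sub>0 'k) module"
    by (rule assoc_alg.intro) (rule assoc_algebra_free)
  have minus: "p \<ominus>\<^bsub>free_algebra G\<^esub> q = p - q" if "q \<in> carrier (free_algebra G)" for p q :: "'g list \<Rightarrow>\<^sub>0 'k"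
    using minus_eq_smult[OF that] by (simp add: a_minus_def scalar_def single_uminus flip: zero_list_def)
  define S where "S = qchain (free_algebra G) c x y m"
  define w where "w = (\<lambda>k. x ^ k * y * x ^ (Suc m - k))"
  have S: "S = (\<Sum>k\<le>m. scalar (chain_coeff c m k) * (x ^ k * y * x ^ (m - k)))"
    unfolding S_def by (rule Suc.IH)
  have xS: "x * S = (\<Sum>k\<le>m. scalar (chain_coeff c m k) * w (Suc k))"
    unfolding S w_def sum_distrib_left
    by (intro sum.cong refl) (simp add: mult.assoc scalar_left_commute)
  have "S * x = (\<Sum>k\<le>m. scalar (chain_coeff c m k) * w k)"
    unfolding S w_def sum_distrib_right
    by (intro sum.cong refl) (simp add: mult.assoc Suc_diff_le power_commutes)
  also have "\<dots> = (\<Sum>k\<le>Suc m. scalar (chain_coeff c m k) * w k)"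
    by (simp add: chain_coeff_eq_0 scalar_simps)
  also have "\<dots> = scalar (chain_coeff c m 0) * w 0 + (\<Sum>k\<le>m. scalar (chain_coeff c m (Suc k)) * w (Suc k))"
    by (rule sum.atMost_Suc_shift)
  finally have Sx: "S * x = scalar (chain_coeff c m 0) * w 0 + (\<Sum>k\<le>m. scalar (chain_coeff c m (Suc k)) * w (Suc k))" .
  have "x * S - scalar (c m) * (S * x) =
      scalar (- c m * chain_coeff c m 0) * w 0 +
      (\<Sum>k\<le>m. scalar (chain_coeff c m k - c m * chain_coeff c m (Suc k)) * w (Suc k))"
    unfolding xS Sx
    by (simp add: scalar_simps scalar_minus scalar_diff left_diff_distrib sum_subtractf distrib_left
        sum_distrib_left mult.assoc)
  also have "\<dots> = (\<Sum>k\<le>Suc m. scalar (chain_coeff c (Suc m) k) * w k)"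
    by (subst sum.atMost_Suc_shift) simp
  finally have eq: "x * S - scalar (c m) * (S * x) = (\<Sum>k\<le>Suc m. scalar (chain_coeff c (Suc m) k) * w k)" .
  have cl: "S \<in> carrier (free_algebra G)"
    unfolding S_def using assms by (rule qchain_closed)
  have "qchain (free_algebra G) c x y (Suc m) = x * S \<ominus>\<^bsub>free_algebra G\<^esub> scalar (c m) * (S * x)"
    by (simp add: S_def)
  also have "\<dots> = x * S - scalar (c m) * (S * x)"
    by (rule minus) (intro free_algebra_closed cl assms(1))
  finally show ?case
    unfolding eq w_def .
qed (simp add: scalar_simps)

subsection \<open>The q-binomial theorem\<close>

text \<open>The balanced q-integer \<open>(q\<^bsup>dn\<^esup> - q\<^bsup>-dn\<^esup>) / (q\<^bsup>d\<^esup> - q\<^bsup>-d\<^esup>)\<close> without the division: for \<open>d = 0\<close> the denominator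
vanishes, and the sum shows at once that the constant term is \<open>n\<close>.\<close>

definition q_num :: "rat \<Rightarrow> nat \<Rightarrow> rat fps" where
  "q_num d n = (\<Sum>j<n. fps_exp (d * (of_nat n - 1 - 2 * of_nat j)))"

lemma fps_exp_mult: "fps_exp a * fps_exp b = fps_exp (a + b :: rat)"
  by (simp add: fps_exp_add_mult)

lemma q_num_mult: "(fps_exp d - fps_exp (- d)) * q_num d n = fps_exp (d * of_nat n) - fps_exp (- d * of_nat n)"
proof -
  have "(fps_exp d - fps_exp (- d)) * q_num d n =
     (\<Sum>j<n. fps_exp (d * (of_nat n - 2 * of_nat j)) - fps_exp (d * (of_nat n - 2 * of_nat (Suc j))))"
    unfolding q_num_def sum_distrib_left
    by (intro sum.cong refl) (simp add: left_diff_distrib fps_exp_mult algebra_simps)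
  also have "\<dots> = fps_exp (d * (of_nat n - 2 * of_nat 0)) - fps_exp (d * (of_nat n - 2 * of_nat n))"
    by (rule sum_lessThan_telescope')
  finally show ?thesis by (simp add: algebra_simps)
qed

lemma q_diff_nonzero: "d \<noteq> 0 \<Longrightarrow> fps_exp d - fps_exp (- d :: rat) \<noteq> 0"
proof
  assume "d \<noteq> 0" "fps_exp d - fps_exp (- d) = 0"
  then have "fps_nth (fps_exp d - fps_exp (- d)) 1 = 0" by simp
  then show False using \<open>d \<noteq> 0\<close> by simp
qed

lemma q_num_uminus: "q_num (- d) n = q_num d n"
proof (cases "d = 0")
  case False
  have "(fps_exp d - fps_exp (- d)) * q_num (- d) n = - ((fps_exp (- d) - fps_exp (- (- d))) * q_num (- d) n)"
    by (simp add: algebra_simps)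
  also have "\<dots> = (fps_exp d - fps_exp (- d)) * q_num d n"
    unfolding q_num_mult by simp
  finally have "(fps_exp d - fps_exp (- d)) * q_num (- d) n = (fps_exp d - fps_exp (- d)) * q_num d n" .
  then show ?thesis using q_diff_nonzero[OF False] by simp
qed simp

lemma q_num_pascal:
  assumes "k \<le> Suc m" "d \<noteq> 0"
  shows "q_num d (Suc m) = fps_exp (d * of_nat k) * q_num d (Suc m - k) + fps_exp (d * (of_nat k - of_nat m - 1)) * q_num d k"
proof -
  let ?q = "fps_exp d - fps_exp (- d)"
  have "?q * q_num d (Suc m) = fps_exp (d * of_nat k) * (?q * q_num d (Suc m - k)) + fps_exp (d * (of_nat k - of_nat m - 1)) * (?q * q_num d k)"
    unfolding q_num_mult using assms(1)
    by (simp add: right_diff_distrib fps_exp_mult of_nat_diff) (simp add: algebra_simps)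
  then have "?q * q_num d (Suc m) = ?q * (fps_exp (d * of_nat k) * q_num d (Suc m - k) + fps_exp (d * (of_nat k - of_nat m - 1)) * q_num d k)"
    by (simp add: algebra_simps)
  then show ?thesis using q_diff_nonzero[OF assms(2)] by (metis mult_cancel_left)
qed

definition q_factorial :: "rat \<Rightarrow> nat \<Rightarrow> rat fps" where
  "q_factorial d n = (\<Prod>k=1..n. q_num d k)"

lemma q_factorial_Suc: "q_factorial d (Suc n) = q_factorial d n * q_num d (Suc n)"
  by (simp add: q_factorial_def)

lemma q_factorial_0 [simp]: "q_factorial d 0 = 1"
  by (simp add: q_factorial_def)

text \<open>The constant term of the q-factorial in the formal parameter is \<open>n!\<close>, which is invertible over the rationals.\<close>

lemma q_factorial_unit: "q_factorial d n * inverse (q_factorial d n) = 1"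
proof -
  have "fps_nth (q_num d n) 0 = of_nat n" for n
    by (simp add: q_num_def fps_sum_nth)
  then have "fps_nth (q_factorial d n) 0 = fact n"
    by (induction n) (simp_all add: q_factorial_Suc algebra_simps)
  then show ?thesis
    using inverse_mult_eq_1[of "q_factorial d n"] by (simp add: mult.commute)
qed

lemma q_factorial_uminus: "q_factorial (- d) n = q_factorial d n"
  by (simp add: q_factorial_def q_num_uminus)

text \<open>Gauss' binomial formula for \<open>(X - q\<^bsup>da\<^esup>) (X - q\<^bsup>d(a+2)\<^esup>) \<dots>\<close>, cleared of denominators: the induction step is
then the Pascal rule for q-integers.\<close>

lemma q_binomial_theorem:
  assumes "d \<noteq> 0" "k \<le> m"
  shows "chain_coeff (\<lambda>j. fps_exp (d * (a + 2 * of_nat j))) m k * (q_factorial d k * q_factorial d (m - k)) =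
    (- 1) ^ (m - k) * fps_exp (d * (of_nat (m - k) * (a + of_nat m - 1))) * q_factorial d m"
  using assms(2)
proof (induction m arbitrary: k)
  case (Suc m)
  let ?\<gamma> = "chain_coeff (\<lambda>j. fps_exp (d * (a + 2 * of_nat j)))"
  note e = fps_exp_mult
  consider "k = 0" | "k = Suc m" | l where "k = Suc l" "l < m"
    using Suc.prems by (cases k; cases "k = Suc m") auto
  then show ?case
  proof cases
    case 1
    have "?\<gamma> (Suc m) 0 * (q_factorial d 0 * q_factorial d (Suc m)) =
        - fps_exp (d * (a + 2 * of_nat m)) * (?\<gamma> m 0 * (q_factorial d 0 * q_factorial d (m - 0))) * q_num d (Suc m)"
      by (simp add: q_factorial_Suc mult_ac)
    also have "\<dots> = - (fps_exp (d * (a + 2 * of_nat m)) * fps_exp (d * (of_nat m * (a + of_nat m - 1)))) * ((- 1) ^ m * q_factorial d (Suc m))"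
      unfolding Suc.IH[of 0, OF le0] by (simp add: q_factorial_Suc mult_ac)
    also have "\<dots> = (- 1) ^ Suc m * fps_exp (d * (of_nat (Suc m) * (a + of_nat (Suc m) - 1))) * q_factorial d (Suc m)"
      unfolding e by (simp add: algebra_simps)
    finally show ?thesis using 1 by simp
  next
    case 2
    have "?\<gamma> (Suc m) (Suc m) = ?\<gamma> m m" by (simp add: chain_coeff_eq_0)
    moreover have "?\<gamma> m m * q_factorial d m = q_factorial d m"
      using Suc.IH[of m, OF le_refl]
      by (simp only: diff_self_eq_0 power_0 q_factorial_0 mult_1_right mult_1_left of_nat_0 mult_zero_left
          mult_zero_right fps_exp_0)
    ultimately show ?thesis using 2 by (simp add: q_factorial_Suc flip: mult.assoc)
  next
    case 3
    have sub: "m - l = Suc (m - Suc l)" using 3 by simp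
    have "?\<gamma> (Suc m) (Suc l) * (q_factorial d (Suc l) * q_factorial d (m - l)) =
        (?\<gamma> m l * (q_factorial d l * q_factorial d (m - l))) * q_num d (Suc l) -
        fps_exp (d * (a + 2 * of_nat m)) * (?\<gamma> m (Suc l) * (q_factorial d (Suc l) * q_factorial d (m - Suc l))) * q_num d (m - l)"
      by (simp add: sub q_factorial_Suc algebra_simps)
    also have "\<dots> = (- 1) ^ (m - l) * q_factorial d m *
        (fps_exp (d * (of_nat (m - l) * (a + of_nat m - 1))) * q_num d (Suc l) +
         fps_exp (d * (a + 2 * of_nat m)) * fps_exp (d * (of_nat (m - Suc l) * (a + of_nat m - 1))) * q_num d (m - l))"
      using Suc.IH[of l] Suc.IH[of "Suc l"] 3 by (simp add: sub algebra_simps)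
    also have "fps_exp (d * (a + 2 * of_nat m)) * fps_exp (d * (of_nat (m - Suc l) * (a + of_nat m - 1))) =
        fps_exp (d * (of_nat (m - l) * (a + of_nat m))) * fps_exp (d * of_nat (Suc l))"
      unfolding e using 3 by (simp add: sub of_nat_diff algebra_simps)
    also have "fps_exp (d * (of_nat (m - l) * (a + of_nat m - 1))) =
        fps_exp (d * (of_nat (m - l) * (a + of_nat m))) * fps_exp (d * (of_nat (Suc l) - of_nat m - 1))"
      unfolding e using 3 by (simp add: of_nat_diff algebra_simps)
    also have "fps_exp (d * (of_nat (m - l) * (a + of_nat m))) * fps_exp (d * (of_nat (Suc l) - of_nat m - 1)) * q_num d (Suc l) +
        fps_exp (d * (of_nat (m - l) * (a + of_nat m))) * fps_exp (d * of_nat (Suc l)) * q_num d (m - l) =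
        fps_exp (d * (of_nat (m - l) * (a + of_nat m))) * q_num d (Suc m)"
      using q_num_pascal[of "Suc l" m d] 3 assms(1) by (simp add: algebra_simps)
    finally show ?thesis using 3 by (simp add: q_factorial_Suc mult_ac)
  qed
qed simp

text \<open>For \<open>m < N\<close> these are the powers of \<open>q\<^sup>d\<close> with exponents \<open>1 - N, 3 - N, \<dots>, N - 1\<close>, the roots of the
q-binomial polynomial whose coefficients occur in the Serre relation.\<close>

definition q_seq :: "rat \<Rightarrow> nat \<Rightarrow> nat \<Rightarrow> rat fps" where
  "q_seq d N m = fps_exp (d * (1 - of_nat N + 2 * of_nat m))"

lemma chain_coeff_q_seq:
  assumes "d \<noteq> 0" "k \<le> N"
  shows "chain_coeff (q_seq d N) N k =
    (- 1) ^ (N - k) * q_factorial d N * inverse (q_factorial d k) * inverse (q_factorial d (N - k))"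
proof -
  note u = q_factorial_unit[of d]
  have "chain_coeff (q_seq d N) N k * (q_factorial d k * q_factorial d (N - k)) = (- 1) ^ (N - k) * q_factorial d N"
    using q_binomial_theorem[OF assms, of "1 - of_nat N"] by (simp add: q_seq_def[abs_def])
  then have "chain_coeff (q_seq d N) N k * (q_factorial d k * q_factorial d (N - k)) *
      (inverse (q_factorial d k) * inverse (q_factorial d (N - k))) =
      (- 1) ^ (N - k) * q_factorial d N * (inverse (q_factorial d k) * inverse (q_factorial d (N - k)))"
    by simp
  then have "chain_coeff (q_seq d N) N k * (q_factorial d k * inverse (q_factorial d k)) *
      (q_factorial d (N - k) * inverse (q_factorial d (N - k))) =
      (- 1) ^ (N - k) * q_factorial d N * inverse (q_factorial d k) * inverse (q_factorial d (N - k))"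
    by (simp only: mult_ac)
  then show ?thesis unfolding u by simp
qed

text \<open>Replacing \<open>d\<close> by \<open>- d\<close> reverses the order of the factors. As left and right multiplication by \<open>x\<close> commute,
this changes nothing; formally, q-binomial coefficients are invariant under \<open>q \<mapsto> q\<inverse>\<close>. The computation
takes place in the free algebra on two letters and is transported by evaluation.\<close>

lemma qchain_q_seq_uminus:
  fixes C :: "(rat fps, 'c, 'm) module_scheme"
  assumes "assoc_algebra C" "x \<in> carrier C" "y \<in> carrier C" "d \<noteq> 0"
  shows "qchain C (q_seq (- d) N) x y N = qchain C (q_seq d N) x y N"
proof -
  interpret assoc_alg C by (rule assoc_alg.intro) fact
  let ?F = "free_algebra UNIV :: (rat fps, bool list \<Rightarrow>\<^sub>0 rat fps) module"
  define \<phi> where "\<phi> b = (if b then x else y)" for b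
  have hom: "alg_hom ?F C (eval_free C \<phi>)"
    by (rule eval_free_hom) (simp add: \<phi>_def assms)
  have l: "letter b \<in> carrier ?F" for b by (simp add: free_algebra_closed)
  have ev: "qchain C c x y N = eval_free C \<phi> (qchain ?F c (letter True) (letter False) N)" for c
    using alg_hom_qchain[OF hom assoc_algebra_free assms(1) l l, of c True False N] assms(2,3)
    by (simp add: \<phi>_def)
  have "qchain ?F (q_seq (- d) N) (letter True) (letter False) N = qchain ?F (q_seq d N) (letter True) (letter False) N"
    unfolding qchain_free_expand[OF l l] using assms(4)
    by (intro sum.cong refl) (simp add: chain_coeff_q_seq q_factorial_uminus)
  then show ?thesis by (simp add: ev)
qed

lemma q_int_eq_q_num: "half_norm D i \<noteq> 0 \<Longrightarrow> q_int D i n = q_num (half_norm D i) n"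
  unfolding q_int_def q_num_mult[symmetric] by (rule nonzero_mult_div_cancel_left[OF q_diff_nonzero])

lemma scalar_collect:
  "scalar r * (scalar s * (scalar a * x) * y * (scalar b * z)) = scalar (r * s * a * b) * (x * y * z)"
proof -
  have "scalar s * (scalar a * x) * y * (scalar b * z) = scalar s * scalar a * ((x * y) * (scalar b * z))"
    by (simp only: mult.assoc)
  also have "\<dots> = scalar s * scalar a * (scalar b * (x * y * z))"
    by (subst scalar_left_commute) (rule refl)
  finally show ?thesis by (simp only: scalar_simps mult.assoc)
qed

text \<open>Up to the q-factorial of \<open>N\<close> and a sign, the coefficients of the Serre polynomial are the alternating
q-binomial coefficients of \<open>chain_coeff_q_seq\<close>.\<close>

lemma serre_eq_qchain:
  fixes D :: "('i, 't) root_datum" and Y :: "'i \<Rightarrow> 'g list \<Rightarrow>\<^sub>0 rat fps"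
  assumes "half_norm D i \<noteq> 0" "root D j (coroot D i) = 1 - of_nat N"
    and "Y i \<in> carrier (free_algebra G)" "Y j \<in> carrier (free_algebra G)"
  shows "scalar (q_factorial (half_norm D i) N) * serre D Y i j =
    scalar ((- 1) ^ N) * qchain (free_algebra G) (q_seq (half_norm D i) N) (Y i) (Y j) N"
proof -
  let ?d = "half_norm D i"
  have N: "nat \<lfloor>1 - root D j (coroot D i)\<rfloor> = N" by (simp add: assms(2))
  have q: "q_fact D i n = q_factorial ?d n" for n
    by (simp add: q_fact_def q_factorial_def q_int_eq_q_num[OF assms(1)])
  have sgn: "(- 1) ^ k = (scalar ((- 1) ^ k) :: 'g list \<Rightarrow>\<^sub>0 rat fps)" for k
    by (induction k) (simp_all add: scalar_simps scalar_minus)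
  have "scalar (q_factorial ?d N) * ((- 1) ^ k * divided_power D i k (Y i) * Y j * divided_power D i (N - k) (Y i)) =
      scalar ((- 1) ^ N) * (scalar (chain_coeff (q_seq ?d N) N k) * (Y i ^ k * Y j * Y i ^ (N - k)))"
    if "k \<le> N" for k
  proof -
    have s: "(- 1) ^ N * (- 1) ^ (N - k) = ((- 1) ^ k :: rat fps)"
      using that by (auto simp: minus_one_power_iff)
    have "scalar (q_factorial ?d N) * ((- 1) ^ k * divided_power D i k (Y i) * Y j * divided_power D i (N - k) (Y i)) =
        scalar (q_factorial ?d N * (- 1) ^ k * inverse (q_factorial ?d k) * inverse (q_factorial ?d (N - k))) *
        (Y i ^ k * Y j * Y i ^ (N - k))"
      unfolding divided_power_def q sgn by (rule scalar_collect)
    also have "q_factorial ?d N * (- 1) ^ k * inverse (q_factorial ?d k) * inverse (q_factorial ?d (N - k)) =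
        (- 1) ^ N * chain_coeff (q_seq ?d N) N k"
      unfolding chain_coeff_q_seq[OF assms(1) that] s[symmetric] by (simp only: mult_ac)
    finally show ?thesis by (simp add: scalar_simps mult.assoc)
  qed
  then show ?thesis
    unfolding serre_def Let_def N qchain_free_expand[OF assms(3,4)] sum_distrib_left atLeast0AtMost
    by (intro sum.cong refl) auto
qed

text \<open>Since the q-factorial and the sign are units, the Serre relation may be replaced by the vanishing of an
iterated q-commutator.\<close>

lemma eval_serre_iff:
  fixes C :: "(rat fps, 'c, 'm) module_scheme"
  assumes "half_norm D i \<noteq> 0" "root D j (coroot D i) = 1 - of_nat N"
    and "Y i \<in> carrier (free_algebra G)" "Y j \<in> carrier (free_algebra G)"
    and "assoc_algebra C" "alg_hom (free_algebra G) C f" "serre D Y i j \<in> carrier (free_algebra G)"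
  shows "f (serre D Y i j) = \<zero>\<^bsub>C\<^esub> \<longleftrightarrow> qchain C (q_seq (half_norm D i) N) (f (Y i)) (f (Y j)) N = \<zero>\<^bsub>C\<^esub>"
proof -
  interpret C: assoc_alg C by (rule assoc_alg.intro) fact
  interpret F: assoc_alg "free_algebra G :: (rat fps, 'd list \<Rightarrow>\<^sub>0 rat fps) module"
    by (rule assoc_alg.intro) (rule assoc_algebra_free)
  let ?p = "q_factorial (half_norm D i) N" and ?s = "(- 1) ^ N :: rat fps"
  let ?Z = "qchain C (q_seq (half_norm D i) N) (f (Y i)) (f (Y j)) N"
  note fD = alg_homD[OF assms(6)]
  have Zc: "?Z \<in> carrier C" using assms(3,4) by (simp add: fD)
  have sc: "f (serre D Y i j) \<in> carrier C" by (rule fD(1)) fact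
  have "f (scalar ?p * serre D Y i j) = f (scalar ?s * qchain (free_algebra G) (q_seq (half_norm D i) N) (Y i) (Y j) N)"
    by (simp only: serre_eq_qchain[OF assms(1-4)])
  then have eq: "?p \<odot>\<^bsub>C\<^esub> f (serre D Y i j) = ?s \<odot>\<^bsub>C\<^esub> ?Z"
    using fD(5)[OF assms(7), of ?p] fD(5)[OF F.qchain_closed[OF assms(3,4)], of ?s]
      alg_hom_qchain[OF assms(6) assoc_algebra_free assms(5,3,4)]
    by simp
  have 1: "?s * ?s = 1" by (simp flip: power_mult_distrib)
  have "f (serre D Y i j) = inverse ?p \<odot>\<^bsub>C\<^esub> (?p \<odot>\<^bsub>C\<^esub> f (serre D Y i j))"
    using sc q_factorial_unit[of "half_norm D i" N] by (simp add: mult.commute)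
  moreover have "?Z = ?s \<odot>\<^bsub>C\<^esub> (?s \<odot>\<^bsub>C\<^esub> ?Z)"
    using Zc 1 by simp
  ultimately show ?thesis
    using eq C.smult_zero_right by metis
qed

subsection \<open>Sums and twists of families satisfying the Serre relations\<close>

context assoc_alg
begin

lemma qchain_smult:
  assumes "x \<in> carrier A" "y \<in> carrier A"
  shows "qchain A c (r \<odot> x) (s \<odot> y) m = (r ^ m * s) \<odot> qchain A c x y m"
  using assms by (induction m) (simp_all add: smult_diff_right mult_ac)

lemma qchain_add_second:
  assumes "x \<in> carrier A" "y \<in> carrier A" "z \<in> carrier A"
  shows "qchain A c x (y \<oplus> z) m = qchain A c x y m \<oplus> qchain A c x z m"
proof (induction m)
  case (Suc m)
  have "x \<otimes> u \<oplus> x \<otimes> v \<ominus> (r \<odot> (u \<otimes> x) \<oplus> r \<odot> (v \<otimes> x)) = (x \<otimes> u \<ominus> r \<odot> (u \<otimes> x)) \<oplus> (x \<otimes> v \<ominus> r \<odot> (v \<otimes> x))"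
    if "u \<in> carrier A" "v \<in> carrier A" for u v r
    using that assms by (simp add: a_minus_def minus_add a_ac)
  then show ?case
    using assms by (simp add: Suc.IH r_distr l_distr smult_r_distr)
qed simp

text \<open>If \<open>b\<close> q-commutes with \<open>a\<close> and \<open>y\<close>, it q-commutes with the \<open>m\<close>-th iterated q-commutator of \<open>a\<close> and \<open>y\<close>. For a
geometric sequence \<open>c\<close> with the matching ratio the factor is exactly \<open>c m\<close>, so the summand \<open>b\<close> drops out of
every step.\<close>

lemma qchain_add_q_commuting:
  assumes "a \<in> carrier A" "b \<in> carrier A" "y \<in> carrier A" 
    and b_a: "b \<otimes> a = p \<odot> (a \<otimes> b)" and b_y: "b \<otimes> y = r \<odot> (y \<otimes> b)"
    and c: "\<And>m. c m = p ^ m * r"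
  shows "qchain A c (a \<oplus> b) y m = qchain A c a y m"
proof -
  have comm: "b \<otimes> qchain A c a y m = c m \<odot> (qchain A c a y m \<otimes> b)" for m
  proof (induction m)
    case 0
    show ?case using b_y by (simp add: c)
  next
    case (Suc m)
    let ?z = "qchain A c a y m"
    have z: "?z \<in> carrier A" using assms by simp
    have cS: "c (Suc m) = p * c m" by (simp add: c mult_ac)
    have "b \<otimes> (a \<otimes> ?z) = p \<odot> (a \<otimes> (b \<otimes> ?z))"
      using assms(1-5) z b_a by (simp flip: m_assoc) 
    also have "\<dots> = c (Suc m) \<odot> (a \<otimes> ?z \<otimes> b)"
      using assms(1-5) z by (simp add: Suc.IH m_assoc cS)
    finally have 1: "b \<otimes> (a \<otimes> ?z) = c (Suc m) \<odot> (a \<otimes> ?z \<otimes> b)" .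
    have "b \<otimes> (?z \<otimes> a) = c m \<odot> (?z \<otimes> (b \<otimes> a))"
      using assms(1-5) z by (simp add: Suc.IH m_assoc flip: m_assoc[of b])
    also have "\<dots> = c (Suc m) \<odot> (?z \<otimes> a \<otimes> b)"
      using assms(1-5) z by (simp add: b_a m_assoc cS mult.commute)
    finally have 2: "b \<otimes> (?z \<otimes> a) = c (Suc m) \<odot> (?z \<otimes> a \<otimes> b)" .
    have "b \<otimes> (a \<otimes> ?z \<ominus> c m \<odot> (?z \<otimes> a)) = b \<otimes> (a \<otimes> ?z) \<ominus> c m \<odot> (b \<otimes> (?z \<otimes> a))"
      using assms(1-5) z by (simp add: a_minus_def r_distr r_minus smult_minus_right)
    also have "\<dots> = c (Suc m) \<odot> ((a \<otimes> ?z \<ominus> c m \<odot> (?z \<otimes> a)) \<otimes> b)"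
      unfolding 1 2 using assms(1-5) z
      by (simp add: a_minus_def l_distr l_minus smult_r_distr smult_minus_right mult.commute)
    finally show ?case by simp
  qed
  show ?thesis
  proof (induction m)
    case (Suc m)
    have cl: "qchain A c a y m \<in> carrier A" using assms by simp
    have "(a \<oplus> b) \<otimes> z \<ominus> k \<odot> (z \<otimes> (a \<oplus> b)) = a \<otimes> z \<ominus> k \<odot> (z \<otimes> a)"
      if "z \<in> carrier A" "b \<otimes> z = k \<odot> (z \<otimes> b)" for z k
    proof -
      have "u \<oplus> w \<ominus> (v \<oplus> w) = u \<ominus> v" if "u \<in> carrier A" "v \<in> carrier A" "w \<in> carrier A" for u v w
        using that by algebra
      then show ?thesis using that assms by (simp add: l_distr r_distr smult_r_distr)
    qed
    from this[OF cl comm] show ?case by (simp add: Suc.IH)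
  qed simp
qed

text \<open>All occurrences of \<open>g\<close> and \<open>k\<close> can be moved to the left. Because \<open>y g\<close> and \<open>x k\<close> produce the same scalar
\<open>r\<close>, both terms of the \<open>m\<close>-th q-commutator produce the scalar \<open>p\<^sup>m r\<close>, which factors out.\<close>

lemma qchain_twist:
  assumes "x \<in> carrier A" "y \<in> carrier A" "g \<in> carrier A" "k \<in> carrier A"
    and gk: "g \<otimes> k = k \<otimes> g" and xg: "x \<otimes> g = p \<odot> (g \<otimes> x)" and yg: "y \<otimes> g = r \<odot> (g \<otimes> y)"
    and xk: "x \<otimes> k = r \<odot> (k \<otimes> x)"
  shows "\<exists>u. \<exists>w\<in>carrier A. qchain A c (g \<otimes> x) (k \<otimes> y) m = u \<odot> (w \<otimes> qchain A c x y m)"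
proof -
  have gcomm: "g \<otimes> (g [^] m \<otimes> k) = g [^] m \<otimes> k \<otimes> g" for m :: nat
  proof -
    have "g \<otimes> (g [^] m \<otimes> k) = g [^] Suc m \<otimes> k"
      using assms nat_pow_Suc2[OF assms(3), of m] by (simp add: m_assoc del: nat_pow_Suc)
    also have "\<dots> = g [^] m \<otimes> k \<otimes> g"
      using assms by (simp add: m_assoc flip: gk)
    finally show ?thesis .
  qed
  have xG: "x \<otimes> (g [^] m \<otimes> k) = (p ^ m * r) \<odot> (g [^] m \<otimes> k \<otimes> x)" for m :: nat
  proof (induction m)
    case 0
    show ?case using assms xk by simp
  next
    case (Suc m)
    have "x \<otimes> (g [^] Suc m \<otimes> k) = x \<otimes> (g [^] m \<otimes> k) \<otimes> g"
      using assms by (simp add: m_assoc gk)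
    also have "\<dots> = (p ^ m * r) \<odot> (g [^] m \<otimes> k \<otimes> (x \<otimes> g))"
      unfolding Suc.IH using assms by (simp add: m_assoc)
    also have "\<dots> = (p ^ Suc m * r) \<odot> (g [^] m \<otimes> k \<otimes> g \<otimes> x)"
      unfolding xg using assms by (simp add: m_assoc mult_ac)
    also have "g [^] m \<otimes> k \<otimes> g = g [^] Suc m \<otimes> k"
      using assms by (simp add: m_assoc gk)
    finally show ?case .
  qed
  have yG: "qchain A c x y m \<otimes> g = (p ^ m * r) \<odot> (g \<otimes> qchain A c x y m)" for m
  proof (induction m)
    case 0
    show ?case using yg by simp
  next
    case (Suc m)
    let ?z = "qchain A c x y m"
    have z: "?z \<in> carrier A" using assms by simp
    have "x \<otimes> (g \<otimes> ?z) = (p \<odot> (g \<otimes> x)) \<otimes> ?z"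
      unfolding xg[symmetric] by (rule m_assoc[symmetric]) (use assms z in simp_all)
    also have "\<dots> = p \<odot> (g \<otimes> (x \<otimes> ?z))"
      using assms(1,3) z by (simp add: m_assoc)
    finally have 1: "x \<otimes> ?z \<otimes> g = (p ^ Suc m * r) \<odot> (g \<otimes> (x \<otimes> ?z))"
      using assms z by (simp add: m_assoc Suc.IH mult_ac)
    have "?z \<otimes> x \<otimes> g = p \<odot> (?z \<otimes> g \<otimes> x)"
      using assms z by (simp add: m_assoc xg)
    then have 2: "?z \<otimes> x \<otimes> g = (p ^ Suc m * r) \<odot> (g \<otimes> (?z \<otimes> x))"
      unfolding Suc.IH using assms z by (simp add: m_assoc mult_ac)
    show ?case
      using assms z by (simp add: a_minus_def l_distr r_distr l_minus r_minus 1 2 smult_r_distr smult_minus_right mult_ac)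
  qed
  have main: "qchain A c (g \<otimes> x) (k \<otimes> y) m =
      (\<Prod>j<m. p ^ j * r) \<odot> (g [^] m \<otimes> k \<otimes> qchain A c x y m)" for m
  proof (induction m)
    case 0
    show ?case using assms by simp
  next
    case (Suc m)
    let ?z = "qchain A c x y m" and ?G = "g [^] m \<otimes> k" and ?u = "\<Prod>j<m. p ^ j * r"
    have z: "?z \<in> carrier A" and G: "?G \<in> carrier A" using assms by simp_all
    have "g \<otimes> x \<otimes> (?G \<otimes> ?z) = g \<otimes> (x \<otimes> ?G) \<otimes> ?z"
      using assms z G by (simp add: m_assoc del: nat_pow_mult)
    then have 1: "g \<otimes> x \<otimes> (?G \<otimes> ?z) = (p ^ m * r) \<odot> (g \<otimes> ?G \<otimes> (x \<otimes> ?z))"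
      unfolding xG using assms z G by (simp add: m_assoc)
    have "?G \<otimes> ?z \<otimes> (g \<otimes> x) = ?G \<otimes> (?z \<otimes> g) \<otimes> x"
      using assms z G by (simp add: m_assoc)
    then have 2: "?G \<otimes> ?z \<otimes> (g \<otimes> x) = (p ^ m * r) \<odot> (g \<otimes> ?G \<otimes> (?z \<otimes> x))"
      unfolding yG gcomm using assms z G by (simp add: m_assoc)
    have GG: "g [^] Suc m \<otimes> k = g \<otimes> ?G"
      using assms by (simp add: gcomm m_assoc gk)
    have gG: "g \<otimes> ?G \<in> carrier A" using assms G by simp
    have "qchain A c (g \<otimes> x) (k \<otimes> y) (Suc m) =
        ?u \<odot> (g \<otimes> x \<otimes> (?G \<otimes> ?z)) \<ominus> (c m * ?u) \<odot> (?G \<otimes> ?z \<otimes> (g \<otimes> x))"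
      using assms z G by (simp add: Suc.IH)
    also have "\<dots> = (?u * (p ^ m * r)) \<odot> (g \<otimes> ?G \<otimes> (x \<otimes> ?z \<ominus> c m \<odot> (?z \<otimes> x)))"
      unfolding 1 2 using assms z gG by (simp add: a_minus_def r_distr r_minus smult_r_distr smult_minus_right mult_ac)
    finally show ?case unfolding GG by simp
  qed
  show ?thesis
    using main[of m] assms by blast
qed

end

text \<open>The hypotheses are the q-commutation rules between the two summands of a comultiplied root vector. Then
\<open>bi\<close> drops out of the chain over \<open>aj\<close>, and \<open>ai\<close> drops out of the chain over \<open>bj\<close>; in the second case the
rules hold with \<open>q\<close> inverted, so the factors of the chain are first put in the opposite order.\<close>

lemma qchain_q_seq_sum:
  fixes C :: "(rat fps, 'c, 'm) module_scheme" (structure)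
  assumes "assoc_algebra C" "d \<noteq> 0"
    and cl: "ai \<in> carrier C" "aj \<in> carrier C" "bi \<in> carrier C" "bj \<in> carrier C"
    and ii: "bi \<otimes> ai = fps_exp (2 * d) \<odot> (ai \<otimes> bi)"
    and ij: "bi \<otimes> aj = fps_exp (d * (1 - of_nat N)) \<odot> (aj \<otimes> bi)"
    and ji: "bj \<otimes> ai = fps_exp (d * (1 - of_nat N)) \<odot> (ai \<otimes> bj)"
  shows "qchain C (q_seq d N) (ai \<oplus> bi) (aj \<oplus> bj) N =
    qchain C (q_seq d N) ai aj N \<oplus> qchain C (q_seq d N) bi bj N"
proof -
  interpret assoc_alg C by (rule assoc_alg.intro) fact
  have seq: "q_seq e N m = fps_exp (2 * e) ^ m * fps_exp (e * (1 - of_nat N))" for e m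
    by (simp add: q_seq_def fps_exp_power_mult fps_exp_mult algebra_simps)
  \<comment> \<open>Used to read the q-commutation rules with the factors exchanged.\<close>
  have inv: "u = fps_exp (- e) \<odot> v" if "v = fps_exp e \<odot> u" "u \<in> carrier C" for u v e
    using that by (simp add: fps_exp_mult)
  have "qchain C (q_seq d N) (ai \<oplus> bi) aj N = qchain C (q_seq d N) ai aj N"
    by (rule qchain_add_q_commuting[OF _ _ _ ii ij seq]) (use cl in simp_all)
  moreover have "qchain C (q_seq (- d) N) (bi \<oplus> ai) bj N = qchain C (q_seq (- d) N) bi bj N"
  proof (rule qchain_add_q_commuting[OF _ _ _ _ _ seq])
    show "ai \<otimes> bi = fps_exp (2 * - d) \<odot> (bi \<otimes> ai)"
      using inv[OF ii] cl by simp
    show "ai \<otimes> bj = fps_exp (- d * (1 - of_nat N)) \<odot> (bj \<otimes> ai)"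
      using inv[OF ji] cl by simp
  qed (use cl in simp_all)
  ultimately show ?thesis
    using cl assms(1,2) by (simp add: qchain_add_second qchain_q_seq_uminus a_comm[of ai bi])
qed

section \<open>A family of quantized enveloping algebras\<close>

lemma fps_exp_mult_left: "fps_exp a * (fps_exp b * c) = fps_exp (a + b :: rat) * c"
  by (simp add: fps_exp_mult flip: mult.assoc)

definition serre_len :: "('i, 't) root_datum \<Rightarrow> 'i \<Rightarrow> 'i \<Rightarrow> nat" where
  "serre_len D i j = nat \<lfloor>1 - root D j (coroot D i)\<rfloor>"

text \<open>What the presentations see of a symmetrizable root datum: \<open>t_exp D i\<close> represents the root \<open>i\<close> under the form,
so \<open>root_t_exp_sym\<close> is the symmetry of the form, and it lies in the lattice because \<open>half_norm D i\<close> is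
an integer. The off-diagonal Cartan integers are written as \<open>1 - N\<close> because \<open>N\<close> is the degree of the Serre
relation.\<close>

locale quantum_datum =
  fixes D :: "('i, 't::ab_group_add) root_datum"
  assumes half_norm_nonzero: "i \<in> index D \<Longrightarrow> half_norm D i \<noteq> 0"
    and lattice_zero [simp]: "0 \<in> coroot_lattice D"
    and lattice_add [simp]: "h \<in> coroot_lattice D \<Longrightarrow> h' \<in> coroot_lattice D \<Longrightarrow> h + h' \<in> coroot_lattice D"
    and lattice_minus [simp]: "h \<in> coroot_lattice D \<Longrightarrow> - h \<in> coroot_lattice D"
    and lattice_t_exp [simp]: "i \<in> index D \<Longrightarrow> t_exp D i \<in> coroot_lattice D"
    and root_add [simp]: "i \<in> index D \<Longrightarrow> root D i (h + h') = root D i h + root D i h'"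
    and root_diag: "i \<in> index D \<Longrightarrow> root D i (coroot D i) = 2"
    and root_offdiag: "i \<in> index D \<Longrightarrow> j \<in> index D \<Longrightarrow> i \<noteq> j \<Longrightarrow>
      \<exists>N>0. root D j (coroot D i) = 1 - of_nat N"
    and root_t_exp: "i \<in> index D \<Longrightarrow> j \<in> index D \<Longrightarrow> root D j (t_exp D i) = half_norm D i * root D j (coroot D i)"
    and root_t_exp_sym: "i \<in> index D \<Longrightarrow> j \<in> index D \<Longrightarrow> root D j (t_exp D i) = root D i (t_exp D j)"
begin

lemma lattice_diff [simp]:
  "h \<in> coroot_lattice D \<Longrightarrow> h' \<in> coroot_lattice D \<Longrightarrow> h - h' \<in> coroot_lattice D"
  using lattice_add[of h "- h'"] by simp

lemma root_zero [simp]: "i \<in> index D \<Longrightarrow> root D i 0 = 0"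
  using root_add[of i 0 0] by simp

lemma root_minus [simp]: "i \<in> index D \<Longrightarrow> root D i (- h) = - root D i h"
  using root_add[of i h "- h"] by simp

lemma serre_len:
  assumes "i \<in> index D" "j \<in> index D" "i \<noteq> j"
  shows "root D j (coroot D i) = 1 - of_nat (serre_len D i j)" "serre_len D i j > 0"
  using root_offdiag[OF assms] by (auto simp: serre_len_def)

lemma root_t_exp_serre:
  assumes "i \<in> index D" "j \<in> index D" "i \<noteq> j"
  shows "root D j (t_exp D i) = half_norm D i * (1 - of_nat (serre_len D i j))"
  using assms by (simp add: root_t_exp serre_len)

lemma root_diff [simp]: "i \<in> index D \<Longrightarrow> root D i (h - h') = root D i h - root D i h'"
  using root_add[of i h "- h'"] by simp

lemma root_t_exp_diag: "i \<in> index D \<Longrightarrow> root D i (t_exp D i) = 2 * half_norm D i"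
  by (simp add: root_t_exp root_diag)

lemma gens_simps [simp]:
  "E i \<in> gens D \<longleftrightarrow> i \<in> index D" "F i \<in> gens D \<longleftrightarrow> i \<in> index D" "Q h \<in> gens D \<longleftrightarrow> h \<in> coroot_lattice D"
  by (auto simp: gens_def)

end

abbreviation serre_chain ::
    "('i, 't) root_datum \<Rightarrow> (rat fps, 'c, 'm) module_scheme \<Rightarrow> 'i \<Rightarrow> 'i \<Rightarrow> 'c \<Rightarrow> 'c \<Rightarrow> 'c" where
  "serre_chain D C i j u v \<equiv> qchain C (q_seq (half_norm D i) (serre_len D i j)) u v (serre_len D i j)"

text \<open>A solution in \<open>C\<close> of the relations shared by the three presentations. The weight relations are stated as
commutation rules, the Serre relations in factored form.\<close>

locale common_relations = quantum_datum D + assoc_alg C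
  for D :: "('i, 't::ab_group_add) root_datum" and C :: "(rat fps, 'c, 'm) module_scheme" (structure) +
  fixes x :: "('i, 't) gen \<Rightarrow> 'c"
  assumes closed: "g \<in> gens D \<Longrightarrow> x g \<in> carrier C"
    and Q_zero: "x (Q 0) = \<one>"
    and Q_mult: "h \<in> coroot_lattice D \<Longrightarrow> h' \<in> coroot_lattice D \<Longrightarrow> x (Q h) \<otimes> x (Q h') = x (Q (h + h'))"
    and Q_E: "h \<in> coroot_lattice D \<Longrightarrow> i \<in> index D \<Longrightarrow> x (Q h) \<otimes> x (E i) = qpow (root D i h) \<odot> (x (E i) \<otimes> x (Q h))"
    and Q_F: "h \<in> coroot_lattice D \<Longrightarrow> i \<in> index D \<Longrightarrow> x (Q h) \<otimes> x (F i) = qpow (- root D i h) \<odot> (x (F i) \<otimes> x (Q h))"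
    and serre_E: "i \<in> index D \<Longrightarrow> j \<in> index D \<Longrightarrow> i \<noteq> j \<Longrightarrow> serre_chain D C i j (x (E i)) (x (E j)) = \<zero>"
    and serre_F: "i \<in> index D \<Longrightarrow> j \<in> index D \<Longrightarrow> i \<noteq> j \<Longrightarrow> serre_chain D C i j (x (F i)) (x (F j)) = \<zero>"
begin

lemma closed' [simp]:
  "i \<in> index D \<Longrightarrow> x (E i) \<in> carrier C" "i \<in> index D \<Longrightarrow> x (F i) \<in> carrier C"
  "h \<in> coroot_lattice D \<Longrightarrow> x (Q h) \<in> carrier C"
  by (simp_all add: closed)

lemma E_Q: "h \<in> coroot_lattice D \<Longrightarrow> i \<in> index D \<Longrightarrow> x (E i) \<otimes> x (Q h) = qpow (- root D i h) \<odot> (x (Q h) \<otimes> x (E i))"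
  by (simp add: Q_E fps_exp_mult)

lemma F_Q: "h \<in> coroot_lattice D \<Longrightarrow> i \<in> index D \<Longrightarrow> x (F i) \<otimes> x (Q h) = qpow (root D i h) \<odot> (x (Q h) \<otimes> x (F i))"
  by (simp add: Q_F fps_exp_mult)

lemma extend_left:
  assumes "u \<otimes> v = r \<odot> (v' \<otimes> u')" "u \<in> carrier C" "v \<in> carrier C" "u' \<in> carrier C" "v' \<in> carrier C" "z \<in> carrier C"
  shows "u \<otimes> (v \<otimes> z) = r \<odot> (v' \<otimes> (u' \<otimes> z))"
proof -
  have "u \<otimes> (v \<otimes> z) = u \<otimes> v \<otimes> z"
    by (rule m_assoc[symmetric]) (use assms in simp_all)
  also have "\<dots> = r \<odot> (v' \<otimes> (u' \<otimes> z))"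
    unfolding assms(1) using assms(2-) by (simp add: m_assoc)
  finally show ?thesis .
qed

lemma E_Q': "h \<in> coroot_lattice D \<Longrightarrow> i \<in> index D \<Longrightarrow> z \<in> carrier C \<Longrightarrow>
    x (E i) \<otimes> (x (Q h) \<otimes> z) = qpow (- root D i h) \<odot> (x (Q h) \<otimes> (x (E i) \<otimes> z))"
  by (rule extend_left[OF E_Q]) simp_all

lemma F_Q': "h \<in> coroot_lattice D \<Longrightarrow> i \<in> index D \<Longrightarrow> z \<in> carrier C \<Longrightarrow>
    x (F i) \<otimes> (x (Q h) \<otimes> z) = qpow (root D i h) \<odot> (x (Q h) \<otimes> (x (F i) \<otimes> z))"
  by (rule extend_left[OF F_Q]) simp_all

lemma Q_mult': "h \<in> coroot_lattice D \<Longrightarrow> h' \<in> coroot_lattice D \<Longrightarrow> z \<in> carrier C \<Longrightarrow>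
    x (Q h) \<otimes> (x (Q h') \<otimes> z) = x (Q (h + h')) \<otimes> z"
  by (simp add: Q_mult flip: m_assoc)

text \<open>Rewriting with these rules moves the group-like elements to the left of every monomial.\<close>

lemmas move_Q = m_assoc E_Q E_Q' F_Q F_Q' Q_mult Q_mult' Q_zero fps_exp_mult fps_exp_mult_left

lemma Q_commute: "h \<in> coroot_lattice D \<Longrightarrow> h' \<in> coroot_lattice D \<Longrightarrow> x (Q h) \<otimes> x (Q h') = x (Q h') \<otimes> x (Q h)"
  by (simp add: Q_mult add.commute)

lemma cong:
  assumes "\<And>g. g \<in> gens D \<Longrightarrow> y g = x g"
  shows "common_relations D C y"
proof -
  have y: "y (E i) = x (E i)" "y (F i) = x (F i)" if "i \<in> index D" for i
    using that by (simp_all add: assms)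
  have yQ: "y (Q h) = x (Q h)" if "h \<in> coroot_lattice D" for h
    using that by (simp add: assms)
  show ?thesis
    by unfold_locales
      (auto simp: y yQ assms closed Q_zero Q_mult Q_E Q_F serre_E serre_F simp del: mult_smult_left mult_smult_right)
qed

lemma hom_image:
  assumes "alg_hom C C' f" "assoc_algebra C'"
  shows "common_relations D C' (\<lambda>g. f (x g))"
proof -
  interpret C': assoc_alg C' by (rule assoc_alg.intro) fact
  note fD = alg_homD[OF assms(1)]
  note chain = alg_hom_qchain[OF assms(1) assoc_algebra assms(2), symmetric]
  note zero = alg_hom_zero[OF assms(1) assoc_algebra assms(2)]
  show ?thesis
  proof
    show "g \<in> gens D \<Longrightarrow> f (x g) \<in> carrier C'" for g by (simp add: fD closed)
    show "f (x (Q 0)) = \<one>\<^bsub>C'\<^esub>" by (simp add: Q_zero fD)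
    show "f (x (Q h)) \<otimes>\<^bsub>C'\<^esub> f (x (Q h')) = f (x (Q (h + h')))"
      if "h \<in> coroot_lattice D" "h' \<in> coroot_lattice D" for h h'
      using that by (simp add: Q_mult flip: fD(2))
    show "f (x (Q h)) \<otimes>\<^bsub>C'\<^esub> f (x (E i)) = qpow (root D i h) \<odot>\<^bsub>C'\<^esub> (f (x (E i)) \<otimes>\<^bsub>C'\<^esub> f (x (Q h)))"
      if "h \<in> coroot_lattice D" "i \<in> index D" for h i
      using that by (simp add: Q_E flip: fD(2,5))
    show "f (x (Q h)) \<otimes>\<^bsub>C'\<^esub> f (x (F i)) = qpow (- root D i h) \<odot>\<^bsub>C'\<^esub> (f (x (F i)) \<otimes>\<^bsub>C'\<^esub> f (x (Q h)))"
      if "h \<in> coroot_lattice D" "i \<in> index D" for h i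
      using that by (simp add: Q_F flip: fD(2,5))
    show "serre_chain D C' i j (f (x (E i))) (f (x (E j))) = \<zero>\<^bsub>C'\<^esub>"
      if "i \<in> index D" "j \<in> index D" "i \<noteq> j" for i j
      using that by (simp add: chain serre_E zero)
    show "serre_chain D C' i j (f (x (F i))) (f (x (F j))) = \<zero>\<^bsub>C'\<^esub>"
      if "i \<in> index D" "j \<in> index D" "i \<noteq> j" for i j
      using that by (simp add: chain serre_F zero)
  qed
qed

end

text \<open>Passing to the opposite algebra exchanges the two terms of each q-commutator, so that, up to a unit, each
factor is replaced by its inverse.\<close>

lemma qchain_op:
  fixes C :: "(rat fps, 'c, 'm) module_scheme" (structure)
  assumes "assoc_algebra C" "u \<in> carrier C" "v \<in> carrier C"
  shows "\<exists>r. qchain (op_algebra C) (q_seq d N) u v m = r \<odot> qchain C (q_seq (- d) N) u v m"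
proof (induction m)
  interpret assoc_alg C by (rule assoc_alg.intro) fact
  case 0
  show ?case using assms by (intro exI[of _ 1]) simp
next
  interpret assoc_alg C by (rule assoc_alg.intro) fact
  case (Suc m)
  let ?c = "q_seq d N m" and ?z = "qchain C (q_seq (- d) N) u v m"
  obtain r where r: "qchain (op_algebra C) (q_seq d N) u v m = r \<odot> ?z" using Suc by blast
  have z: "?z \<in> carrier C" using assms by simp
  have inv: "?c * q_seq (- d) N m = 1" by (simp add: q_seq_def fps_exp_mult)
  have "qchain (op_algebra C) (q_seq d N) u v (Suc m) = r \<odot> (?z \<otimes> u) \<ominus> (?c * r) \<odot> (u \<otimes> ?z)"
    using assms z by (simp add: r)
  also have "\<dots> = (- ?c * r) \<odot> (u \<otimes> ?z \<ominus> q_seq (- d) N m \<odot> (?z \<otimes> u))"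
    using assms z inv
    by (simp add: a_minus_def smult_r_distr smult_minus_right smult_minus_left a_comm mult.assoc mult.left_commute[of _ r])
  finally show ?case by auto
qed

definition invert_Q :: "(('i, 't::ab_group_add) gen \<Rightarrow> 'c) \<Rightarrow> ('i, 't) gen \<Rightarrow> 'c" where
  "invert_Q x g = (case g of Q h \<Rightarrow> x (Q (- h)) | _ \<Rightarrow> x g)"

lemma invert_Q_simps [simp]:
  "invert_Q x (E i) = x (E i)" "invert_Q x (F i) = x (F i)" "invert_Q x (Q h) = x (Q (- h))"
  by (simp_all add: invert_Q_def)

text \<open>The common form of all changes of coordinates below: root vectors are multiplied by scalars and group-like
elements.\<close>

definition twist_gen ::
    "(rat fps, 'c, 'm) module_scheme \<Rightarrow> ('i \<Rightarrow> rat fps) \<Rightarrow> ('i \<Rightarrow> 't) \<Rightarrow> ('i \<Rightarrow> rat fps) \<Rightarrow> ('i \<Rightarrow> 't) \<Rightarrow>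
     (('i, 't) gen \<Rightarrow> 'c) \<Rightarrow> ('i, 't) gen \<Rightarrow> 'c" where
  "twist_gen C \<kappa> \<tau> \<mu> \<nu> x g =
     (case g of E i \<Rightarrow> \<kappa> i \<odot>\<^bsub>C\<^esub> (x (Q (\<tau> i)) \<otimes>\<^bsub>C\<^esub> x (E i))
      | F i \<Rightarrow> \<mu> i \<odot>\<^bsub>C\<^esub> (x (Q (\<nu> i)) \<otimes>\<^bsub>C\<^esub> x (F i))
      | Q h \<Rightarrow> x (Q h))"

lemma twist_gen_simps [simp]:
  "twist_gen C \<kappa> \<tau> \<mu> \<nu> x (E i) = \<kappa> i \<odot>\<^bsub>C\<^esub> (x (Q (\<tau> i)) \<otimes>\<^bsub>C\<^esub> x (E i))"
  "twist_gen C \<kappa> \<tau> \<mu> \<nu> x (F i) = \<mu> i \<odot>\<^bsub>C\<^esub> (x (Q (\<nu> i)) \<otimes>\<^bsub>C\<^esub> x (F i))"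
  "twist_gen C \<kappa> \<tau> \<mu> \<nu> x (Q h) = x (Q h)"
  by (simp_all add: twist_gen_def)

context common_relations
begin

text \<open>Conjugation by a group-like element is inverted in the opposite algebra, hence the indices \<open>h\<close> change sign;
the Serre relations survive because the order of the factors of the chain is irrelevant.\<close>

lemma opposite: "common_relations D (op_algebra C) (invert_Q x)"
proof -
  interpret op: assoc_alg "op_algebra C"
    by (rule assoc_alg.intro) (rule assoc_algebra_op[OF assoc_algebra])
  have chain: "serre_chain D (op_algebra C) i j u v = \<zero>"
    if uv: "u \<in> carrier C" "v \<in> carrier C" and ij: "i \<in> index D" "j \<in> index D" "i \<noteq> j"
      and 0: "serre_chain D C i j u v = \<zero>" for i j u v
  proof -
    obtain r where "serre_chain D (op_algebra C) i j u v =
        r \<odot> qchain C (q_seq (- half_norm D i) (serre_len D i j)) u v (serre_len D i j)"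
      using qchain_op[OF assoc_algebra uv] by blast
    also have "\<dots> = r \<odot> serre_chain D C i j u v"
      using qchain_q_seq_uminus[OF assoc_algebra uv half_norm_nonzero[OF ij(1)]] by simp
    finally show ?thesis using 0 by simp
  qed
  show ?thesis
  proof
    show "invert_Q x g \<in> carrier (op_algebra C)" if "g \<in> gens D" for g
      using that by (cases g) simp_all
  qed (simp_all add: Q_zero Q_mult Q_E Q_F chain serre_E serre_F add.commute fps_exp_mult)
qed

lemma serre_chain_twist:
  assumes "i \<in> index D" "j \<in> index D" "i \<noteq> j"
    and u: "u \<in> carrier C" "v \<in> carrier C" "serre_chain D C i j u v = \<zero>"
    and h: "h \<in> coroot_lattice D" "k \<in> coroot_lattice D"
    and comm: "u \<otimes> x (Q h) = p \<odot> (x (Q h) \<otimes> u)" "v \<otimes> x (Q h) = r \<odot> (x (Q h) \<otimes> v)" "u \<otimes> x (Q k) = r \<odot> (x (Q k) \<otimes> u)"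
  shows "serre_chain D C i j (a \<odot> (x (Q h) \<otimes> u)) (b \<odot> (x (Q k) \<otimes> v)) = \<zero>"
proof -
  obtain s w where "w \<in> carrier C" "serre_chain D C i j (x (Q h) \<otimes> u) (x (Q k) \<otimes> v) = s \<odot> (w \<otimes> serre_chain D C i j u v)"
    using qchain_twist[OF u(1,2) closed'(3)[OF h(1)] closed'(3)[OF h(2)] Q_commute[OF h] comm] by blast
  then show ?thesis using u h by (simp add: qchain_smult)
qed

text \<open>The symmetry hypotheses say that moving the \<open>i\<close>-th group-like factor past the \<open>j\<close>-th root vector costs the
same scalar as moving the \<open>j\<close>-th factor past the \<open>i\<close>-th vector, which is what \<open>qchain_twist\<close> needs.\<close>

lemma twist:
  assumes lat: "\<And>i. i \<in> index D \<Longrightarrow> \<tau> i \<in> coroot_lattice D" "\<And>i. i \<in> index D \<Longrightarrow> \<nu> i \<in> coroot_lattice D"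
    and sym: "\<And>i j. i \<in> index D \<Longrightarrow> j \<in> index D \<Longrightarrow> root D j (\<tau> i) = root D i (\<tau> j)"
      "\<And>i j. i \<in> index D \<Longrightarrow> j \<in> index D \<Longrightarrow> root D j (\<nu> i) = root D i (\<nu> j)"
  shows "common_relations D C (twist_gen C \<kappa> \<tau> \<mu> \<nu> x)"
proof
  show "twist_gen C \<kappa> \<tau> \<mu> \<nu> x g \<in> carrier C" if "g \<in> gens D" for g
    using that lat by (cases g) simp_all
next
  fix i j assume ij: "i \<in> index D" "j \<in> index D" "i \<noteq> j"
  show "serre_chain D C i j (twist_gen C \<kappa> \<tau> \<mu> \<nu> x (E i)) (twist_gen C \<kappa> \<tau> \<mu> \<nu> x (E j)) = \<zero>"
    using ij lat sym(1)[OF ij(2,1)]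
    by (auto intro!: serre_chain_twist[where p = "qpow (- root D i (\<tau> i))" and r = "qpow (- root D j (\<tau> i))"] simp: E_Q serre_E)
  show "serre_chain D C i j (twist_gen C \<kappa> \<tau> \<mu> \<nu> x (F i)) (twist_gen C \<kappa> \<tau> \<mu> \<nu> x (F j)) = \<zero>"
    using ij lat sym(2)[OF ij(2,1)]
    by (auto intro!: serre_chain_twist[where p = "qpow (root D i (\<nu> i))" and r = "qpow (root D j (\<nu> i))"] simp: F_Q serre_F)
qed (use lat in \<open>simp_all add: move_Q add_ac mult.left_commute[of "qpow c" "\<kappa> i" for c i]
    mult.left_commute[of "qpow c" "\<mu> i" for c i]\<close>)

end

text \<open>A solution \<open>x\<close> in \<open>C\<close> of the relations of \<open>H[a,b]\<close>.\<close>

locale hopf_relations = common_relations D C x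
  for D :: "('i, 't::ab_group_add) root_datum" and C :: "(rat fps, 'c, 'm) module_scheme" (structure)
    and x :: "('i, 't) gen \<Rightarrow> 'c" +
  fixes a b :: "rat fps"
  assumes E_F: "i \<in> index D \<Longrightarrow> j \<in> index D \<Longrightarrow> x (E i) \<otimes> x (F j) =
    x (F j) \<otimes> x (E i) \<oplus> (if i = j then b \<odot> x (Q (t_exp D i)) \<ominus> a \<odot> x (Q (- t_exp D i)) else \<zero>)"
begin

lemma hopf_hom_image:
  assumes "alg_hom C C' f" "assoc_algebra C'"
  shows "hopf_relations D C' (\<lambda>g. f (x g)) a b"
proof -
  interpret C': common_relations D C' "\<lambda>g. f (x g)" by (rule hom_image) fact+
  note fD = alg_homD[OF assms(1)]
  note zero = alg_hom_zero[OF assms(1) assoc_algebra assms(2)]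
  note diff = alg_hom_diff[OF assms(1) assoc_algebra assms(2)]
  show ?thesis
  proof
    fix i j assume "i \<in> index D" "j \<in> index D"
    then show "f (x (E i)) \<otimes>\<^bsub>C'\<^esub> f (x (F j)) = f (x (F j)) \<otimes>\<^bsub>C'\<^esub> f (x (E i)) \<oplus>\<^bsub>C'\<^esub>
        (if i = j then b \<odot>\<^bsub>C'\<^esub> f (x (Q (t_exp D i))) \<ominus>\<^bsub>C'\<^esub> a \<odot>\<^bsub>C'\<^esub> f (x (Q (- t_exp D i))) else \<zero>\<^bsub>C'\<^esub>)"
      by (simp add: E_F zero diff fD flip: fD(2))
  qed
qed

end

definition antipode_gen ::
    "('i, 't::ab_group_add) root_datum \<Rightarrow> (rat fps, 'c, 'm) module_scheme \<Rightarrow> (('i, 't) gen \<Rightarrow> 'c) \<Rightarrow> ('i, 't) gen \<Rightarrow> 'c" where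
  "antipode_gen D C y g =
     (case g of E i \<Rightarrow> \<ominus>\<^bsub>C\<^esub> (y (Q (- t_exp D i)) \<otimes>\<^bsub>C\<^esub> y (E i))
      | F i \<Rightarrow> \<ominus>\<^bsub>C\<^esub> (y (F i) \<otimes>\<^bsub>C\<^esub> y (Q (t_exp D i)))
      | Q h \<Rightarrow> y (Q (- h)))"

lemma antipode_gen_simps [simp]:
  "antipode_gen D C y (E i) = \<ominus>\<^bsub>C\<^esub> (y (Q (- t_exp D i)) \<otimes>\<^bsub>C\<^esub> y (E i))"
  "antipode_gen D C y (F i) = \<ominus>\<^bsub>C\<^esub> (y (F i) \<otimes>\<^bsub>C\<^esub> y (Q (t_exp D i)))"
  "antipode_gen D C y (Q h) = y (Q (- h))"
  by (simp_all add: antipode_gen_def)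

context hopf_relations
begin

lemma E_F': "i \<in> index D \<Longrightarrow> j \<in> index D \<Longrightarrow> z \<in> carrier C \<Longrightarrow> x (E i) \<otimes> (x (F j) \<otimes> z) =
    x (F j) \<otimes> (x (E i) \<otimes> z) \<oplus> (if i = j then b \<odot> (x (Q (t_exp D i)) \<otimes> z) \<ominus> a \<odot> (x (Q (- t_exp D i)) \<otimes> z) else \<zero>)"
  by (simp add: E_F a_minus_def l_distr l_minus m_assoc flip: m_assoc[of "x (E i)"])

text \<open>Inverting the group-like elements turns \<open>b T i - a T i\<inverse>\<close> into \<open>b T i\<inverse> - a T i\<close>, and reversing the order of
the product changes the sign of the commutator; together they exchange \<open>a\<close> and \<open>b\<close>. The common relations
hold because the formula is a twist of the opposite solution.\<close>

lemma antipode_relations: "hopf_relations D (op_algebra C) (antipode_gen D C x) b a"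
proof -
  interpret op: common_relations D "op_algebra C" "invert_Q x" by (rule opposite)
  have "common_relations D (op_algebra C)
      (twist_gen (op_algebra C) (\<lambda>i. - qpow (- root D i (t_exp D i))) (t_exp D) (\<lambda>i. - 1) (\<lambda>i. - t_exp D i) (invert_Q x))"
    by (rule op.twist) (simp_all add: root_t_exp_sym)
  then interpret tw: common_relations D "op_algebra C"
    "twist_gen (op_algebra C) (\<lambda>i. - qpow (- root D i (t_exp D i))) (t_exp D) (\<lambda>i. - 1) (\<lambda>i. - t_exp D i) (invert_Q x)" .
  have "common_relations D (op_algebra C) (antipode_gen D C x)"
  proof (rule tw.cong)
    fix g assume "g \<in> gens D"
    then show "antipode_gen D C x g =
        twist_gen (op_algebra C) (\<lambda>i. - qpow (- root D i (t_exp D i))) (t_exp D) (\<lambda>i. - 1) (\<lambda>i. - t_exp D i) (invert_Q x) g"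
      by (cases g) (simp_all add: move_Q smult_minus_left)
  qed
  then interpret S: common_relations D "op_algebra C" "antipode_gen D C x" .
  show ?thesis
  proof
    fix i j assume ij: "i \<in> index D" "j \<in> index D"
    show "antipode_gen D C x (E i) \<otimes>\<^bsub>op_algebra C\<^esub> antipode_gen D C x (F j) =
      antipode_gen D C x (F j) \<otimes>\<^bsub>op_algebra C\<^esub> antipode_gen D C x (E i) \<oplus>\<^bsub>op_algebra C\<^esub>
      (if i = j then a \<odot>\<^bsub>op_algebra C\<^esub> antipode_gen D C x (Q (t_exp D i)) \<ominus>\<^bsub>op_algebra C\<^esub>
         b \<odot>\<^bsub>op_algebra C\<^esub> antipode_gen D C x (Q (- t_exp D i)) else \<zero>\<^bsub>op_algebra C\<^esub>)"
      using ij root_t_exp_sym[OF ij]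
      by (cases "i = j")
        (simp_all add: l_minus r_minus move_Q E_F E_F' r_distr a_minus_def smult_r_distr smult_minus_right minus_add
          a_ac r_neg r_neg1 r_neg2 add_ac)
  qed
qed

end

text \<open>The comultiplication formula for two commuting solutions inside one algebra; the tensor product is the
case \<open>y g \<otimes> 1\<close>, \<open>1 \<otimes> z g\<close>.\<close>

definition product_gen ::
    "('i, 't::ab_group_add) root_datum \<Rightarrow> (rat fps, 'c, 'm) module_scheme \<Rightarrow> (('i, 't) gen \<Rightarrow> 'c) \<Rightarrow> (('i, 't) gen \<Rightarrow> 'c) \<Rightarrow>
     ('i, 't) gen \<Rightarrow> 'c" where
  "product_gen D C y z g =
     (case g of E i \<Rightarrow> y (E i) \<oplus>\<^bsub>C\<^esub> y (Q (t_exp D i)) \<otimes>\<^bsub>C\<^esub> z (E i)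
      | F i \<Rightarrow> y (F i) \<otimes>\<^bsub>C\<^esub> z (Q (- t_exp D i)) \<oplus>\<^bsub>C\<^esub> z (F i)
      | Q h \<Rightarrow> y (Q h) \<otimes>\<^bsub>C\<^esub> z (Q h))"

lemma product_gen_simps [simp]:
  "product_gen D C y z (E i) = y (E i) \<oplus>\<^bsub>C\<^esub> y (Q (t_exp D i)) \<otimes>\<^bsub>C\<^esub> z (E i)"
  "product_gen D C y z (F i) = y (F i) \<otimes>\<^bsub>C\<^esub> z (Q (- t_exp D i)) \<oplus>\<^bsub>C\<^esub> z (F i)"
  "product_gen D C y z (Q h) = y (Q h) \<otimes>\<^bsub>C\<^esub> z (Q h)"
  by (simp_all add: product_gen_def)

text \<open>The commutator of \<open>E i\<close> and \<open>F i\<close> is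
\<open>(b T\<^sub>y - a T\<^sub>y\<inverse>) T\<^sub>z\<inverse> + T\<^sub>y (c T\<^sub>z - b T\<^sub>z\<inverse>) = c T\<^sub>y T\<^sub>z - a T\<^sub>y\<inverse> T\<^sub>z\<inverse>\<close>: the middle scalar cancels. The
remaining terms \<open>T\<^sub>y z (E i)\<close> and \<open>y (F j) T\<^sub>z\<inverse>\<close> commute by the symmetry of the form. The Serre relations
follow from \<open>qchain_q_seq_sum\<close> and \<open>qchain_twist\<close>.\<close>

lemma product_relations:
  fixes C :: "(rat fps, 'c, 'm) module_scheme" (structure)
  assumes "hopf_relations D C y a b" "hopf_relations D C z b c"
    and comm: "\<And>g g'. g \<in> gens D \<Longrightarrow> g' \<in> gens D \<Longrightarrow> z g \<otimes> y g' = y g' \<otimes> z g"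
  shows "hopf_relations D C (product_gen D C y z) a c"
proof -
  interpret y: hopf_relations D C y a b by fact
  interpret z: hopf_relations D C z b c by fact
  have zy: "z g \<otimes> (y g' \<otimes> w) = y g' \<otimes> (z g \<otimes> w)" if "g \<in> gens D" "g' \<in> gens D" "w \<in> carrier C" for g g' w
    using that comm[OF that(1,2)] y.closed z.closed by (simp flip: y.m_assoc)
  note zy = zy comm
  note norm = zy y.move_Q z.move_Q
  show ?thesis
  proof
    show "product_gen D C y z g \<in> carrier C" if "g \<in> gens D" for g
      using that by (cases g) simp_all
    show "product_gen D C y z (Q 0) = \<one>" by (simp add: y.Q_zero z.Q_zero)
    show "product_gen D C y z (Q h) \<otimes> product_gen D C y z (Q h') = product_gen D C y z (Q (h + h'))"
      if "h \<in> coroot_lattice D" "h' \<in> coroot_lattice D" for h h'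
      using that by (simp add: norm)
    show "product_gen D C y z (Q h) \<otimes> product_gen D C y z (E i) = qpow (root D i h) \<odot> (product_gen D C y z (E i) \<otimes> product_gen D C y z (Q h))"
      if "h \<in> coroot_lattice D" "i \<in> index D" for h i
      using that by (simp add: norm y.l_distr y.r_distr y.smult_r_distr add.commute[of h])
    show "product_gen D C y z (Q h) \<otimes> product_gen D C y z (F i) = qpow (- root D i h) \<odot> (product_gen D C y z (F i) \<otimes> product_gen D C y z (Q h))"
      if "h \<in> coroot_lattice D" "i \<in> index D" for h i
      using that by (simp add: norm y.l_distr y.r_distr y.smult_r_distr add.commute[of h])
  next
    fix i j assume ij: "i \<in> index D" "j \<in> index D" "i \<noteq> j"
    note s = y.root_t_exp_serre[OF ij] y.root_t_exp_sym[OF ij(1,2)] y.root_t_exp_diag[OF ij(1)]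
    have tw: "serre_chain D C i j (y (Q (t_exp D i)) \<otimes> z (E i)) (y (Q (t_exp D j)) \<otimes> z (E j)) = \<zero>"
      using y.serre_chain_twist[of i j "z (E i)" "z (E j)" "t_exp D i" "t_exp D j" 1 1 1 1] ij
      by (simp add: comm z.serre_E)
    have "serre_chain D C i j (product_gen D C y z (E i)) (product_gen D C y z (E j)) =
        serre_chain D C i j (y (E i)) (y (E j)) \<oplus>
        serre_chain D C i j (y (Q (t_exp D i)) \<otimes> z (E i)) (y (Q (t_exp D j)) \<otimes> z (E j))"
      unfolding product_gen_simps
      by (rule qchain_q_seq_sum[OF y.assoc_algebra y.half_norm_nonzero[OF ij(1)]])
        (use ij s in \<open>simp_all add: norm\<close>)
    then show "serre_chain D C i j (product_gen D C y z (E i)) (product_gen D C y z (E j)) = \<zero>"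
      using ij by (simp add: tw y.serre_E)
    have tw: "serre_chain D C i j (z (Q (- t_exp D i)) \<otimes> y (F i)) (z (Q (- t_exp D j)) \<otimes> y (F j)) = \<zero>"
      using z.serre_chain_twist[of i j "y (F i)" "y (F j)" "- t_exp D i" "- t_exp D j" 1 1 1 1] ij
      by (simp add: comm y.serre_F)
    have "serre_chain D C i j (z (F i) \<oplus> z (Q (- t_exp D i)) \<otimes> y (F i)) (z (F j) \<oplus> z (Q (- t_exp D j)) \<otimes> y (F j)) =
        serre_chain D C i j (z (F i)) (z (F j)) \<oplus>
        serre_chain D C i j (z (Q (- t_exp D i)) \<otimes> y (F i)) (z (Q (- t_exp D j)) \<otimes> y (F j))"
      by (rule qchain_q_seq_sum[OF y.assoc_algebra y.half_norm_nonzero[OF ij(1)]])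
        (use ij s in \<open>simp_all add: norm\<close>)
    then show "serre_chain D C i j (product_gen D C y z (F i)) (product_gen D C y z (F j)) = \<zero>"
      using ij tw by (simp add: z.serre_F comm y.a_comm)
  next
    fix i j assume ij: "i \<in> index D" "j \<in> index D"
    show "product_gen D C y z (E i) \<otimes> product_gen D C y z (F j) =
        product_gen D C y z (F j) \<otimes> product_gen D C y z (E i) \<oplus>
        (if i = j then c \<odot> product_gen D C y z (Q (t_exp D i)) \<ominus> a \<odot> product_gen D C y z (Q (- t_exp D i)) else \<zero>)"
      using ij y.root_t_exp_sym[OF ij]
      by (cases "i = j") (simp_all add: norm y.l_distr y.r_distr y.smult_r_distr y.E_F z.E_F y.E_F' z.E_F' y.a_ac a_minus_def y.minus_add
         y.l_minus y.r_minus y.r_neg1 y.r_neg2 y.smult_minus_right)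
  qed
qed

section \<open>The cogroupoid structure\<close>

lemma (in hopf_relations) hopf_cong:
  assumes "\<And>g. g \<in> gens D \<Longrightarrow> y g = x g"
  shows "hopf_relations D C y a b"
proof -
  interpret y: common_relations D C y by (rule cong) (rule assms)
  show ?thesis
    by unfold_locales (simp add: assms E_F)
qed

text \<open>Generation makes morphisms out of \<open>C\<close> equal once they agree on the coordinates; this replaces an explicit
identification of \<open>C\<close> with \<open>H[a,b]\<close>.\<close>

locale hopf_object = hopf_relations D C x a b
  for D :: "('i, 't::ab_group_add) root_datum" and C :: "(rat fps, 'c, 'm) module_scheme" (structure)
    and x :: "('i, 't) gen \<Rightarrow> 'c" and a b :: "rat fps" +
  assumes generated: "generates C (x ` gens D)"
begin

lemma hom_eqI:
  assumes "alg_hom C C' f" "alg_hom C C' g"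
    and "\<And>i. i \<in> index D \<Longrightarrow> f (x (E i)) = g (x (E i))" "\<And>i. i \<in> index D \<Longrightarrow> f (x (F i)) = g (x (F i))"
    and "\<And>h. h \<in> coroot_lattice D \<Longrightarrow> f (x (Q h)) = g (x (Q h))" "u \<in> carrier C"
  shows "f u = g u"
proof (rule alg_hom_eqI[OF generated assms(1,2) _ assms(6)])
  fix v assume "v \<in> x ` gens D"
  then obtain k where "k \<in> gens D" "v = x k" by blast
  then show "f v = g v" using assms(3-5) by (cases k) simp_all
qed

end

definition tensor_gen ::
    "('i, 't::ab_group_add) root_datum \<Rightarrow> (rat fps, 'a, 'm) module_scheme \<Rightarrow> (('i, 't) gen \<Rightarrow> 'a) \<Rightarrow>
     (rat fps, 'b, 'n) module_scheme \<Rightarrow> (('i, 't) gen \<Rightarrow> 'b) \<Rightarrow> ('i, 't) gen \<Rightarrow> (('a \<times> 'b) \<Rightarrow>\<^sub>0 rat fps) set" where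
  "tensor_gen D A y B z g =
     (case g of E i \<Rightarrow> y (E i) \<boxtimes>\<^bsub>A,B\<^esub> \<one>\<^bsub>B\<^esub> \<oplus>\<^bsub>A \<boxtimes> B\<^esub> y (Q (t_exp D i)) \<boxtimes>\<^bsub>A,B\<^esub> z (E i)
      | F i \<Rightarrow> y (F i) \<boxtimes>\<^bsub>A,B\<^esub> z (Q (- t_exp D i)) \<oplus>\<^bsub>A \<boxtimes> B\<^esub> \<one>\<^bsub>A\<^esub> \<boxtimes>\<^bsub>A,B\<^esub> z (F i)
      | Q h \<Rightarrow> y (Q h) \<boxtimes>\<^bsub>A,B\<^esub> z (Q h))"

lemma tensor_gen_simps [simp]:
  "tensor_gen D A y B z (E i) = y (E i) \<boxtimes>\<^bsub>A,B\<^esub> \<one>\<^bsub>B\<^esub> \<oplus>\<^bsub>A \<boxtimes> B\<^esub> y (Q (t_exp D i)) \<boxtimes>\<^bsub>A,B\<^esub> z (E i)"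
  "tensor_gen D A y B z (F i) = y (F i) \<boxtimes>\<^bsub>A,B\<^esub> z (Q (- t_exp D i)) \<oplus>\<^bsub>A \<boxtimes> B\<^esub> \<one>\<^bsub>A\<^esub> \<boxtimes>\<^bsub>A,B\<^esub> z (F i)"
  "tensor_gen D A y B z (Q h) = y (Q h) \<boxtimes>\<^bsub>A,B\<^esub> z (Q h)"
  by (simp_all add: tensor_gen_def)

lemma tensor_relations:
  assumes "hopf_relations D A y a b" "hopf_relations D B z b c"
  shows "hopf_relations D (A \<boxtimes> B) (tensor_gen D A y B z) a c"
proof -
  interpret y: hopf_relations D A y a b by fact
  interpret z: hopf_relations D B z b c by fact
  interpret AB: tensor_pair A B by (rule tensor_pairI) (rule y.assoc_algebra, rule z.assoc_algebra)
  have "alg_hom A (A \<boxtimes> B) (\<lambda>u. u \<boxtimes>\<^bsub>A,B\<^esub> \<one>\<^bsub>B\<^esub>)"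
    by (rule alg_homI) (simp_all add: AB.pure_tensor_add_left AB.pure_tensor_smult_left AB.tensor_one)
  then have l: "hopf_relations D (A \<boxtimes> B) (\<lambda>g. y g \<boxtimes>\<^bsub>A,B\<^esub> \<one>\<^bsub>B\<^esub>) a b"
    by (rule y.hopf_hom_image) (rule AB.AB.assoc_algebra)
  have "alg_hom B (A \<boxtimes> B) (\<lambda>u. \<one>\<^bsub>A\<^esub> \<boxtimes>\<^bsub>A,B\<^esub> u)"
    by (rule alg_homI) (simp_all add: AB.pure_tensor_add_right AB.pure_tensor_smult_right AB.tensor_one)
  then have r: "hopf_relations D (A \<boxtimes> B) (\<lambda>g. \<one>\<^bsub>A\<^esub> \<boxtimes>\<^bsub>A,B\<^esub> z g) b c"
    by (rule z.hopf_hom_image) (rule AB.AB.assoc_algebra)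
  interpret p: hopf_relations D "A \<boxtimes> B"
    "product_gen D (A \<boxtimes> B) (\<lambda>g. y g \<boxtimes>\<^bsub>A,B\<^esub> \<one>\<^bsub>B\<^esub>) (\<lambda>g. \<one>\<^bsub>A\<^esub> \<boxtimes>\<^bsub>A,B\<^esub> z g)" a c
    by (rule product_relations[OF l r]) (simp add: y.closed z.closed)
  show ?thesis
    by (rule p.hopf_cong, rename_tac g, case_tac g) simp_all
qed

text \<open>The structure maps of the cogroupoid are characterised by their values on coordinates, so that the laws
below apply to any map with these values, in particular to the maps obtained from presentations.\<close>

definition is_comult ::
    "('i, 't::ab_group_add) root_datum \<Rightarrow> (rat fps, 'c, 'l) module_scheme \<Rightarrow> (('i, 't) gen \<Rightarrow> 'c) \<Rightarrow>
     (rat fps, 'a, 'm) module_scheme \<Rightarrow> (('i, 't) gen \<Rightarrow> 'a) \<Rightarrow>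
     (rat fps, 'b, 'n) module_scheme \<Rightarrow> (('i, 't) gen \<Rightarrow> 'b) \<Rightarrow> ('c \<Rightarrow> (('a \<times> 'b) \<Rightarrow>\<^sub>0 rat fps) set) \<Rightarrow> bool" where
  "is_comult D C x A y B z \<Delta> \<longleftrightarrow>
     alg_hom C (A \<boxtimes> B) \<Delta> \<and> (\<forall>g\<in>gens D. \<Delta> (x g) = tensor_gen D A y B z g)"

definition is_counit ::
    "('i, 't::ab_group_add) root_datum \<Rightarrow> (rat fps, 'c, 'l) module_scheme \<Rightarrow> (('i, 't) gen \<Rightarrow> 'c) \<Rightarrow> ('c \<Rightarrow> rat fps) \<Rightarrow> bool" where
  "is_counit D C x \<epsilon> \<longleftrightarrow> alg_hom C ground_algebra \<epsilon> \<and> (\<forall>g\<in>gens D. \<epsilon> (x g) = U_counit_on g)"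

definition is_antipode ::
    "('i, 't::ab_group_add) root_datum \<Rightarrow> (rat fps, 'c, 'l) module_scheme \<Rightarrow> (('i, 't) gen \<Rightarrow> 'c) \<Rightarrow>
     (rat fps, 'a, 'm) module_scheme \<Rightarrow> (('i, 't) gen \<Rightarrow> 'a) \<Rightarrow> ('c \<Rightarrow> 'a) \<Rightarrow> bool" where
  "is_antipode D C x A y S \<longleftrightarrow>
     alg_hom C (op_algebra A) S \<and> (\<forall>g\<in>gens D. S (x g) = antipode_gen D A y g)"

lemma is_comultD:
  assumes "is_comult D C x A y B z \<Delta>"
  shows "alg_hom C (A \<boxtimes> B) \<Delta>" "g \<in> gens D \<Longrightarrow> \<Delta> (x g) = tensor_gen D A y B z g"
  using assms by (simp_all add: is_comult_def)

lemma is_counitD: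
  assumes "is_counit D C x \<epsilon>"
  shows "alg_hom C ground_algebra \<epsilon>" "g \<in> gens D \<Longrightarrow> \<epsilon> (x g) = U_counit_on g"
  using assms by (simp_all add: is_counit_def)

lemma is_antipodeD:
  assumes "is_antipode D C x A y S"
  shows "alg_hom C (op_algebra A) S" "g \<in> gens D \<Longrightarrow> S (x g) = antipode_gen D A y g"
  using assms by (simp_all add: is_antipode_def)

text \<open>Under the counit both \<open>T i\<close> and its inverse become \<open>1\<close>, so the exchange relation forces the two scalars to
agree.\<close>

lemma counit_relations:
  fixes D :: "('i, 't::ab_group_add) root_datum"
  assumes "quantum_datum D"
  shows "hopf_relations D ground_algebra U_counit_on a a"
proof -
  interpret quantum_datum D by fact
  interpret g: assoc_alg "ground_algebra :: (rat fps, rat fps) module"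
    by (rule assoc_alg.intro) (rule assoc_algebra_ground)
  have minus: "p \<ominus>\<^bsub>ground_algebra\<^esub> q = p - q" for p q :: "rat fps"
    using g.minus_eq_smult[of q] by (simp add: a_minus_def)
  have "qchain ground_algebra c 0 0 m = (0 :: rat fps)" for c m
    by (induction m) (simp_all add: minus)
  then show ?thesis
    by unfold_locales (simp_all add: minus)
qed

text \<open>For scalars \<open>a, b, c, d\<close> both ways of passing from \<open>H[a,d]\<close> to \<open>H[a,b] \<otimes> H[b,c] \<otimes> H[c,d]\<close> send \<open>E i\<close> to
\<open>E \<otimes> 1 \<otimes> 1 + T \<otimes> E \<otimes> 1 + T \<otimes> T \<otimes> E\<close>, and similarly for \<open>F i\<close> and \<open>Q h\<close>.\<close>

lemma coassociativity:
  assumes A: "hopf_object D A x a d" and C1: "hopf_relations D C1 z1 a b" and C2: "hopf_relations D C2 z2 b c"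
    and B2: "hopf_relations D B2 y2 c d" and B1: "hopf_relations D B1 y1 a c" and B3: "hopf_relations D B3 y3 b d"
    and \<Delta>1: "is_comult D A x B1 y1 B2 y2 \<Delta>1" and \<Delta>2: "is_comult D B1 y1 C1 z1 C2 z2 \<Delta>2"
    and \<Delta>3: "is_comult D A x C1 z1 B3 y3 \<Delta>3" and \<Delta>4: "is_comult D B3 y3 C2 z2 B2 y2 \<Delta>4"
    and u: "u \<in> carrier A"
  shows "assoc_map C1 C2 B2 (tensor_map (C1 \<boxtimes> C2) B2 \<Delta>2 (\<lambda>v. v) (\<Delta>1 u)) =
    tensor_map C1 (C2 \<boxtimes> B2) (\<lambda>v. v) \<Delta>4 (\<Delta>3 u)"
proof -
  interpret A: hopf_object D A x a d by fact
  interpret C1: hopf_relations D C1 z1 a b by fact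
  interpret C2: hopf_relations D C2 z2 b c by fact
  interpret B2: hopf_relations D B2 y2 c d by fact
  interpret B1: hopf_relations D B1 y1 a c by fact
  interpret B3: hopf_relations D B3 y3 b d by fact
  note assoc = A.assoc_algebra C1.assoc_algebra C2.assoc_algebra B2.assoc_algebra B1.assoc_algebra B3.assoc_algebra
  interpret B12: tensor_pair B1 B2 by (rule tensor_pairI) (rule assoc)+
  interpret C12: tensor_pair C1 C2 by (rule tensor_pairI) (rule assoc)+
  interpret C1B3: tensor_pair C1 B3 by (rule tensor_pairI) (rule assoc)+
  interpret C2B2: tensor_pair C2 B2 by (rule tensor_pairI) (rule assoc)+
  interpret L: tensor_pair "C1 \<boxtimes> C2" B2 by (rule tensor_pairI) (rule assoc C12.AB.assoc_algebra)+
  interpret R: tensor_pair C1 "C2 \<boxtimes> B2" by (rule tensor_pairI) (rule assoc C2B2.AB.assoc_algebra)+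
  note h1 = is_comultD[OF \<Delta>1] and h2 = is_comultD[OF \<Delta>2] and h3 = is_comultD[OF \<Delta>3] and h4 = is_comultD[OF \<Delta>4]
  note am = assoc_map_hom[OF assoc(2,3,4)]
  note lm = B12.tensor_map_hom[OF C12.AB.assoc_algebra assoc(4) h2(1) alg_hom_id]
  note lm2 = B12.tensor_map_linear(2)[OF C12.AB.assoc_algebra assoc(4) alg_hom_linear[OF h2(1)] alg_hom_linear[OF alg_hom_id]]
  note rm = C1B3.tensor_map_hom[OF assoc(2) C2B2.AB.assoc_algebra alg_hom_id h4(1)]
  note rm2 = C1B3.tensor_map_linear(2)[OF assoc(2) C2B2.AB.assoc_algebra alg_hom_linear[OF alg_hom_id] alg_hom_linear[OF h4(1)]]
  note D = alg_homD(3)[OF am(1)] alg_homD(3)[OF lm] alg_homD(3)[OF rm]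
  note simps = h1(2) h2(2) h3(2) h4(2) D lm2 rm2 am(2) alg_homD(4)[OF h2(1)] alg_homD(4)[OF h4(1)]
    C12.tensor_one C2B2.tensor_one L.pure_tensor_add_left L.pure_tensor_add_right
    R.pure_tensor_add_left R.pure_tensor_add_right R.AB.a_ac
  show ?thesis
    by (rule A.hom_eqI[OF alg_hom_comp[OF alg_hom_comp[OF h1(1) lm] am(1)] alg_hom_comp[OF h3(1) rm] _ _ _ u])
      (simp_all add: simps)
qed

text \<open>Contracting a tensor factor with a counit is multiplicative, so the counit laws are equalities between
morphisms.\<close>

lemma scalar_action_hom:
  assumes "assoc_algebra A" "assoc_algebra T" "alg_hom A ground_algebra \<epsilon>"
  shows "alg_hom (A \<boxtimes> T) T (tensor_lift T (\<lambda>a y. \<epsilon> a \<odot>\<^bsub>T\<^esub> y))"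
    and "\<And>a y. a \<in> carrier A \<Longrightarrow> y \<in> carrier T \<Longrightarrow> tensor_lift T (\<lambda>a y. \<epsilon> a \<odot>\<^bsub>T\<^esub> y) (a \<boxtimes>\<^bsub>A,T\<^esub> y) = \<epsilon> a \<odot>\<^bsub>T\<^esub> y"
    and "alg_hom (T \<boxtimes> A) T (tensor_lift T (\<lambda>y a. \<epsilon> a \<odot>\<^bsub>T\<^esub> y))"
    and "\<And>a y. a \<in> carrier A \<Longrightarrow> y \<in> carrier T \<Longrightarrow> tensor_lift T (\<lambda>y a. \<epsilon> a \<odot>\<^bsub>T\<^esub> y) (y \<boxtimes>\<^bsub>T,A\<^esub> a) = \<epsilon> a \<odot>\<^bsub>T\<^esub> y"
proof -
  interpret AT: tensor_pair A T by (rule tensor_pairI) fact+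
  interpret TA: tensor_pair T A by (rule tensor_pairI) fact+
  note eD = alg_homD[OF assms(3)]
  have bl: "bilinear_map A T T (\<lambda>a y. \<epsilon> a \<odot>\<^bsub>T\<^esub> y)"
    by (rule bilinear_mapI) (simp_all add: eD AT.B.smult_l_distr AT.B.smult_r_distr mult.commute)
  have br: "bilinear_map T A T (\<lambda>y a. \<epsilon> a \<odot>\<^bsub>T\<^esub> y)"
    using bl by (simp add: bilinear_map_def)
  note l = AT.tensor_lift[OF assms(2) bl] and r = TA.tensor_lift[OF assms(2) br]
  show "tensor_lift T (\<lambda>a y. \<epsilon> a \<odot>\<^bsub>T\<^esub> y) (a \<boxtimes>\<^bsub>A,T\<^esub> y) = \<epsilon> a \<odot>\<^bsub>T\<^esub> y"
    if "a \<in> carrier A" "y \<in> carrier T" for a y using that by (rule l(2))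
  show "tensor_lift T (\<lambda>y a. \<epsilon> a \<odot>\<^bsub>T\<^esub> y) (y \<boxtimes>\<^bsub>T,A\<^esub> a) = \<epsilon> a \<odot>\<^bsub>T\<^esub> y"
    if "a \<in> carrier A" "y \<in> carrier T" for a y using that by (simp add: r(2))
  show "alg_hom (A \<boxtimes> T) T (tensor_lift T (\<lambda>a y. \<epsilon> a \<odot>\<^bsub>T\<^esub> y))"
    by (rule AT.linear_map_multiplicativeI[OF assms(2) l(1)]) (simp_all add: l(2) eD mult.commute)
  show "alg_hom (T \<boxtimes> A) T (tensor_lift T (\<lambda>y a. \<epsilon> a \<odot>\<^bsub>T\<^esub> y))"
    by (rule TA.linear_map_multiplicativeI[OF assms(2) r(1)]) (simp_all add: r(2) eD mult.commute)
qed

lemma counit_left: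
  assumes T: "hopf_object D T y a b" and A: "hopf_relations D A x a a"
    and \<alpha>: "is_comult D T y A x T y \<alpha>" and \<epsilon>: "is_counit D A x \<epsilon>" and u: "u \<in> carrier T"
  shows "tensor_lift T (\<lambda>a y. \<epsilon> a \<odot>\<^bsub>T\<^esub> y) (\<alpha> u) = u"
proof -
  interpret T: hopf_object D T y a b by fact
  interpret A: hopf_relations D A x a a by fact
  interpret AT: tensor_pair A T by (rule tensor_pairI) (rule A.assoc_algebra T.assoc_algebra)+
  note l = scalar_action_hom[OF A.assoc_algebra T.assoc_algebra is_counitD(1)[OF \<epsilon>]]
  show ?thesis
    by (rule T.hom_eqI[OF alg_hom_comp[OF is_comultD(1)[OF \<alpha>] l(1)] alg_hom_id _ _ _ u])
      (simp_all add: is_comultD(2)[OF \<alpha>] is_counitD(2)[OF \<epsilon>] alg_homD(3)[OF l(1)] l(2)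
        alg_homD(4)[OF is_counitD(1)[OF \<epsilon>]])
qed

lemma counit_right:
  assumes T: "hopf_object D T y a b" and A: "hopf_relations D A x b b"
    and \<beta>: "is_comult D T y T y A x \<beta>" and \<epsilon>: "is_counit D A x \<epsilon>" and u: "u \<in> carrier T"
  shows "tensor_lift T (\<lambda>y a. \<epsilon> a \<odot>\<^bsub>T\<^esub> y) (\<beta> u) = u"
proof -
  interpret T: hopf_object D T y a b by fact
  interpret A: hopf_relations D A x b b by fact
  interpret TA: tensor_pair T A by (rule tensor_pairI) (rule A.assoc_algebra T.assoc_algebra)+
  note l = scalar_action_hom[OF A.assoc_algebra T.assoc_algebra is_counitD(1)[OF \<epsilon>]]
  show ?thesis
    by (rule T.hom_eqI[OF alg_hom_comp[OF is_comultD(1)[OF \<beta>] l(3)] alg_hom_id _ _ _ u])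
      (simp_all add: is_comultD(2)[OF \<beta>] is_counitD(2)[OF \<epsilon>] alg_homD(3)[OF l(3)] l(4)
        alg_homD(4)[OF is_counitD(1)[OF \<epsilon>]])
qed

lemma antipode_right:
  assumes A: "hopf_object D A x a a" and T: "hopf_relations D T y a b" and Z: "hopf_relations D Z z b a"
    and \<gamma>: "is_comult D A x T y Z z \<gamma>" and S: "is_antipode D Z z T y S" and \<epsilon>: "is_counit D A x \<epsilon>"
    and u: "u \<in> carrier A"
  shows "mult_map T (tensor_map T T (\<lambda>v. v) S (\<gamma> u)) = \<epsilon> u \<odot>\<^bsub>T\<^esub> \<one>\<^bsub>T\<^esub>"
proof -
  interpret A: hopf_object D A x a a by fact
  interpret T: hopf_relations D T y a b by fact
  interpret Z: hopf_relations D Z z b a by fact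
  interpret TZ: tensor_pair T Z by (rule tensor_pairI) (rule T.assoc_algebra Z.assoc_algebra)+
  interpret TT: tensor_pair T T by (rule tensor_pairI) (rule T.assoc_algebra)+
  note S' = is_antipodeD[OF S]
  note tm = TZ.tensor_map_linear[OF T.assoc_algebra T.assoc_algebra alg_hom_linear[OF alg_hom_id] anti_hom_linear[OF S'(1)]]
  note mm = mult_map_linear[OF T.assoc_algebra]
  note simps = is_comultD(2)[OF \<gamma>] is_counitD(2)[OF \<epsilon>] S'(2) linear_mapD(2)[OF tm(1)] tm(2) linear_mapD(2)[OF mm(1)] mm(2)
    T.r_minus T.l_minus T.move_Q T.r_neg T.l_neg
  have S1: "S \<one>\<^bsub>Z\<^esub> = \<one>\<^bsub>T\<^esub>" using alg_homD(4)[OF S'(1)] by simp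
  show ?thesis
  proof (rule convolution_inverse_right[OF T.assoc_algebra Z.assoc_algebra A.assoc_algebra is_comultD(1)[OF \<gamma>] S'(1)
      is_counitD(1)[OF \<epsilon>] A.generated _ u])
    fix v assume "v \<in> x ` gens D"
    then obtain k where k: "k \<in> gens D" "v = x k" by blast
    show "mult_map T (tensor_map T T (\<lambda>v. v) S (\<gamma> v)) = \<epsilon> v \<odot>\<^bsub>T\<^esub> \<one>\<^bsub>T\<^esub>"
      using k by (cases k) (simp_all add: simps S1)
  qed
qed

lemma antipode_left:
  assumes A: "hopf_object D A x b b" and T: "hopf_relations D T y a b" and Z: "hopf_relations D Z z b a"
    and \<delta>: "is_comult D A x Z z T y \<delta>" and S: "is_antipode D Z z T y S" and \<epsilon>: "is_counit D A x \<epsilon>"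
    and u: "u \<in> carrier A"
  shows "mult_map T (tensor_map T T S (\<lambda>v. v) (\<delta> u)) = \<epsilon> u \<odot>\<^bsub>T\<^esub> \<one>\<^bsub>T\<^esub>"
proof -
  interpret A: hopf_object D A x b b by fact
  interpret T: hopf_relations D T y a b by fact
  interpret Z: hopf_relations D Z z b a by fact
  interpret ZT: tensor_pair Z T by (rule tensor_pairI) (rule T.assoc_algebra Z.assoc_algebra)+
  interpret TT: tensor_pair T T by (rule tensor_pairI) (rule T.assoc_algebra)+
  note S' = is_antipodeD[OF S]
  note tm = ZT.tensor_map_linear[OF T.assoc_algebra T.assoc_algebra anti_hom_linear[OF S'(1)] alg_hom_linear[OF alg_hom_id]]
  note mm = mult_map_linear[OF T.assoc_algebra]
  note simps = is_comultD(2)[OF \<delta>] is_counitD(2)[OF \<epsilon>] S'(2) linear_mapD(2)[OF tm(1)] tm(2) linear_mapD(2)[OF mm(1)] mm(2)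
    T.r_minus T.l_minus T.move_Q T.r_neg T.l_neg
  have S1: "S \<one>\<^bsub>Z\<^esub> = \<one>\<^bsub>T\<^esub>" using alg_homD(4)[OF S'(1)] by simp
  show ?thesis
  proof (rule convolution_inverse_left[OF T.assoc_algebra Z.assoc_algebra A.assoc_algebra is_comultD(1)[OF \<delta>] S'(1)
      is_counitD(1)[OF \<epsilon>] A.generated _ u])
    fix v assume "v \<in> x ` gens D"
    then obtain k where k: "k \<in> gens D" "v = x k" by blast
    show "mult_map T (tensor_map T T S (\<lambda>v. v) (\<delta> v)) = \<epsilon> v \<odot>\<^bsub>T\<^esub> \<one>\<^bsub>T\<^esub>"
      using k by (cases k) (simp_all add: simps S1)
  qed
qed

lemma (in tensor_pair) tensor_map_anti_hom:
  assumes "assoc_algebra C" "assoc_algebra D" "alg_hom A (op_algebra C) f" "alg_hom B (op_algebra D) g"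
  shows "alg_hom (A \<boxtimes> B) (op_algebra (C \<boxtimes> D)) (tensor_map C D f g)"
proof -
  interpret CD: tensor_pair C D by (intro tensor_pair.intro assoc_alg.intro assms)
  note t = tensor_map_linear[OF assms(1,2) anti_hom_linear[OF assms(3)] anti_hom_linear[OF assms(4)]]
  have l: "linear_map (A \<boxtimes> B) (op_algebra (C \<boxtimes> D)) (tensor_map C D f g)"
    using t(1) by (simp add: linear_map_def)
  show ?thesis
    by (rule linear_map_multiplicativeI[OF assoc_algebra_op[OF CD.AB.assoc_algebra] l])
      (use alg_homD(1,2,4)[OF assms(3)] alg_homD(1,2,4)[OF assms(4)] in \<open>simp_all add: t(2) CD.tensor_one\<close>)
qed

text \<open>Both sides are anti-morphisms on a generated algebra and agree on coordinates. With the scalars left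
free this covers all six antipode compatibilities of a complete Hopf-Galois system.\<close>

lemma antipode_anticomultiplicative:
  assumes A: "hopf_object D A x a c" and B: "hopf_relations D B y a b" and C: "hopf_relations D C z b c"
    and A': "hopf_relations D A' x' c a" and B': "hopf_relations D B' y' b a" and C': "hopf_relations D C' z' c b"
    and \<Delta>: "is_comult D A x B y C z \<Delta>" and \<Delta>': "is_comult D A' x' C' z' B' y' \<Delta>'"
    and SA: "is_antipode D A x A' x' S\<^sub>A" and SB: "is_antipode D B y B' y' S\<^sub>B" and SC: "is_antipode D C z C' z' S\<^sub>C"
    and u: "u \<in> carrier A"
  shows "flip_map B' C' (tensor_map B' C' S\<^sub>B S\<^sub>C (\<Delta> u)) = \<Delta>' (S\<^sub>A u)"
proof -
  interpret A: hopf_object D A x a c by fact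
  interpret B: hopf_relations D B y a b by fact
  interpret C: hopf_relations D C z b c by fact
  interpret A': hopf_relations D A' x' c a by fact
  interpret B': hopf_relations D B' y' b a by fact
  interpret C': hopf_relations D C' z' c b by fact
  interpret BC: tensor_pair B C by (rule tensor_pairI) (rule B.assoc_algebra C.assoc_algebra)+
  interpret BC': tensor_pair B' C' by (rule tensor_pairI) (rule B'.assoc_algebra C'.assoc_algebra)+
  interpret CB': tensor_pair C' B' by (rule tensor_pairI) (rule B'.assoc_algebra C'.assoc_algebra)+
  note sa = is_antipodeD[OF SA] and sb = is_antipodeD[OF SB] and sc = is_antipodeD[OF SC]
  note d = is_comultD[OF \<Delta>] and d' = is_comultD[OF \<Delta>']
  note tm = BC.tensor_map_anti_hom[OF B'.assoc_algebra C'.assoc_algebra sb(1) sc(1)]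
  note tm2 = BC.tensor_map_linear[OF B'.assoc_algebra C'.assoc_algebra anti_hom_linear[OF sb(1)] anti_hom_linear[OF sc(1)]]
  note fl = BC'.flip_map_hom
  have one: "S\<^sub>B \<one>\<^bsub>B\<^esub> = \<one>\<^bsub>B'\<^esub>" "S\<^sub>C \<one>\<^bsub>C\<^esub> = \<one>\<^bsub>C'\<^esub>"
    using alg_homD(4)[OF sb(1)] alg_homD(4)[OF sc(1)] by simp_all
  have minusA: "\<Delta>' (\<ominus>\<^bsub>A'\<^esub> p) = \<ominus>\<^bsub>C' \<boxtimes> B'\<^esub> \<Delta>' p" if "p \<in> carrier A'" for p
    using that by (rule alg_hom_minus[OF d'(1) A'.assoc_algebra CB'.AB.assoc_algebra])
  have m1: "(\<ominus>\<^bsub>C'\<^esub> p) \<boxtimes>\<^bsub>C',B'\<^esub> q = \<ominus>\<^bsub>C' \<boxtimes> B'\<^esub> (p \<boxtimes>\<^bsub>C',B'\<^esub> q)" if "p \<in> carrier C'" "q \<in> carrier B'" for p q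
    using that by (simp add: C'.minus_eq_smult CB'.AB.minus_eq_smult CB'.pure_tensor_smult_left)
  have m2: "p \<boxtimes>\<^bsub>C',B'\<^esub> (\<ominus>\<^bsub>B'\<^esub> q) = \<ominus>\<^bsub>C' \<boxtimes> B'\<^esub> (p \<boxtimes>\<^bsub>C',B'\<^esub> q)" if "p \<in> carrier C'" "q \<in> carrier B'" for p q
    using that by (simp add: B'.minus_eq_smult CB'.AB.minus_eq_smult CB'.pure_tensor_smult_right)
  note simps = sa(2) sb(2) sc(2) d(2) d'(2) linear_mapD(2)[OF tm2(1)] tm2(2) fl(2) alg_homD(3)[OF fl(1)] one minusA m1 m2
    alg_homD(2)[OF d'(1)] CB'.AB.r_distr CB'.AB.l_distr CB'.AB.minus_add CB'.AB.a_ac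
  show ?thesis
    by (rule A.hom_eqI[OF alg_hom_comp[OF alg_hom_comp[OF d(1) tm] alg_hom_op[OF fl(1)]]
          alg_hom_comp[OF sa(1) alg_hom_op[OF d'(1)]] _ _ _ u])
      (simp_all add: simps B'.Q_mult C'.Q_mult B'.Q_zero C'.Q_zero)
qed

section \<open>The presentations\<close>

locale evaluation = assoc_alg C for C :: "('k::comm_ring_1, 'c, 'm) module_scheme" (structure) +
  fixes G :: "'g set" and \<phi> :: "'g \<Rightarrow> 'c"
  assumes \<phi>_closed: "g \<in> G \<Longrightarrow> \<phi> g \<in> carrier C"
begin

abbreviation "ev \<equiv> eval_free C \<phi>"

lemma ev_hom: "alg_hom (free_algebra G) C ev"
  by (rule eval_free_hom) (rule \<phi>_closed)

lemma ev_closed: "p \<in> carrier (free_algebra G) \<Longrightarrow> ev p \<in> carrier C"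
  by (rule alg_homD(1)[OF ev_hom])

lemma ev_simps:
  "p \<in> carrier (free_algebra G) \<Longrightarrow> q \<in> carrier (free_algebra G) \<Longrightarrow> ev (p + q) = ev p \<oplus> ev q"
  "p \<in> carrier (free_algebra G) \<Longrightarrow> q \<in> carrier (free_algebra G) \<Longrightarrow> ev (p - q) = ev p \<ominus> ev q"
  "p \<in> carrier (free_algebra G) \<Longrightarrow> q \<in> carrier (free_algebra G) \<Longrightarrow> ev (p * q) = ev p \<otimes> ev q"
  "ev (scalar r) = r \<odot> \<one>"
  "ev 1 = \<one>"
  "ev 0 = \<zero>"
  "g \<in> G \<Longrightarrow> ev (letter g) = \<phi> g"
proof -
  note h = alg_homD[OF ev_hom]
  show add: "p \<in> carrier (free_algebra G) \<Longrightarrow> q \<in> carrier (free_algebra G) \<Longrightarrow> ev (p + q) = ev p \<oplus> ev q" for p q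
    using h(3) by simp
  show "p \<in> carrier (free_algebra G) \<Longrightarrow> q \<in> carrier (free_algebra G) \<Longrightarrow> ev (p * q) = ev p \<otimes> ev q"
    using h(2) by simp
  show one: "ev 1 = \<one>" using h(4) by simp
  show "ev 0 = \<zero>" using alg_hom_zero[OF ev_hom assoc_algebra_free assoc_algebra] by simp
  show "ev (scalar r) = r \<odot> \<one>" using h(5)[of 1 r] one by (simp add: free_algebra_closed)
  show "g \<in> G \<Longrightarrow> ev (letter g) = \<phi> g" by (simp add: \<phi>_closed)
  show "ev (p - q) = ev p \<ominus> ev q" if pq: "p \<in> carrier (free_algebra G)" "q \<in> carrier (free_algebra G)"
  proof -
    have "p - q \<in> carrier (free_algebra G)" using pq by (rule free_algebra_closed_more)
    moreover from this have "ev p = ev (p - q) \<oplus> ev q"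
      using add[of "p - q" q] pq by simp
    moreover have "u = u \<oplus> v \<ominus> v" if "u \<in> carrier C" "v \<in> carrier C" for u v
      using that by algebra
    ultimately show ?thesis using pq ev_closed by metis
  qed
qed

end

lemma serre_closed:
  assumes "Y i \<in> carrier (free_algebra G)" "Y j \<in> carrier (free_algebra G)"
  shows "serre D Y i j \<in> carrier (free_algebra G)"
  unfolding serre_def Let_def divided_power_def
  by (intro free_algebra_closed free_algebra_closed_more assms)

context quantum_datum
begin

lemma letter_closed:
  "i \<in> index D \<Longrightarrow> letter (E i) \<in> carrier (free_algebra (gens D))"
  "i \<in> index D \<Longrightarrow> letter (F i) \<in> carrier (free_algebra (gens D))"
  "h \<in> coroot_lattice D \<Longrightarrow> letter (Q h) \<in> carrier (free_algebra (gens D))"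
  by (simp_all add: free_algebra_closed)

lemma serre_letter_closed:
  "i \<in> index D \<Longrightarrow> j \<in> index D \<Longrightarrow> serre D (\<lambda>k. letter (E k)) i j \<in> carrier (free_algebra (gens D))"
  "i \<in> index D \<Longrightarrow> j \<in> index D \<Longrightarrow> serre D (\<lambda>k. letter (F k)) i j \<in> carrier (free_algebra (gens D))"
  using serre_closed[of "\<lambda>k. letter (E k)" i "gens D" j] serre_closed[of "\<lambda>k. letter (F k)" i "gens D" j]
  by (simp_all add: letter_closed)

lemmas rel_closed = free_algebra_closed(1,3-6) free_algebra_closed_more(1) letter_closed serre_letter_closed

lemma common_rels_subset: "common_rels D \<subseteq> carrier (free_algebra (gens D))"
  unfolding common_rels_def by (auto intro!: rel_closed)

lemma evaluationI: "assoc_algebra C \<Longrightarrow> (\<And>g. g \<in> gens D \<Longrightarrow> \<phi> g \<in> carrier C) \<Longrightarrow> evaluation C (gens D) \<phi>"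
  by (intro evaluation.intro assoc_alg.intro evaluation_axioms.intro)

lemma common_rels_eval:
  assumes "common_relations D C \<phi>" "r \<in> common_rels D"
  shows "eval_free C \<phi> r = \<zero>\<^bsub>C\<^esub>"
proof -
  interpret common_relations D C \<phi> by fact
  interpret ev: evaluation C "gens D" \<phi> by (rule evaluationI) (rule assoc_algebra, rule closed)
  have serre: "ev.ev (serre D (\<lambda>k. letter (Y k)) i j) = \<zero>\<^bsub>C\<^esub>"
    if "i \<in> index D" "j \<in> index D" "i \<noteq> j" "Y i \<in> gens D" "Y j \<in> gens D" "serre_chain D C i j (\<phi> (Y i)) (\<phi> (Y j)) = \<zero>\<^bsub>C\<^esub>" for i j Y
    using eval_serre_iff[OF half_norm_nonzero[OF that(1)] serre_len(1)[OF that(1-3)], of "\<lambda>k. letter (Y k)" "gens D" C ev.ev] that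
    by (simp add: assoc_algebra ev.ev_hom free_algebra_closed serre_closed ev.ev_simps)
  from assms(2) show ?thesis
    unfolding common_rels_def
    by (elim UnE) (auto simp: ev.ev_simps rel_closed Q_zero move_Q serre serre_E serre_F r_right_minus_eq)
qed

text \<open>The converse of \<open>common_rels_eval\<close>; the weight relations are presented by conjugation with \<open>Q h\<close>, which is
turned into a commutation rule by multiplying with \<open>Q h\<close> from the right.\<close>

lemma common_relationsI:
  fixes C :: "(rat fps, 'c, 'm) module_scheme" (structure)
  assumes C: "assoc_algebra C" and cl: "\<And>g. g \<in> gens D \<Longrightarrow> \<phi> g \<in> carrier C"
    and rels: "\<And>r. r \<in> common_rels D \<Longrightarrow> eval_free C \<phi> r = \<zero>"
  shows "common_relations D C \<phi>"
proof -
  interpret assoc_alg C by (rule assoc_alg.intro) fact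
  interpret ev: evaluation C "gens D" \<phi> by (rule evaluationI) fact+
  have cl': "i \<in> index D \<Longrightarrow> \<phi> (E i) \<in> carrier C" "i \<in> index D \<Longrightarrow> \<phi> (F i) \<in> carrier C"
    "h \<in> coroot_lattice D \<Longrightarrow> \<phi> (Q h) \<in> carrier C" for i h
    by (simp_all add: cl)
  have Q0: "\<phi> (Q 0) = \<one>"
    using rels[of "letter (Q 0) - 1"] by (simp add: common_rels_def ev.ev_simps rel_closed cl')
  have QQ: "\<phi> (Q h) \<otimes> \<phi> (Q h') = \<phi> (Q (h + h'))" if "h \<in> coroot_lattice D" "h' \<in> coroot_lattice D" for h h'
  proof -
    have "letter (Q h) * letter (Q h') - letter (Q (h + h')) \<in> common_rels D"
      using that unfolding common_rels_def by blast
    from rels[OF this] show ?thesis using that by (simp add: ev.ev_simps rel_closed cl')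
  qed
  have conj: "\<phi> (Q h) \<otimes> u = r \<odot> (u \<otimes> \<phi> (Q h))"
    if "\<phi> (Q h) \<otimes> u \<otimes> \<phi> (Q (- h)) = r \<odot> u" "h \<in> coroot_lattice D" "u \<in> carrier C" for h u r
  proof -
    have "\<phi> (Q h) \<otimes> u = \<phi> (Q h) \<otimes> u \<otimes> (\<phi> (Q (- h)) \<otimes> \<phi> (Q h))"
      using that by (simp add: QQ Q0 cl')
    also have "\<dots> = \<phi> (Q h) \<otimes> u \<otimes> \<phi> (Q (- h)) \<otimes> \<phi> (Q h)"
      by (rule m_assoc[symmetric]) (use that cl' in simp_all)
    also have "\<dots> = r \<odot> (u \<otimes> \<phi> (Q h))"
      unfolding that(1) using that cl' by simp
    finally show ?thesis .
  qed
  have serre: "serre_chain D C i j (\<phi> (Y i)) (\<phi> (Y j)) = \<zero>"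
    if "i \<in> index D" "j \<in> index D" "i \<noteq> j" "Y i \<in> gens D" "Y j \<in> gens D" "ev.ev (serre D (\<lambda>k. letter (Y k)) i j) = \<zero>" for i j Y
    using eval_serre_iff[OF half_norm_nonzero[OF that(1)] serre_len(1)[OF that(1-3)], of "\<lambda>k. letter (Y k)" "gens D" C ev.ev] that
    by (simp add: C ev.ev_hom free_algebra_closed serre_closed ev.ev_simps)
  show ?thesis
  proof
    show "g \<in> gens D \<Longrightarrow> \<phi> g \<in> carrier C" for g by (rule cl)
    show "\<phi> (Q 0) = \<one>" by (rule Q0)
    show "\<phi> (Q h) \<otimes> \<phi> (Q h') = \<phi> (Q (h + h'))" if "h \<in> coroot_lattice D" "h' \<in> coroot_lattice D" for h h'
      using that by (rule QQ)
    show "\<phi> (Q h) \<otimes> \<phi> (E i) = qpow (root D i h) \<odot> (\<phi> (E i) \<otimes> \<phi> (Q h))" if "h \<in> coroot_lattice D" "i \<in> index D" for h i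
    proof (rule conj)
      have "letter (Q h) * letter (E i) * letter (Q (- h)) - scalar (qpow (root D i h)) * letter (E i) \<in> common_rels D"
        using that unfolding common_rels_def by blast
      from rels[OF this] show "\<phi> (Q h) \<otimes> \<phi> (E i) \<otimes> \<phi> (Q (- h)) = qpow (root D i h) \<odot> \<phi> (E i)"
        using that by (simp add: ev.ev_simps rel_closed cl')
    qed (use that cl' in simp_all)
    show "\<phi> (Q h) \<otimes> \<phi> (F i) = qpow (- root D i h) \<odot> (\<phi> (F i) \<otimes> \<phi> (Q h))" if "h \<in> coroot_lattice D" "i \<in> index D" for h i
    proof (rule conj)
      have "letter (Q h) * letter (F i) * letter (Q (- h)) - scalar (qpow (- root D i h)) * letter (F i) \<in> common_rels D"
        using that unfolding common_rels_def by blast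
      from rels[OF this] show "\<phi> (Q h) \<otimes> \<phi> (F i) \<otimes> \<phi> (Q (- h)) = qpow (- root D i h) \<odot> \<phi> (F i)"
        using that by (simp add: ev.ev_simps rel_closed cl')
    qed (use that cl' in simp_all)
    show "serre_chain D C i j (\<phi> (E i)) (\<phi> (E j)) = \<zero>" if "i \<in> index D" "j \<in> index D" "i \<noteq> j" for i j
    proof (rule serre[of i j E])
      have "serre D (\<lambda>k. letter (E k)) i j \<in> common_rels D"
        using that unfolding common_rels_def by blast
      then show "ev.ev (serre D (\<lambda>k. letter (E k)) i j) = \<zero>" by (rule rels)
    qed (use that in simp_all)
    show "serre_chain D C i j (\<phi> (F i)) (\<phi> (F j)) = \<zero>" if "i \<in> index D" "j \<in> index D" "i \<noteq> j" for i j
    proof (rule serre[of i j F])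
      have "serre D (\<lambda>k. letter (F k)) i j \<in> common_rels D"
        using that unfolding common_rels_def by blast
      then show "ev.ev (serre D (\<lambda>k. letter (F k)) i j) = \<zero>" by (rule rels)
    qed (use that in simp_all)
  qed
qed

end

text \<open>The three presentations share the common relations and differ in the exchange relation
  \<open>e i f j = r f j e i + w\<close>.\<close>

locale exchange_presentation = quantum_datum D
  for D :: "('i, 't::ab_group_add) root_datum" +
  fixes r :: "'i \<Rightarrow> 'i \<Rightarrow> rat fps" and w :: "'i \<Rightarrow> 'i \<Rightarrow> ('i, 't) gen list \<Rightarrow>\<^sub>0 rat fps"
    and Rels :: "(('i, 't) gen list \<Rightarrow>\<^sub>0 rat fps) set"
  assumes w_closed: "i \<in> index D \<Longrightarrow> j \<in> index D \<Longrightarrow> w i j \<in> carrier (free_algebra (gens D))"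
    and Rels: "Rels = common_rels D \<union>
      {letter (E i) * letter (F j) - (scalar (r i j) * letter (F j) * letter (E i) + w i j) |i j. i \<in> index D \<and> j \<in> index D}"
begin

abbreviation "P \<equiv> presented_algebra (gens D) Rels"
abbreviation "gen \<equiv> generator (gens D) Rels"

sublocale presentation "gens D" Rels
  unfolding Rels
  by unfold_locales (use common_rels_subset in \<open>auto intro!: rel_closed w_closed\<close>)

lemma common_in_Rels: "p \<in> common_rels D \<Longrightarrow> p \<in> Rels"
  by (simp add: Rels)

lemma exchange_in_Rels:
  "i \<in> index D \<Longrightarrow> j \<in> index D \<Longrightarrow>
    letter (E i) * letter (F j) - (scalar (r i j) * letter (F j) * letter (E i) + w i j) \<in> Rels"
  unfolding Rels by blast

lemma presented_relations: "common_relations D P gen"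
  by (rule common_relationsI[OF assoc_algebra_presented generator_closed eval_free_relation[OF common_in_Rels]])

lemma eval_exchange:
  assumes "common_relations D C \<phi>" "i \<in> index D" "j \<in> index D"
  shows "eval_free C \<phi> (letter (E i) * letter (F j) - (scalar (r i j) * letter (F j) * letter (E i) + w i j)) = \<zero>\<^bsub>C\<^esub> \<longleftrightarrow>
    \<phi> (E i) \<otimes>\<^bsub>C\<^esub> \<phi> (F j) = r i j \<odot>\<^bsub>C\<^esub> (\<phi> (F j) \<otimes>\<^bsub>C\<^esub> \<phi> (E i)) \<oplus>\<^bsub>C\<^esub> eval_free C \<phi> (w i j)"
proof -
  interpret C: common_relations D C \<phi> by fact
  interpret ev: evaluation C "gens D" \<phi> by (rule evaluationI) (rule C.assoc_algebra, rule C.closed)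
  have "ev.ev (w i j) \<in> carrier C" using w_closed assms ev.ev_closed by blast
  then show ?thesis using assms(2,3) by (simp add: ev.ev_simps rel_closed w_closed)
qed

lemma presented_exchange:
  assumes "i \<in> index D" "j \<in> index D"
  shows "gen (E i) \<otimes>\<^bsub>P\<^esub> gen (F j) = r i j \<odot>\<^bsub>P\<^esub> (gen (F j) \<otimes>\<^bsub>P\<^esub> gen (E i)) \<oplus>\<^bsub>P\<^esub> eval_free P gen (w i j)"
  unfolding eval_exchange[OF presented_relations assms, symmetric]
  by (rule eval_free_relation) (rule exchange_in_Rels[OF assms])

lemma hom_exists:
  assumes "common_relations D C \<phi>"
    and "\<And>i j. i \<in> index D \<Longrightarrow> j \<in> index D \<Longrightarrow>
      \<phi> (E i) \<otimes>\<^bsub>C\<^esub> \<phi> (F j) = r i j \<odot>\<^bsub>C\<^esub> (\<phi> (F j) \<otimes>\<^bsub>C\<^esub> \<phi> (E i)) \<oplus>\<^bsub>C\<^esub> eval_free C \<phi> (w i j)"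
  shows "\<exists>f. alg_hom P C f \<and> (\<forall>g\<in>gens D. f (gen g) = \<phi> g)"
proof -
  interpret C: common_relations D C \<phi> by fact
  show ?thesis
  proof (rule presented_hom_exists[OF C.assoc_algebra C.closed])
    fix p assume "p \<in> Rels"
    then consider "p \<in> common_rels D"
      | i j where "i \<in> index D" "j \<in> index D"
        "p = letter (E i) * letter (F j) - (scalar (r i j) * letter (F j) * letter (E i) + w i j)"
      unfolding Rels by blast
    then show "eval_free C \<phi> p = \<zero>\<^bsub>C\<^esub>"
    proof cases
      case 1
      then show ?thesis by (rule common_rels_eval[OF assms(1)])
    next
      case 2
      then show ?thesis using eval_exchange[OF assms(1) 2(1,2)] assms(2)[OF 2(1,2)] by simp
    qed
  qed
qed

end

context quantum_datum
begin

lemma kashiwara_presentation: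
  "exchange_presentation D (\<lambda>i j. qpow (half_norm D i * root D j (coroot D i))) (\<lambda>i j. if i = j then 1 else 0)
     (kashiwara_rels D)"
  by unfold_locales (auto simp: kashiwara_rels_def intro!: rel_closed)

lemma U_hat_presentation:
  "exchange_presentation D (\<lambda>i j. 1) (\<lambda>i j. if i = j then letter (Q (t_exp D i)) - letter (Q (- t_exp D i)) else 0)
     (U_hat_rels D)"
proof unfold_locales
  show "U_hat_rels D = common_rels D \<union>
    {letter (E i) * letter (F j) - (scalar 1 * letter (F j) * letter (E i) +
       (if i = j then letter (Q (t_exp D i)) - letter (Q (- t_exp D i)) else 0)) |i j. i \<in> index D \<and> j \<in> index D}"
    unfolding U_hat_rels_def by (simp only: scalar_simps mult_1_left diff_diff_eq)
qed (auto intro!: rel_closed)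

lemma U_prime_presentation:
  "exchange_presentation D (\<lambda>i j. qpow (- half_norm D i * root D j (coroot D i))) (\<lambda>i j. 0) (U_prime_rels D)"
proof unfold_locales
  show "U_prime_rels D = common_rels D \<union>
    {letter (E i) * letter (F j) - (scalar (qpow (- half_norm D i * root D j (coroot D i))) * letter (F j) * letter (E i) + 0)
      |i j. i \<in> index D \<and> j \<in> index D}"
    unfolding U_prime_rels_def by (simp only: add_0_right)
qed (auto intro!: rel_closed)

end

text \<open>A change of coordinates keeps a generating set if every old generator is, up to a scalar, a product of
two new ones; the trivial factor \<open>Q 0\<close> is available for generators that do not change.\<close>

lemma generates_from_products:
  assumes "generates A M" "assoc_algebra A" "N \<subseteq> carrier A"
    and "\<And>m. m \<in> M \<Longrightarrow> \<exists>r. \<exists>u\<in>N. \<exists>v\<in>N. m = r \<odot>\<^bsub>A\<^esub> (u \<otimes>\<^bsub>A\<^esub> v)"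
  shows "generates A N"
  unfolding generates_def
proof (intro allI impI)
  interpret assoc_alg A by (rule assoc_alg.intro) fact
  fix S assume S: "N \<subseteq> S" "\<one>\<^bsub>A\<^esub> \<in> S"
    "\<forall>x\<in>carrier A \<inter> S. \<forall>y\<in>carrier A \<inter> S. x \<oplus>\<^bsub>A\<^esub> y \<in> S \<and> x \<otimes>\<^bsub>A\<^esub> y \<in> S"
    "\<forall>r. \<forall>x\<in>carrier A \<inter> S. r \<odot>\<^bsub>A\<^esub> x \<in> S"
  have "M \<subseteq> S"
  proof
    fix m assume "m \<in> M"
    then obtain r u v where "u \<in> N" "v \<in> N" "m = r \<odot>\<^bsub>A\<^esub> (u \<otimes>\<^bsub>A\<^esub> v)" using assms(4) by blast
    moreover from this have "u \<otimes>\<^bsub>A\<^esub> v \<in> carrier A \<inter> S" using S(1,3) assms(3) by blast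
    ultimately show "m \<in> S" using S(4) by blast
  qed
  then show "carrier A \<subseteq> S" using assms(1) S(2-4) unfolding generates_def by blast
qed

text \<open>Substitutions between the generators of the presentations and the coordinates of \<open>H[a,b]\<close>: \<open>shift_E\<close>,
\<open>unshift_F\<close> and \<open>op_gen\<close> produce coordinates from the generators of the Kashiwara algebra, of \<open>U_prime\<close> and
of the opposite Kashiwara algebra; \<open>unshift_E\<close>, \<open>shift_F\<close> and \<open>un_op_gen\<close> are the inverse substitutions. In
\<open>op_gen\<close> products are those of the Kashiwara algebra, in \<open>un_op_gen\<close> those of an algebra with the relations
of \<open>H[1,0]\<close>, whence the different order of the factors.\<close>

definition shift_E :: "('i, 't::ab_group_add) root_datum \<Rightarrow> (rat fps, 'c, 'm) module_scheme \<Rightarrow> (('i, 't) gen \<Rightarrow> 'c) \<Rightarrow> ('i, 't) gen \<Rightarrow> 'c" where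
  "shift_E D C \<phi> g = (case g of E i \<Rightarrow> \<phi> (Q (t_exp D i)) \<otimes>\<^bsub>C\<^esub> \<phi> (E i) | _ \<Rightarrow> \<phi> g)"

definition unshift_E :: "('i, 't::ab_group_add) root_datum \<Rightarrow> (rat fps, 'c, 'm) module_scheme \<Rightarrow> (('i, 't) gen \<Rightarrow> 'c) \<Rightarrow> ('i, 't) gen \<Rightarrow> 'c" where
  "unshift_E D C x g = (case g of E i \<Rightarrow> x (Q (- t_exp D i)) \<otimes>\<^bsub>C\<^esub> x (E i) | _ \<Rightarrow> x g)"

definition unshift_F :: "('i, 't::ab_group_add) root_datum \<Rightarrow> (rat fps, 'c, 'm) module_scheme \<Rightarrow> (('i, 't) gen \<Rightarrow> 'c) \<Rightarrow> ('i, 't) gen \<Rightarrow> 'c" where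
  "unshift_F D C \<phi> g = (case g of F i \<Rightarrow> \<phi> (Q (- t_exp D i)) \<otimes>\<^bsub>C\<^esub> \<phi> (F i) | _ \<Rightarrow> \<phi> g)"

definition shift_F :: "('i, 't::ab_group_add) root_datum \<Rightarrow> (rat fps, 'c, 'm) module_scheme \<Rightarrow> (('i, 't) gen \<Rightarrow> 'c) \<Rightarrow> ('i, 't) gen \<Rightarrow> 'c" where
  "shift_F D C x g = (case g of F i \<Rightarrow> x (Q (t_exp D i)) \<otimes>\<^bsub>C\<^esub> x (F i) | _ \<Rightarrow> x g)"

definition op_gen :: "('i, 't::ab_group_add) root_datum \<Rightarrow> (rat fps, 'c, 'm) module_scheme \<Rightarrow> (('i, 't) gen \<Rightarrow> 'c) \<Rightarrow> ('i, 't) gen \<Rightarrow> 'c" where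
  "op_gen D C \<phi> g = (case g of E i \<Rightarrow> \<ominus>\<^bsub>C\<^esub> \<phi> (E i) | F i \<Rightarrow> \<ominus>\<^bsub>C\<^esub> (\<phi> (F i) \<otimes>\<^bsub>C\<^esub> \<phi> (Q (t_exp D i))) | Q h \<Rightarrow> \<phi> (Q (- h)))"

definition un_op_gen :: "('i, 't::ab_group_add) root_datum \<Rightarrow> (rat fps, 'c, 'm) module_scheme \<Rightarrow> (('i, 't) gen \<Rightarrow> 'c) \<Rightarrow> ('i, 't) gen \<Rightarrow> 'c" where
  "un_op_gen D C x g = (case g of E i \<Rightarrow> \<ominus>\<^bsub>C\<^esub> x (E i) | F i \<Rightarrow> \<ominus>\<^bsub>C\<^esub> (x (Q (t_exp D i)) \<otimes>\<^bsub>C\<^esub> x (F i)) | Q h \<Rightarrow> x (Q (- h)))"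

lemma change_gen_simps [simp]:
  "shift_E D C \<phi> (E i) = \<phi> (Q (t_exp D i)) \<otimes>\<^bsub>C\<^esub> \<phi> (E i)" "shift_E D C \<phi> (F i) = \<phi> (F i)" "shift_E D C \<phi> (Q h) = \<phi> (Q h)"
  "unshift_E D C \<phi> (E i) = \<phi> (Q (- t_exp D i)) \<otimes>\<^bsub>C\<^esub> \<phi> (E i)" "unshift_E D C \<phi> (F i) = \<phi> (F i)" "unshift_E D C \<phi> (Q h) = \<phi> (Q h)"
  "unshift_F D C \<phi> (F i) = \<phi> (Q (- t_exp D i)) \<otimes>\<^bsub>C\<^esub> \<phi> (F i)" "unshift_F D C \<phi> (E i) = \<phi> (E i)" "unshift_F D C \<phi> (Q h) = \<phi> (Q h)"
  "shift_F D C \<phi> (F i) = \<phi> (Q (t_exp D i)) \<otimes>\<^bsub>C\<^esub> \<phi> (F i)" "shift_F D C \<phi> (E i) = \<phi> (E i)" "shift_F D C \<phi> (Q h) = \<phi> (Q h)"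
  "op_gen D C \<phi> (E i) = \<ominus>\<^bsub>C\<^esub> \<phi> (E i)" "op_gen D C \<phi> (F i) = \<ominus>\<^bsub>C\<^esub> (\<phi> (F i) \<otimes>\<^bsub>C\<^esub> \<phi> (Q (t_exp D i)))" "op_gen D C \<phi> (Q h) = \<phi> (Q (- h))"
  "un_op_gen D C \<phi> (E i) = \<ominus>\<^bsub>C\<^esub> \<phi> (E i)" "un_op_gen D C \<phi> (F i) = \<ominus>\<^bsub>C\<^esub> (\<phi> (Q (t_exp D i)) \<otimes>\<^bsub>C\<^esub> \<phi> (F i))" "un_op_gen D C \<phi> (Q h) = \<phi> (Q (- h))"
  by (simp_all add: shift_E_def unshift_E_def shift_F_def unshift_F_def op_gen_def un_op_gen_def)

context common_relations
begin

lemma half_norm_root: "i \<in> index D \<Longrightarrow> j \<in> index D \<Longrightarrow> half_norm D i * root D j (coroot D i) = root D i (t_exp D j)"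
  by (simp add: root_t_exp root_t_exp_sym flip: root_t_exp)

lemma twist_variants:
  "common_relations D C (shift_E D C x)" "common_relations D C (unshift_E D C x)"
  "common_relations D C (unshift_F D C x)" "common_relations D C (shift_F D C x)"
proof -
  interpret t1: common_relations D C "twist_gen C (\<lambda>_. 1) (t_exp D) (\<lambda>_. 1) (\<lambda>_. 0) x"
    by (rule twist) (simp_all add: root_t_exp_sym)
  show "common_relations D C (shift_E D C x)"
    by (rule t1.cong, rename_tac g, case_tac g) (simp_all add: Q_zero)
  interpret t2: common_relations D C "twist_gen C (\<lambda>_. 1) (\<lambda>i. - t_exp D i) (\<lambda>_. 1) (\<lambda>_. 0) x"
    by (rule twist) (simp_all add: root_t_exp_sym)
  show "common_relations D C (unshift_E D C x)"
    by (rule t2.cong, rename_tac g, case_tac g) (simp_all add: Q_zero)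
  interpret t3: common_relations D C "twist_gen C (\<lambda>_. 1) (\<lambda>_. 0) (\<lambda>_. 1) (\<lambda>i. - t_exp D i) x"
    by (rule twist) (simp_all add: root_t_exp_sym)
  show "common_relations D C (unshift_F D C x)"
    by (rule t3.cong, rename_tac g, case_tac g) (simp_all add: Q_zero)
  interpret t4: common_relations D C "twist_gen C (\<lambda>_. 1) (\<lambda>_. 0) (\<lambda>_. 1) (t_exp D) x"
    by (rule twist) (simp_all add: root_t_exp_sym)
  show "common_relations D C (shift_F D C x)"
    by (rule t4.cong, rename_tac g, case_tac g) (simp_all add: Q_zero)
qed

lemma op_variants:
  "common_relations D (op_algebra C) (op_gen D C x)" "common_relations D (op_algebra C) (un_op_gen D C x)"
proof -
  interpret op: common_relations D "op_algebra C" "invert_Q x" by (rule opposite)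
  interpret t1: common_relations D "op_algebra C"
    "twist_gen (op_algebra C) (\<lambda>_. - 1) (\<lambda>_. 0) (\<lambda>_. - 1) (\<lambda>i. - t_exp D i) (invert_Q x)"
    by (rule op.twist) (simp_all add: root_t_exp_sym)
  show "common_relations D (op_algebra C) (op_gen D C x)"
    by (rule t1.cong, rename_tac g, case_tac g) (simp_all add: Q_zero smult_minus_left)
  interpret t2: common_relations D "op_algebra C"
    "twist_gen (op_algebra C) (\<lambda>_. - 1) (\<lambda>_. 0) (\<lambda>i. - qpow (- root D i (t_exp D i))) (\<lambda>i. - t_exp D i) (invert_Q x)"
    by (rule op.twist) (simp_all add: root_t_exp_sym)
  show "common_relations D (op_algebra C) (un_op_gen D C x)"
    by (rule t2.cong, rename_tac g, case_tac g) (simp_all add: Q_zero smult_minus_left F_Q fps_exp_mult)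
qed

text \<open>Multiplying \<open>E i\<close> by \<open>T i\<close> absorbs the q-power in the exchange relation, and the constant term \<open>1\<close> becomes
\<open>T i\<close>.\<close>

lemma kashiwara_to_hopf:
  assumes "\<And>i j. i \<in> index D \<Longrightarrow> j \<in> index D \<Longrightarrow>
    x (E i) \<otimes> x (F j) = qpow (half_norm D i * root D j (coroot D i)) \<odot> (x (F j) \<otimes> x (E i)) \<oplus> (if i = j then \<one> else \<zero>)"
  shows "hopf_relations D C (shift_E D C x) 0 1"
    and "hopf_relations D (op_algebra C) (op_gen D C x) 1 0"
proof -
  have EF: "x (E i) \<otimes> x (F j) = qpow (root D i (t_exp D j)) \<odot> (x (F j) \<otimes> x (E i)) \<oplus> (if i = j then \<one> else \<zero>)"
    if "i \<in> index D" "j \<in> index D" for i j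
    using assms[OF that] by (simp add: half_norm_root that)
  have EF': "x (E i) \<otimes> (x (F j) \<otimes> z) = qpow (root D i (t_exp D j)) \<odot> (x (F j) \<otimes> (x (E i) \<otimes> z)) \<oplus> (if i = j then z else \<zero>)"
    if "i \<in> index D" "j \<in> index D" "z \<in> carrier C" for i j z
    using that by (simp add: EF l_distr m_assoc flip: m_assoc[of "x (E i)"])
  interpret s: common_relations D C "shift_E D C x" by (rule twist_variants)
  show "hopf_relations D C (shift_E D C x) 0 1"
  proof
    fix i j assume ij: "i \<in> index D" "j \<in> index D"
    show "shift_E D C x (E i) \<otimes> shift_E D C x (F j) = shift_E D C x (F j) \<otimes> shift_E D C x (E i) \<oplus>
        (if i = j then 1 \<odot> shift_E D C x (Q (t_exp D i)) \<ominus> 0 \<odot> shift_E D C x (Q (- t_exp D i)) else \<zero>)"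
      using ij root_t_exp_sym[OF ij]
      by (cases "i = j") (simp_all add: move_Q EF EF' r_distr a_minus_def)
  qed
  interpret o: common_relations D "op_algebra C" "op_gen D C x" by (rule op_variants)
  show "hopf_relations D (op_algebra C) (op_gen D C x) 1 0"
  proof
    fix i j assume ij: "i \<in> index D" "j \<in> index D"
    show "op_gen D C x (E i) \<otimes>\<^bsub>op_algebra C\<^esub> op_gen D C x (F j) = op_gen D C x (F j) \<otimes>\<^bsub>op_algebra C\<^esub> op_gen D C x (E i) \<oplus>\<^bsub>op_algebra C\<^esub>
        (if i = j then 0 \<odot>\<^bsub>op_algebra C\<^esub> op_gen D C x (Q (t_exp D i)) \<ominus>\<^bsub>op_algebra C\<^esub> 1 \<odot>\<^bsub>op_algebra C\<^esub> op_gen D C x (Q (- t_exp D i)) else \<zero>\<^bsub>op_algebra C\<^esub>)"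
      using ij root_t_exp_sym[OF ij]
      by (cases "i = j") (simp_all add: move_Q EF EF' r_distr smult_r_distr smult_minus_right a_minus_def l_minus r_minus
          minus_add a_ac r_neg r_neg1 r_neg2)
  qed
qed

lemma U_prime_to_hopf:
  assumes "\<And>i j. i \<in> index D \<Longrightarrow> j \<in> index D \<Longrightarrow>
    x (E i) \<otimes> x (F j) = qpow (- half_norm D i * root D j (coroot D i)) \<odot> (x (F j) \<otimes> x (E i))"
  shows "hopf_relations D C (unshift_F D C x) 0 0"
proof -
  have EF: "x (E i) \<otimes> x (F j) = qpow (- root D i (t_exp D j)) \<odot> (x (F j) \<otimes> x (E i))"
    if "i \<in> index D" "j \<in> index D" for i j
    using assms[OF that] by (simp add: half_norm_root that)
  interpret s: common_relations D C "unshift_F D C x" by (rule twist_variants)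
  show "hopf_relations D C (unshift_F D C x) 0 0"
    by unfold_locales (auto simp: move_Q EF r_neg a_minus_def)
qed

end

context hopf_relations
begin

lemma hopf_to_kashiwara:
  assumes "a = 0" "b = 1" "i \<in> index D" "j \<in> index D"
  defines "y \<equiv> unshift_E D C x"
  shows "y (E i) \<otimes> y (F j) = qpow (half_norm D i * root D j (coroot D i)) \<odot> (y (F j) \<otimes> y (E i)) \<oplus> (if i = j then \<one> else \<zero>)"
  using assms(3,4) root_t_exp_sym[OF assms(3,4)]
  by (cases "i = j") (simp_all add: assms(1,2) half_norm_root y_def move_Q E_F E_F' r_distr a_minus_def)

lemma hopf_to_kashiwara_op:
  assumes "a = 1" "b = 0" "i \<in> index D" "j \<in> index D"
  defines "y \<equiv> un_op_gen D C x"
  shows "y (E i) \<otimes>\<^bsub>op_algebra C\<^esub> y (F j) = qpow (half_norm D i * root D j (coroot D i)) \<odot> (y (F j) \<otimes>\<^bsub>op_algebra C\<^esub> y (E i)) \<oplus> (if i = j then \<one> else \<zero>)"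
  using assms(3,4) root_t_exp_sym[OF assms(3,4)]
  by (cases "i = j")
    (simp_all add: assms(1,2) half_norm_root y_def move_Q E_F E_F' r_distr smult_r_distr a_minus_def l_minus r_minus smult_minus_right
      a_ac r_neg r_neg1 r_neg2)

lemma hopf_to_U_prime:
  assumes "a = 0" "b = 0" "i \<in> index D" "j \<in> index D"
  defines "y \<equiv> shift_F D C x"
  shows "y (E i) \<otimes> y (F j) = qpow (- half_norm D i * root D j (coroot D i)) \<odot> (y (F j) \<otimes> y (E i))"
  using assms(3,4) root_t_exp_sym[OF assms(3,4)]
  by (cases "i = j") (simp_all add: assms(1,2) half_norm_root y_def move_Q E_F a_minus_def)

end

section \<open>The four objects\<close>

lemma hopf_object_same:
  assumes "same_algebra A A'" "hopf_object D A' x a b"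
  shows "hopf_object D A x a b"
proof -
  interpret A': hopf_object D A' x a b by fact
  have A: "assoc_algebra A" by (rule same_algebra_assoc_algebra[OF assms(1) A'.assoc_algebra])
  have "alg_hom A' A (\<lambda>u. u)"
    by (rule alg_homI) (simp_all add: same_algebra_simps[OF assms(1)])
  then have "hopf_relations D A x a b"
    using A by (rule A'.hopf_hom_image)
  moreover have "generates A (x ` gens D)"
    using A'.generated by (simp add: same_algebra_generates[OF assms(1)])
  ultimately show ?thesis
    by (intro hopf_object.intro hopf_object_axioms.intro)
qed

lemma same_algebra_U_prime: "same_algebra (U_prime D) (U_prime_alg D)"
  by (simp add: same_algebra_def U_prime_def module.extend_def bialgebra.fields_def)

lemma same_algebra_U_hat: "same_algebra (U_hat D) (U_hat_alg D)"
  by (simp add: same_algebra_def U_hat_def module.extend_def bialgebra.fields_def)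

abbreviation "U_prime_coords D \<equiv> unshift_F D (U_prime D) (U_prime_gen D)"
abbreviation "kashiwara_coords D \<equiv> shift_E D (kashiwara D) (kashiwara_gen D)"
abbreviation "kashiwara_op_coords D \<equiv> op_gen D (kashiwara D) (kashiwara_gen D)"

abbreviation (input) extends_coords ::
    "('i, 't::ab_group_add) root_datum \<Rightarrow> (rat fps, 'a, 'm) module_scheme \<Rightarrow> (('i, 't) gen \<Rightarrow> 'a) \<Rightarrow>
     (('i, 't) gen \<Rightarrow> 'a) \<Rightarrow> (rat fps, 'c, 'n) module_scheme \<Rightarrow> (('i, 't) gen \<Rightarrow> 'c) \<Rightarrow> (('i, 't) gen \<Rightarrow> 'c) \<Rightarrow> bool" where
  "extends_coords D A \<iota> x C \<phi> y \<equiv>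
     well_defined_hom A (gens D) \<iota> C \<phi> \<and> alg_hom A C (induced_hom A (gens D) \<iota> C \<phi>) \<and>
     (\<forall>g\<in>gens D. induced_hom A (gens D) \<iota> C \<phi> (x g) = y g)"

text \<open>The maps are prescribed on the generators \<open>\<iota>\<close> of a presentation but are used through their values on the
coordinates \<open>x\<close>.\<close>

lemma well_defined_hom_coords:
  assumes "generates A (\<iota> ` gens D)" "assoc_algebra A" "\<And>g. g \<in> gens D \<Longrightarrow> \<iota> g \<in> carrier A"
    and "alg_hom A C f" "\<And>g. g \<in> gens D \<Longrightarrow> f (\<iota> g) = \<phi> g"
    and "\<And>g. g \<in> gens D \<Longrightarrow> x g \<in> carrier A" "\<And>g. g \<in> gens D \<Longrightarrow> f (x g) = y g"
  shows "extends_coords D A \<iota> x C \<phi> y"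
  using well_defined_homI[OF assms(1-5)] assms(6,7) by simp

context quantum_datum
begin

text \<open>The coordinates satisfy the relations of \<open>H[0,1]\<close> and of \<open>H[1,0]\<close> respectively and still generate. Conversely,
a solution \<open>y\<close> of these relations in \<open>C\<close> yields, by the inverse substitution, a solution of the defining
relations and hence a morphism that takes the coordinates to \<open>y\<close>.\<close>

lemma kashiwara_object: "hopf_object D (kashiwara D) (kashiwara_coords D) 0 1"
  and kashiwara_op_object: "hopf_object D (kashiwara_op D) (kashiwara_op_coords D) 1 0"
  and kashiwara_hom: "hopf_relations D C y 0 1 \<Longrightarrow> (\<And>g. g \<in> gens D \<Longrightarrow> unshift_E D C y g = \<phi> g) \<Longrightarrow>
    extends_coords D (kashiwara D) (kashiwara_gen D) (kashiwara_coords D) C \<phi> y"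
  and kashiwara_op_hom: "hopf_relations D C y 1 0 \<Longrightarrow> (\<And>g. g \<in> gens D \<Longrightarrow> un_op_gen D C y g = \<phi> g) \<Longrightarrow>
    extends_coords D (kashiwara_op D) (kashiwara_gen D) (kashiwara_op_coords D) C \<phi> y"
  for C :: "(rat fps, 'c, 'm) module_scheme"
proof -
  interpret B: exchange_presentation D "\<lambda>i j. qpow (half_norm D i * root D j (coroot D i))" "\<lambda>i j. if i = j then 1 else 0"
    "kashiwara_rels D"
    by (rule kashiwara_presentation)
  have fold: "B.P = kashiwara D" "B.gen = kashiwara_gen D"
    by (simp_all add: kashiwara_def kashiwara_gen_def)
  interpret common_relations D "kashiwara D" "kashiwara_gen D"
    using B.presented_relations unfolding fold .
  interpret ev: evaluation "kashiwara D" "gens D" "kashiwara_gen D"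
    by (rule evaluationI) (rule assoc_algebra, rule closed)
  have ex: "kashiwara_gen D (E i) \<otimes>\<^bsub>kashiwara D\<^esub> kashiwara_gen D (F j) =
      qpow (half_norm D i * root D j (coroot D i)) \<odot>\<^bsub>kashiwara D\<^esub> (kashiwara_gen D (F j) \<otimes>\<^bsub>kashiwara D\<^esub> kashiwara_gen D (E i)) \<oplus>\<^bsub>kashiwara D\<^esub>
      (if i = j then \<one>\<^bsub>kashiwara D\<^esub> else \<zero>\<^bsub>kashiwara D\<^esub>)"
    if "i \<in> index D" "j \<in> index D" for i j
    using B.presented_exchange[OF that] unfolding fold by (simp add: ev.ev_simps split: if_splits)
  note rel = kashiwara_to_hopf[OF ex]
  have gen: "generates (kashiwara D) (kashiwara_gen D ` gens D)"
    using B.generates_presented unfolding fold .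
  interpret sE: hopf_relations D "kashiwara D" "kashiwara_coords D" 0 1 by (rule rel)
  interpret op: hopf_relations D "kashiwara_op D" "kashiwara_op_coords D" 1 0 by (rule rel)
  show obj: "hopf_object D (kashiwara D) (kashiwara_coords D) 0 1"
  proof (intro hopf_object.intro hopf_object_axioms.intro sE.hopf_relations_axioms
      generates_from_products[OF gen assoc_algebra])
    show "kashiwara_coords D ` gens D \<subseteq> carrier (kashiwara D)"
      using sE.closed by blast
    fix m assume "m \<in> kashiwara_gen D ` gens D"
    then obtain g where g: "g \<in> gens D" "m = kashiwara_gen D g" by blast
    \<comment> \<open>The group-like factor that undoes the change of coordinates.\<close>
    define h where "h = (case g of E i \<Rightarrow> - t_exp D i | _ \<Rightarrow> 0)"
    have "h \<in> coroot_lattice D" using g(1) by (cases g) (simp_all add: h_def)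
    moreover have "m = 1 \<odot>\<^bsub>kashiwara D\<^esub> (kashiwara_coords D (Q h) \<otimes>\<^bsub>kashiwara D\<^esub> kashiwara_coords D g)"
      using g by (cases g) (simp_all add: h_def Q_zero move_Q)
    ultimately show "\<exists>r. \<exists>u\<in>kashiwara_coords D ` gens D. \<exists>v\<in>kashiwara_coords D ` gens D. m = r \<odot>\<^bsub>kashiwara D\<^esub> (u \<otimes>\<^bsub>kashiwara D\<^esub> v)"
      using g(1) by (metis gens_simps(3) imageI)
  qed
  show "hopf_object D (kashiwara_op D) (kashiwara_op_coords D) 1 0"
  proof (intro hopf_object.intro hopf_object_axioms.intro op.hopf_relations_axioms
      generates_from_products[OF generates_op[OF gen] op.assoc_algebra])
    show "kashiwara_op_coords D ` gens D \<subseteq> carrier (kashiwara_op D)"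
      using op.closed by blast
    fix m assume "m \<in> kashiwara_gen D ` gens D"
    then obtain g where g: "g \<in> gens D" "m = kashiwara_gen D g" by blast
    define h where "h = (case g of F i \<Rightarrow> t_exp D i | _ \<Rightarrow> 0)"
    define g' where "g' = (case g of Q k \<Rightarrow> Q (- k) | _ \<Rightarrow> g)"
    define r :: "rat fps" where "r = (case g of Q k \<Rightarrow> 1 | _ \<Rightarrow> - 1)"
    have "h \<in> coroot_lattice D" "g' \<in> gens D" using g(1) by (cases g; simp add: h_def g'_def)+
    moreover have "m = r \<odot>\<^bsub>kashiwara_op D\<^esub> (kashiwara_op_coords D (Q h) \<otimes>\<^bsub>kashiwara_op D\<^esub> kashiwara_op_coords D g')"
      using g by (cases g) (simp_all add: h_def g'_def r_def Q_zero smult_minus_left l_minus m_assoc Q_mult)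
    ultimately show "\<exists>r. \<exists>u\<in>kashiwara_op_coords D ` gens D. \<exists>v\<in>kashiwara_op_coords D ` gens D. m = r \<odot>\<^bsub>kashiwara_op D\<^esub> (u \<otimes>\<^bsub>kashiwara_op D\<^esub> v)"
      by (metis gens_simps(3) imageI)
  qed
  show "extends_coords D (kashiwara D) (kashiwara_gen D) (kashiwara_coords D) C \<phi> y"
    if y: "hopf_relations D C y 0 1" and \<phi>: "\<And>g. g \<in> gens D \<Longrightarrow> unshift_E D C y g = \<phi> g"
  proof -
    interpret y: hopf_relations D C y 0 1 by fact
    interpret y': common_relations D C "unshift_E D C y" by (rule y.twist_variants)
    interpret evC: evaluation C "gens D" "unshift_E D C y" by (rule evaluationI) (rule y.assoc_algebra, rule y'.closed)
    have "\<exists>f. alg_hom B.P C f \<and> (\<forall>g\<in>gens D. f (B.gen g) = unshift_E D C y g)"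
    proof (rule B.hom_exists[OF y'.common_relations_axioms])
      fix i j assume ij: "i \<in> index D" "j \<in> index D"
      show "unshift_E D C y (E i) \<otimes>\<^bsub>C\<^esub> unshift_E D C y (F j) =
        qpow (half_norm D i * root D j (coroot D i)) \<odot>\<^bsub>C\<^esub> (unshift_E D C y (F j) \<otimes>\<^bsub>C\<^esub> unshift_E D C y (E i)) \<oplus>\<^bsub>C\<^esub>
        eval_free C (unshift_E D C y) (if i = j then 1 else 0)"
        unfolding y.hopf_to_kashiwara[OF refl refl ij] by (simp add: evC.ev_simps)
    qed
    then obtain f where f: "alg_hom (kashiwara D) C f" "\<And>g. g \<in> gens D \<Longrightarrow> f (kashiwara_gen D g) = unshift_E D C y g"
      unfolding fold by blast
    show ?thesis
    proof (rule well_defined_hom_coords[OF gen assoc_algebra closed f(1)])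
      show "f (kashiwara_coords D g) = y g" if "g \<in> gens D" for g
        using that by (cases g) (simp_all add: alg_homD(2)[OF f(1)] f(2) y.Q_mult' y.Q_zero)
    qed (simp_all add: f(2) \<phi> sE.closed)
  qed
  show "extends_coords D (kashiwara_op D) (kashiwara_gen D) (kashiwara_op_coords D) C \<phi> y"
    if y: "hopf_relations D C y 1 0" and \<phi>: "\<And>g. g \<in> gens D \<Longrightarrow> un_op_gen D C y g = \<phi> g"
  proof -
    interpret y: hopf_relations D C y 1 0 by fact
    interpret y': common_relations D "op_algebra C" "un_op_gen D C y" by (rule y.op_variants)
    interpret evC: evaluation "op_algebra C" "gens D" "un_op_gen D C y" by (rule evaluationI) (rule y'.assoc_algebra, rule y'.closed)
    have "\<exists>f. alg_hom B.P (op_algebra C) f \<and> (\<forall>g\<in>gens D. f (B.gen g) = un_op_gen D C y g)"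
    proof (rule B.hom_exists[OF y'.common_relations_axioms])
      fix i j assume ij: "i \<in> index D" "j \<in> index D"
      show "un_op_gen D C y (E i) \<otimes>\<^bsub>op_algebra C\<^esub> un_op_gen D C y (F j) =
        qpow (half_norm D i * root D j (coroot D i)) \<odot>\<^bsub>op_algebra C\<^esub> (un_op_gen D C y (F j) \<otimes>\<^bsub>op_algebra C\<^esub> un_op_gen D C y (E i)) \<oplus>\<^bsub>op_algebra C\<^esub>
        eval_free (op_algebra C) (un_op_gen D C y) (if i = j then 1 else 0)"
        unfolding y.hopf_to_kashiwara_op[OF refl refl ij] by (simp add: evC.ev_simps)
    qed
    then obtain f where f: "alg_hom (kashiwara D) (op_algebra C) f" "\<And>g. g \<in> gens D \<Longrightarrow> f (kashiwara_gen D g) = un_op_gen D C y g"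
      unfolding fold by blast
    have f': "alg_hom (kashiwara_op D) C f" using alg_hom_op[OF f(1)] by simp
    note minus = alg_hom_minus[OF f' op.assoc_algebra y.assoc_algebra]
    show ?thesis
    proof (rule well_defined_hom_coords[OF generates_op[OF gen] op.assoc_algebra _ f'])
      show "f (kashiwara_op_coords D g) = y g" if "g \<in> gens D" for g
        using that alg_homD(2)[OF f(1)] minus
        by (cases g) (simp_all add: f(2) y.Q_mult' y.Q_zero y.l_minus y.r_minus y.move_Q)
    qed (use op.closed in \<open>simp_all add: f(2) \<phi> closed\<close>)
  qed
qed

lemma U_prime_object: "hopf_object D (U_prime D) (U_prime_coords D) 0 0"
  and U_prime_gen_relations: "common_relations D (U_prime D) (U_prime_gen D)"
  and U_prime_hom: "hopf_relations D C y 0 0 \<Longrightarrow> (\<And>g. g \<in> gens D \<Longrightarrow> shift_F D C y g = \<phi> g) \<Longrightarrow>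
    extends_coords D (U_prime D) (U_prime_gen D) (U_prime_coords D) C \<phi> y"
  for C :: "(rat fps, 'c, 'm) module_scheme"
proof -
  interpret W: exchange_presentation D "\<lambda>i j. qpow (- half_norm D i * root D j (coroot D i))" "\<lambda>i j. 0" "U_prime_rels D"
    by (rule U_prime_presentation)
  have fold: "W.P = U_prime_alg D" "W.gen = U_prime_gen D"
    by (simp_all add: U_prime_alg_def U_prime_gen_def)
  note same = same_algebra_U_prime[of D]
  interpret W0: common_relations D "U_prime_alg D" "U_prime_gen D"
    using W.presented_relations unfolding fold .
  interpret ev: evaluation "U_prime_alg D" "gens D" "U_prime_gen D"
    by (rule evaluationI) (rule W0.assoc_algebra, rule W0.closed)
  have ex: "U_prime_gen D (E i) \<otimes>\<^bsub>U_prime_alg D\<^esub> U_prime_gen D (F j) =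
      qpow (- half_norm D i * root D j (coroot D i)) \<odot>\<^bsub>U_prime_alg D\<^esub> (U_prime_gen D (F j) \<otimes>\<^bsub>U_prime_alg D\<^esub> U_prime_gen D (E i))"
    if "i \<in> index D" "j \<in> index D" for i j
    using W.presented_exchange[OF that] that unfolding fold by (simp add: ev.ev_simps)
  have "alg_hom (U_prime_alg D) (U_prime D) (\<lambda>u. u)"
    by (rule alg_homI) (simp_all add: same_algebra_simps[OF same])
  then show rel: "common_relations D (U_prime D) (U_prime_gen D)"
    by (rule W0.hom_image) (rule same_algebra_assoc_algebra[OF same W0.assoc_algebra])
  interpret common_relations D "U_prime D" "U_prime_gen D" by (rule rel)
  interpret sF: hopf_relations D "U_prime D" "U_prime_coords D" 0 0
    by (rule U_prime_to_hopf) (simp add: same_algebra_simps[OF same] ex)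
  have gen: "generates (U_prime D) (U_prime_gen D ` gens D)"
    using W.generates_presented unfolding fold same_algebra_generates[OF same] .
  show obj: "hopf_object D (U_prime D) (U_prime_coords D) 0 0"
  proof (intro hopf_object.intro hopf_object_axioms.intro sF.hopf_relations_axioms
      generates_from_products[OF gen assoc_algebra])
    show "U_prime_coords D ` gens D \<subseteq> carrier (U_prime D)"
      using sF.closed by blast
    fix m assume "m \<in> U_prime_gen D ` gens D"
    then obtain g where g: "g \<in> gens D" "m = U_prime_gen D g" by blast
    define h where "h = (case g of F i \<Rightarrow> t_exp D i | _ \<Rightarrow> 0)"
    have "h \<in> coroot_lattice D" using g(1) by (cases g) (simp_all add: h_def)
    moreover have "m = 1 \<odot>\<^bsub>U_prime D\<^esub> (U_prime_coords D (Q h) \<otimes>\<^bsub>U_prime D\<^esub> U_prime_coords D g)"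
      using g by (cases g) (simp_all add: h_def Q_zero move_Q)
    ultimately show "\<exists>r. \<exists>u\<in>U_prime_coords D ` gens D. \<exists>v\<in>U_prime_coords D ` gens D. m = r \<odot>\<^bsub>U_prime D\<^esub> (u \<otimes>\<^bsub>U_prime D\<^esub> v)"
      using g(1) by (metis gens_simps(3) imageI)
  qed
  show "extends_coords D (U_prime D) (U_prime_gen D) (U_prime_coords D) C \<phi> y"
    if y: "hopf_relations D C y 0 0" and \<phi>: "\<And>g. g \<in> gens D \<Longrightarrow> shift_F D C y g = \<phi> g"
  proof -
    interpret y: hopf_relations D C y 0 0 by fact
    interpret y': common_relations D C "shift_F D C y" by (rule y.twist_variants)
    interpret evC: evaluation C "gens D" "shift_F D C y" by (rule evaluationI) (rule y.assoc_algebra, rule y'.closed)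
    have "\<exists>f. alg_hom W.P C f \<and> (\<forall>g\<in>gens D. f (W.gen g) = shift_F D C y g)"
    proof (rule W.hom_exists[OF y'.common_relations_axioms])
      fix i j assume ij: "i \<in> index D" "j \<in> index D"
      then have "shift_F D C y (F j) \<otimes>\<^bsub>C\<^esub> shift_F D C y (E i) \<in> carrier C" by simp
      then show "shift_F D C y (E i) \<otimes>\<^bsub>C\<^esub> shift_F D C y (F j) =
        qpow (- half_norm D i * root D j (coroot D i)) \<odot>\<^bsub>C\<^esub> (shift_F D C y (F j) \<otimes>\<^bsub>C\<^esub> shift_F D C y (E i)) \<oplus>\<^bsub>C\<^esub>
        eval_free C (shift_F D C y) 0"
        unfolding y.hopf_to_U_prime[OF refl refl ij] evC.ev_simps by simp
    qed
    then obtain f where f: "alg_hom (U_prime D) C f" "\<And>g. g \<in> gens D \<Longrightarrow> f (U_prime_gen D g) = shift_F D C y g"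
      unfolding fold same_algebra_alg_hom[OF same] by blast
    show ?thesis
    proof (rule well_defined_hom_coords[OF gen assoc_algebra closed f(1)])
      show "f (U_prime_coords D g) = y g" if "g \<in> gens D" for g
        using that by (cases g) (simp_all add: alg_homD(2)[OF f(1)] f(2) y.Q_mult' y.Q_zero)
    qed (simp_all add: f(2) \<phi> sF.closed)
  qed
qed

lemma U_hat_object: "hopf_object D (U_hat D) (U_hat_gen D) 1 1"
  and U_hat_hom: "hopf_relations D C y 1 1 \<Longrightarrow> (\<And>g. g \<in> gens D \<Longrightarrow> y g = \<phi> g) \<Longrightarrow>
    extends_coords D (U_hat D) (U_hat_gen D) (U_hat_gen D) C \<phi> y"
  for C :: "(rat fps, 'c, 'm) module_scheme"
proof -
  interpret V: exchange_presentation D "\<lambda>i j. 1"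
    "\<lambda>i j. if i = j then letter (Q (t_exp D i)) - letter (Q (- t_exp D i)) else 0" "U_hat_rels D"
    by (rule U_hat_presentation)
  have fold: "V.P = U_hat_alg D" "V.gen = U_hat_gen D"
    by (simp_all add: U_hat_alg_def U_hat_gen_def)
  note same = same_algebra_U_hat[of D]
  interpret V0: common_relations D "U_hat_alg D" "U_hat_gen D"
    using V.presented_relations unfolding fold .
  interpret ev: evaluation "U_hat_alg D" "gens D" "U_hat_gen D"
    by (rule evaluationI) (rule V0.assoc_algebra, rule V0.closed)
  have "hopf_relations D (U_hat_alg D) (U_hat_gen D) 1 1"
  proof
    fix i j assume ij: "i \<in> index D" "j \<in> index D"
    show "U_hat_gen D (E i) \<otimes>\<^bsub>U_hat_alg D\<^esub> U_hat_gen D (F j) =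
      U_hat_gen D (F j) \<otimes>\<^bsub>U_hat_alg D\<^esub> U_hat_gen D (E i) \<oplus>\<^bsub>U_hat_alg D\<^esub>
      (if i = j then 1 \<odot>\<^bsub>U_hat_alg D\<^esub> U_hat_gen D (Q (t_exp D i)) \<ominus>\<^bsub>U_hat_alg D\<^esub> 1 \<odot>\<^bsub>U_hat_alg D\<^esub> U_hat_gen D (Q (- t_exp D i))
       else \<zero>\<^bsub>U_hat_alg D\<^esub>)"
      using V.presented_exchange[OF ij] ij unfolding fold
      by (cases "i = j") (simp_all add: ev.ev_simps rel_closed)
  qed
  moreover have gen0: "generates (U_hat_alg D) (U_hat_gen D ` gens D)"
    using V.generates_presented unfolding fold .
  ultimately have "hopf_object D (U_hat_alg D) (U_hat_gen D) 1 1"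
    by (intro hopf_object.intro hopf_object_axioms.intro)
  then show obj: "hopf_object D (U_hat D) (U_hat_gen D) 1 1"
    by (rule hopf_object_same[OF same])
  interpret hopf_object D "U_hat D" "U_hat_gen D" 1 1 by (rule obj)
  show "extends_coords D (U_hat D) (U_hat_gen D) (U_hat_gen D) C \<phi> y"
    if y: "hopf_relations D C y 1 1" and \<phi>: "\<And>g. g \<in> gens D \<Longrightarrow> y g = \<phi> g"
  proof -
    interpret y: hopf_relations D C y 1 1 by fact
    interpret evC: evaluation C "gens D" y by (rule evaluationI) (rule y.assoc_algebra, rule y.closed)
    have "\<exists>f. alg_hom V.P C f \<and> (\<forall>g\<in>gens D. f (V.gen g) = y g)"
      by (rule V.hom_exists[OF y.common_relations_axioms]) (simp add: y.E_F evC.ev_simps rel_closed)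
    then obtain f where f: "alg_hom (U_hat D) C f" "\<And>g. g \<in> gens D \<Longrightarrow> f (U_hat_gen D g) = y g"
      unfolding fold same_algebra_alg_hom[OF same] by blast
    show ?thesis
      by (rule well_defined_hom_coords[OF generated assoc_algebra closed f(1)]) (simp_all add: f(2) \<phi> closed)
  qed
qed

end

section \<open>Hopf-Galois systems from the cogroupoid\<close>

lemma counit_nonzero:
  assumes "assoc_algebra A" "alg_hom A ground_algebra \<epsilon>"
  shows "\<one>\<^bsub>A\<^esub> \<noteq> \<zero>\<^bsub>A\<^esub>"
  using alg_hom_zero[OF assms(2,1) assoc_algebra_ground] alg_homD(4)[OF assms(2)] by auto

text \<open>Coassociativity for the scalars \<open>a, a, a, b\<close>.\<close>

lemma left_comodule_algebraI:
  assumes A: "hopf_object D A x a a" and T: "hopf_object D T t a b"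
    and \<Delta>: "is_comult D A x A x A x (comult A)" and \<epsilon>: "is_counit D A x (counit A)"
    and \<alpha>: "is_comult D T t A x T t \<alpha>"
  shows "left_comodule_algebra A T \<alpha>"
proof -
  interpret A: hopf_object D A x a a by fact
  interpret T: hopf_object D T t a b by fact
  show ?thesis
    unfolding left_comodule_algebra_def
    using coassociativity[OF T A.hopf_relations_axioms A.hopf_relations_axioms T.hopf_relations_axioms A.hopf_relations_axioms
        T.hopf_relations_axioms \<alpha> \<Delta> \<alpha> \<alpha>] counit_left[OF T A.hopf_relations_axioms \<alpha> \<epsilon>] is_comultD(1)[OF \<alpha>] T.assoc_algebra
    by blast
qed

text \<open>Coassociativity for the scalars \<open>a, b, b, b\<close>.\<close>

lemma right_comodule_algebraI:
  assumes B: "hopf_object D B x b b" and T: "hopf_object D T t a b"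
    and \<Delta>: "is_comult D B x B x B x (comult B)" and \<epsilon>: "is_counit D B x (counit B)"
    and \<beta>: "is_comult D T t T t B x \<beta>"
  shows "right_comodule_algebra B T \<beta>"
proof -
  interpret B: hopf_object D B x b b by fact
  interpret T: hopf_object D T t a b by fact
  show ?thesis
    unfolding right_comodule_algebra_def
    using coassociativity[OF T T.hopf_relations_axioms B.hopf_relations_axioms B.hopf_relations_axioms T.hopf_relations_axioms
        B.hopf_relations_axioms \<beta> \<beta> \<beta> \<Delta>] counit_right[OF T B.hopf_relations_axioms \<beta> \<epsilon>] is_comultD(1)[OF \<beta>] T.assoc_algebra
    by blast
qed

lemma bialgebraI:
  assumes "hopf_object D A x a a" "is_comult D A x A x A x (comult A)" "is_counit D A x (counit A)"
  shows "bialgebra A"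
  unfolding bialgebra_def
  using left_comodule_algebraI[OF assms(1,1,2,3,2)] right_comodule_algebraI[OF assms(1,1,2,3,2)] is_counitD(1)[OF assms(3)]
  by blast

text \<open>With \<open>A = H[a,a]\<close>, \<open>B = H[b,b]\<close>, \<open>T = H[a,b]\<close> and \<open>Z = H[b,a]\<close>, the compatibilities between \<open>\<alpha>\<close>, \<open>\<beta>\<close>,
\<open>\<gamma>\<close>, \<open>\<delta>\<close> and the comultiplications are coassociativity along paths of four scalars, for instance
\<open>a, b, a, b\<close> for the one that relates \<open>\<gamma>\<close> and \<open>\<delta>\<close> on \<open>T\<close>; the conditions on \<open>S\<close> are the antipode laws.\<close>

lemma hopf_galois_systemI:
  assumes A: "hopf_object D A x a a" and B: "hopf_object D B y b b" and T: "hopf_object D T t a b" and Z: "hopf_object D Z z b a"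
    and nz: "nonzero_algebra A" "nonzero_algebra B" "nonzero_algebra T" "nonzero_algebra Z"
    and \<Delta>A: "is_comult D A x A x A x (comult A)" and \<epsilon>A: "is_counit D A x (counit A)"
    and \<Delta>B: "is_comult D B y B y B y (comult B)" and \<epsilon>B: "is_counit D B y (counit B)"
    and \<alpha>: "is_comult D T t A x T t \<alpha>" and \<beta>: "is_comult D T t T t B y \<beta>"
    and \<gamma>: "is_comult D A x T t Z z \<gamma>" and \<delta>: "is_comult D B y Z z T t \<delta>"
    and S: "is_antipode D Z z T t S"
  shows "hopf_galois_system A B T Z \<alpha> \<beta> \<gamma> \<delta> S"
proof -
  interpret A: hopf_object D A x a a by fact
  interpret B: hopf_object D B y b b by fact
  interpret T: hopf_object D T t a b by fact
  interpret Z: hopf_object D Z z b a by fact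
  note r = A.hopf_relations_axioms B.hopf_relations_axioms T.hopf_relations_axioms Z.hopf_relations_axioms
  show ?thesis
    unfolding hopf_galois_system_def bicomodule_algebra_def
  proof (intro conjI ballI nz)
    show "bialgebra A" by (rule bialgebraI[OF A \<Delta>A \<epsilon>A])
    show "bialgebra B" by (rule bialgebraI[OF B \<Delta>B \<epsilon>B])
    show "left_comodule_algebra A T \<alpha>" by (rule left_comodule_algebraI[OF A T \<Delta>A \<epsilon>A \<alpha>])
    show "right_comodule_algebra B T \<beta>" by (rule right_comodule_algebraI[OF B T \<Delta>B \<epsilon>B \<beta>])
    show "alg_hom A (T \<boxtimes> Z) \<gamma>" "alg_hom B (Z \<boxtimes> T) \<delta>" by (rule is_comultD(1)[OF \<gamma>], rule is_comultD(1)[OF \<delta>])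
    show "linear_map Z T S" by (rule anti_hom_linear[OF is_antipodeD(1)[OF S]])
    fix u
    { assume u: "u \<in> carrier T"
      show "assoc_map A T B (tensor_map (A \<boxtimes> T) B \<alpha> (\<lambda>y. y) (\<beta> u)) = tensor_map A (T \<boxtimes> B) (\<lambda>y. y) \<beta> (\<alpha> u)"
        by (rule coassociativity[OF T r(1,3,2,3,3) \<beta> \<alpha> \<alpha> \<beta> u])
      show "assoc_map T Z T (tensor_map (T \<boxtimes> Z) T \<gamma> (\<lambda>y. y) (\<alpha> u)) = tensor_map T (Z \<boxtimes> T) (\<lambda>y. y) \<delta> (\<beta> u)"
        by (rule coassociativity[OF T r(3,4,3,1,2) \<alpha> \<gamma> \<beta> \<delta> u]) }
    { assume u: "u \<in> carrier A"
      show "tensor_map A (T \<boxtimes> Z) (\<lambda>y. y) \<gamma> (comult A u) = assoc_map A T Z (tensor_map (A \<boxtimes> T) Z \<alpha> (\<lambda>y. y) (\<gamma> u))"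
        by (rule coassociativity[OF A r(1,3,4,3,1) \<gamma> \<alpha> \<Delta>A \<gamma> u, symmetric])
      show "mult_map T (tensor_map T T (\<lambda>y. y) S (\<gamma> u)) = counit A u \<odot>\<^bsub>T\<^esub> \<one>\<^bsub>T\<^esub>"
        by (rule antipode_right[OF A r(3,4) \<gamma> S \<epsilon>A u]) }
    { assume u: "u \<in> carrier B"
      show "assoc_map Z T B (tensor_map (Z \<boxtimes> T) B \<delta> (\<lambda>y. y) (comult B u)) = tensor_map Z (T \<boxtimes> B) (\<lambda>y. y) \<beta> (\<delta> u)"
        by (rule coassociativity[OF B r(4,3,2,2,3) \<Delta>B \<delta> \<delta> \<beta> u])
      show "mult_map T (tensor_map T T S (\<lambda>y. y) (\<delta> u)) = counit B u \<odot>\<^bsub>T\<^esub> \<one>\<^bsub>T\<^esub>"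
        by (rule antipode_left[OF B r(3,4) \<delta> S \<epsilon>B u]) }
  qed
qed

lemma antipodeI:
  assumes A: "hopf_object D A x a a"
    and \<Delta>: "is_comult D A x A x A x (comult A)" and \<epsilon>: "is_counit D A x (counit A)" and S: "is_antipode D A x A x S"
  shows "antipode A S"
proof -
  interpret A: hopf_object D A x a a by fact
  note r = A.hopf_relations_axioms
  show ?thesis
    unfolding antipode_def
    using antipode_right[OF A r r \<Delta> S \<epsilon>] antipode_left[OF A r r \<Delta> S \<epsilon>] anti_hom_linear[OF is_antipodeD(1)[OF S]]
    by blast
qed

text \<open>The roles of \<open>a\<close> and \<open>b\<close> are symmetric, so the second Hopf-Galois system is an instance of the first
construction.\<close>

lemma complete_hopf_galois_systemI:
  assumes A: "hopf_object D A x a a" and B: "hopf_object D B y b b" and T: "hopf_object D T t a b" and Z: "hopf_object D Z z b a"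
    and nz: "nonzero_algebra A" "nonzero_algebra B" "nonzero_algebra T" "nonzero_algebra Z"
    and \<Delta>A: "is_comult D A x A x A x (comult A)" and \<epsilon>A: "is_counit D A x (counit A)"
    and \<Delta>B: "is_comult D B y B y B y (comult B)" and \<epsilon>B: "is_counit D B y (counit B)"
    and \<alpha>: "is_comult D T t A x T t \<alpha>" and \<beta>: "is_comult D T t T t B y \<beta>"
    and lam: "is_comult D Z z B y Z z lam" and \<rho>: "is_comult D Z z Z z A x \<rho>"
    and \<gamma>: "is_comult D A x T t Z z \<gamma>" and \<delta>: "is_comult D B y Z z T t \<delta>"
    and ST: "is_antipode D T t Z z S\<^sub>T" and SZ: "is_antipode D Z z T t S\<^sub>Z"
    and SA: "is_antipode D A x A x S\<^sub>A" and SB: "is_antipode D B y B y S\<^sub>B"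
  shows "complete_hopf_galois_system A B T Z S\<^sub>A S\<^sub>B \<alpha> \<beta> lam \<rho> \<gamma> \<delta> S\<^sub>T S\<^sub>Z"
proof -
  interpret A: hopf_object D A x a a by fact
  interpret B: hopf_object D B y b b by fact
  interpret T: hopf_object D T t a b by fact
  interpret Z: hopf_object D Z z b a by fact
  note r = A.hopf_relations_axioms B.hopf_relations_axioms T.hopf_relations_axioms Z.hopf_relations_axioms
  show ?thesis
    unfolding complete_hopf_galois_system_def
  proof (intro conjI ballI)
    show "hopf_galois_system A B T Z \<alpha> \<beta> \<gamma> \<delta> S\<^sub>Z"
      by (rule hopf_galois_systemI[OF A B T Z nz \<Delta>A \<epsilon>A \<Delta>B \<epsilon>B \<alpha> \<beta> \<gamma> \<delta> SZ])
    show "hopf_galois_system B A Z T lam \<rho> \<delta> \<gamma> S\<^sub>T"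
      by (rule hopf_galois_systemI[OF B A Z T nz(2,1,4,3) \<Delta>B \<epsilon>B \<Delta>A \<epsilon>A lam \<rho> \<delta> \<gamma> ST])
    show "antipode A S\<^sub>A" by (rule antipodeI[OF A \<Delta>A \<epsilon>A SA])
    show "antipode B S\<^sub>B" by (rule antipodeI[OF B \<Delta>B \<epsilon>B SB])
    fix u
    { assume u: "u \<in> carrier A"
      show "assoc_map T B Z (tensor_map (T \<boxtimes> B) Z \<beta> (\<lambda>y. y) (\<gamma> u)) = tensor_map T (B \<boxtimes> Z) (\<lambda>y. y) lam (\<gamma> u)"
        by (rule coassociativity[OF A r(3,2,4,3,4) \<gamma> \<beta> \<gamma> lam u])
      show "flip_map Z T (tensor_map Z T S\<^sub>T S\<^sub>Z (\<gamma> u)) = \<gamma> (S\<^sub>A u)"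
        by (rule antipode_anticomultiplicative[OF A r(3,4,1,4,3) \<gamma> \<gamma> SA ST SZ u]) }
    { assume u: "u \<in> carrier B"
      show "assoc_map Z A T (tensor_map (Z \<boxtimes> A) T \<rho> (\<lambda>y. y) (\<delta> u)) = tensor_map Z (A \<boxtimes> T) (\<lambda>y. y) \<alpha> (\<delta> u)"
        by (rule coassociativity[OF B r(4,1,3,4,3) \<delta> \<rho> \<delta> \<alpha> u])
      show "flip_map T Z (tensor_map T Z S\<^sub>Z S\<^sub>T (\<delta> u)) = \<delta> (S\<^sub>B u)"
        by (rule antipode_anticomultiplicative[OF B r(4,3,2,3,4) \<delta> \<delta> SB SZ ST u]) }
    { assume u: "u \<in> carrier T"
      show "flip_map A Z (tensor_map A Z S\<^sub>A S\<^sub>T (\<alpha> u)) = \<rho> (S\<^sub>T u)"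
        by (rule antipode_anticomultiplicative[OF T r(1,3,4,1,4) \<alpha> \<rho> ST SA ST u])
      show "flip_map Z B (tensor_map Z B S\<^sub>T S\<^sub>B (\<beta> u)) = lam (S\<^sub>T u)"
        by (rule antipode_anticomultiplicative[OF T r(3,2,4,4,2) \<beta> lam ST ST SB u]) }
    { assume u: "u \<in> carrier Z"
      show "flip_map B T (tensor_map B T S\<^sub>B S\<^sub>Z (lam u)) = \<beta> (S\<^sub>Z u)"
        by (rule antipode_anticomultiplicative[OF Z r(2,4,3,2,3) lam \<beta> SZ SB SZ u])
      show "flip_map T A (tensor_map T A S\<^sub>Z S\<^sub>A (\<rho> u)) = \<alpha> (S\<^sub>Z u)"
        by (rule antipode_anticomultiplicative[OF Z r(4,1,3,3,1) \<rho> \<alpha> SZ SZ SA u]) }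
  qed
qed

section \<open>The Kashiwara algebra is nonzero\<close>

text \<open>Linear operators on the space of all rational-valued functions on a set, where a power
series acts through its constant term: the
formal parameter acts as \<open>0\<close> and \<open>q\<close> as \<open>1\<close>.\<close>

definition operator_algebra :: "(rat fps, ('x \<Rightarrow> rat) \<Rightarrow> 'x \<Rightarrow> rat) module" where
  "operator_algebra =
     \<lparr>carrier = {A. (\<forall>u v. A (\<lambda>n. u n + v n) = (\<lambda>n. A u n + A v n)) \<and> (\<forall>c u. A (\<lambda>n. c * u n) = (\<lambda>n. c * A u n))},
      monoid.mult = (\<lambda>A B u. A (B u)), one = (\<lambda>u. u), ring.zero = (\<lambda>u n. 0),
      add = (\<lambda>A B u n. A u n + B u n), module.smult = (\<lambda>r A u n. fps_nth r 0 * A u n)\<rparr>"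

lemma operator_algebra_simps [simp]:
  "A \<otimes>\<^bsub>operator_algebra\<^esub> B = (\<lambda>u. A (B u))"
  "A \<oplus>\<^bsub>operator_algebra\<^esub> B = (\<lambda>u n. A u n + B u n)"
  "\<one>\<^bsub>operator_algebra\<^esub> = (\<lambda>u. u)"
  "\<zero>\<^bsub>operator_algebra\<^esub> = (\<lambda>u n. 0)"
  "r \<odot>\<^bsub>operator_algebra\<^esub> A = (\<lambda>u n. fps_nth r 0 * A u n)"
  by (simp_all add: operator_algebra_def)

lemma operator_algebra_carrier:
  "A \<in> carrier operator_algebra \<longleftrightarrow>
    (\<forall>u v. A (\<lambda>n. u n + v n) = (\<lambda>n. A u n + A v n)) \<and> (\<forall>c u. A (\<lambda>n. c * u n) = (\<lambda>n. c * A u n))"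
  by (simp add: operator_algebra_def)

lemma assoc_algebra_operator: "assoc_algebra operator_algebra"
proof (rule assoc_algebraI)
  show "ring (operator_algebra :: (rat fps, ('x \<Rightarrow> rat) \<Rightarrow> 'x \<Rightarrow> rat) module)"
  proof (rule ringI)
    show "abelian_group (operator_algebra :: (rat fps, ('x \<Rightarrow> rat) \<Rightarrow> 'x \<Rightarrow> rat) module)"
    proof (rule abelian_groupI)
      fix A :: "('x \<Rightarrow> rat) \<Rightarrow> 'x \<Rightarrow> rat"
      assume "A \<in> carrier operator_algebra"
      then show "\<exists>B\<in>carrier operator_algebra. B \<oplus>\<^bsub>operator_algebra\<^esub> A = \<zero>\<^bsub>operator_algebra\<^esub>"
        by (intro bexI[of _ "\<lambda>u n. - A u n"]) (simp_all add: operator_algebra_carrier)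
    qed (simp_all add: operator_algebra_carrier algebra_simps)
    show "Group.monoid (operator_algebra :: (rat fps, ('x \<Rightarrow> rat) \<Rightarrow> 'x \<Rightarrow> rat) module)"
      by (rule monoidI) (simp_all add: operator_algebra_carrier)
  qed (simp_all add: operator_algebra_carrier)
qed (simp_all add: operator_algebra_carrier distrib_left distrib_right mult.assoc mult.left_commute)

text \<open>If \<open>u n\<close> is read as the coefficient of the divided power monomial of exponent \<open>n\<close>, then \<open>E i\<close> is the derivative
with respect to the \<open>i\<close>-th variable and \<open>F i\<close> the multiplication by it. When \<open>n i = 0\<close> the factor \<open>n i\<close> kills the
meaningless value of \<open>u\<close> at the truncated difference.\<close>

fun weyl_gen :: "('i, 't) gen \<Rightarrow> (('i \<Rightarrow> nat) \<Rightarrow> rat) \<Rightarrow> ('i \<Rightarrow> nat) \<Rightarrow> rat" where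
  "weyl_gen (E i) u n = u (n(i := Suc (n i)))"
| "weyl_gen (F i) u n = of_nat (n i) * u (n(i := n i - 1))"
| "weyl_gen (Q h) u n = u n"

context quantum_datum
begin

text \<open>At \<open>q = 1\<close> the iterated q-commutators are ordinary commutators, and operators in different variables
commute.\<close>

lemma weyl_relations: "common_relations D operator_algebra weyl_gen"
proof -
  interpret Op: assoc_alg "operator_algebra :: (rat fps, (('i \<Rightarrow> nat) \<Rightarrow> rat) \<Rightarrow> ('i \<Rightarrow> nat) \<Rightarrow> rat) module"
    by (rule assoc_alg.intro) (rule assoc_algebra_operator)
  have cl: "weyl_gen g \<in> carrier operator_algebra" for g :: "('i, 't) gen"
    by (cases g) (auto simp: operator_algebra_carrier fun_eq_iff algebra_simps)
  \<comment> \<open>The first commutator vanishes already, so every chain of positive length does.\<close>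
  have chain: "qchain operator_algebra (q_seq d N) A B m = (\<lambda>u n. 0)"
    if "A \<in> carrier operator_algebra" "B \<in> carrier operator_algebra" "\<And>u. A (B u) = B (A u)" "m > 0"
    for A B :: "(('i \<Rightarrow> nat) \<Rightarrow> rat) \<Rightarrow> ('i \<Rightarrow> nat) \<Rightarrow> rat" and d N m
    using that(4)
  proof (induction m)
    case (Suc m)
    have c: "fps_nth (q_seq d N m) 0 = 1" by (simp add: q_seq_def)
    have A0: "A (\<lambda>n. 0) = (\<lambda>n. 0)"
    proof -
      have "A (\<lambda>n. c * u n) = (\<lambda>n. c * A u n)" for c u
        using that(1) by (simp add: operator_algebra_carrier)
      from this[of 0 "\<lambda>_. 0"] show ?thesis by simp
    qed
    have diff: "S \<ominus>\<^bsub>operator_algebra\<^esub> S = \<zero>\<^bsub>operator_algebra\<^esub>" if "S \<in> carrier operator_algebra"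
      for S :: "(('i \<Rightarrow> nat) \<Rightarrow> rat) \<Rightarrow> ('i \<Rightarrow> nat) \<Rightarrow> rat"
      using that by (simp only: a_minus_def Op.r_neg)
    show ?case
    proof (cases "m = 0")
      case True
      have "(\<lambda>u. B (A u)) \<in> carrier operator_algebra" using Op.m_closed[OF that(2,1)] by simp
      from diff[OF this] show ?thesis using True c that(3) by (simp add: q_seq_def)
    next
      case False
      then show ?thesis using Suc.IH c A0 diff[OF Op.zero_closed] by simp
    qed
  qed simp
  show ?thesis
  proof
    fix i j assume ij: "i \<in> index D" "j \<in> index D" "i \<noteq> j"
    have comm: "weyl_gen (E i :: ('i, 't) gen) (weyl_gen (E j :: ('i, 't) gen) u) =
        weyl_gen (E j :: ('i, 't) gen) (weyl_gen (E i :: ('i, 't) gen) u)" for u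
    proof
      show "weyl_gen (E i :: ('i, 't) gen) (weyl_gen (E j :: ('i, 't) gen) u) n =
          weyl_gen (E j :: ('i, 't) gen) (weyl_gen (E i :: ('i, 't) gen) u) n" for n
        using ij(3) fun_upd_twist[OF ij(3), of n "Suc (n i)" "Suc (n j)"] by simp
    qed
    show "serre_chain D operator_algebra i j (weyl_gen (E i :: ('i, 't) gen)) (weyl_gen (E j :: ('i, 't) gen)) = \<zero>\<^bsub>operator_algebra\<^esub>"
      unfolding operator_algebra_simps by (rule chain[of "weyl_gen (E i :: ('i, 't) gen)" "weyl_gen (E j :: ('i, 't) gen)", OF cl cl comm serre_len(2)[OF ij]])
    have comm: "weyl_gen (F i :: ('i, 't) gen) (weyl_gen (F j :: ('i, 't) gen) u) =
        weyl_gen (F j :: ('i, 't) gen) (weyl_gen (F i :: ('i, 't) gen) u)" for u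
    proof
      show "weyl_gen (F i :: ('i, 't) gen) (weyl_gen (F j :: ('i, 't) gen) u) n =
          weyl_gen (F j :: ('i, 't) gen) (weyl_gen (F i :: ('i, 't) gen) u) n" for n
        using ij(3) fun_upd_twist[OF ij(3), of n "n i - 1" "n j - 1"] by simp
    qed
    show "serre_chain D operator_algebra i j (weyl_gen (F i :: ('i, 't) gen)) (weyl_gen (F j :: ('i, 't) gen)) = \<zero>\<^bsub>operator_algebra\<^esub>"
      unfolding operator_algebra_simps by (rule chain[of "weyl_gen (F i :: ('i, 't) gen)" "weyl_gen (F j :: ('i, 't) gen)", OF cl cl comm serre_len(2)[OF ij]])
  next
    fix h and i :: 'i
    show "weyl_gen (Q h) \<otimes>\<^bsub>operator_algebra\<^esub> weyl_gen (E i) =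
        qpow (root D i h) \<odot>\<^bsub>operator_algebra\<^esub> (weyl_gen (E i) \<otimes>\<^bsub>operator_algebra\<^esub> weyl_gen (Q h))"
      "weyl_gen (Q h) \<otimes>\<^bsub>operator_algebra\<^esub> weyl_gen (F i) =
        qpow (- root D i h) \<odot>\<^bsub>operator_algebra\<^esub> (weyl_gen (F i) \<otimes>\<^bsub>operator_algebra\<^esub> weyl_gen (Q h))"
      by (simp_all add: fun_eq_iff)
  qed (simp_all add: cl fun_eq_iff)
qed

lemma kashiwara_nonzero: "\<one>\<^bsub>kashiwara D\<^esub> \<noteq> \<zero>\<^bsub>kashiwara D\<^esub>"
proof -
  interpret B: exchange_presentation D "\<lambda>i j. qpow (half_norm D i * root D j (coroot D i))" "\<lambda>i j. if i = j then 1 else 0"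
    "kashiwara_rels D"
    by (rule kashiwara_presentation)
  interpret W: common_relations D operator_algebra weyl_gen by (rule weyl_relations)
  interpret ev: evaluation operator_algebra "gens D" weyl_gen
    by (rule evaluationI) (rule W.assoc_algebra, rule W.closed)
  have EF: "weyl_gen (E i :: ('i, 't) gen) (weyl_gen (F j :: ('i, 't) gen) u) n =
      weyl_gen (F j :: ('i, 't) gen) (weyl_gen (E i :: ('i, 't) gen) u) n + (if i = j then u n else 0)"
    for i j u n
  proof (cases "i = j")
    case True
    then show ?thesis by (cases "n j") (simp_all add: fun_upd_idem algebra_simps)
  next
    case False
    then show ?thesis using fun_upd_twist[OF False, of n "Suc (n i)" "n j - 1"] by simp
  qed
  have "\<exists>f. alg_hom B.P operator_algebra f \<and> (\<forall>g\<in>gens D. f (B.gen g) = (weyl_gen g :: (('i \<Rightarrow> nat) \<Rightarrow> rat) \<Rightarrow> _))"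
    by (rule B.hom_exists[OF weyl_relations])
      (simp add: ev.ev_simps fun_eq_iff EF del: weyl_gen.simps)
  then obtain f :: "_ \<Rightarrow> (('i \<Rightarrow> nat) \<Rightarrow> rat) \<Rightarrow> ('i \<Rightarrow> nat) \<Rightarrow> rat" where f: "alg_hom (kashiwara D) operator_algebra f"
    by (auto simp: kashiwara_def)
  have "(\<lambda>u. u) \<noteq> (\<lambda>(u :: ('i \<Rightarrow> nat) \<Rightarrow> rat) n. 0)"
    by (metis zero_neq_one)
  then show ?thesis
    using alg_homD(4)[OF f] alg_hom_zero[OF f B.assoc_algebra_presented[folded kashiwara_def] assoc_algebra_operator] by auto
qed

end

section \<open>The structure maps\<close>

context quantum_datum
begin

text \<open>The indices are the scalars \<open>a\<close> and \<open>b\<close> of the family \<open>H[a,b]\<close>.\<close>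

abbreviation "A00 \<equiv> U_prime D"
abbreviation "A11 \<equiv> U_hat D"
abbreviation "A01 \<equiv> kashiwara D"
abbreviation "A10 \<equiv> kashiwara_op D"
abbreviation "x00 \<equiv> U_prime_coords D"
abbreviation "x11 \<equiv> U_hat_gen D"
abbreviation "x01 \<equiv> kashiwara_coords D"
abbreviation "x10 \<equiv> kashiwara_op_coords D"

lemmas relations_W = hopf_object.axioms(1)[OF U_prime_object]
lemmas relations_V = hopf_object.axioms(1)[OF U_hat_object]
lemmas relations_B = hopf_object.axioms(1)[OF kashiwara_object]
lemmas relations_O = hopf_object.axioms(1)[OF kashiwara_op_object]

lemma kashiwara_gen_relations: "common_relations D A01 (kashiwara_gen D)"
proof -
  interpret B: exchange_presentation D "\<lambda>i j. qpow (half_norm D i * root D j (coroot D i))" "\<lambda>i j. if i = j then 1 else 0"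
    "kashiwara_rels D"
    by (rule kashiwara_presentation)
  show ?thesis using B.presented_relations by (simp add: kashiwara_def kashiwara_gen_def)
qed

text \<open>In each case the inverse substitution turns the cogroupoid formula into the prescribed values on
generators, so that the prescribed map exists and is the corresponding comultiplication, counit or
antipode. The identity is an antipode because the coordinates of the opposite Kashiwara algebra
are the antipodes of those of the Kashiwara algebra.\<close>

lemma structure_maps:
  shows "well_defined_hom A00 (gens D) (U_prime_gen D) (A00 \<boxtimes> A00) (U_prime_comult_on D) \<and>
      is_comult D A00 x00 A00 x00 A00 x00 (induced_hom A00 (gens D) (U_prime_gen D) (A00 \<boxtimes> A00) (U_prime_comult_on D))"
    and "well_defined_hom A11 (gens D) (U_hat_gen D) (A11 \<boxtimes> A11) (U_hat_comult_on D) \<and>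
      is_comult D A11 x11 A11 x11 A11 x11 (induced_hom A11 (gens D) (U_hat_gen D) (A11 \<boxtimes> A11) (U_hat_comult_on D))"
    and "well_defined_hom A01 (gens D) (kashiwara_gen D) (A00 \<boxtimes> A01) (alpha_B_on D) \<and> is_comult D A01 x01 A00 x00 A01 x01 (alpha_B D)"
    and "well_defined_hom A01 (gens D) (kashiwara_gen D) (A01 \<boxtimes> A11) (beta_B_on D) \<and> is_comult D A01 x01 A01 x01 A11 x11 (beta_B D)"
    and "well_defined_hom A10 (gens D) (kashiwara_gen D) (A11 \<boxtimes> A10) (alpha_Bop_on D) \<and>
      is_comult D A10 x10 A11 x11 A10 x10 (alpha_Bop D)"
    and "well_defined_hom A10 (gens D) (kashiwara_gen D) (A10 \<boxtimes> A00) (beta_Bop_on D) \<and>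
      is_comult D A10 x10 A10 x10 A00 x00 (beta_Bop D)"
    and "well_defined_hom A00 (gens D) (U_prime_gen D) (A01 \<boxtimes> A10) (gamma_on D) \<and> is_comult D A00 x00 A01 x01 A10 x10 (gamma_B D)"
    and "well_defined_hom A11 (gens D) (U_hat_gen D) (A10 \<boxtimes> A01) (delta_on D) \<and> is_comult D A11 x11 A10 x10 A01 x01 (delta_B D)"
    and "well_defined_hom A00 (gens D) (U_prime_gen D) ground_algebra U_counit_on \<and>
      is_counit D A00 x00 (induced_hom A00 (gens D) (U_prime_gen D) ground_algebra U_counit_on)"
    and "well_defined_hom A11 (gens D) (U_hat_gen D) ground_algebra U_counit_on \<and>
      is_counit D A11 x11 (induced_hom A11 (gens D) (U_hat_gen D) ground_algebra U_counit_on)"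
    and "well_defined_hom A00 (gens D) (U_prime_gen D) (op_algebra A00) (U_prime_antipode_on D) \<and>
      is_antipode D A00 x00 A00 x00 (induced_hom A00 (gens D) (U_prime_gen D) (op_algebra A00) (U_prime_antipode_on D))"
    and "well_defined_hom A11 (gens D) (U_hat_gen D) (op_algebra A11) (U_hat_antipode_on D) \<and>
      is_antipode D A11 x11 A11 x11 (induced_hom A11 (gens D) (U_hat_gen D) (op_algebra A11) (U_hat_antipode_on D))"
    and "well_defined_hom A01 (gens D) (kashiwara_gen D) (op_algebra A10) (theta_B_on D) \<and> is_antipode D A01 x01 A10 x10 (S_B D)"
    and "is_antipode D A10 x10 A01 x01 S_Bop"
proof -
  interpret W: hopf_object D A00 x00 0 0 by (rule U_prime_object)
  interpret V: hopf_object D A11 x11 1 1 by (rule U_hat_object)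
  interpret B: hopf_object D A01 x01 0 1 by (rule kashiwara_object)
  interpret Op: hopf_object D A10 x10 1 0 by (rule kashiwara_op_object)
  interpret Wg: common_relations D A00 "U_prime_gen D" by (rule U_prime_gen_relations)
  interpret Bg: common_relations D A01 "kashiwara_gen D" by (rule kashiwara_gen_relations)
  interpret WW: tensor_pair A00 A00 by (rule tensor_pairI) (rule W.assoc_algebra)+
  interpret VV: tensor_pair A11 A11 by (rule tensor_pairI) (rule V.assoc_algebra)+
  interpret WB: tensor_pair A00 A01 by (rule tensor_pairI) (rule W.assoc_algebra B.assoc_algebra)+
  interpret BV: tensor_pair A01 A11 by (rule tensor_pairI) (rule V.assoc_algebra B.assoc_algebra)+
  interpret VO: tensor_pair A11 A10 by (rule tensor_pairI) (rule V.assoc_algebra Op.assoc_algebra)+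
  interpret OW: tensor_pair A10 A00 by (rule tensor_pairI) (rule W.assoc_algebra Op.assoc_algebra)+
  interpret BO: tensor_pair A01 A10 by (rule tensor_pairI) (rule B.assoc_algebra Op.assoc_algebra)+
  interpret OB: tensor_pair A10 A01 by (rule tensor_pairI) (rule B.assoc_algebra Op.assoc_algebra)+
  note sW = same_algebra_U_prime[of D] and sV = same_algebra_U_hat[of D]
  note sameW = same_algebra_simps[OF sW, symmetric] same_algebra_tensor[OF sW sW, symmetric]
  note sameV = same_algebra_simps[OF sV, symmetric] same_algebra_tensor[OF sV sV, symmetric]
  \<comment> \<open>The signs in the coordinates of the opposite algebra are moved out of pure tensors, once for each shape.\<close>
  have pt_minus1: "(\<ominus>\<^bsub>A11\<^esub> p) \<boxtimes>\<^bsub>A11,A10\<^esub> q = \<ominus>\<^bsub>A11 \<boxtimes> A10\<^esub> (p \<boxtimes>\<^bsub>A11,A10\<^esub> q)"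
    if "p \<in> carrier A11" "q \<in> carrier A01" for p q
    using that by (simp add: V.minus_eq_smult VO.AB.minus_eq_smult VO.pure_tensor_smult_left)
  have pt_minus2: "p \<boxtimes>\<^bsub>A11,A10\<^esub> (\<ominus>\<^bsub>A01\<^esub> q) = \<ominus>\<^bsub>A11 \<boxtimes> A10\<^esub> (p \<boxtimes>\<^bsub>A11,A10\<^esub> q)"
    if "p \<in> carrier A11" "q \<in> carrier A01" for p q
    using that VO.pure_tensor_smult_right[of p q "- 1"] by (simp add: B.minus_eq_smult VO.AB.minus_eq_smult)
  have pt_minus3: "(\<ominus>\<^bsub>A01\<^esub> p) \<boxtimes>\<^bsub>A10,A00\<^esub> q = \<ominus>\<^bsub>A10 \<boxtimes> A00\<^esub> (p \<boxtimes>\<^bsub>A10,A00\<^esub> q)"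
    if "p \<in> carrier A01" "q \<in> carrier A00" for p q
    using that OW.pure_tensor_smult_left[of p q "- 1"] by (simp add: B.minus_eq_smult OW.AB.minus_eq_smult)
  have pt_minus4: "p \<boxtimes>\<^bsub>A01,A10\<^esub> (\<ominus>\<^bsub>A01\<^esub> q) = \<ominus>\<^bsub>A01 \<boxtimes> A10\<^esub> (p \<boxtimes>\<^bsub>A01,A10\<^esub> q)"
    if "p \<in> carrier A01" "q \<in> carrier A01" for p q
    using that BO.pure_tensor_smult_right[of p q "- 1"] by (simp add: B.minus_eq_smult BO.AB.minus_eq_smult)
  have pt_minus5: "(\<ominus>\<^bsub>A01\<^esub> p) \<boxtimes>\<^bsub>A10,A01\<^esub> q = \<ominus>\<^bsub>A10 \<boxtimes> A01\<^esub> (p \<boxtimes>\<^bsub>A10,A01\<^esub> q)"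
    if "p \<in> carrier A01" "q \<in> carrier A01" for p q
    using that OB.pure_tensor_smult_left[of p q "- 1"] by (simp add: B.minus_eq_smult OB.AB.minus_eq_smult)
  note pt_minus = pt_minus1 pt_minus2 pt_minus3 pt_minus4 pt_minus5

  have vals: "shift_F D (A00 \<boxtimes> A00) (tensor_gen D A00 x00 A00 x00) g = U_prime_comult_on D g" if "g \<in> gens D" for g
    using that by (cases g) (simp_all add: sameW WW.AB.r_distr Wg.Q_mult' Wg.Q_zero Wg.Q_mult)
  show "well_defined_hom A00 (gens D) (U_prime_gen D) (A00 \<boxtimes> A00) (U_prime_comult_on D) \<and>
      is_comult D A00 x00 A00 x00 A00 x00 (induced_hom A00 (gens D) (U_prime_gen D) (A00 \<boxtimes> A00) (U_prime_comult_on D))"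
    using U_prime_hom[OF tensor_relations[OF relations_W relations_W] vals] by (simp add: is_comult_def)

  have vals: "tensor_gen D A11 x11 A11 x11 g = U_hat_comult_on D g" if "g \<in> gens D" for g
    using that by (cases g) (simp_all add: sameV)
  show "well_defined_hom A11 (gens D) (U_hat_gen D) (A11 \<boxtimes> A11) (U_hat_comult_on D) \<and>
      is_comult D A11 x11 A11 x11 A11 x11 (induced_hom A11 (gens D) (U_hat_gen D) (A11 \<boxtimes> A11) (U_hat_comult_on D))"
    using U_hat_hom[OF tensor_relations[OF relations_V relations_V] vals] by (simp add: is_comult_def)

  have vals: "unshift_E D (A00 \<boxtimes> A01) (tensor_gen D A00 x00 A01 x01) g = alpha_B_on D g" if "g \<in> gens D" for g
    using that by (cases g) (simp_all add: WB.AB.r_distr WB.AB.a_comm Bg.Q_mult' Bg.Q_zero Wg.Q_mult Wg.Q_zero)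
  show "well_defined_hom A01 (gens D) (kashiwara_gen D) (A00 \<boxtimes> A01) (alpha_B_on D) \<and> is_comult D A01 x01 A00 x00 A01 x01 (alpha_B D)"
    using kashiwara_hom[OF tensor_relations[OF relations_W relations_B] vals] by (simp add: is_comult_def alpha_B_def)

  have vals: "unshift_E D (A01 \<boxtimes> A11) (tensor_gen D A01 x01 A11 x11) g = beta_B_on D g" if "g \<in> gens D" for g
    using that by (cases g) (simp_all add: BV.AB.r_distr BV.AB.a_comm Bg.Q_mult' Bg.Q_zero Bg.Q_mult)
  show "well_defined_hom A01 (gens D) (kashiwara_gen D) (A01 \<boxtimes> A11) (beta_B_on D) \<and> is_comult D A01 x01 A01 x01 A11 x11 (beta_B D)"
    using kashiwara_hom[OF tensor_relations[OF relations_B relations_V] vals] by (simp add: is_comult_def beta_B_def)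

  have vals: "un_op_gen D (A11 \<boxtimes> A10) (tensor_gen D A11 x11 A10 x10) g = alpha_Bop_on D g" if "g \<in> gens D" for g
    using that by (cases g)
      (simp_all add: VO.AB.r_distr VO.AB.r_minus VO.AB.a_comm VO.AB.minus_add a_minus_def pt_minus B.l_minus B.r_minus B.m_assoc
        Bg.Q_zero Bg.Q_mult V.Q_zero V.Q_mult)
  show "well_defined_hom A10 (gens D) (kashiwara_gen D) (A11 \<boxtimes> A10) (alpha_Bop_on D) \<and>
      is_comult D A10 x10 A11 x11 A10 x10 (alpha_Bop D)"
    using kashiwara_op_hom[OF tensor_relations[OF relations_V relations_O] vals] by (simp add: is_comult_def alpha_Bop_def)

  have vals: "un_op_gen D (A10 \<boxtimes> A00) (tensor_gen D A10 x10 A00 x00) g = beta_Bop_on D g" if "g \<in> gens D" for g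
    using that by (cases g)
      (simp_all add: OW.AB.r_distr OW.AB.r_minus OW.AB.a_comm OW.AB.minus_add a_minus_def pt_minus B.l_minus B.r_minus B.m_assoc
        Bg.Q_zero Bg.Q_mult Wg.Q_zero Wg.Q_mult Wg.Q_mult')
  show "well_defined_hom A10 (gens D) (kashiwara_gen D) (A10 \<boxtimes> A00) (beta_Bop_on D) \<and> is_comult D A10 x10 A10 x10 A00 x00 (beta_Bop D)"
    using kashiwara_op_hom[OF tensor_relations[OF relations_O relations_W] vals] by (simp add: is_comult_def beta_Bop_def)

  have vals: "shift_F D (A01 \<boxtimes> A10) (tensor_gen D A01 x01 A10 x10) g = gamma_on D g" if "g \<in> gens D" for g
    using that by (cases g)
      (simp_all add: BO.AB.r_distr BO.AB.r_minus a_minus_def pt_minus B.l_minus B.r_minus B.m_assoc Bg.Q_zero Bg.Q_mult)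
  show "well_defined_hom A00 (gens D) (U_prime_gen D) (A01 \<boxtimes> A10) (gamma_on D) \<and> is_comult D A00 x00 A01 x01 A10 x10 (gamma_B D)"
    using U_prime_hom[OF tensor_relations[OF relations_B relations_O] vals] by (simp add: is_comult_def gamma_B_def)

  have vals: "tensor_gen D A10 x10 A01 x01 g = delta_on D g" if "g \<in> gens D" for g
    using that by (cases g) (simp_all add: a_minus_def pt_minus OB.AB.a_comm)
  show "well_defined_hom A11 (gens D) (U_hat_gen D) (A10 \<boxtimes> A01) (delta_on D) \<and> is_comult D A11 x11 A10 x10 A01 x01 (delta_B D)"
    using U_hat_hom[OF tensor_relations[OF relations_O relations_B] vals] by (simp add: is_comult_def delta_B_def)

  have vals: "shift_F D ground_algebra U_counit_on g = U_counit_on g" for g :: "('i, 't) gen"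
    by (cases g) simp_all
  show "well_defined_hom A00 (gens D) (U_prime_gen D) ground_algebra U_counit_on \<and>
      is_counit D A00 x00 (induced_hom A00 (gens D) (U_prime_gen D) ground_algebra U_counit_on)"
    using U_prime_hom[OF counit_relations[OF quantum_datum_axioms] vals] by (simp add: is_counit_def)
  show "well_defined_hom A11 (gens D) (U_hat_gen D) ground_algebra U_counit_on \<and>
      is_counit D A11 x11 (induced_hom A11 (gens D) (U_hat_gen D) ground_algebra U_counit_on)"
    using U_hat_hom[OF counit_relations[OF quantum_datum_axioms] refl] by (simp add: is_counit_def)

  have vals: "shift_F D (op_algebra A00) (antipode_gen D A00 x00) g = U_prime_antipode_on D g" if "g \<in> gens D" for g
    using that by (cases g) (simp_all add: sameW W.l_minus W.m_assoc Wg.Q_mult Wg.Q_zero)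
  show "well_defined_hom A00 (gens D) (U_prime_gen D) (op_algebra A00) (U_prime_antipode_on D) \<and>
      is_antipode D A00 x00 A00 x00 (induced_hom A00 (gens D) (U_prime_gen D) (op_algebra A00) (U_prime_antipode_on D))"
    using U_prime_hom[OF W.antipode_relations vals] by (simp add: is_antipode_def)
  have vals: "antipode_gen D A11 x11 g = U_hat_antipode_on D g" if "g \<in> gens D" for g
    using that by (cases g) (simp_all add: sameV)
  show "well_defined_hom A11 (gens D) (U_hat_gen D) (op_algebra A11) (U_hat_antipode_on D) \<and>
      is_antipode D A11 x11 A11 x11 (induced_hom A11 (gens D) (U_hat_gen D) (op_algebra A11) (U_hat_antipode_on D))"
    using U_hat_hom[OF V.antipode_relations vals] by (simp add: is_antipode_def)

  have vals: "unshift_E D (op_algebra A10) (antipode_gen D A10 x10) g = theta_B_on D g" if "g \<in> gens D" for g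
    using that by (cases g) (simp_all add: B.l_minus B.r_minus B.m_assoc)
  show "well_defined_hom A01 (gens D) (kashiwara_gen D) (op_algebra A10) (theta_B_on D) \<and> is_antipode D A01 x01 A10 x10 (S_B D)"
    using kashiwara_hom[OF Op.antipode_relations vals] by (simp add: is_antipode_def S_B_def)

  have "x10 g = antipode_gen D A01 x01 g" if "g \<in> gens D" for g
    using that by (cases g) (simp_all add: Bg.Q_mult' Bg.Q_zero)
  then show "is_antipode D A10 x10 A01 x01 S_Bop"
    by (simp add: is_antipode_def S_Bop_def alg_hom_id)
qed

text \<open>The torsor map fixes the group-like elements and multiplies \<open>E i\<close> and \<open>F i\<close> by mutually inverse powers of \<open>q\<close>.
The inverse scaling preserves the relations of \<open>H[0,1]\<close> as well, and the resulting morphism is an inverse.\<close>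

lemma autonomous_kashiwara: "autonomous A01 (S_B D) S_Bop"
proof -
  interpret B: hopf_object D A01 x01 0 1 by (rule kashiwara_object)
  have S: "is_antipode D A01 x01 A10 x10 (S_B D)" using structure_maps(13) by blast
  have S_hom: "alg_hom A01 A01 (S_B D)" using is_antipodeD(1)[OF S] by simp
  define c where "c i = root D i (t_exp D i)" for i
  interpret Bg: common_relations D A01 "kashiwara_gen D" by (rule kashiwara_gen_relations)
  have S_E: "S_B D (x01 (E i)) = qpow (- c i) \<odot>\<^bsub>A01\<^esub> x01 (E i)" if "i \<in> index D" for i
    using is_antipodeD(2)[OF S, of "E i"] that by (simp add: Bg.move_Q c_def B.r_minus B.l_minus)
  have S_F: "S_B D (x01 (F i)) = qpow (c i) \<odot>\<^bsub>A01\<^esub> x01 (F i)" if "i \<in> index D" for i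
    using is_antipodeD(2)[OF S, of "F i"] that by (simp add: Bg.move_Q c_def B.r_minus B.l_minus)
  have S_Q: "S_B D (x01 (Q h)) = x01 (Q h)" if "h \<in> coroot_lattice D" for h
    using is_antipodeD(2)[OF S, of "Q h"] that by simp
  \<comment> \<open>The coordinates scaled inversely to the torsor map.\<close>
  define y where "y = twist_gen A01 (\<lambda>i. qpow (c i)) (\<lambda>_. 0) (\<lambda>i. qpow (- c i)) (\<lambda>_. 0) x01"
  interpret y: common_relations D A01 y
    unfolding y_def by (rule B.twist) simp_all
  have y_rel: "hopf_relations D A01 y 0 1"
    by unfold_locales (simp add: y_def B.Q_zero B.E_F B.smult_r_distr fps_exp_mult del: change_gen_simps)
  define g where "g = induced_hom A01 (gens D) (kashiwara_gen D) A01 (unshift_E D A01 y)"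
  have g: "alg_hom A01 A01 g" "\<And>k. k \<in> gens D \<Longrightarrow> g (x01 k) = y k"
    using kashiwara_hom[OF y_rel refl] by (simp_all add: g_def)
  have g_E: "g (x01 (E i)) = qpow (c i) \<odot>\<^bsub>A01\<^esub> x01 (E i)" if "i \<in> index D" for i
    using g(2)[of "E i"] that by (simp add: y_def Bg.Q_zero)
  have g_F: "g (x01 (F i)) = qpow (- c i) \<odot>\<^bsub>A01\<^esub> x01 (F i)" if "i \<in> index D" for i
    using g(2)[of "F i"] that by (simp add: y_def Bg.Q_zero)
  have g_Q: "g (x01 (Q h)) = x01 (Q h)" if "h \<in> coroot_lattice D" for h
    using g(2)[of "Q h"] that by (simp add: y_def)
  note vals = S_E S_F S_Q g_E g_F g_Q alg_homD(5)[OF S_hom] alg_homD(5)[OF g(1)] fps_exp_mult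
  have "g (S_B D u) = u" if "u \<in> carrier A01" for u
    by (rule B.hom_eqI[OF alg_hom_comp[OF S_hom g(1)] alg_hom_id _ _ _ that])
      (use B.closed' in \<open>simp_all add: vals del: change_gen_simps\<close>)
  moreover have "S_B D (g u) = u" if "u \<in> carrier A01" for u
    by (rule B.hom_eqI[OF alg_hom_comp[OF g(1) S_hom] alg_hom_id _ _ _ that])
      (use B.closed' in \<open>simp_all add: vals del: change_gen_simps\<close>)
  ultimately have "bij_betw (S_B D) (carrier A01) (carrier A01)"
    using alg_homD(1)[OF S_hom] alg_homD(1)[OF g(1)] by (intro bij_betw_byWitness[where f' = g]) auto
  then show ?thesis by (simp add: autonomous_def S_Bop_def comp_def)
qed

end

section \<open>Symmetrizable Kac-Moody algebras\<close>

text \<open>The element \<open>t_exp D i\<close> is an integral multiple of a coroot as the norm of the root is even, and it pairs with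
the root \<open>j\<close> to the value of the form on the two roots.\<close>

lemma (in symmetrizable_kac_moody_algebra) quantum_datum: "quantum_datum D"
proof
  have dual: "root D i (h + h') = root D i h + root D i h'" "root D i (t_scale D c h) = c * root D i h"
    if "i \<in> index D" for i h h' c
  proof -
    interpret l: Vector_Spaces.linear "t_scale D" "(*)" "root D i"
      using root_dual[OF that] by (simp add: t_dual_def)
    show "root D i (h + h') = root D i h + root D i h'" by (rule l.add)
    show "root D i (t_scale D c h) = c * root D i h" by (rule l.scale)
  qed
  have norm_nz: "form D (root D i) (root D i) \<noteq> 0" if "i \<in> index D" for i
    using form_even[OF that] by auto
  show nz: "half_norm D i \<noteq> 0" if "i \<in> index D" for i
    using norm_nz[OF that] by (simp add: half_norm_def)
  have lat: "h \<in> coroot_lattice D \<longleftrightarrow> (\<exists>n. h = (\<Sum>i\<in>index D. t_scale D (of_int (n i)) (coroot D i)))" for h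
    by (auto simp: coroot_lattice_def)
  show "0 \<in> coroot_lattice D"
    unfolding lat by (intro exI[of _ "\<lambda>_. 0"]) simp
  show "h + h' \<in> coroot_lattice D" if hh: "h \<in> coroot_lattice D" "h' \<in> coroot_lattice D" for h h'
  proof -
    obtain n n' where "h = (\<Sum>i\<in>index D. t_scale D (of_int (n i)) (coroot D i))" "h' = (\<Sum>i\<in>index D. t_scale D (of_int (n' i)) (coroot D i))"
      using hh unfolding lat by blast
    then show ?thesis
      unfolding lat by (intro exI[of _ "\<lambda>i. n i + n' i"]) (simp add: t.scale_left_distrib sum.distrib)
  qed
  show "- h \<in> coroot_lattice D" if "h \<in> coroot_lattice D" for h
  proof -
    obtain n where "h = (\<Sum>i\<in>index D. t_scale D (of_int (n i)) (coroot D i))"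
      using \<open>h \<in> coroot_lattice D\<close> unfolding lat by blast
    then show ?thesis
      unfolding lat by (intro exI[of _ "\<lambda>i. - n i"]) (simp add: t.scale_minus_left sum_negf)
  qed
  show "t_exp D i \<in> coroot_lattice D" if i: "i \<in> index D" for i
  proof -
    obtain m :: nat where m: "half_norm D i = of_nat m"
      using form_even[OF i] by (auto simp: half_norm_def)
    have "t_exp D i = (\<Sum>j\<in>index D. if j = i then t_scale D (of_int (int m)) (coroot D j) else 0)"
      using i finite_index by (simp add: t_exp_def m)
    also have "\<dots> = (\<Sum>j\<in>index D. t_scale D (of_int (if j = i then int m else 0)) (coroot D j))"
      by (intro sum.cong) auto
    finally show ?thesis unfolding lat by (rule exI[of _ "\<lambda>j. if j = i then int m else 0"])
  qed
  show "root D i (h + h') = root D i h + root D i h'" if "i \<in> index D" for i h h'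
    using that by (rule dual)
  show "root D i (coroot D i) = 2" if "i \<in> index D" for i
    using that by (rule cartan_diag)
  show "\<exists>N>0. root D j (coroot D i) = 1 - of_nat N" if ij: "i \<in> index D" "j \<in> index D" "i \<noteq> j" for i j
  proof -
    obtain z where z: "root D j (coroot D i) = of_int z"
      using cartan_int[OF ij(1,2)] by (auto elim: Ints_cases)
    have "z \<le> 0" using cartan_nonpos[OF ij] z by simp
    then show ?thesis using z by (intro exI[of _ "nat (1 - z)"]) auto
  qed
  show t: "root D j (t_exp D i) = half_norm D i * root D j (coroot D i)" if "i \<in> index D" "j \<in> index D" for i j
    unfolding t_exp_def using that by (simp add: dual(2))
  have "root D j (t_exp D i) = form D (root D i) (root D j)" if "i \<in> index D" "j \<in> index D" for i j
    using coroot_form[OF that(1) root_dual[OF that(2)]] norm_nz[OF that(1)]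
    by (simp add: t[OF that] half_norm_def)
  then show "root D j (t_exp D i) = root D i (t_exp D j)" if "i \<in> index D" "j \<in> index D" for i j
    using that form_sym[OF root_dual root_dual] by simp
qed

theorem proposition4:
  fixes D :: "('i, 't::ab_group_add) root_datum"
    and g_scale :: "rat \<Rightarrow> 'g::ab_group_add \<Rightarrow> 'g"
    and bracket :: "'g \<Rightarrow> 'g \<Rightarrow> 'g"
    and incl :: "'t \<Rightarrow> 'g"
    and chev_e chev_f :: "'i \<Rightarrow> 'g"
  assumes "symmetrizable_kac_moody_algebra D g_scale bracket incl chev_e chev_f"
  shows
    "\<comment> \<open>the Hopf algebra structures of the two quantized enveloping algebras\<close>
     well_defined_hom (U_prime_alg D) (gens D) (U_prime_gen D)
       (U_prime_alg D \<boxtimes> U_prime_alg D) (U_prime_comult_on D) \<and>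
     well_defined_hom (U_prime_alg D) (gens D) (U_prime_gen D) ground_algebra U_counit_on \<and>
     well_defined_hom (U_prime_alg D) (gens D) (U_prime_gen D)
       (op_algebra (U_prime_alg D)) (U_prime_antipode_on D) \<and>
     well_defined_hom (U_hat_alg D) (gens D) (U_hat_gen D)
       (U_hat_alg D \<boxtimes> U_hat_alg D) (U_hat_comult_on D) \<and>
     well_defined_hom (U_hat_alg D) (gens D) (U_hat_gen D) ground_algebra U_counit_on \<and>
     well_defined_hom (U_hat_alg D) (gens D) (U_hat_gen D)
       (op_algebra (U_hat_alg D)) (U_hat_antipode_on D) \<and>
     \<comment> \<open>the structure maps\<close>
     well_defined_hom (kashiwara D) (gens D) (kashiwara_gen D)
       (U_prime D \<boxtimes> kashiwara D) (alpha_B_on D) \<and>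
     well_defined_hom (kashiwara D) (gens D) (kashiwara_gen D)
       (kashiwara D \<boxtimes> U_hat D) (beta_B_on D) \<and>
     well_defined_hom (kashiwara_op D) (gens D) (kashiwara_gen D)
       (U_hat D \<boxtimes> kashiwara_op D) (alpha_Bop_on D) \<and>
     well_defined_hom (kashiwara_op D) (gens D) (kashiwara_gen D)
       (kashiwara_op D \<boxtimes> U_prime D) (beta_Bop_on D) \<and>
     well_defined_hom (U_prime D) (gens D) (U_prime_gen D)
       (kashiwara D \<boxtimes> kashiwara_op D) (gamma_on D) \<and>
     well_defined_hom (U_hat D) (gens D) (U_hat_gen D)
       (kashiwara_op D \<boxtimes> kashiwara D) (delta_on D) \<and>
     alg_hom (kashiwara_op D) (op_algebra (kashiwara D)) S_Bop \<and>
     well_defined_hom (kashiwara D) (gens D) (kashiwara_gen D)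
       (op_algebra (kashiwara_op D)) (theta_B_on D) \<and>
     complete_hopf_galois_system (U_prime D) (U_hat D) (kashiwara D) (kashiwara_op D)
       (U_prime_antipode D) (U_hat_antipode D)
       (alpha_B D) (beta_B D) (alpha_Bop D) (beta_Bop D) (gamma_B D) (delta_B D)
       (S_B D) S_Bop \<and>
     autonomous (kashiwara D) (S_B D) S_Bop"
proof -
  interpret quantum_datum D
    using assms by (rule symmetrizable_kac_moody_algebra.quantum_datum)
  interpret W: hopf_object D A00 x00 0 0 by (rule U_prime_object)
  interpret V: hopf_object D A11 x11 1 1 by (rule U_hat_object)
  interpret B: hopf_object D A01 x01 0 1 by (rule kashiwara_object)
  interpret Op: hopf_object D A10 x10 1 0 by (rule kashiwara_op_object)
  note sW = same_algebra_U_prime[of D] and sV = same_algebra_U_hat[of D]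
  have opW: "same_algebra (op_algebra (U_prime D)) (op_algebra (U_prime_alg D))"
    and opV: "same_algebra (op_algebra (U_hat D)) (op_algebra (U_hat_alg D))"
    using sW sV by (simp_all add: same_algebra_def op_algebra_def)
  \<comment> \<open>Extensions see only the algebra operations of the target, not its bialgebra structure.\<close>
  have target: "well_defined_hom P G \<iota> C \<phi> = well_defined_hom P G \<iota> C' \<phi>" "induced_hom P G \<iota> C \<phi> = induced_hom P G \<iota> C' \<phi>"
    if "same_algebra C C'" for P :: "(rat fps, 'p) bialgebra" and G :: "'q set" and \<iota> \<phi> and C :: "(rat fps, 'r) bialgebra" and C' :: "(rat fps, 'r) module"
    using that by (simp_all add: well_defined_hom_def induced_hom_def is_extension_def alg_hom_def ring_hom_def same_algebra_simps)
  note same = same_algebra_induced_hom[OF sW, symmetric] same_algebra_induced_hom[OF sV, symmetric]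
    same_algebra_tensor(1)[OF sW sW, symmetric] same_algebra_tensor(1)[OF sV sV, symmetric]
    target[OF opW, symmetric] target[OF opV, symmetric]
  have fields: "comult (U_prime D) = induced_hom A00 (gens D) (U_prime_gen D) (A00 \<boxtimes> A00) (U_prime_comult_on D)"
    "counit (U_prime D) = induced_hom A00 (gens D) (U_prime_gen D) ground_algebra U_counit_on"
    "comult (U_hat D) = induced_hom A11 (gens D) (U_hat_gen D) (A11 \<boxtimes> A11) (U_hat_comult_on D)"
    "counit (U_hat D) = induced_hom A11 (gens D) (U_hat_gen D) ground_algebra U_counit_on"
    unfolding same[symmetric]
    by (simp_all add: U_prime_def U_hat_def module.extend_def bialgebra.fields_def)
  have antipodes: "U_prime_antipode D = induced_hom A00 (gens D) (U_prime_gen D) (op_algebra A00) (U_prime_antipode_on D)"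
    "U_hat_antipode D = induced_hom A11 (gens D) (U_hat_gen D) (op_algebra A11) (U_hat_antipode_on D)"
    by (simp_all only: U_prime_antipode_def U_hat_antipode_def same)
  note maps = structure_maps[folded fields antipodes]
  have nz: "nonzero_algebra A00" "nonzero_algebra A11" "nonzero_algebra A01" "nonzero_algebra A10"
    using counit_nonzero[OF W.assoc_algebra is_counitD(1)[OF conjunct2[OF maps(9)]]]
      counit_nonzero[OF V.assoc_algebra is_counitD(1)[OF conjunct2[OF maps(10)]]] kashiwara_nonzero
    by (simp_all add: nonzero_algebra_def W.assoc_algebra V.assoc_algebra B.assoc_algebra Op.assoc_algebra)
  have "complete_hopf_galois_system A00 A11 A01 A10 (U_prime_antipode D) (U_hat_antipode D)
      (alpha_B D) (beta_B D) (alpha_Bop D) (beta_Bop D) (gamma_B D) (delta_B D) (S_B D) S_Bop"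
    by (rule complete_hopf_galois_systemI[OF U_prime_object U_hat_object kashiwara_object kashiwara_op_object])
      (use nz maps in blast)+
  then show ?thesis
    unfolding same using structure_maps autonomous_kashiwara
    by (auto simp: S_Bop_def alg_hom_id)
qed

end
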